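(* No simplified weak Spector bar recursor $\Phi\in \mathsf{SP}^0(2\to 2\to 1)$ is left-well-founded (LWF). Hence no simplified weak Spector bar recursor in $\mathsf{SP}^0$ is definable in $\mathrm{T}+\mathit{min}$, and none is definable in $\mathrm{W}$.
   Context: **Types and languages.** Types are $\sigma,\tau ::= \mathtt N\mid \sigma\to\tau$; every type has the form $\sigma_0\to\cdots\to\sigma_{r-1}\to\mathtt N$. Pure types: $0=\mathtt N$, $k+1=k\to\mathtt N$. The base language $\mathrm B$ is the simply typed $\lambda$-calculus over constants $\widehat n:\mathtt N$ ($n\in\mathbb N$), $\mathit{suc},\mathit{pre}:\mathtt N\to\mathtt N$, $\mathit{ifzero}:\mathtt N\to\mathtt N\to\mathtt N\to\mathtt N$. Write $\mathit{ifzero}_\sigma=\lambda nxy\vec z.\,\mathit{ifzero}\,n\,(x\vec z)\,(y\vec z)$. Extensions of $\mathrm B$: - $\mathrm{PCF}+\mathit{byval}$ adds $Y_\sigma:(\sigma\to\sigma)\to\sigma$ and $\mathit{byval}^{\vec\sigma}_\tau:(\vec\sigma\to\mathtt N\to\tau)\to(\vec\sigma\to\mathtt N\to\tau)$ (with $\epsilon$ the empty list of types); - $\mathrm T+\mathit{min}$ adds $\mathit{rec}_\sigma:\sigma\to(\sigma\to\mathtt N\to\sigma)\to\mathtt N\to\sigma$ and $\mathit{min}:(\mathtt N\to\mathtt N)\to\mathtt N\to\mathtt N$; - $\mathrm W$ adds $\mathit{while}_\sigma:(\sigma\to\mathtt N)\to\sigma\to(\sigma\to\sigma)\to\sigma$;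 - $\mathrm T_0^{\mathrm{str}}$ adds $\mathit{byval}^\epsilon_{\mathtt N}$ and $\mathit{rec}^{\mathrm{str}}_{\mathtt N}$ (of the type of $\mathit{rec}_{\mathtt N}$). Terms of these languages are translated into $\mathrm{PCF}+\mathit{byval}$ by replacing constants by the following programs, where $\mathit{byval}^+_\sigma=\mathit{byval}^{\sigma,(\sigma\to\mathtt N\to\sigma)}_\sigma$ and $\rho,\mu$ are the types of $\mathit{rec}_\sigma,\mathit{min}$: $\mathit{Rec}_\sigma=\mathit{byval}^+_\sigma(Y_\rho(\lambda r.\lambda xfn.\,\mathit{ifzero}_\sigma\,n\,x\,(\mathit{byval}^\epsilon_\sigma(\lambda n'.f((\mathit{byval}^+_\sigma r)xfn')n')(\mathit{pre}\,n))))$; $\mathit{Min}=\mathit{byval}^{\mathtt N\to\mathtt N}_{\mathtt N}(Y_\mu(\lambda m.\lambda fn.\,\mathit{ifzero}(fn)\,n\,((\mathit{byval}^{\mathtt N\to\mathtt N}_{\mathtt N}m)f(\mathit{suc}\,n))))$; $\mathit{While}_\sigma=\lambda cxf.\,Y_{\sigma\to\sigma}(\lambda w.\lambda x'.\,\mathit{ifzero}_\sigma(cx')(w(fx'))x')\,x$; $\mathit{Rec}^{\mathrm{str}}_{\mathtt N}=\mathit{byval}^+_{\mathtt N}(Y(\lambda r.\lambda xfn.\,\mathit{ifzero}\,n\,x\,(\mathit{byval}^\epsilon_{\mathtt N}(\lambda n'.\mathit{byval}^\epsilon_{\mathtt N}(\lambda m.fmn')((\mathit{byval}^+_{\mathtt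 N}r)xfn'))(\mathit{pre}\,n))))$. **Nested sequential procedures (NSPs).** These are possibly infinite terms generated coinductively by: procedures $p,q::=\lambda x_0\ldots x_{r-1}.e$; expressions $d,e::=\bot\mid n\mid \mathtt{case}\ a\ \mathtt{of}\ (i\Rightarrow e_i\mid i\in\mathbb N)$; applications $a::=x\,q_0\ldots q_{r-1}$ (with $r\ge 0$; written $x()$ if $r=0$). Variables carry types; terms are taken up to $\alpha$-equivalence and are well-typed in the evident sense (expressions and applications have type $\mathtt N$). If $p=\lambda\vec y.e$, then $\lambda x.p$ means $\lambda x\vec y.e$. $\mathsf{SP}(\sigma)$ is the set of procedures of type $\sigma$, $\mathsf{SP}^0(\sigma)$ the set of closed ones; $\lambda.n,\lambda.\bot\in\mathsf{SP}^0(\mathtt N)$ are written $n$ ("numerals"), $\bot$. For $x$ of type $\sigma=\sigma_0\to\cdots\to\sigma_{r-1}\to\mathtt N$, $x^\eta=\lambda z_0\ldots z_{r-1}.\,\mathtt{case}\ x z_0^\eta\ldots z_{r-1}^\eta\ \mathtt{of}\ (i\Rightarrow i)$. *Meta-terms* (coinductive): $P,Q::=\lambda\vec x.E$; $D,E::=\bot\mid n\mid\mathtt{case}\ G\ \mathtt{of}\ (i\Rightarrow E_i)$; $G::=E\mid x\vec Q\mid P\vec Q$. Head reduction $\rightsquigarrow_h$: $(\lambda\vec x.E)\vec Q\rightsquigarrow_h E[\vec x\mapsto\vec Q]$; $\mathtt{case}\,\bot\,\mathtt{of}(i\Rightarrow E_i)\rightsquigarrow_h\bot$; $\mathtt{case}\,n\,\mathtt{of}(i\Rightarrow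 E_i)\rightsquigarrow_h E_n$; $\mathtt{case}(\mathtt{case}\,G\,\mathtt{of}(i\Rightarrow E_i))\mathtt{of}(j\Rightarrow F_j)\rightsquigarrow_h\mathtt{case}\,G\,\mathtt{of}(i\Rightarrow\mathtt{case}\,E_i\,\mathtt{of}(j\Rightarrow F_j))$; if $G\rightsquigarrow_h G'$ and $G$ is not a case meta-term, then $\mathtt{case}\,G\,\mathtt{of}(\cdots)\rightsquigarrow_h\mathtt{case}\,G'\,\mathtt{of}(\cdots)$; if $E\rightsquigarrow_hE'$ then $\lambda\vec x.E\rightsquigarrow_h\lambda\vec x.E'$. The normal form of a meta-term (Böhm-tree style): head-reduce; if no head normal form is reached it is $\bot$ (under the appropriate $\lambda\vec x$); if the head normal form is $\bot$ or $n$ (possibly under $\lambda$) that is the normal form; if it is $\mathtt{case}\,y\vec Q\,\mathtt{of}(i\Rightarrow E_i)$ (possibly under $\lambda$) or $y\vec Q$, normalize the $Q_j$, $E_i$ corecursively. For $p=\lambda x_0\cdots x_r.e\in\mathsf{SP}(\sigma\to\tau)$ and $q\in\mathsf{SP}(\sigma)$, $p\cdot q\in\mathsf{SP}(\tau)$ is the normal form of $\lambda x_1\cdots x_r.e[x_0\mapsto q]$. In mixed expressions a variable $z$ is read as $z^\eta$, and $\lambda z.(\cdots)$ is NSP abstraction. *Left-well-foundedness.* The application tree of an NSP term $t$ is the tree of all occurrences of applications $x\vec q$ in $t$, ordered by subterm inclusion. $t$ is left-well-founded (LWF) if this tree is well-founded, i.e. there is no infinite sequence of application occurrences each strictly inside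 the previous one. **Interpretation.** Each $\mathrm{PCF}+\mathit{byval}$ term $M:\sigma$ has a denotation $[\![M]\!]\in\mathsf{SP}(\sigma)$: $[\![x]\!]=x^\eta$; $[\![\lambda x.M]\!]=\lambda x.[\![M]\!]$; $[\![MN]\!]=[\![M]\!]\cdot[\![N]\!]$; $[\![\widehat n]\!]=\lambda.n$; $[\![\mathit{suc}]\!]=\lambda x.\mathtt{case}\,x()\,\mathtt{of}(i\Rightarrow i+1)$; $[\![\mathit{pre}]\!]=\lambda x.\mathtt{case}\,x()\,\mathtt{of}(0\Rightarrow0\mid i+1\Rightarrow i)$; $[\![\mathit{ifzero}]\!]=\lambda xyz.\mathtt{case}\,x()\,\mathtt{of}(0\Rightarrow\mathtt{case}\,y()\,\mathtt{of}(j\Rightarrow j)\mid i+1\Rightarrow\mathtt{case}\,z()\,\mathtt{of}(j\Rightarrow j))$; $[\![\mathit{byval}^{\vec\sigma}_\tau]\!]=\lambda f\vec xn\vec y.\mathtt{case}\,n()\,\mathtt{of}(i\Rightarrow\mathtt{case}\,f\vec x^{\,\eta}(\lambda.i)\vec y^{\,\eta}\,\mathtt{of}(j\Rightarrow j))$; $[\![Y_\sigma]\!]=\lambda f\vec x.\mathtt{case}\,f\,q\,\vec x^{\,\eta}\,\mathtt{of}(i\Rightarrow i)$, where $q$ is the infinite procedure with $q=\lambda\vec y.\mathtt{case}\,f\,q\,\vec y^{\,\eta}\,\mathtt{of}(i\Rightarrow i)$. Terms of $\mathrm T+\mathit{min}$, $\mathrm W$, $\mathrm T_0^{\mathrm{str}}$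 are interpreted in $\mathsf{SP}$ via their translations. An element of $\mathsf{SP}^0(\sigma)$ is definable in one of these languages if it is the interpretation of a closed term of that language. **Trees and bar recursors.** $\langle\cdots\rangle:\mathbb N^*\to\mathbb N$ is a fixed standard (injective) primitive recursive coding of finite sequences. Write $\mathtt N^*$ for $\mathtt N$ when used for sequence codes. Fix closed $\mathrm T_0^{\mathrm{str}}$ programs $\mathrm{len}:\mathtt N^*\to\mathtt N$, $\mathrm{add}:\mathtt N^*\to\mathtt N\to\mathtt N^*$ and $\mathrm{basic}:\mathtt N^*\to\mathtt N\to(\mathtt N\to\mathtt N)$ such that $\mathrm{len}\,\langle\vec x\rangle$ evaluates to the length $|\vec x|$, $\mathrm{add}\,\langle\vec x\rangle\,z$ evaluates to $\langle\vec x,z\rangle$, and $\mathrm{basic}\,\langle\vec x\rangle\,j\,i$ evaluates to $x_i$ if $i<|\vec x|$ and to $j$ otherwise; identify them with their interpretations in $\mathsf{SP}^0$. For $F\in\mathsf{SP}^0(2)$, $\vec x\in\mathbb N^*$ satisfies the Spector bar condition w.r.t. $F$ if $F\cdot(\mathrm{basic}\cdot\langle\vec x\rangle\cdot0)<\mathrm{len}\cdot\langle\vec x\rangle$. The tree $\mathcal T^S(F)\subseteq\mathbb N^*$ consists of all $\vec x$ no proper prefix of which satisfies this condition. $\mathcal T^S(F)^l$ is the set of leaves (nodes with no child in the tree) and $\mathcal T^S(F)^n$ the set of internal nodes (all of whose children $(\vec x,y)$, $y\in\mathbb N$, are in the tree). A *simplified weak Spector bar recursor* is an element $\Phi\in\mathsf{SP}^0(2\to2\to1)$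 such that for all $\mathrm T_0^{\mathrm{str}}$-definable $F,G\in\mathsf{SP}^0(2)$ and all $\vec x\in\mathcal T^S(F)$: $\Phi\cdot F\cdot G\cdot\langle\vec x\rangle=2\langle\vec x\rangle+1$ if $\vec x\in\mathcal T^S(F)^l$; and $\Phi\cdot F\cdot G\cdot\langle\vec x\rangle=G\cdot(\lambda z^{\mathtt N}.\,\Phi\cdot F\cdot G\cdot(\mathrm{add}\cdot\langle\vec x\rangle\cdot z))$ if $\vec x\in\mathcal T^S(F)^n$. *)

theory Defs
  imports Main "HOL-Library.Sublist"
begin

section \<open>Types\<close>

datatype ty = N | Fun ty ty  (infixr "\<rightarrow>" 60)

fun args :: "ty \<Rightarrow> ty list" where
  "args N = []"
| "args (\<sigma> \<rightarrow> \<tau>) = \<sigma> # args \<tau>"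

definition funs :: "ty list \<Rightarrow> ty \<Rightarrow> ty" where
  "funs \<sigma>s \<tau> = foldr Fun \<sigma>s \<tau>"

fun pure :: "nat \<Rightarrow> ty" where
  "pure 0 = N"
| "pure (Suc k) = pure k \<rightarrow> N"

lemma size_args: "\<tau> \<in> set (args \<sigma>) \<Longrightarrow> size \<tau> < size \<sigma>"
  by (induction \<sigma>) auto


section \<open>Nested sequential procedures\<close>

text \<open>
  Terms up to \<open>\<alpha>\<close>-equivalence are represented with de Bruijn indices.  The block
  \<open>Lam [\<sigma>\<^sub>0, \<dots>, \<sigma>\<^sub>r\<^sub>-\<^sub>1] e\<close> stands for \<open>\<lambda>x\<^sub>0 \<dots> x\<^sub>r\<^sub>-\<^sub>1. e\<close> and counts as \<open>r\<close> nested
  binders: in \<open>e\<close> the variable \<open>x\<^sub>r\<^sub>-\<^sub>1\<close> has index \<open>0\<close> and \<open>x\<^sub>0\<close> has index \<open>r - 1\<close>.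
\<close>

codatatype proc = Lam "ty list" exp
  and exp = Bot | Num nat | Case app "nat \<Rightarrow> exp"
  and app = App nat "proc list"

coinductive wt_proc :: "ty list \<Rightarrow> proc \<Rightarrow> ty \<Rightarrow> bool"
  and wt_exp :: "ty list \<Rightarrow> exp \<Rightarrow> bool"
  and wt_app :: "ty list \<Rightarrow> app \<Rightarrow> bool" where
  "wt_exp (rev \<sigma>s @ \<Gamma>) e \<Longrightarrow> wt_proc \<Gamma> (Lam \<sigma>s e) (funs \<sigma>s N)"
| "wt_exp \<Gamma> Bot"
| "wt_exp \<Gamma> (Num n)"
| "wt_app \<Gamma> a \<Longrightarrow> (\<And>i. wt_exp \<Gamma> (es i)) \<Longrightarrow> wt_exp \<Gamma> (Case a es)"
| "x < length \<Gamma> \<Longrightarrow> list_all2 (wt_proc \<Gamma>) qs (args (\<Gamma> ! x)) \<Longrightarrow> wt_app \<Gamma> (App x qs)"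
monos list_all2_mono

definition SP0 :: "ty \<Rightarrow> proc set" where
  "SP0 \<sigma> = {p. wt_proc [] p \<sigma>}"

definition num :: "nat \<Rightarrow> proc" where
  "num n = Lam [] (Num n)"

text \<open>
  The abstraction \<open>\<lambda>x. p\<close> over the variable with index \<open>0\<close> in the context of \<open>p\<close>.
  Since blocks count as nested binders, no index changes.
\<close>

fun lam :: "ty \<Rightarrow> proc \<Rightarrow> proc" where
  "lam \<sigma> (Lam \<tau>s e) = Lam (\<sigma> # \<tau>s) e"

function eta :: "ty \<Rightarrow> nat \<Rightarrow> proc" where
  "eta \<sigma> x =
    Lam (args \<sigma>)
      (Case (App (x + length (args \<sigma>))
                 (map (\<lambda>(\<tau>, z). eta \<tau> z) (zip (args \<sigma>) (rev [0..<length (args \<sigma>)]))))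
            Num)"
  by pat_completeness auto
termination
  by (relation "measure (\<lambda>(\<sigma>, x). size \<sigma>)") (auto dest: set_zip_leftD size_args)

declare eta.simps [simp del]

text \<open>
  The list \<open>x\<^sub>0\<^sup>\<eta>, \<dots>, x\<^sub>r\<^sub>-\<^sub>1\<^sup>\<eta>\<close> for a block of variables of types \<open>\<sigma>s\<close> whose last
  variable has index \<open>k\<close>.
\<close>

definition etas :: "ty list \<Rightarrow> nat \<Rightarrow> proc list" where
  "etas \<sigma>s k = map2 eta \<sigma>s (rev [k..<k + length \<sigma>s])"


subsection \<open>Left-well-foundedness\<close>

datatype step = Body | Scrut | Branch nat | Arg nat

text \<open>
  The positions of the application occurrences in a term.  An occurrence lies strictly
  inside another one iff its position is a proper extension of that of the other.
\<close>

inductive app_at_proc :: "proc \<Rightarrow> step list \<Rightarrow> bool"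
  and app_at_exp :: "exp \<Rightarrow> step list \<Rightarrow> bool"
  and app_at_app :: "app \<Rightarrow> step list \<Rightarrow> bool" where
  "app_at_exp e \<pi> \<Longrightarrow> app_at_proc (Lam \<sigma>s e) (Body # \<pi>)"
| "app_at_app a \<pi> \<Longrightarrow> app_at_exp (Case a es) (Scrut # \<pi>)"
| "app_at_exp (es i) \<pi> \<Longrightarrow> app_at_exp (Case a es) (Branch i # \<pi>)"
| "app_at_app a []"
| "j < length qs \<Longrightarrow> app_at_proc (qs ! j) \<pi> \<Longrightarrow> app_at_app (App x qs) (Arg j # \<pi>)"

definition LWF :: "proc \<Rightarrow> bool" where
  "LWF p \<longleftrightarrow>
    \<not> (\<exists>\<pi> :: nat \<Rightarrow> step list. \<forall>k. app_at_proc p (\<pi> k) \<and> strict_prefix (\<pi> k) (\<pi> (Suc k)))"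


section \<open>Meta-terms and application\<close>

codatatype mproc = MLam "ty list" mexp
  and mexp = MBot | MNum nat | MCase mapp "nat \<Rightarrow> mexp"
  and mapp = MExp mexp | MVar nat "mproc list" | MApp mproc "mproc list"

primcorec emb_proc :: "proc \<Rightarrow> mproc"
  and emb_exp :: "exp \<Rightarrow> mexp"
  and emb_app :: "app \<Rightarrow> mapp" where
  "emb_proc p = (case p of Lam \<sigma>s e \<Rightarrow> MLam \<sigma>s (emb_exp e))"
| "emb_exp e = (case e of Bot \<Rightarrow> MBot | Num n \<Rightarrow> MNum n | Case a es \<Rightarrow> MCase (emb_app a) (emb_exp \<circ> es))"
| "emb_app a = (case a of App x qs \<Rightarrow> MVar x (map emb_proc qs))"

definition up_ren :: "nat \<Rightarrow> (nat \<Rightarrow> nat) \<Rightarrow> nat \<Rightarrow> nat" where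
  "up_ren r f i = (if i < r then i else f (i - r) + r)"

primcorec ren_proc :: "(nat \<Rightarrow> nat) \<Rightarrow> mproc \<Rightarrow> mproc"
  and ren_exp :: "(nat \<Rightarrow> nat) \<Rightarrow> mexp \<Rightarrow> mexp"
  and ren_app :: "(nat \<Rightarrow> nat) \<Rightarrow> mapp \<Rightarrow> mapp" where
  "ren_proc f P = (case P of MLam \<sigma>s E \<Rightarrow> MLam \<sigma>s (ren_exp (up_ren (length \<sigma>s) f) E))"
| "ren_exp f E =
    (case E of MBot \<Rightarrow> MBot | MNum n \<Rightarrow> MNum n | MCase G Es \<Rightarrow> MCase (ren_app f G) (ren_exp f \<circ> Es))"
| "ren_app f G =
    (case G of
      MExp E \<Rightarrow> MExp (ren_exp f E)
    | MVar x Qs \<Rightarrow> MVar (f x) (map (ren_proc f) Qs)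
    | MApp P Qs \<Rightarrow> MApp (ren_proc f P) (map (ren_proc f) Qs))"

text \<open>
  A substitution maps each variable either to a variable or to a meta-procedure.
\<close>

type_synonym subst = "nat \<Rightarrow> nat + mproc"

definition up_subst :: "nat \<Rightarrow> subst \<Rightarrow> subst" where
  "up_subst r s i =
    (if i < r then Inl i else map_sum (\<lambda>j. j + r) (ren_proc (\<lambda>j. j + r)) (s (i - r)))"

primcorec sub_proc :: "subst \<Rightarrow> mproc \<Rightarrow> mproc"
  and sub_exp :: "subst \<Rightarrow> mexp \<Rightarrow> mexp"
  and sub_app :: "subst \<Rightarrow> mapp \<Rightarrow> mapp" where
  "sub_proc s P = (case P of MLam \<sigma>s E \<Rightarrow> MLam \<sigma>s (sub_exp (up_subst (length \<sigma>s) s) E))"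
| "sub_exp s E =
    (case E of MBot \<Rightarrow> MBot | MNum n \<Rightarrow> MNum n | MCase G Es \<Rightarrow> MCase (sub_app s G) (sub_exp s \<circ> Es))"
| "sub_app s G =
    (case G of
      MExp E \<Rightarrow> MExp (sub_exp s E)
    | MVar x Qs \<Rightarrow>
        (case s x of
          Inl y \<Rightarrow> MVar y (map (sub_proc s) Qs)
        | Inr P \<Rightarrow> MApp P (map (sub_proc s) Qs))
    | MApp P Qs \<Rightarrow> MApp (sub_proc s P) (map (sub_proc s) Qs))"

text \<open>
  The substitution \<open>[x\<^sub>0 \<dots> x\<^sub>r\<^sub>-\<^sub>1 \<mapsto> Q\<^sub>0 \<dots> Q\<^sub>r\<^sub>-\<^sub>1]\<close> for the innermost \<open>r\<close> binders.
\<close>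

definition inst :: "mproc list \<Rightarrow> subst" where
  "inst Qs i = (if i < length Qs then Inr (rev Qs ! i) else Inl (i - length Qs))"

text \<open>
  Head reduction of expressions.  Reduction under the binders of a procedure is built into
  the normal form below.
\<close>

inductive hred_app :: "mapp \<Rightarrow> mapp \<Rightarrow> bool"
  and hred_exp :: "mexp \<Rightarrow> mexp \<Rightarrow> bool" where
  beta: "length Qs = length \<sigma>s \<Longrightarrow> hred_app (MApp (MLam \<sigma>s E) Qs) (MExp (sub_exp (inst Qs) E))"
| in_exp: "hred_exp E E' \<Longrightarrow> hred_app (MExp E) (MExp E')"
| case_bot: "hred_exp (MCase (MExp MBot) Es) MBot"
| case_num: "hred_exp (MCase (MExp (MNum n)) Es) (Es n)"
| case_case: "hred_exp (MCase (MExp (MCase G Es)) Fs) (MCase G (\<lambda>i. MCase (MExp (Es i)) Fs))"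
| in_case: "hred_app G G' \<Longrightarrow> (\<nexists>H Fs. G = MExp (MCase H Fs)) \<Longrightarrow> hred_exp (MCase G Es) (MCase G' Es)"

inductive hnf :: "mexp \<Rightarrow> bool" where
  "hnf MBot"
| "hnf (MNum n)"
| "hnf (MCase (MVar x Qs) Es)"

definition head_reduce :: "mexp \<Rightarrow> mexp" where
  "head_reduce E =
    (if \<exists>H. hred_exp\<^sup>*\<^sup>* E H \<and> hnf H then THE H. hred_exp\<^sup>*\<^sup>* E H \<and> hnf H else MBot)"

primcorec nf_proc :: "mproc \<Rightarrow> proc"
  and nf_exp :: "mexp \<Rightarrow> exp"
  and nf_app :: "nat \<Rightarrow> mproc list \<Rightarrow> app" where
  "nf_proc P = (case P of MLam \<sigma>s E \<Rightarrow> Lam \<sigma>s (nf_exp E))"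
| "nf_exp E =
    (case head_reduce E of
      MBot \<Rightarrow> Bot
    | MNum n \<Rightarrow> Num n
    | MCase G Es \<Rightarrow>
        (case G of
          MVar x Qs \<Rightarrow> Case (nf_app x Qs) (nf_exp \<circ> Es)
        | _ \<Rightarrow> Bot))"
| "nf_app x Qs = App x (map nf_proc Qs)"

text \<open>
  In the equation for \<open>\<lambda>x\<^sub>0 \<dots> x\<^sub>r. e\<close>, passing below the remaining binders \<open>x\<^sub>1 \<dots> x\<^sub>r\<close> is
  left to \<^const>\<open>sub_proc\<close>.  The equation for the ill-typed case is arbitrary.
\<close>

fun nsp_app :: "proc \<Rightarrow> proc \<Rightarrow> proc"  (infixl "\<cdot>" 75) where
  "Lam (\<sigma> # \<tau>s) e \<cdot> q = nf_proc (sub_proc (inst [emb_proc q]) (MLam \<tau>s (emb_exp e)))"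
| "Lam [] e \<cdot> q = Lam [] Bot"


section \<open>Languages\<close>

type_synonym name = string

text \<open>The parameter \<open>'c\<close> comprises the constants that a language adds to the base language.\<close>

datatype 'c const = CNum nat | Suc_c | Pre_c | Ifzero_c | Ext 'c

datatype 'c tm =
    Var name
  | Con "'c const"
  | App_tm "'c tm" "'c tm"  (infixl "\<bullet>" 80)
  | Abs name ty "'c tm"

type_synonym ctx = "(name \<times> ty) list"

fun const_ty :: "('c \<Rightarrow> ty) \<Rightarrow> 'c const \<Rightarrow> ty" where
  "const_ty cty (CNum n) = N"
| "const_ty cty Suc_c = N \<rightarrow> N"
| "const_ty cty Pre_c = N \<rightarrow> N"
| "const_ty cty Ifzero_c = N \<rightarrow> N \<rightarrow> N \<rightarrow> N"
| "const_ty cty (Ext c) = cty c"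

inductive wt_tm :: "('c \<Rightarrow> ty) \<Rightarrow> ctx \<Rightarrow> 'c tm \<Rightarrow> ty \<Rightarrow> bool" for cty where
  "map_of \<Gamma> x = Some \<sigma> \<Longrightarrow> wt_tm cty \<Gamma> (Var x) \<sigma>"
| "wt_tm cty \<Gamma> (Con c) (const_ty cty c)"
| "wt_tm cty \<Gamma> L (\<sigma> \<rightarrow> \<tau>) \<Longrightarrow> wt_tm cty \<Gamma> M \<sigma> \<Longrightarrow> wt_tm cty \<Gamma> (L \<bullet> M) \<tau>"
| "wt_tm cty ((x, \<sigma>) # \<Gamma>) M \<tau> \<Longrightarrow> wt_tm cty \<Gamma> (Abs x \<sigma> M) (\<sigma> \<rightarrow> \<tau>)"

text \<open>Only used for replacing constants by closed terms, so that no variable can be captured.\<close>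

primrec replace :: "('c \<Rightarrow> 'd tm) \<Rightarrow> 'c tm \<Rightarrow> 'd tm" where
  "replace tr (Var x) = Var x"
| "replace tr (Con c) =
    (case c of CNum n \<Rightarrow> Con (CNum n) | Suc_c \<Rightarrow> Con Suc_c | Pre_c \<Rightarrow> Con Pre_c
      | Ifzero_c \<Rightarrow> Con Ifzero_c | Ext c' \<Rightarrow> tr c')"
| "replace tr (L \<bullet> M) = replace tr L \<bullet> replace tr M"
| "replace tr (Abs x \<sigma> M) = Abs x \<sigma> (replace tr M)"

definition abss :: "ctx \<Rightarrow> 'c tm \<Rightarrow> 'c tm" where
  "abss \<Gamma> M = foldr (\<lambda>(x, \<sigma>). Abs x \<sigma>) \<Gamma> M"

definition apps :: "'c tm \<Rightarrow> 'c tm list \<Rightarrow> 'c tm" where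
  "apps M Ms = foldl App_tm M Ms"

text \<open>The \<open>i\<close>-th member of a family of names, all different from the one-letter names used below.\<close>

definition zname :: "nat \<Rightarrow> name" where
  "zname i = ''z'' @ replicate i (CHR ''z'')"

definition ifzero_at :: "ty \<Rightarrow> 'c tm" where
  "ifzero_at \<sigma> =
    (let ns = map zname [0..<length (args \<sigma>)]
     in abss ([(''n'', N), (''x'', \<sigma>), (''y'', \<sigma>)] @ zip ns (args \<sigma>))
          (Con Ifzero_c \<bullet> Var ''n'' \<bullet> apps (Var ''x'') (map Var ns) \<bullet> apps (Var ''y'') (map Var ns)))"


subsection \<open>PCF with \<open>byval\<close> and its interpretation\<close>

datatype pcf = Y_c ty | Byval_c "ty list" ty

fun pcf_ty :: "pcf \<Rightarrow> ty" where
  "pcf_ty (Y_c \<sigma>) = (\<sigma> \<rightarrow> \<sigma>) \<rightarrow> \<sigma>"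
| "pcf_ty (Byval_c \<sigma>s \<tau>) = funs \<sigma>s (N \<rightarrow> \<tau>) \<rightarrow> funs \<sigma>s (N \<rightarrow> \<tau>)"

text \<open>
  \<open>fix_proc \<sigma> k\<close> is the procedure \<open>q = \<lambda>y\<^sub>0 \<dots> y\<^sub>r\<^sub>-\<^sub>1. case f q y\<^sub>0\<^sup>\<eta> \<dots> y\<^sub>r\<^sub>-\<^sub>1\<^sup>\<eta> of (i \<Rightarrow> i)\<close>
  for the variable \<open>f\<close> of type \<open>\<sigma> \<rightarrow> \<sigma>\<close> with index \<open>k\<close>; see \<open>fix_proc_unfold\<close>.
\<close>

primcorec fix_proc :: "ty \<Rightarrow> nat \<Rightarrow> proc"
  and fix_exp :: "ty \<Rightarrow> nat \<Rightarrow> exp"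
  and fix_app :: "ty \<Rightarrow> nat \<Rightarrow> app" where
  "fix_proc \<sigma> k = Lam (args \<sigma>) (fix_exp \<sigma> (k + length (args \<sigma>)))"
| "fix_exp \<sigma> k = Case (fix_app \<sigma> k) Num"
| "fix_app \<sigma> k =
    App k (map (\<lambda>u. case u of Inl k' \<Rightarrow> fix_proc \<sigma> k' | Inr p \<Rightarrow> p) (Inl k # map Inr (etas (args \<sigma>) 0)))"

lemma fix_proc_unfold:
  "fix_proc \<sigma> k =
    Lam (args \<sigma>)
      (Case (App (k + length (args \<sigma>))
                 (fix_proc \<sigma> (k + length (args \<sigma>)) # etas (args \<sigma>) 0))
            Num)"
  by (subst fix_proc.code, subst fix_exp.code, subst fix_app.code) (simp add: comp_def)

fun den_const :: "pcf const \<Rightarrow> proc" where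
  "den_const (CNum n) = num n"
| "den_const Suc_c = Lam [N] (Case (App 0 []) (\<lambda>i. Num (i + 1)))"
| "den_const Pre_c = Lam [N] (Case (App 0 []) (\<lambda>i. Num (i - 1)))"
| "den_const Ifzero_c =
    Lam [N, N, N]
      (Case (App 2 []) (\<lambda>i. if i = 0 then Case (App 1 []) Num else Case (App 0 []) Num))"
| "den_const (Ext (Byval_c \<sigma>s \<tau>)) =
    (let r = length \<sigma>s; s = length (args \<tau>)
     in Lam (funs \<sigma>s (N \<rightarrow> \<tau>) # \<sigma>s @ N # args \<tau>)
          (Case (App s [])
            (\<lambda>i. Case (App (s + 1 + r) (etas \<sigma>s (s + 1) @ num i # etas (args \<tau>) 0)) Num)))"
| "den_const (Ext (Y_c \<sigma>)) =
    (let r = length (args \<sigma>)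
     in Lam ((\<sigma> \<rightarrow> \<sigma>) # args \<sigma>) (Case (App r (fix_proc \<sigma> r # etas (args \<sigma>) 0)) Num))"

fun index :: "ctx \<Rightarrow> name \<Rightarrow> nat" where
  "index [] x = 0"
| "index ((y, \<sigma>) # \<Gamma>) x = (if x = y then 0 else Suc (index \<Gamma> x))"

primrec den :: "ctx \<Rightarrow> pcf tm \<Rightarrow> proc" where
  "den \<Gamma> (Var x) = eta (the (map_of \<Gamma> x)) (index \<Gamma> x)"
| "den \<Gamma> (Con c) = den_const c"
| "den \<Gamma> (L \<bullet> M) = den \<Gamma> L \<cdot> den \<Gamma> M"
| "den \<Gamma> (Abs x \<sigma> M) = lam \<sigma> (den ((x, \<sigma>) # \<Gamma>) M)"


subsection \<open>The other languages and their translations\<close>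

definition rec_ty :: "ty \<Rightarrow> ty" where
  "rec_ty \<sigma> = \<sigma> \<rightarrow> (\<sigma> \<rightarrow> N \<rightarrow> \<sigma>) \<rightarrow> N \<rightarrow> \<sigma>"

definition min_ty :: ty where
  "min_ty = (N \<rightarrow> N) \<rightarrow> N \<rightarrow> N"

abbreviation Y_tm :: "ty \<Rightarrow> pcf tm" where
  "Y_tm \<sigma> \<equiv> Con (Ext (Y_c \<sigma>))"

abbreviation byval_tm :: "ty list \<Rightarrow> ty \<Rightarrow> pcf tm" where
  "byval_tm \<sigma>s \<tau> \<equiv> Con (Ext (Byval_c \<sigma>s \<tau>))"

abbreviation byval_plus :: "ty \<Rightarrow> pcf tm" where
  "byval_plus \<sigma> \<equiv> byval_tm [\<sigma>, \<sigma> \<rightarrow> N \<rightarrow> \<sigma>] \<sigma>"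

definition Rec_tm :: "ty \<Rightarrow> pcf tm" where
  "Rec_tm \<sigma> =
    byval_plus \<sigma> \<bullet> (Y_tm (rec_ty \<sigma>) \<bullet>
      abss [(''r'', rec_ty \<sigma>), (''x'', \<sigma>), (''f'', \<sigma> \<rightarrow> N \<rightarrow> \<sigma>), (''n'', N)]
        (ifzero_at \<sigma> \<bullet> Var ''n'' \<bullet> Var ''x'' \<bullet>
          (byval_tm [] \<sigma> \<bullet>
            Abs ''m'' N
              (Var ''f'' \<bullet> (byval_plus \<sigma> \<bullet> Var ''r'' \<bullet> Var ''x'' \<bullet> Var ''f'' \<bullet> Var ''m'') \<bullet> Var ''m'') \<bullet>
            (Con Pre_c \<bullet> Var ''n''))))"

definition Min_tm :: "pcf tm" where
  "Min_tm =
    byval_tm [N \<rightarrow> N] N \<bullet> (Y_tm min_ty \<bullet>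
      abss [(''m'', min_ty), (''f'', N \<rightarrow> N), (''n'', N)]
        (Con Ifzero_c \<bullet> (Var ''f'' \<bullet> Var ''n'') \<bullet> Var ''n'' \<bullet>
          (byval_tm [N \<rightarrow> N] N \<bullet> Var ''m'' \<bullet> Var ''f'' \<bullet> (Con Suc_c \<bullet> Var ''n''))))"

definition While_tm :: "ty \<Rightarrow> pcf tm" where
  "While_tm \<sigma> =
    abss [(''c'', \<sigma> \<rightarrow> N), (''x'', \<sigma>), (''f'', \<sigma> \<rightarrow> \<sigma>)]
      (Y_tm (\<sigma> \<rightarrow> \<sigma>) \<bullet>
        abss [(''w'', \<sigma> \<rightarrow> \<sigma>), (''v'', \<sigma>)]
          (ifzero_at \<sigma> \<bullet> (Var ''c'' \<bullet> Var ''v'') \<bullet> (Var ''w'' \<bullet> (Var ''f'' \<bullet> Var ''v'')) \<bullet> Var ''v'') \<bullet>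
        Var ''x'')"

definition Rec_str_tm :: "pcf tm" where
  "Rec_str_tm =
    byval_plus N \<bullet> (Y_tm (rec_ty N) \<bullet>
      abss [(''r'', rec_ty N), (''x'', N), (''f'', N \<rightarrow> N \<rightarrow> N), (''n'', N)]
        (Con Ifzero_c \<bullet> Var ''n'' \<bullet> Var ''x'' \<bullet>
          (byval_tm [] N \<bullet>
            Abs ''k'' N
              (byval_tm [] N \<bullet>
                Abs ''m'' N (Var ''f'' \<bullet> Var ''m'' \<bullet> Var ''k'') \<bullet>
                (byval_plus N \<bullet> Var ''r'' \<bullet> Var ''x'' \<bullet> Var ''f'' \<bullet> Var ''k'')) \<bullet>
            (Con Pre_c \<bullet> Var ''n''))))"

definition definable :: "('c \<Rightarrow> ty) \<Rightarrow> ('c \<Rightarrow> pcf tm) \<Rightarrow> ty \<Rightarrow> proc \<Rightarrow> bool" where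
  "definable cty tr \<sigma> p \<longleftrightarrow> (\<exists>M. wt_tm cty [] M \<sigma> \<and> p = den [] (replace tr M))"

datatype t_min = Rec_c ty | Min_c

fun t_min_ty :: "t_min \<Rightarrow> ty" where
  "t_min_ty (Rec_c \<sigma>) = rec_ty \<sigma>"
| "t_min_ty Min_c = min_ty"

fun t_min_tr :: "t_min \<Rightarrow> pcf tm" where
  "t_min_tr (Rec_c \<sigma>) = Rec_tm \<sigma>"
| "t_min_tr Min_c = Min_tm"

definition definable_T_min :: "ty \<Rightarrow> proc \<Rightarrow> bool" where
  "definable_T_min = definable t_min_ty t_min_tr"

datatype w = While_c ty

fun w_ty :: "w \<Rightarrow> ty" where
  "w_ty (While_c \<sigma>) = (\<sigma> \<rightarrow> N) \<rightarrow> \<sigma> \<rightarrow> (\<sigma> \<rightarrow> \<sigma>) \<rightarrow> \<sigma>"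

fun w_tr :: "w \<Rightarrow> pcf tm" where
  "w_tr (While_c \<sigma>) = While_tm \<sigma>"

definition definable_W :: "ty \<Rightarrow> proc \<Rightarrow> bool" where
  "definable_W = definable w_ty w_tr"

datatype t0_str = Byval_N_c | Rec_str_c

fun t0_str_ty :: "t0_str \<Rightarrow> ty" where
  "t0_str_ty Byval_N_c = (N \<rightarrow> N) \<rightarrow> N \<rightarrow> N"
| "t0_str_ty Rec_str_c = rec_ty N"

fun t0_str_tr :: "t0_str \<Rightarrow> pcf tm" where
  "t0_str_tr Byval_N_c = byval_tm [] N"
| "t0_str_tr Rec_str_c = Rec_str_tm"

definition definable_T0_str :: "ty \<Rightarrow> proc \<Rightarrow> bool" where
  "definable_T0_str = definable t0_str_ty t0_str_tr"


section \<open>Bar recursors\<close>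

text \<open>
  A coding \<open>c\<close> of finite sequences together with (the interpretations of) programs for the
  basic operations on codes.  That \<open>c\<close> is primitive recursive follows from the
  definability of \<open>add\<close>.
\<close>

definition sequence_coding :: "(nat list \<Rightarrow> nat) \<Rightarrow> proc \<Rightarrow> proc \<Rightarrow> proc \<Rightarrow> bool" where
  "sequence_coding c len add basic \<longleftrightarrow>
    inj c \<and>
    definable_T0_str (N \<rightarrow> N) len \<and>
    definable_T0_str (N \<rightarrow> N \<rightarrow> N) add \<and>
    definable_T0_str (N \<rightarrow> N \<rightarrow> (N \<rightarrow> N)) basic \<and>
    (\<forall>xs. len \<cdot> num (c xs) = num (length xs)) \<and>
    (\<forall>xs z. add \<cdot> num (c xs) \<cdot> num z = num (c (xs @ [z]))) \<and>
    (\<forall>xs j i. basic \<cdot> num (c xs) \<cdot> num j \<cdot> num i = num (if i < length xs then xs ! i else j))"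

definition Spector_bar ::
  "(nat list \<Rightarrow> nat) \<Rightarrow> proc \<Rightarrow> proc \<Rightarrow> proc \<Rightarrow> nat list \<Rightarrow> bool" where
  "Spector_bar c len basic F xs \<longleftrightarrow>
    (\<exists>m l. F \<cdot> (basic \<cdot> num (c xs) \<cdot> num 0) = num m \<and> len \<cdot> num (c xs) = num l \<and> m < l)"

definition Spector_tree ::
  "(nat list \<Rightarrow> nat) \<Rightarrow> proc \<Rightarrow> proc \<Rightarrow> proc \<Rightarrow> nat list set" where
  "Spector_tree c len basic F = {xs. \<forall>ys. strict_prefix ys xs \<longrightarrow> \<not> Spector_bar c len basic F ys}"

definition leaves :: "nat list set \<Rightarrow> nat list set" where
  "leaves T = {xs \<in> T. \<forall>y. xs @ [y] \<notin> T}"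

definition internal_nodes :: "nat list set \<Rightarrow> nat list set" where
  "internal_nodes T = T - leaves T"

definition simplified_weak_Spector_bar_recursor ::
  "(nat list \<Rightarrow> nat) \<Rightarrow> proc \<Rightarrow> proc \<Rightarrow> proc \<Rightarrow> proc \<Rightarrow> bool" where
  "simplified_weak_Spector_bar_recursor c len add basic \<Phi> \<longleftrightarrow>
    \<Phi> \<in> SP0 (pure 2 \<rightarrow> pure 2 \<rightarrow> pure 1) \<and>
    (\<forall>F \<in> SP0 (pure 2). \<forall>G \<in> SP0 (pure 2).
      definable_T0_str (pure 2) F \<longrightarrow> definable_T0_str (pure 2) G \<longrightarrow>
      (\<forall>xs \<in> leaves (Spector_tree c len basic F).
        \<Phi> \<cdot> F \<cdot> G \<cdot> num (c xs) = num (2 * c xs + 1)) \<and>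
      (\<forall>xs \<in> internal_nodes (Spector_tree c len basic F).
        \<Phi> \<cdot> F \<cdot> G \<cdot> num (c xs) =
          G \<cdot> lam N (\<Phi> \<cdot> F \<cdot> G \<cdot> (add \<cdot> num (c xs) \<cdot> eta N 0))))"

end

theory Submission
  imports Defs
begin

text \<open>
  Let \<open>x\<close> be a sequence of nonzero numbers.  At stage \<open>k\<close>, the functional \<open>F\<close> finds the first position
  before \<open>k\<close> where its argument differs from \<open>x\<close>, and gives \<open>k\<close> if there is none; then
  \<open>(x 0, \<dots>, x (k - 1))\<close> is an internal node of the tree all of whose children are leaves, and
  \<open>(x 0, \<dots>, x (i - 1), 0)\<close> is a leaf for \<open>i \<le> k\<close>.  The functional \<open>G\<close> recognizes the node from
  which it is called by the value \<open>2\<langle>x 0, \<dots>, x (i - 1), 0\<rangle> + 1\<close> of its argument at \<open>0\<close>.  It answers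
  \<open>K\<close> if \<open>i = k\<close>; if \<open>i < k\<close>, it asks for the value at \<open>x i\<close> and answers \<open>K\<close> or \<open>0\<close> according to
  whether this value is \<open>K\<close>.  The bar recursion equations force the value \<open>K\<close> at the empty sequence.

  For \<open>K = 0\<close> the answers of \<open>G\<close> carry no information.  If each \<open>x k\<close> exceeds all numbers in the
  finite evaluation of \<open>\<Phi> F G \<langle>\<rangle>\<close> at stage \<open>k\<close>, then the outermost applications evaluated
  are the same at all stages.  If \<open>\<Phi>\<close> is left-well-founded, then induction on the nesting of applications
  combines these evaluations into one finite evaluation, valid at all late stages.  It has the value
  \<open>0\<close> and remains valid for \<open>k\<close> and \<open>K\<close> larger than all numbers in it, where the value should be \<open>K\<close>.

  That definable procedures are left-well-founded is shown by a reducibility argument.  In recursion the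
  numerical argument is evaluated before it is passed on, so that the nesting of applications is
  bounded by its value; minimization and iteration repeat along the branches of case expressions
  and add no nesting.
\<close>

section \<open>Substitution\<close>

text \<open>Unrestricted recursion satisfies the bar recursion equations, so the values at the
  single stages cannot contradict each other. What has to be refuted is a common limit of the
  evaluations. For the whole sequence the recursion would never end, and \<open>F\<close> has no
  value at an argument equal to \<open>x\<close>. The limit evaluation is thus not an instance of
  the equations; it can only come from left-well-foundedness, which restricts the nesting of
  arguments but not the length of case branches.

  On the side of the procedures the obstacle is that application normalizes each time. Computing
  with iterated applications requires that normal forms do not change when parts of a meta-term are
  normalized beforehand. Terms are infinite and parts may diverge, so this is shown by a coinductive
  simulation of machine runs.\<close>

lemma ren_simps [simp]:
  "ren_proc f (MLam \<sigma>s E) = MLam \<sigma>s (ren_exp (up_ren (length \<sigma>s) f) E)"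
  "ren_exp f MBot = MBot"
  "ren_exp f (MNum n) = MNum n"
  "ren_exp f (MCase G Es) = MCase (ren_app f G) (ren_exp f \<circ> Es)"
  "ren_app f (MExp E) = MExp (ren_exp f E)"
  "ren_app f (MVar x Qs) = MVar (f x) (map (ren_proc f) Qs)"
  "ren_app f (MApp P Qs) = MApp (ren_proc f P) (map (ren_proc f) Qs)"
  by (simp_all add: ren_proc.code ren_exp.code ren_app.code)

lemma sub_simps [simp]:
  "sub_proc s (MLam \<sigma>s E) = MLam \<sigma>s (sub_exp (up_subst (length \<sigma>s) s) E)"
  "sub_exp s MBot = MBot"
  "sub_exp s (MNum n) = MNum n"
  "sub_exp s (MCase G Es) = MCase (sub_app s G) (sub_exp s \<circ> Es)"
  "sub_app s (MExp E) = MExp (sub_exp s E)"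
  "sub_app s (MVar x Qs) =
    (case s x of Inl y \<Rightarrow> MVar y (map (sub_proc s) Qs) | Inr P \<Rightarrow> MApp P (map (sub_proc s) Qs))"
  "sub_app s (MApp P Qs) = MApp (sub_proc s P) (map (sub_proc s) Qs)"
  by (simp_all add: sub_proc.code sub_exp.code sub_app.code)

lemma emb_simps [simp]:
  "emb_proc (Lam \<sigma>s e) = MLam \<sigma>s (emb_exp e)"
  "emb_exp Bot = MBot"
  "emb_exp (Num n) = MNum n"
  "emb_exp (Case a es) = MCase (emb_app a) (emb_exp \<circ> es)"
  "emb_app (App x qs) = MVar x (map emb_proc qs)"
  by (simp_all add: emb_proc.code emb_exp.code emb_app.code)

lemma nf_proc_MLam [simp]: "nf_proc (MLam \<sigma>s E) = Lam \<sigma>s (nf_exp E)"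
  and nf_app_simp [simp]: "nf_app x Qs = App x (map nf_proc Qs)"
  by (simp_all add: nf_proc.code nf_app.code)

lemma mterm_coinduct:
  assumes "\<And>P P'. R1 P P' \<Longrightarrow> \<exists>\<sigma>s E E'. P = MLam \<sigma>s E \<and> P' = MLam \<sigma>s E' \<and> R2 E E'"
    and "\<And>E E'. R2 E E' \<Longrightarrow> E = E' \<or>
      (\<exists>G G' Es Es'. E = MCase G Es \<and> E' = MCase G' Es' \<and> R3 G G' \<and> (\<forall>i. R2 (Es i) (Es' i)))"
    and "\<And>G G'. R3 G G' \<Longrightarrow> G = G' \<or> (\<exists>E E'. G = MExp E \<and> G' = MExp E' \<and> R2 E E') \<or>
      (\<exists>x Qs Qs'. G = MVar x Qs \<and> G' = MVar x Qs' \<and> list_all2 R1 Qs Qs') \<or>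
      (\<exists>P P' Qs Qs'. G = MApp P Qs \<and> G' = MApp P' Qs' \<and> (P = P' \<or> R1 P P') \<and> list_all2 R1 Qs Qs')"
  shows "R1 P P' \<Longrightarrow> P = P'" and "R2 E E' \<Longrightarrow> E = E'" and "R3 G G' \<Longrightarrow> G = G'"
proof -
  let ?R1 = "\<lambda>P P'. P = P' \<or> R1 P P'" and ?R2 = "\<lambda>P P'. P = P' \<or> R2 P P'"
    and ?R3 = "\<lambda>P P'. P = P' \<or> R3 P P'"
  have la: "list_all2 ?R1 Qs Qs" for Qs by (simp add: list_all2_refl)
  have lb: "list_all2 R1 Qs Qs' \<Longrightarrow> list_all2 ?R1 Qs Qs'" for Qs Qs'
    by (erule list_all2_mono) simp
  have "(?R1 P P' \<longrightarrow> P = P') \<and> (?R2 E E' \<longrightarrow> E = E') \<and> (?R3 G G' \<longrightarrow> G = G')" for P P' E E' G G'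
  proof (rule mproc_mexp_mapp.coinduct, goal_cases)
    case (1 P P')
    then show ?case using assms(1)[of P P'] by auto
  next
    case (2 E E')
    then show ?case
    proof
      assume "E = E'" then show ?thesis by (auto simp: rel_fun_def)
    next
      assume "R2 E E'" then show ?thesis by (drule_tac assms(2)) (auto simp: rel_fun_def)
    qed
  next
    case (3 G G')
    then show ?case
    proof
      assume "G = G'" then show ?thesis using la by auto
    next
      assume "R3 G G'" then show ?thesis using la lb by (drule_tac assms(3)) auto
    qed
  qed
  then show "R1 P P' \<Longrightarrow> P = P'" and "R2 E E' \<Longrightarrow> E = E'" and "R3 G G' \<Longrightarrow> G = G'" by blast+
qed

section \<open>Laws of renaming and substitution\<close>

lemma list_all2_map_map: "(\<And>x. x \<in> set xs \<Longrightarrow> R (f x) (g x)) \<Longrightarrow> list_all2 R (map f xs) (map g xs)"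
  by (simp add: list_all2_conv_all_nth)

lemma up_subst_Inl: "up_subst r (Inl \<circ> f) = Inl \<circ> up_ren r f"
  by (auto simp: up_subst_def up_ren_def fun_eq_iff)

lemma up_subst_up_ren: "up_subst r s \<circ> up_ren r f = up_subst r (s \<circ> f)"
  by (auto simp: up_subst_def up_ren_def fun_eq_iff)

text \<open>With this, runs and reductions have to be studied under substitutions only; renamings
  are the case \<open>Inl \<circ> f\<close>.\<close>

lemma ren_conv_sub:
  "ren_proc f P = sub_proc (Inl \<circ> f) P" "ren_exp f E = sub_exp (Inl \<circ> f) E"
  "ren_app f G = sub_app (Inl \<circ> f) G"
proof -
  let ?R1 = "\<lambda>P P'. \<exists>f X. P = ren_proc f X \<and> P' = sub_proc (Inl \<circ> f) X"
  let ?R2 = "\<lambda>P P'. \<exists>f X. P = ren_exp f X \<and> P' = sub_exp (Inl \<circ> f) X"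
  let ?R3 = "\<lambda>P P'. \<exists>f X. P = ren_app f X \<and> P' = sub_app (Inl \<circ> f) X"
  have 1: "?R1 P P' \<Longrightarrow> \<exists>\<sigma>s E E'. P = MLam \<sigma>s E \<and> P' = MLam \<sigma>s E' \<and> ?R2 E E'" for P P'
    by (auto, case_tac X) (auto simp: up_subst_Inl)
  have 2: "?R2 E E' \<Longrightarrow> E = E' \<or>
      (\<exists>G G' Es Es'. E = MCase G Es \<and> E' = MCase G' Es' \<and> ?R3 G G' \<and> (\<forall>i. ?R2 (Es i) (Es' i)))" for E E'
    by (auto, case_tac X) auto
  have 3: "?R3 G G' \<Longrightarrow> G = G' \<or> (\<exists>E E'. G = MExp E \<and> G' = MExp E' \<and> ?R2 E E') \<or>
      (\<exists>x Qs Qs'. G = MVar x Qs \<and> G' = MVar x Qs' \<and> list_all2 ?R1 Qs Qs') \<or>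
      (\<exists>P P' Qs Qs'. G = MApp P Qs \<and> G' = MApp P' Qs' \<and> (P = P' \<or> ?R1 P P') \<and> list_all2 ?R1 Qs Qs')" for G G'
    by (auto, case_tac X) (auto intro!: list_all2_map_map)
  note co = mterm_coinduct[of ?R1 ?R2 ?R3, OF 1 2 3]
  show "ren_proc f P = sub_proc (Inl \<circ> f) P" by (rule co(1)) auto
  show "ren_exp f E = sub_exp (Inl \<circ> f) E" by (rule co(2)) auto
  show "ren_app f G = sub_app (Inl \<circ> f) G" by (rule co(3)) auto
qed

lemma sub_ren:
  "sub_proc s (ren_proc f P) = sub_proc (s \<circ> f) P" "sub_exp s (ren_exp f E) = sub_exp (s \<circ> f) E"
  "sub_app s (ren_app f G) = sub_app (s \<circ> f) G"
proof -
  let ?R1 = "\<lambda>P P'. \<exists>s f X. P = sub_proc s (ren_proc f X) \<and> P' = sub_proc (s \<circ> f) X"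
  let ?R2 = "\<lambda>P P'. \<exists>s f X. P = sub_exp s (ren_exp f X) \<and> P' = sub_exp (s \<circ> f) X"
  let ?R3 = "\<lambda>P P'. \<exists>s f X. P = sub_app s (ren_app f X) \<and> P' = sub_app (s \<circ> f) X"
  have 1: "?R1 P P' \<Longrightarrow> \<exists>\<sigma>s E E'. P = MLam \<sigma>s E \<and> P' = MLam \<sigma>s E' \<and> ?R2 E E'" for P P'
    by (auto, case_tac X) (auto simp: up_subst_up_ren[symmetric])
  have 2: "?R2 E E' \<Longrightarrow> E = E' \<or>
      (\<exists>G G' Es Es'. E = MCase G Es \<and> E' = MCase G' Es' \<and> ?R3 G G' \<and> (\<forall>i. ?R2 (Es i) (Es' i)))" for E E'
    by (auto, case_tac X) auto
  have 3: "?R3 G G' \<Longrightarrow> G = G' \<or> (\<exists>E E'. G = MExp E \<and> G' = MExp E' \<and> ?R2 E E') \<or>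
      (\<exists>x Qs Qs'. G = MVar x Qs \<and> G' = MVar x Qs' \<and> list_all2 ?R1 Qs Qs') \<or>
      (\<exists>P P' Qs Qs'. G = MApp P Qs \<and> G' = MApp P' Qs' \<and> (P = P' \<or> ?R1 P P') \<and> list_all2 ?R1 Qs Qs')" for G G'
    by (auto, case_tac X) (auto intro!: list_all2_map_map split: sum.splits, blast+)
  note co = mterm_coinduct[of ?R1 ?R2 ?R3, OF 1 2 3]
  show "sub_proc s (ren_proc f P) = sub_proc (s \<circ> f) P" by (rule co(1)) auto
  show "sub_exp s (ren_exp f E) = sub_exp (s \<circ> f) E" by (rule co(2)) auto
  show "sub_app s (ren_app f G) = sub_app (s \<circ> f) G" by (rule co(3)) auto
qed

lemma ren_ren: "ren_proc f (ren_proc g P) = ren_proc (f \<circ> g) P"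
  by (simp add: ren_conv_sub(1)[of f] ren_conv_sub(1)[of "f \<circ> g"] sub_ren comp_assoc)

lemma up_ren_add: "up_ren r f \<circ> (\<lambda>j. j + r) = (\<lambda>j. j + r) \<circ> f"
  by (auto simp: up_ren_def)

lemma up_subst_map_ren:
  "map_sum (up_ren r f) (ren_proc (up_ren r f)) \<circ> up_subst r s = up_subst r (map_sum f (ren_proc f) \<circ> s)"
proof
  fix i
  show "(map_sum (up_ren r f) (ren_proc (up_ren r f)) \<circ> up_subst r s) i
    = up_subst r (map_sum f (ren_proc f) \<circ> s) i"
    by (cases "s (i - r)") (auto simp: up_subst_def up_ren_def ren_ren up_ren_add)
qed

lemma ren_sub:
  "ren_proc f (sub_proc s P) = sub_proc (map_sum f (ren_proc f) \<circ> s) P"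
  "ren_exp f (sub_exp s E) = sub_exp (map_sum f (ren_proc f) \<circ> s) E"
  "ren_app f (sub_app s G) = sub_app (map_sum f (ren_proc f) \<circ> s) G"
proof -
  let ?R1 = "\<lambda>P P'. \<exists>s f X. P = ren_proc f (sub_proc s X) \<and> P' = sub_proc (map_sum f (ren_proc f) \<circ> s) X"
  let ?R2 = "\<lambda>P P'. \<exists>s f X. P = ren_exp f (sub_exp s X) \<and> P' = sub_exp (map_sum f (ren_proc f) \<circ> s) X"
  let ?R3 = "\<lambda>P P'. \<exists>s f X. P = ren_app f (sub_app s X) \<and> P' = sub_app (map_sum f (ren_proc f) \<circ> s) X"
  have 1: "?R1 P P' \<Longrightarrow> \<exists>\<sigma>s E E'. P = MLam \<sigma>s E \<and> P' = MLam \<sigma>s E' \<and> ?R2 E E'" for P P'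
    by (auto, case_tac X) (auto simp: up_subst_map_ren[symmetric])
  have 2: "?R2 E E' \<Longrightarrow> E = E' \<or>
      (\<exists>G G' Es Es'. E = MCase G Es \<and> E' = MCase G' Es' \<and> ?R3 G G' \<and> (\<forall>i. ?R2 (Es i) (Es' i)))" for E E'
    by (auto, case_tac X) auto
  have 3: "?R3 G G' \<Longrightarrow> G = G' \<or> (\<exists>E E'. G = MExp E \<and> G' = MExp E' \<and> ?R2 E E') \<or>
      (\<exists>x Qs Qs'. G = MVar x Qs \<and> G' = MVar x Qs' \<and> list_all2 ?R1 Qs Qs') \<or>
      (\<exists>P P' Qs Qs'. G = MApp P Qs \<and> G' = MApp P' Qs' \<and> (P = P' \<or> ?R1 P P') \<and> list_all2 ?R1 Qs Qs')" for G G'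
    by (auto, case_tac X) (auto intro!: list_all2_map_map split: sum.splits, blast+)
  note co = mterm_coinduct[of ?R1 ?R2 ?R3, OF 1 2 3]
  show "ren_proc f (sub_proc s P) = sub_proc (map_sum f (ren_proc f) \<circ> s) P" by (rule co(1)) auto
  show "ren_exp f (sub_exp s E) = sub_exp (map_sum f (ren_proc f) \<circ> s) E" by (rule co(2)) auto
  show "ren_app f (sub_app s G) = sub_app (map_sum f (ren_proc f) \<circ> s) G" by (rule co(3)) auto
qed

definition comp_subst :: "subst \<Rightarrow> subst \<Rightarrow> subst" (infixl "\<odot>" 55) where
  "(s \<odot> t) i = (case t i of Inl j \<Rightarrow> s j | Inr P \<Rightarrow> Inr (sub_proc s P))"

lemma up_subst_comp: "up_subst r s \<odot> up_subst r t = up_subst r (s \<odot> t)"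
proof
  fix i
  have *: "up_subst r s \<circ> (\<lambda>j. j + r) = map_sum (\<lambda>j. j + r) (ren_proc (\<lambda>j. j + r)) \<circ> s"
    by (auto simp: up_subst_def)
  then show "(up_subst r s \<odot> up_subst r t) i = up_subst r (s \<odot> t) i"
    by (cases "t (i - r)") (auto simp: up_subst_def comp_subst_def sub_ren ren_sub *)
qed

lemma sub_sub:
  "sub_proc s (sub_proc t P) = sub_proc (s \<odot> t) P"
  "sub_exp s (sub_exp t E) = sub_exp (s \<odot> t) E"
  "sub_app s (sub_app t G) = sub_app (s \<odot> t) G"
proof -
  let ?R1 = "\<lambda>P P'. \<exists>s t X. P = sub_proc s (sub_proc t X) \<and> P' = sub_proc (s \<odot> t) X"
  let ?R2 = "\<lambda>P P'. \<exists>s t X. P = sub_exp s (sub_exp t X) \<and> P' = sub_exp (s \<odot> t) X"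
  let ?R3 = "\<lambda>P P'. \<exists>s t X. P = sub_app s (sub_app t X) \<and> P' = sub_app (s \<odot> t) X"
  have 1: "?R1 P P' \<Longrightarrow> \<exists>\<sigma>s E E'. P = MLam \<sigma>s E \<and> P' = MLam \<sigma>s E' \<and> ?R2 E E'" for P P'
    by (auto, case_tac X) (auto simp: up_subst_comp[symmetric])
  have 2: "?R2 E E' \<Longrightarrow> E = E' \<or>
      (\<exists>G G' Es Es'. E = MCase G Es \<and> E' = MCase G' Es' \<and> ?R3 G G' \<and> (\<forall>i. ?R2 (Es i) (Es' i)))" for E E'
    by (auto, case_tac X) auto
  have 3: "?R3 G G' \<Longrightarrow> G = G' \<or> (\<exists>E E'. G = MExp E \<and> G' = MExp E' \<and> ?R2 E E') \<or>
      (\<exists>x Qs Qs'. G = MVar x Qs \<and> G' = MVar x Qs' \<and> list_all2 ?R1 Qs Qs') \<or>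
      (\<exists>P P' Qs Qs'. G = MApp P Qs \<and> G' = MApp P' Qs' \<and> (P = P' \<or> ?R1 P P') \<and> list_all2 ?R1 Qs Qs')" for G G'
    by (auto, case_tac X) (auto intro!: list_all2_map_map simp: comp_subst_def split: sum.splits, blast+)
  note co = mterm_coinduct[of ?R1 ?R2 ?R3, OF 1 2 3]
  show "sub_proc s (sub_proc t P) = sub_proc (s \<odot> t) P" by (rule co(1)) auto
  show "sub_exp s (sub_exp t E) = sub_exp (s \<odot> t) E" by (rule co(2)) auto
  show "sub_app s (sub_app t G) = sub_app (s \<odot> t) G" by (rule co(3)) auto
qed

lemma up_subst_id: "up_subst r Inl = Inl"
  by (auto simp: up_subst_def fun_eq_iff)

lemma sub_Inl [simp]: "sub_proc Inl P = P" "sub_exp Inl E = E" "sub_app Inl G = G"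
proof -
  let ?R1 = "\<lambda>P P'. P = sub_proc Inl P'"
  let ?R2 = "\<lambda>P P'. P = sub_exp Inl P'"
  let ?R3 = "\<lambda>P P'. P = sub_app Inl P'"
  have 1: "?R1 P P' \<Longrightarrow> \<exists>\<sigma>s E E'. P = MLam \<sigma>s E \<and> P' = MLam \<sigma>s E' \<and> ?R2 E E'" for P P'
    by (cases P') (auto simp: up_subst_id)
  have 2: "?R2 E E' \<Longrightarrow> E = E' \<or>
      (\<exists>G G' Es Es'. E = MCase G Es \<and> E' = MCase G' Es' \<and> ?R3 G G' \<and> (\<forall>i. ?R2 (Es i) (Es' i)))" for E E'
    by (cases E') auto
  have 3: "?R3 G G' \<Longrightarrow> G = G' \<or> (\<exists>E E'. G = MExp E \<and> G' = MExp E' \<and> ?R2 E E') \<or>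
      (\<exists>x Qs Qs'. G = MVar x Qs \<and> G' = MVar x Qs' \<and> list_all2 ?R1 Qs Qs') \<or>
      (\<exists>P P' Qs Qs'. G = MApp P Qs \<and> G' = MApp P' Qs' \<and> (P = P' \<or> ?R1 P P') \<and> list_all2 ?R1 Qs Qs')" for G G'
    by (cases G') (auto simp: list_all2_conv_all_nth)
  note co = mterm_coinduct[of ?R1 ?R2 ?R3, OF 1 2 3]
  show "sub_proc Inl P = P" by (rule co(1)) auto
  show "sub_exp Inl E = E" by (rule co(2)) auto
  show "sub_app Inl G = G" by (rule co(3)) auto
qed

lemma up_subst_0 [simp]: "up_subst 0 s = s"
proof
  fix i
  have "ren_proc (\<lambda>j. j) P = P" for P
    by (simp add: ren_conv_sub comp_def)
  then show "up_subst 0 s i = s i" by (cases "s i") (auto simp: up_subst_def)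
qed

text \<open>As for \<^const>\<open>inst\<close>, the last member of the list replaces the variable with index \<open>0\<close>.\<close>

definition push :: "(nat + mproc) list \<Rightarrow> subst \<Rightarrow> subst" where
  "push vs s i = (if i < length vs then rev vs ! i else s (i - length vs))"

lemma inst_Nil [simp]: "inst [] = Inl"
  by (auto simp: inst_def)

lemma inst_conv_push: "inst Qs = push (map Inr Qs) Inl"
  by (auto simp: inst_def push_def rev_map)

text \<open>Passing under a block and then instantiating it is one simultaneous substitution. All
  uses of beta reduction under a substitution rest on this law.\<close>

lemma push_comp_up: "push vs s \<odot> up_subst (length vs) t = push vs (s \<odot> t)"
proof
  fix i
  have *: "push vs s \<circ> (\<lambda>j. j + length vs) = s" by (auto simp: push_def)
  then show "(push vs s \<odot> up_subst (length vs) t) i = push vs (s \<odot> t) i"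
    by (cases "t (i - length vs)") (auto simp: up_subst_def comp_subst_def push_def sub_ren)
qed

lemma comp_Inl [simp]: "Inl \<odot> s = s" "s \<odot> Inl = s"
  by (auto simp: comp_subst_def fun_eq_iff split: sum.splits)

lemma comp_Inl_ren: "s \<odot> (Inl \<circ> f) = s \<circ> f"
  by (auto simp: comp_subst_def fun_eq_iff)

definition sub_var :: "subst \<Rightarrow> nat + mproc \<Rightarrow> nat + mproc" where
  "sub_var s v = (case v of Inl y \<Rightarrow> s y | Inr P \<Rightarrow> Inr (sub_proc s P))"

lemma sub_var_simps [simp]: "sub_var s (Inl y) = s y" "sub_var s (Inr P) = Inr (sub_proc s P)"
  by (simp_all add: sub_var_def)

lemma comp_push: "s \<odot> push vs t = push (map (sub_var s) vs) (s \<odot> t)"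
  by (auto simp: comp_subst_def push_def sub_var_def fun_eq_iff rev_map)

lemma push_push: "push ws (push vs s) = push (vs @ ws) s"
  by (auto simp: push_def fun_eq_iff nth_append add.commute)

lemma push_Nil [simp]: "push [] s = s"
  by (auto simp: push_def)

lemma sub_inst_up:
  "length Qs = r \<Longrightarrow> sub_exp (inst Qs) (sub_exp (up_subst r s) E) = sub_exp (push (map Inr Qs) s) E"
  using push_comp_up[of "map Inr Qs" Inl s] by (simp add: sub_sub inst_conv_push)

section \<open>Head reduction as a stack machine\<close>

type_synonym state = "mexp \<times> (nat \<Rightarrow> mexp) list"

text \<open>The stack holds the branches waiting for the value, innermost first. Pushing replaces
  the case-of-case conversion, so contexts are never copied into the expression and a run can be
  split at any frame.\<close>

inductive mstep :: "state \<Rightarrow> state \<Rightarrow> bool" where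
  num: "mstep (MNum n, F # S) (F n, S)"
| exp: "mstep (MCase (MExp D) Es, S) (D, Es # S)"
| beta: "length Qs = length \<sigma>s \<Longrightarrow>
    mstep (MCase (MApp (MLam \<sigma>s B) Qs) Es, S) (sub_exp (inst Qs) B, Es # S)"

inductive_cases mstepE: "mstep (E, S) st"
inductive_cases mstep_NumE: "mstep (MNum n, S) st"
inductive_cases mstep_BotE [elim!]: "mstep (MBot, S) st"
inductive_cases mstep_ExpE: "mstep (MCase (MExp D) Es, S) st"
inductive_cases mstep_AppE: "mstep (MCase (MApp P Qs) Es, S) st"
inductive_cases mstep_VarE [elim!]: "mstep (MCase (MVar x Qs) Es, S) st"

abbreviation msteps :: "state \<Rightarrow> state \<Rightarrow> bool" where
  "msteps \<equiv> mstep\<^sup>*\<^sup>*"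

lemma mstep_det: "mstep st st1 \<Longrightarrow> mstep st st2 \<Longrightarrow> st1 = st2"
  by (induction rule: mstep.induct) (auto elim: mstepE)

inductive final :: "state \<Rightarrow> bool" where
  "final (MBot, S)"
| "final (MNum n, [])"
| "final (MCase (MVar x Qs) Es, S)"

lemma final_no_step: "final st \<Longrightarrow> \<not> mstep st st'"
  by (auto simp: final.simps elim: mstep_NumE)

definition halts :: "state \<Rightarrow> bool" where
  "halts st \<longleftrightarrow> (\<exists>st'. msteps st st' \<and> final st')"

lemma msteps_final_final:
  assumes "msteps st st1" "final st1" "msteps st st2" "final st2" shows "st1 = st2"
  using assms
proof (induction rule: converse_rtranclp_induct)
  case base
  then show ?case by (metis converse_rtranclpE final_no_step)
next
  case (step y z)
  then show ?case by (metis converse_rtranclpE final_no_step mstep_det)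
qed

lemma halts_step: "mstep st st' \<Longrightarrow> halts st \<longleftrightarrow> halts st'"
  unfolding halts_def by (metis converse_rtranclpE converse_rtranclp_into_rtranclp final_no_step mstep_det)

lemma halts_steps: "msteps st st' \<Longrightarrow> halts st \<longleftrightarrow> halts st'"
  by (induction rule: rtranclp_induct) (auto dest: halts_step)

text \<open>Reads a state back as a meta-term. The remaining frames sit inside the branches of the
  first one, which is the shape that case-of-case conversions produce.\<close>

fun rload :: "mexp \<Rightarrow> (nat \<Rightarrow> mexp) list \<Rightarrow> mexp" where
  "rload E [] = E"
| "rload E (F # S) = MCase (MExp E) (\<lambda>i. rload (F i) S)"

text \<open>The side condition of \<open>in_case\<close> leaves a case in the scrutinee to
  \<open>case_case\<close>, so at most one rule applies.\<close>

lemma hred_det: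
  "hred_app G G1 \<Longrightarrow> hred_app G G2 \<Longrightarrow> G1 = G2"
  "hred_exp E E1 \<Longrightarrow> hred_exp E E2 \<Longrightarrow> E1 = E2"
proof (induction arbitrary: G2 and E2 rule: hred_app_hred_exp.inducts)
  case (beta Qs \<sigma>s E)
  then show ?case by (auto elim: hred_app.cases)
next
  case (in_exp E E')
  from in_exp.prems show ?case by (cases rule: hred_app.cases) (auto dest: in_exp.IH)
next
  case (case_bot Es)
  then show ?case by (cases rule: hred_exp.cases) (auto elim: hred_app.cases hred_exp.cases)
next
  case (case_num n Es)
  then show ?case by (cases rule: hred_exp.cases) (auto elim: hred_app.cases hred_exp.cases)
next
  case (case_case G Es Fs)
  then show ?case by (cases rule: hred_exp.cases) auto
next
  case (in_case G G' Es)
  from in_case.prems show ?case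
  proof (cases rule: hred_exp.cases)
    case (in_case G'')
    with in_case.IH show ?thesis by auto
  qed (use in_case.hyps in \<open>auto elim: hred_app.cases hred_exp.cases\<close>)
qed

lemma hnf_App: "\<not> hnf (MCase (MApp P Qs) Es)"
  by (auto elim: hnf.cases)

lemma hnf_no_hred: "hnf E \<Longrightarrow> \<not> hred_exp E E'"
  by (auto elim!: hnf.cases elim: hred_exp.cases hred_app.cases)

lemma hred_hnf_unique:
  assumes "hred_exp\<^sup>*\<^sup>* E H1" "hnf H1" "hred_exp\<^sup>*\<^sup>* E H2" "hnf H2" shows "H1 = H2"
  using assms
proof (induction rule: converse_rtranclp_induct)
  case base
  then show ?case by (metis converse_rtranclpE hnf_no_hred)
next
  case (step y z)
  then show ?case by (metis converse_rtranclpE hnf_no_hred hred_det(2))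
qed

lemma head_reduce_eq: "hred_exp\<^sup>*\<^sup>* E H \<Longrightarrow> hnf H \<Longrightarrow> head_reduce E = H"
  unfolding head_reduce_def using hred_hnf_unique by (auto intro!: the_equality)

lemma rload_case: "hred_exp\<^sup>*\<^sup>* (rload (MCase G Es) S) (MCase G (\<lambda>i. rload (Es i) S))"
  by (cases S) (auto intro: case_case)

lemma mstep_hred: "mstep (E, S) (E', S') \<Longrightarrow> hred_exp\<^sup>*\<^sup>* (rload E S) (rload E' S')"
proof (induction "(E, S)" "(E', S')" rule: mstep.induct)
  case (num n F)
  then show ?case using case_num[of n "\<lambda>i. rload (F i) S'"] by auto
next
  case (exp Es)
  then show ?case using rload_case[of "MExp E'" Es S] by auto
next
  case (beta Qs \<sigma>s B Es)
  have "hred_exp (MCase (MApp (MLam \<sigma>s B) Qs) (\<lambda>i. rload (Es i) S))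
    (MCase (MExp (sub_exp (inst Qs) B)) (\<lambda>i. rload (Es i) S))"
    using beta by (intro in_case hred_app_hred_exp.beta) auto
  with rload_case[of "MApp (MLam \<sigma>s B) Qs" Es S] beta show ?case
    by (auto intro: rtranclp.rtrancl_into_rtrancl)
qed

lemma msteps_hred: "msteps st st' \<Longrightarrow> hred_exp\<^sup>*\<^sup>* (rload (fst st) (snd st)) (rload (fst st') (snd st'))"
proof (induction rule: rtranclp_induct)
  case (step y z)
  with mstep_hred[of "fst y" "snd y" "fst z" "snd z"] show ?case by simp
qed simp

text \<open>Only the step from \<open>(MCase (MExp D) Es, [])\<close> is invisible to head reduction.\<close>

lemma hred_halts:
  "(hred_exp ^^ n) (rload E S) H \<Longrightarrow> hnf H \<Longrightarrow> halts (E, S)"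
proof (induction n arbitrary: E S rule: less_induct)
  case (less n)
  \<comment> \<open>By determinacy the given reduction to \<open>H\<close> must begin with any step
    that is possible.\<close>
  have stp: "\<exists>k. m = Suc k \<and> (hred_exp ^^ k) E1 H"
    if "hred_exp E0 E1" "(hred_exp ^^ m) E0 H" for E0 E1 m
  proof (cases m)
    case 0
    with that less.prems(2) show ?thesis using hnf_no_hred by auto
  next
    case (Suc k)
    with that(2) obtain E2 where "hred_exp E0 E2" "(hred_exp ^^ k) E2 H" by (blast dest: relpowp_Suc_D2)
    with that(1) hred_det(2) Suc show ?thesis by blast
  qed
  \<comment> \<open>Looking one level further into \<open>D\<close> finds a final state or a step
    that head reduction sees. Hence the count may still be \<open>m = n\<close>.\<close>
  have ex: "halts (D, Es # S')" if *: "(hred_exp ^^ m) (MCase (MExp D) (\<lambda>i. rload (Es i) S')) H"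
    and m: "m < n \<or> (m = n \<and> S = [])" for m D Es S'
  proof -
    show ?thesis
    proof (cases D)
      case MBot
      then show ?thesis by (auto simp: halts_def intro: final.intros)
    next
      case (MNum i)
      from stp[OF case_num *[unfolded MNum]] obtain k where "m = Suc k"
        "(hred_exp ^^ k) (rload (Es i) S') H" by auto
      with less.IH[of k "Es i" S'] m less.prems have "halts (Es i, S')" by auto
      then show ?thesis using halts_step[OF mstep.num] MNum by blast
    next
      case (MCase G Fs)
      from stp[OF case_case *[unfolded MCase]] obtain k where k: "m = Suc k"
        "(hred_exp ^^ k) (MCase G (\<lambda>i. MCase (MExp (Fs i)) (\<lambda>i. rload (Es i) S'))) H" by auto
      show ?thesis
      proof (cases G)
        case (MExp D')
        have "(hred_exp ^^ k) (rload D' (Fs # Es # S')) H" using k MExp by simp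
        with less.IH[of k D' "Fs # Es # S'"] k m less.prems have "halts (D', Fs # Es # S')" by auto
        then show ?thesis using halts_step[OF mstep.exp] MCase MExp by blast
      next
        case (MVar x Qs)
        then show ?thesis using MCase by (auto simp: halts_def intro: final.intros)
      next
        case (MApp P Qs)
        from k(2) MApp less.prems(2) have "k \<noteq> 0" by (intro notI) (auto simp: hnf_App)
        then obtain k' E' where k': "k = Suc k'"
          "hred_exp (MCase G (\<lambda>i. MCase (MExp (Fs i)) (\<lambda>i. rload (Es i) S'))) E'"
          "(hred_exp ^^ k') E' H"
          using k(2) by (cases k) (auto dest: relpowp_Suc_D2 simp del: relpowp.simps)
        from k'(2) MApp obtain \<sigma>s B where B: "P = MLam \<sigma>s B" "length Qs = length \<sigma>s"
          "E' = rload (sub_exp (inst Qs) B) (Fs # Es # S')"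
          by (auto elim!: hred_exp.cases[of "MCase _ _"] hred_app.cases[of "MApp _ _"])
        with less.IH[of k' _ "Fs # Es # S'"] k'(3) k k' m less.prems
        have "halts (sub_exp (inst Qs) B, Fs # Es # S')" by auto
        then show ?thesis using halts_step[OF mstep.beta] B MCase MApp by blast
      qed
    qed
  qed
  show ?case
  proof (cases S)
    case Nil
    show ?thesis
    proof (cases E)
      case (MCase G Es)
      show ?thesis
      proof (cases G)
        case (MExp D)
        with ex[of n D Es "[]"] less.prems(1) MCase Nil have "halts (D, [Es])" by simp
        then show ?thesis using halts_step[OF mstep.exp] MCase MExp Nil by blast
      next
        case (MVar x Qs)
        then show ?thesis using MCase by (auto simp: halts_def intro: final.intros)
      next
        case (MApp P Qs)
        from less.prems MApp MCase Nil have "n \<noteq> 0" by (intro notI) (auto simp: hnf_App)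
        then obtain k' E' where k': "n = Suc k'" "hred_exp (MCase G Es) E'" "(hred_exp ^^ k') E' H"
          using less.prems(1) MCase Nil by (cases n) (auto dest: relpowp_Suc_D2 simp del: relpowp.simps)
        from k'(2) MApp obtain \<sigma>s B where B: "P = MLam \<sigma>s B" "length Qs = length \<sigma>s"
          "E' = rload (sub_exp (inst Qs) B) [Es]"
          by (auto elim!: hred_exp.cases[of "MCase _ _"] hred_app.cases[of "MApp _ _"])
        with less.IH[of k' _ "[Es]"] k' less.prems
        have "halts (sub_exp (inst Qs) B, [Es])" by auto
        then show ?thesis using halts_step[OF mstep.beta] B MCase MApp Nil by blast
      qed
    qed (use Nil in \<open>auto simp: halts_def intro: final.intros\<close>)
  next
    case (Cons F S')
    show ?thesis
    proof (cases "\<exists>i. E = MNum i \<or> E = MBot")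
      case True
      then show ?thesis
      proof (elim exE disjE)
        fix i assume E: "E = MNum i"
        from stp[of "rload E S" "rload (F i) S'" n] less.prems(1) E Cons obtain k where "n = Suc k"
          "(hred_exp ^^ k) (rload (F i) S') H" by (auto intro: case_num)
        with less.IH[of k "F i" S'] less.prems have "halts (F i, S')" by auto
        then show ?thesis using halts_step[OF mstep.num] E Cons by blast
      qed (auto simp: halts_def intro: final.intros)
    next
      case False
      then obtain G Fs where E: "E = MCase G Fs" by (cases E) auto
      from stp[of "rload E S" "MCase G (\<lambda>i. MCase (MExp (Fs i)) (\<lambda>i. rload (F i) S'))" n]
        less.prems(1) E Cons obtain k where k: "n = Suc k"
        "(hred_exp ^^ k) (MCase G (\<lambda>i. rload (Fs i) (F # S'))) H" by (auto intro: case_case)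
      show ?thesis
      proof (cases G)
        case (MExp D)
        with ex[of k D Fs "F # S'"] k have "halts (D, Fs # F # S')" by simp
        then show ?thesis using halts_step[OF mstep.exp] E MExp Cons by blast
      next
        case (MVar x Qs)
        then show ?thesis using E by (auto simp: halts_def intro: final.intros)
      next
        case (MApp P Qs)
        from k(2) MApp less.prems(2) have "k \<noteq> 0" by (intro notI) (auto simp: hnf_App)
        then obtain k' E' where k': "k = Suc k'" "hred_exp (MCase G (\<lambda>i. rload (Fs i) (F # S'))) E'"
          "(hred_exp ^^ k') E' H"
          using k(2) by (cases k) (auto dest: relpowp_Suc_D2 simp del: relpowp.simps)
        from k'(2) MApp obtain \<sigma>s B where B: "P = MLam \<sigma>s B" "length Qs = length \<sigma>s"
          "E' = rload (sub_exp (inst Qs) B) (Fs # F # S')"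
          by (auto elim!: hred_exp.cases[of "MCase _ _"] hred_app.cases[of "MApp _ _"])
        with less.IH[of k' _ "Fs # F # S'"] k' k less.prems
        have "halts (sub_exp (inst Qs) B, Fs # F # S')" by auto
        then show ?thesis using halts_step[OF mstep.beta] B E MApp Cons by blast
      qed
    qed
  qed
qed

section \<open>Normal forms of machine states\<close>

definition nfs :: "state \<Rightarrow> exp" where
  "nfs st = nf_exp (rload (fst st) (snd st))"

lemma nf_exp_conv_nfs: "nf_exp E = nfs (E, [])"
  by (simp add: nfs_def)

lemma nfs_bot: "msteps st (MBot, S) \<Longrightarrow> nfs st = Bot"
proof -
  assume "msteps st (MBot, S)"
  from msteps_hred[OF this] have "hred_exp\<^sup>*\<^sup>* (rload (fst st) (snd st)) MBot"
    by (cases S) (auto intro: case_bot rtranclp.rtrancl_into_rtrancl)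
  then have "head_reduce (rload (fst st) (snd st)) = MBot" by (rule head_reduce_eq) (rule hnf.intros)
  then show ?thesis by (simp add: nfs_def nf_exp.code)
qed

lemma nfs_num: "msteps st (MNum n, []) \<Longrightarrow> nfs st = Num n"
proof -
  assume "msteps st (MNum n, [])"
  from msteps_hred[OF this] have "head_reduce (rload (fst st) (snd st)) = MNum n"
    by (intro head_reduce_eq) (auto intro: hnf.intros)
  then show ?thesis by (simp add: nfs_def nf_exp.code)
qed

lemma nfs_case: "msteps st (MCase (MVar x Qs) Es, S) \<Longrightarrow>
  nfs st = Case (App x (map nf_proc Qs)) (\<lambda>i. nfs (Es i, S))"
proof -
  assume "msteps st (MCase (MVar x Qs) Es, S)"
  from msteps_hred[OF this] rload_case[of "MVar x Qs" Es S]
  have "head_reduce (rload (fst st) (snd st)) = MCase (MVar x Qs) (\<lambda>i. rload (Es i) S)"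
    by (intro head_reduce_eq) (auto intro: hnf.intros)
  then show ?thesis by (simp add: nfs_def nf_exp.code[of "rload (fst st) (snd st)"] comp_def)
qed

lemma nfs_no_halt: "\<not> halts st \<Longrightarrow> nfs st = Bot"
proof -
  assume "\<not> halts st"
  then have "\<not> (\<exists>H. hred_exp\<^sup>*\<^sup>* (rload (fst st) (snd st)) H \<and> hnf H)"
    by (metis hred_halts prod.collapse rtranclp_imp_relpowp)
  then have "head_reduce (rload (fst st) (snd st)) = MBot"
    unfolding head_reduce_def by (simp only: if_False)
  then show ?thesis by (simp add: nfs_def nf_exp.code)
qed

text \<open>Either both states run to the same final state, or neither halts and both normal forms
  are \<open>Bot\<close>. Normal forms can thus be computed by running the machine.\<close>

lemma nfs_step: "mstep st st' \<Longrightarrow> nfs st = nfs st'"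
proof (cases "halts st'")
  case True
  assume st: "mstep st st'"
  from True obtain st'' where "msteps st' st''" "final st''" by (auto simp: halts_def)
  from this(1) have "msteps st st''" using st by (rule converse_rtranclp_into_rtranclp[rotated])
  with \<open>msteps st' st''\<close> \<open>final st''\<close> show ?thesis
    by (auto simp: final.simps nfs_bot nfs_num nfs_case)
next
  case False
  moreover assume "mstep st st'"
  ultimately show ?thesis using halts_step nfs_no_halt by metis
qed

lemma nfs_steps: "msteps st st' \<Longrightarrow> nfs st = nfs st'"
  by (induction rule: rtranclp_induct) (auto dest: nfs_step)

lemma nfs_simps [simp]:
  "nfs (MBot, S) = Bot"
  "nfs (MNum n, []) = Num n"
  "nfs (MNum n, F # S) = nfs (F n, S)"
  "nfs (MCase (MExp D) Es, S) = nfs (D, Es # S)"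
  "nfs (MCase (MVar x Qs) Es, S) = Case (App x (map nf_proc Qs)) (\<lambda>i. nfs (Es i, S))"
  using nfs_bot nfs_num nfs_case nfs_step mstep.intros by blast+

lemma nfs_beta: "length Qs = length \<sigma>s \<Longrightarrow>
    nfs (MCase (MApp (MLam \<sigma>s B) Qs) Es, S) = nfs (sub_exp (inst Qs) B, Es # S)"
  by (rule nfs_step) (rule mstep.beta)

lemma nf_exp_simps [simp]:
  "nf_exp MBot = Bot" "nf_exp (MNum n) = Num n"
  "nf_exp (MCase (MVar x Qs) Es) = Case (App x (map nf_proc Qs)) (\<lambda>i. nf_exp (Es i))"
  by (simp_all add: nf_exp_conv_nfs)

lemma halts_induct [consumes 1, case_names final step]:
  assumes "halts st" and "\<And>st. final st \<Longrightarrow> P st"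
    and "\<And>st st'. mstep st st' \<Longrightarrow> halts st' \<Longrightarrow> P st' \<Longrightarrow> P st"
  shows "P st"
proof -
  from assms(1) obtain st' where "msteps st st'" "final st'" by (auto simp: halts_def)
  then show ?thesis
  proof (induction rule: converse_rtranclp_induct)
    case base
    then show ?case by (rule assms(2))
  next
    case (step y z)
    then show ?case using assms(3)[of y z] unfolding halts_def by blast
  qed
qed

section \<open>Runs under substitutions and with longer stacks\<close>

definition sub_state :: "subst \<Rightarrow> state \<Rightarrow> state" where
  "sub_state s st = (sub_exp s (fst st), map (\<lambda>F. sub_exp s \<circ> F) (snd st))"

lemma sub_exp_inst: "length Qs = r \<Longrightarrow>
    sub_exp s (sub_exp (inst Qs) B) = sub_exp (inst (map (sub_proc s) Qs)) (sub_exp (up_subst r s) B)"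
  by (simp add: sub_inst_up) (simp add: inst_conv_push sub_sub comp_push comp_def)

lemma mstep_sub: "mstep st st' \<Longrightarrow> mstep (sub_state s st) (sub_state s st')"
  by (induction rule: mstep.induct)
    (auto simp: sub_state_def sub_exp_inst intro: mstep.intros mstep.num[of _ "sub_exp s \<circ> _", simplified])

lemma msteps_sub: "msteps st st' \<Longrightarrow> msteps (sub_state s st) (sub_state s st')"
  by (induction rule: rtranclp_induct) (auto dest: mstep_sub[of _ _ s])

lemma mstep_append: "mstep (E, S) (E', S') \<Longrightarrow> mstep (E, S @ U) (E', S' @ U)"
  by (induction "(E, S)" "(E', S')" rule: mstep.induct) (auto intro: mstep.intros)

lemma msteps_append: "msteps (E, S) (E', S') \<Longrightarrow> msteps (E, S @ U) (E', S' @ U)"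
  by (induction rule: rtranclp_induct2) (auto dest: mstep_append[of _ _ _ _ U])

text \<open>Meta-terms carry no typing here, so a redex may have the wrong number of arguments. Such
  a state is not final and cannot move; it counts as divergent.\<close>

lemma state_cases:
  obtains (final) "final st" | (step) st' where "mstep st st'"
  | (stuck) \<sigma>s B Qs Es S where "st = (MCase (MApp (MLam \<sigma>s B) Qs) Es, S)" "length Qs \<noteq> length \<sigma>s"
proof (cases st)
  case (Pair E S)
  show ?thesis
  proof (cases E)
    case MBot
    then show ?thesis using Pair by (auto intro: final.intros that(1))
  next
    case (MNum n)
    then show ?thesis using Pair by (cases S) (auto intro: final.intros mstep.intros that(1,2))
  next
    case (MCase G Es)
    show ?thesis
    proof (cases G)
      case (MExp D)
      then show ?thesis using Pair MCase by (auto intro: mstep.intros that(2))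
    next
      case (MVar x Qs)
      then show ?thesis using Pair MCase by (auto intro: final.intros that(1))
    next
      case (MApp P Qs)
      obtain \<sigma>s B where P: "P = MLam \<sigma>s B" by (cases P)
      show ?thesis
      proof (cases "length Qs = length \<sigma>s")
        case True
        then show ?thesis using Pair MCase MApp P mstep.beta that(2) by blast
      next
        case False
        then show ?thesis using Pair MCase MApp P that(3) by blast
      qed
    qed
  qed
qed

lemma stuck_not_halts:
  assumes "length Qs \<noteq> length \<sigma>s" shows "\<not> halts (MCase (MApp (MLam \<sigma>s B) Qs) Es, S)"
proof -
  have "\<not> mstep (MCase (MApp (MLam \<sigma>s B) Qs) Es, S) st" for st
    using assms by (auto elim: mstep_AppE)
  moreover have "\<not> final (MCase (MApp (MLam \<sigma>s B) Qs) Es, S)" by (auto elim: final.cases)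
  ultimately show ?thesis unfolding halts_def by (metis converse_rtranclpE)
qed

lemma final_halts: "final st \<Longrightarrow> halts st"
  unfolding halts_def by blast

text \<open>The instance repeats every step of the original, so the original cannot run longer. Used
  in the contrapositive: divergence survives substitution.\<close>

lemma halts_sub: "halts (sub_state s st) \<Longrightarrow> halts st"
proof (induction "sub_state s st" arbitrary: st rule: halts_induct)
  case final
  show ?case
  proof (cases st rule: state_cases)
    case (step st')
    then show ?thesis using mstep_sub final final_no_step by blast
  next
    case (stuck \<sigma>s B Qs Es S)
    then show ?thesis using final by (auto simp: sub_state_def elim: final.cases)
  qed (rule final_halts)
next
  case (step st')
  show ?case
  proof (cases st rule: state_cases)
    case (step st1)
    then show ?thesis using mstep_sub[of st st1 s] step.hyps mstep_det halts_step by metis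
  next
    case (stuck \<sigma>s B Qs Es S)
    then show ?thesis using step.hyps(1) by (auto simp: sub_state_def elim: mstep_AppE)
  qed (rule final_halts)
qed

lemma halts_append: "halts (E, S @ U) \<Longrightarrow> halts (E, S)"
proof (induction "(E, S @ U)" arbitrary: E S rule: halts_induct)
  case final
  then show ?case by (auto simp: final.simps intro: final_halts final.intros)
next
  case (step st')
  show ?case
  proof (cases "(E, S)" rule: state_cases)
    case (step st1)
    then have "mstep (E, S @ U) (fst st1, snd st1 @ U)" by (cases st1) (auto dest: mstep_append)
    then have "st' = (fst st1, snd st1 @ U)" using step.hyps mstep_det by blast
    with step.hyps(3) step show ?thesis using halts_step by (metis prod.collapse)
  next
    case (stuck \<sigma>s B Qs Es S)
    then show ?thesis using step.hyps(1) by (auto elim: mstep_AppE)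
  qed (rule final_halts)
qed

section \<open>Normalizing parts of a meta-term\<close>

text \<open>\<open>Qp P P'\<close> holds if \<open>P'\<close> arises from \<open>P\<close> by head-reducing, arbitrarily far, some of the
  subexpressions of \<open>P\<close>, possibly at infinitely many places and infinitely often along a branch;
  subexpressions without head normal form may be replaced by \<open>MBot\<close>.  An expression of \<open>P\<close> is
  given as a machine state, since the branches that become visible by reducing it are states.\<close>

coinductive Qp :: "mproc \<Rightarrow> mproc \<Rightarrow> bool"
  and Qe :: "mexp \<Rightarrow> (nat \<Rightarrow> mexp) list \<Rightarrow> mexp \<Rightarrow> bool"
  and Qa :: "mapp \<Rightarrow> mapp \<Rightarrow> bool" where
  Qp: "Qe B [] B' \<Longrightarrow> Qp (MLam \<sigma>s B) (MLam \<sigma>s B')"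
| Qe_div: "\<not> halts (E, T) \<Longrightarrow> Qe E T MBot"
| Qe_bot: "msteps (E, T) (MBot, T') \<Longrightarrow> Qe E T MBot"
| Qe_num: "msteps (E, T) (MNum n, []) \<Longrightarrow> Qe E T (MNum n)"
| Qe_case: "msteps (E, T) (MCase G Es, T') \<Longrightarrow> Qa G G' \<Longrightarrow> (\<And>i. Qe (Es i) T' (Es' i)) \<Longrightarrow>
    Qe E T (MCase G' Es')"
| Qa_exp: "Qe D [] D' \<Longrightarrow> Qa (MExp D) (MExp D')"
| Qa_var: "list_all2 Qp Qs Qs' \<Longrightarrow> Qa (MVar x Qs) (MVar x Qs')"
| Qa_app: "Qp P P' \<Longrightarrow> list_all2 Qp Qs Qs' \<Longrightarrow> Qa (MApp P Qs) (MApp P' Qs')"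
monos list_all2_mono

text \<open>The operator of \<open>MApp\<close> may be related by \<open>Qp\<close> instead of
  \<open>X1\<close>, as happens when related substitutions supply it.\<close>

lemma Q_coinduct:
  assumes 1: "\<And>P P'. X1 P P' \<Longrightarrow> \<exists>\<sigma>s B B'. P = MLam \<sigma>s B \<and> P' = MLam \<sigma>s B' \<and> X2 B [] B'"
    and 2: "\<And>E T E'. X2 E T E' \<Longrightarrow> (E' = MBot \<and> (\<not> halts (E, T) \<or> (\<exists>T'. msteps (E, T) (MBot, T')))) \<or>
      (\<exists>n. E' = MNum n \<and> msteps (E, T) (MNum n, [])) \<or>
      (\<exists>G Es T' G' Es'. E' = MCase G' Es' \<and> msteps (E, T) (MCase G Es, T') \<and> X3 G G' \<and>
        (\<forall>i. X2 (Es i) T' (Es' i)))"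
    and 3: "\<And>G G'. X3 G G' \<Longrightarrow> (\<exists>D D'. G = MExp D \<and> G' = MExp D' \<and> X2 D [] D') \<or>
      (\<exists>x Qs Qs'. G = MVar x Qs \<and> G' = MVar x Qs' \<and> list_all2 X1 Qs Qs') \<or>
      (\<exists>P P' Qs Qs'. G = MApp P Qs \<and> G' = MApp P' Qs' \<and> (X1 P P' \<or> Qp P P') \<and> list_all2 X1 Qs Qs')"
  shows "X1 P P' \<Longrightarrow> Qp P P'" "X2 E T E' \<Longrightarrow> Qe E T E'"
proof -
  have l: "list_all2 X1 Qs Qs' \<Longrightarrow> list_all2 (\<lambda>x y. X1 x y \<or> Qp x y) Qs Qs'" for Qs Qs'
    by (erule list_all2_mono) simp
  have "(\<forall>P P'. X1 P P' \<longrightarrow> Qp P P') \<and> (\<forall>E T E'. X2 E T E' \<longrightarrow> Qe E T E') \<and> (\<forall>G G'. X3 G G' \<longrightarrow> Qa G G')"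
  proof (rule Qp_Qe_Qa.coinduct, goal_cases)
    case (1 P P')
    from assms(1)[OF this] show ?case by auto
  next
    case (2 E T E')
    from assms(2)[OF this] show ?case
    proof (elim disjE exE conjE)
      fix G Es T' G' Es'
      assume "E' = MCase G' Es'" "msteps (E, T) (MCase G Es, T')" "X3 G G'" "\<forall>i. X2 (Es i) T' (Es' i)"
      then show ?thesis
        by (intro disjI2) (simp, intro exI[of _ G] exI[of _ Es] exI[of _ T'], simp)
    qed auto
  next
    case (3 G G')
    from assms(3)[OF this] show ?case
    proof (elim disjE exE conjE, goal_cases)
      case 1
      then show ?thesis by simp
    next
      case (2 x Qs Qs')
      then show ?thesis using l[of Qs Qs'] by simp
    next
      case (3 P P' Qs Qs')
      then show ?thesis using l[of Qs Qs'] by simp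
    next
      case (4 P P' Qs Qs')
      then show ?thesis using l[of Qs Qs'] by simp
    qed
  qed
  then show "X1 P P' \<Longrightarrow> Qp P P'" "X2 E T E' \<Longrightarrow> Qe E T E'" by blast+
qed

text \<open>Reducing at every place and replacing all divergent parts is the extreme case of
  reducing some parts.\<close>

lemma Qp_nf: "Qp P (emb_proc (nf_proc P))" and Qe_nf: "Qe E T (emb_exp (nfs (E, T)))"
proof -
  let ?X1 = "\<lambda>P P'. P' = emb_proc (nf_proc P)"
  let ?X2 = "\<lambda>E T E'. E' = emb_exp (nfs (E, T))"
  let ?X3 = "\<lambda>G G'. \<exists>x Qs. G = MVar x Qs \<and> G' = MVar x (map (\<lambda>P. emb_proc (nf_proc P)) Qs)"
  have 1: "\<exists>\<sigma>s B B'. P = MLam \<sigma>s B \<and> P' = MLam \<sigma>s B' \<and> ?X2 B [] B'" if "?X1 P P'" for P P'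
    using that by (cases P) (auto simp: nf_exp_conv_nfs)
  have 2: "(E' = MBot \<and> (\<not> halts (E, T) \<or> (\<exists>T'. msteps (E, T) (MBot, T')))) \<or>
      (\<exists>n. E' = MNum n \<and> msteps (E, T) (MNum n, [])) \<or>
      (\<exists>G Es T' G' Es'. E' = MCase G' Es' \<and> msteps (E, T) (MCase G Es, T') \<and> ?X3 G G' \<and>
        (\<forall>i. ?X2 (Es i) T' (Es' i)))" if "?X2 E T E'" for E T E'
  proof (cases "halts (E, T)")
    case True
    then obtain st where st: "msteps (E, T) st" "final st" by (auto simp: halts_def)
    from st(2) show ?thesis
    proof cases
      case (1 S)
      have "E' = MBot" using that nfs_bot st(1) 1 by simp
      then show ?thesis using st(1) 1 by blast
    next
      case (2 n)
      have "E' = MNum n" using that nfs_num st(1) 2 by simp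
      then show ?thesis using st(1) 2 by blast
    next
      case (3 x Qs Es S)
      with st that have "E' = MCase (MVar x (map (\<lambda>P. emb_proc (nf_proc P)) Qs)) (\<lambda>i. emb_exp (nfs (Es i, S)))"
        using nfs_case[of "(E, T)" x Qs Es S] by (simp add: comp_def)
      with st(1) 3 show ?thesis by blast
    qed
  qed (use that nfs_no_halt in simp)
  have 3: "(\<exists>D D'. G = MExp D \<and> G' = MExp D' \<and> ?X2 D [] D') \<or>
      (\<exists>x Qs Qs'. G = MVar x Qs \<and> G' = MVar x Qs' \<and> list_all2 ?X1 Qs Qs') \<or>
      (\<exists>P P' Qs Qs'. G = MApp P Qs \<and> G' = MApp P' Qs' \<and> (?X1 P P' \<or> Qp P P') \<and> list_all2 ?X1 Qs Qs')"
    if "?X3 G G'" for G G' using that by (auto simp: list_all2_conv_all_nth)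
  note co = Q_coinduct[of ?X1 ?X2 ?X3, OF 1 2 3]
  show "Qp P (emb_proc (nf_proc P))" by (rule co(1)) auto
  show "Qe E T (emb_exp (nfs (E, T)))" by (rule co(2)) auto
qed

inductive_cases QpE: "Qp P P'"
inductive_cases Qe_BotE: "Qe E T MBot"
inductive_cases Qe_NumE: "Qe E T (MNum n)"
inductive_cases Qe_CaseE: "Qe E T (MCase G' Es')"
inductive_cases Qa_ExpE: "Qa G (MExp D)"
inductive_cases Qa_VarE: "Qa G (MVar x Qs)"
inductive_cases Qa_AppE: "Qa G (MApp P Qs)"

section \<open>Partial normalization under substitutions\<close>

definition Qsub :: "subst \<Rightarrow> subst \<Rightarrow> bool" where
  "Qsub s s' \<longleftrightarrow> (\<forall>i. rel_sum (=) Qp (s i) (s' i))"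

text \<open>The class \<open>Z\<close> breaks a circle: \<open>Qsub\<close> passes under binders
  only if \<open>Qp\<close> is preserved by renaming, which is itself an instance of this lemma. It
  is applied to renamings first and then to \<open>Z = Qsub\<close>.\<close>

lemma Q_sub_aux:
  assumes Z: "\<And>s s'. Z s s' \<Longrightarrow> Qsub s s'" and up: "\<And>s s' r. Z s s' \<Longrightarrow> Z (up_subst r s) (up_subst r s')"
    and s: "Z s s'"
  shows "Qp P P' \<Longrightarrow> Qp (sub_proc s P) (sub_proc s' P')"
    and "Qe E T E' \<Longrightarrow> Qe (sub_exp s E) (map (\<lambda>F. sub_exp s \<circ> F) T) (sub_exp s' E')"
proof -
  let ?X1 = "\<lambda>P P'. \<exists>s s' Y Y'. Z s s' \<and> Qp Y Y' \<and> P = sub_proc s Y \<and> P' = sub_proc s' Y'"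
  let ?X2 = "\<lambda>E T E'. \<exists>s s' Y U Y'. Z s s' \<and> Qe Y U Y' \<and> E = sub_exp s Y \<and> T = map (\<lambda>F. sub_exp s \<circ> F) U \<and> E' = sub_exp s' Y'"
  let ?X3 = "\<lambda>G G'. \<exists>s s' Y Y'. Z s s' \<and> Qa Y Y' \<and> G = sub_app s Y \<and> G' = sub_app s' Y'"
  have 1: "\<exists>\<sigma>s B B'. P = MLam \<sigma>s B \<and> P' = MLam \<sigma>s B' \<and> ?X2 B [] B'" if "?X1 P P'" for P P'
  proof -
    from that obtain s s' Y Y' where *: "Z s s'" "Qp Y Y'" "P = sub_proc s Y" "P' = sub_proc s' Y'" by blast
    from *(2) obtain \<sigma>s B B' where "Y = MLam \<sigma>s B" "Y' = MLam \<sigma>s B'" "Qe B [] B'" by (auto elim: QpE)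
    then show ?thesis using * up[OF *(1), of "length \<sigma>s"] by fastforce
  qed
  have 2: "(E' = MBot \<and> (\<not> halts (E, T) \<or> (\<exists>T'. msteps (E, T) (MBot, T')))) \<or>
      (\<exists>n. E' = MNum n \<and> msteps (E, T) (MNum n, [])) \<or>
      (\<exists>G Es T' G' Es'. E' = MCase G' Es' \<and> msteps (E, T) (MCase G Es, T') \<and> ?X3 G G' \<and>
        (\<forall>i. ?X2 (Es i) T' (Es' i)))" if X: "?X2 E T E'" for E T E'
  proof -
    from X obtain s s' Y U Y' where *: "Z s s'" "Qe Y U Y'" "E = sub_exp s Y"
      "T = map (\<lambda>F. sub_exp s \<circ> F) U" "E' = sub_exp s' Y'" by blast
    have st: "(E, T) = sub_state s (Y, U)" using * by (simp add: sub_state_def)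
    from *(2) show ?thesis
    proof cases
      case Qe_div
      then show ?thesis using * st halts_sub by auto
    next
      case (Qe_bot T')
      from msteps_sub[OF this(2), of s] show ?thesis using Qe_bot *(5) unfolding st
        by (auto simp: sub_state_def)
    next
      case (Qe_num n)
      from msteps_sub[OF this(2), of s] show ?thesis using Qe_num *(5) unfolding st
        by (auto simp: sub_state_def)
    next
      case (Qe_case G Es T' G' Es')
      from msteps_sub[OF this(2), of s]
      have ms: "msteps (E, T) (MCase (sub_app s G) (sub_exp s \<circ> Es), map (\<lambda>F. sub_exp s \<circ> F) T')"
        unfolding st by (simp add: sub_state_def)
      have E': "E' = MCase (sub_app s' G') (sub_exp s' \<circ> Es')" using Qe_case *(5) by simp
      have "?X3 (sub_app s G) (sub_app s' G')" using Qe_case *(1) by blast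
      moreover have "\<forall>i. ?X2 ((sub_exp s \<circ> Es) i) (map (\<lambda>F. sub_exp s \<circ> F) T') ((sub_exp s' \<circ> Es') i)"
      proof
        fix i
        show "?X2 ((sub_exp s \<circ> Es) i) (map (\<lambda>F. sub_exp s \<circ> F) T') ((sub_exp s' \<circ> Es') i)"
          using Qe_case(4)[of i] *(1) unfolding comp_apply by blast
      qed
      ultimately show ?thesis using ms E' by blast
    qed
  qed
  have 3: "(\<exists>D D'. G = MExp D \<and> G' = MExp D' \<and> ?X2 D [] D') \<or>
      (\<exists>x Qs Qs'. G = MVar x Qs \<and> G' = MVar x Qs' \<and> list_all2 ?X1 Qs Qs') \<or>
      (\<exists>P P' Qs Qs'. G = MApp P Qs \<and> G' = MApp P' Qs' \<and> (?X1 P P' \<or> Qp P P') \<and> list_all2 ?X1 Qs Qs')"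
    if X: "?X3 G G'" for G G'
  proof -
    from X obtain s s' Y Y' where *: "Z s s'" "Qa Y Y'" "G = sub_app s Y" "G' = sub_app s' Y'" by blast
    have l: "list_all2 Qp Qs Qs' \<Longrightarrow> list_all2 ?X1 (map (sub_proc s) Qs) (map (sub_proc s') Qs')" for Qs Qs'
      using *(1) unfolding list_all2_map1 list_all2_map2 by (elim list_all2_mono) blast
    from *(2) show ?thesis
    proof cases
      case (Qa_exp D D')
      then have "G = MExp (sub_exp s D)" "G' = MExp (sub_exp s' D')" using * by auto
      moreover have "?X2 (sub_exp s D) [] (sub_exp s' D')" using Qa_exp *(1) by fastforce
      ultimately show ?thesis by blast
    next
      case (Qa_var Qs Qs' x)
      have "rel_sum (=) Qp (s x) (s' x)" using Z[OF *(1)] by (simp add: Qsub_def)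
      then show ?thesis
      proof cases
        case (1 y y')
        with Qa_var * l[OF Qa_var(3)] show ?thesis by auto
      next
        case (2 P P')
        have G: "G = MApp P (map (sub_proc s) Qs)" "G' = MApp P' (map (sub_proc s') Qs')"
          using Qa_var 2 * by auto
        show ?thesis unfolding G using l[OF Qa_var(3)] 2(3) by blast
      qed
    next
      case (Qa_app P P' Qs Qs')
      have G: "G = MApp (sub_proc s P) (map (sub_proc s) Qs)" "G' = MApp (sub_proc s' P') (map (sub_proc s') Qs')"
        using Qa_app * by auto
      show ?thesis unfolding G using l[OF Qa_app(4)] Qa_app(3) *(1) by blast
    qed
  qed
  note co = Q_coinduct[of ?X1 ?X2 ?X3, OF 1 2 3]
  show "Qp P P' \<Longrightarrow> Qp (sub_proc s P) (sub_proc s' P')" using s by (intro co(1)) auto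
  show "Qe E T E' \<Longrightarrow> Qe (sub_exp s E) (map (\<lambda>F. sub_exp s \<circ> F) T) (sub_exp s' E')"
  proof (rule co(2))
    assume "Qe E T E'"
    then show "?X2 (sub_exp s E) (map (\<lambda>F. sub_exp s \<circ> F) T) (sub_exp s' E')"
      using s by (intro exI[of _ s] exI[of _ s'] exI[of _ E] exI[of _ T] exI[of _ E']) simp
  qed
qed

lemma Qp_ren: "Qp P P' \<Longrightarrow> Qp (ren_proc f P) (ren_proc f P')"
  unfolding ren_conv_sub
  by (rule Q_sub_aux(1)[where Z = "\<lambda>s s'. \<exists>f. s = Inl \<circ> f \<and> s' = Inl \<circ> f"])
    (auto simp: Qsub_def up_subst_Inl)

lemma Qsub_up: "Qsub s s' \<Longrightarrow> Qsub (up_subst r s) (up_subst r s')"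
proof -
  assume *: "Qsub s s'"
  have "rel_sum (=) Qp (up_subst r s i) (up_subst r s' i)" for i
  proof -
    have "rel_sum (=) Qp (s (i - r)) (s' (i - r))" using * by (simp add: Qsub_def)
    then show ?thesis by cases (auto simp: up_subst_def Qp_ren)
  qed
  then show ?thesis by (simp add: Qsub_def)
qed

lemma Qp_sub: "Qsub s s' \<Longrightarrow> Qp P P' \<Longrightarrow> Qp (sub_proc s P) (sub_proc s' P')"
  and Qe_sub: "Qsub s s' \<Longrightarrow> Qe E T E' \<Longrightarrow> Qe (sub_exp s E) (map (\<lambda>F. sub_exp s \<circ> F) T) (sub_exp s' E')"
  using Q_sub_aux[where Z = Qsub] Qsub_up by blast+

lemma Qsub_inst: "list_all2 Qp Qs Qs' \<Longrightarrow> Qsub (inst Qs) (inst Qs')"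
  by (auto simp: Qsub_def inst_def list_all2_conv_all_nth rev_nth)

text \<open>One frame of the reduct may stand for a frame of the original together with the segment
  \<open>T\<close> after it, since \<open>Qe\<close> relates an expression with a local stack to a
  single expression.\<close>

inductive Qst :: "(nat \<Rightarrow> mexp) list \<Rightarrow> (nat \<Rightarrow> mexp) list \<Rightarrow> bool" where
  "Qst [] []"
| "(\<And>i. Qe (F i) T (F' i)) \<Longrightarrow> Qst U U' \<Longrightarrow> Qst (F # T @ U) (F' # U')"

inductive_cases Qst_ConsE: "Qst U (F' # U')"
inductive_cases Qst_NilE [elim!]: "Qst U []"

definition Qstate :: "state \<Rightarrow> state \<Rightarrow> bool" where
  "Qstate st st' \<longleftrightarrow> (\<exists>E T U E' U'. st = (E, T @ U) \<and> st' = (E', U') \<and> Qe E T E' \<and> Qst U U')"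

text \<open>Either the outcome can be read off, or one step of the reduct is matched by at least one
  step of the original. That it is at least one is what later transfers termination to the
  reduct.\<close>

lemma Qstate_cases:
  assumes "Qstate st st'"
  obtains (none) S where "st' = (MBot, S)" "\<not> halts st"
  | (bot) S T where "st' = (MBot, S)" "msteps st (MBot, T)"
  | (num) n where "st' = (MNum n, [])" "msteps st (MNum n, [])"
  | (case_var) x Qs Qs' Es Es' S S' where "st' = (MCase (MVar x Qs') Es', S')"
      "msteps st (MCase (MVar x Qs) Es, S)" "list_all2 Qp Qs Qs'" "\<And>i. Qstate (Es i, S) (Es' i, S')"
  | (step) st1 st1' where "mstep st' st1'" "mstep\<^sup>+\<^sup>+ st st1" "Qstate st1 st1'"
  | (stuck) \<sigma>s B Qs Es S where "st' = (MCase (MApp (MLam \<sigma>s B) Qs) Es, S)" "\<not> halts st" "\<not> halts st'"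
proof -
  from assms obtain E T U E' U' where st: "st = (E, T @ U)" "st' = (E', U')" "Qe E T E'" "Qst U U'"
    by (auto simp: Qstate_def)
  from st(3) show thesis
  proof cases
    case Qe_div
    then show ?thesis using st halts_append by (auto intro!: none)
  next
    case (Qe_bot T')
    then show ?thesis using st msteps_append[of E T MBot T' U] bot by auto
  next
    case (Qe_num n)
    have ms: "msteps st (MNum n, U)" using Qe_num(2) st msteps_append[of E T "MNum n" "[]" U] by auto
    from st(4) show ?thesis
    proof cases
      case 1
      then show ?thesis using ms num st Qe_num by auto
    next
      case (2 F T2 F' U2 U2')
      have "mstep st' (F' n, U2')" using 2 Qe_num st by (auto intro: mstep.num)
      moreover have "mstep\<^sup>+\<^sup>+ st (F n, T2 @ U2)"
        using ms mstep.num[of n F "T2 @ U2"] 2 by (auto intro: rtranclp_into_tranclp1)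
      moreover have "Qstate (F n, T2 @ U2) (F' n, U2')" using 2 by (auto simp: Qstate_def)
      ultimately show ?thesis by (rule step)
    qed
  next
    case (Qe_case G Es T' G' Es')
    have ms: "msteps st (MCase G Es, T' @ U)" using Qe_case(2) st msteps_append[of E T "MCase G Es" T' U] by auto
    have stk: "Qst (Es # T' @ U) (Es' # U')" using Qe_case(4) st(4) by (rule Qst.intros)
    from Qe_case(3) show ?thesis
    proof cases
      case (Qa_exp D D')
      have "mstep st' (D', Es' # U')" using Qe_case Qa_exp st by (auto intro: mstep.exp)
      moreover have "mstep\<^sup>+\<^sup>+ st (D, [] @ Es # T' @ U)"
        using ms mstep.exp[of D Es "T' @ U"] Qa_exp by (auto intro: rtranclp_into_tranclp1)
      moreover have "Qstate (D, [] @ Es # T' @ U) (D', Es' # U')"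
        unfolding Qstate_def using Qa_exp stk by blast
      ultimately show ?thesis by (rule step)
    next
      case (Qa_var Qs Qs' x)
      have "Qstate (Es i, T' @ U) (Es' i, U')" for i
        unfolding Qstate_def using Qe_case(4) st(4) by blast
      then show ?thesis using case_var[of x Qs' Es' U' Qs Es "T' @ U"] ms Qa_var st Qe_case by auto
    next
      case (Qa_app P P' Qs Qs')
      from Qa_app(3) obtain \<sigma>s B B' where P: "P = MLam \<sigma>s B" "P' = MLam \<sigma>s B'" "Qe B [] B'"
        by (auto elim: QpE)
      have len: "length Qs = length Qs'" using Qa_app(4) by (rule list_all2_lengthD)
      show ?thesis
      proof (cases "length Qs = length \<sigma>s")
        case True
        have "mstep st' (sub_exp (inst Qs') B', Es' # U')"
          using Qe_case Qa_app P len True st by (auto intro: mstep.beta)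
        moreover have "mstep\<^sup>+\<^sup>+ st (sub_exp (inst Qs) B, [] @ Es # T' @ U)"
          using ms mstep.beta[OF True, of B Es "T' @ U"] Qa_app P by (auto intro: rtranclp_into_tranclp1)
        moreover have "Qstate (sub_exp (inst Qs) B, [] @ Es # T' @ U) (sub_exp (inst Qs') B', Es' # U')"
          unfolding Qstate_def using Qe_sub[OF Qsub_inst[OF Qa_app(4)] P(3)] stk by fastforce
        ultimately show ?thesis by (rule step)
      next
        case False
        then have "\<not> halts st" using halts_steps[OF ms] stuck_not_halts Qa_app P by auto
        moreover have "\<not> halts st'" using False len stuck_not_halts Qa_app P Qe_case st by auto
        ultimately show ?thesis using stuck Qe_case Qa_app P st by blast
      qed
    qed
  qed
qed

definition Qout :: "state \<Rightarrow> state \<Rightarrow> bool" where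
  "Qout st st' \<longleftrightarrow> (\<exists>S. st' = (MBot, S) \<and> nfs st = Bot) \<or> (\<exists>n. st' = (MNum n, []) \<and> msteps st (MNum n, [])) \<or>
    (\<exists>x Qs Qs' Es Es' S S'. st' = (MCase (MVar x Qs') Es', S') \<and> msteps st (MCase (MVar x Qs) Es, S) \<and>
      list_all2 Qp Qs Qs' \<and> (\<forall>i. Qstate (Es i, S) (Es' i, S')))"

lemma Qout_steps: "msteps st st2 \<Longrightarrow> Qout st2 st' \<Longrightarrow> Qout st st'"
  unfolding Qout_def by (elim disjE exE conjE) (use nfs_steps rtranclp_trans[of mstep] in metis)+

lemma Qstate_final:
  assumes "msteps st' st1'" "final st1'" "Qstate st st'"
  shows "Qout st st1'"
  using assms
proof (induction arbitrary: st rule: converse_rtranclp_induct)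
  case base
  from base(2) show ?case
  proof (cases rule: Qstate_cases)
    case (step st2 st2')
    then show ?thesis using final_no_step base by blast
  next
    case (none S)
    then show ?thesis using nfs_no_halt unfolding Qout_def by blast
  next
    case (bot S T)
    then show ?thesis using nfs_bot unfolding Qout_def by blast
  next
    case (num n)
    then show ?thesis unfolding Qout_def by blast
  next
    case (case_var x Qs Qs' Es Es' S S')
    then show ?thesis unfolding Qout_def by blast
  next
    case (stuck \<sigma>s B Qs Es S)
    then show ?thesis using base final_halts by blast
  qed
next
  case (step y z)
  from step.prems(2) show ?case
  proof (cases rule: Qstate_cases)
    case (step st2 st2')
    from step(1) step.hyps(1) have "st2' = z" using mstep_det by blast
    with step.IH[OF step.prems(1), of st2] step have "Qout st2 st1'" by blast
    then show ?thesis using tranclp_into_rtranclp[OF step(2)] by (rule Qout_steps[rotated])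
  next
    case (none S)
    with step.hyps(1) show ?thesis by (auto elim: mstep.cases)
  next
    case (bot S T)
    with step.hyps(1) show ?thesis by (auto elim: mstep.cases)
  next
    case (num n)
    with step.hyps(1) show ?thesis by (auto elim: mstep.cases)
  next
    case (case_var x Qs Qs' Es Es' S S')
    with step.hyps(1) show ?thesis by (auto elim: mstep.cases)
  next
    case (stuck \<sigma>s B Qs Es S)
    moreover have "halts y" using step.hyps step.prems by (meson halts_def converse_rtranclp_into_rtranclp)
    ultimately show ?thesis by blast
  qed
qed

text \<open>Every step of the reduct uses up at least one step of the terminating run of the
  original, so the length of that run bounds the run of the reduct.\<close>

lemma Qstate_halts:
  assumes "(mstep ^^ n) st st1" "final st1" "Qstate st st'"
  shows "halts st'"
  using assms(1,3)
proof (induction n arbitrary: st st' rule: less_induct)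
  case (less n)
  have h: "halts st" using less.prems(1) assms(2) by (meson halts_def relpowp_imp_rtranclp)
  from less.prems(2) show ?case
  proof (cases rule: Qstate_cases)
    case (step st2 st2')
    from step(2) obtain st3 where "mstep st st3" "msteps st3 st2" by (meson tranclpD)
    then obtain m where m: "(mstep ^^ m) st st2" "m > 0"
      by (metis rtranclp_imp_relpowp relpowp_Suc_I2 zero_less_Suc)
    have "halts st2" using h halts_steps step(2) tranclp_into_rtranclp by metis
    then obtain k st4 where k: "(mstep ^^ k) st2 st4" "final st4"
      by (meson halts_def rtranclp_imp_relpowp)
    \<comment> \<open>Determinacy puts \<open>st2\<close> on the run to \<open>st1\<close>, and
      \<open>m > 0\<close> makes the rest of the run shorter.\<close>
    have "\<exists>j<n. (mstep ^^ j) st2 st1" using m less.prems(1) assms(2)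
    proof (induction m arbitrary: n st)
      case (Suc m)
      from Suc.prems(1) obtain y where y: "mstep st y" "(mstep ^^ m) y st2" by (blast dest: relpowp_Suc_D2)
      have "n \<noteq> 0"
      proof
        assume "n = 0"
        then have "st = st1" using Suc.prems(3) by simp
        then show False using Suc.prems(4) y(1) final_no_step by blast
      qed
      then obtain n' where n': "n = Suc n'" by (cases n) auto
      with Suc.prems(3) obtain y' where y': "mstep st y'" "(mstep ^^ n') y' st1" by (blast dest: relpowp_Suc_D2)
      have "y' = y" using y y' mstep_det by blast
      show ?case
      proof (cases "m = 0")
        case True
        then show ?thesis using y y' \<open>y' = y\<close> n' by auto
      next
        case False
        with Suc.IH[of y n'] y y' \<open>y' = y\<close> assms(2) obtain j where "j < n'" "(mstep ^^ j) st2 st1" by auto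
        then show ?thesis using n' by (intro exI[of _ j]) auto
      qed
    qed simp
    then obtain j where "j < n" "(mstep ^^ j) st2 st1" by blast
    from less.IH[OF this step(3)] show ?thesis using step(1) halts_step by blast
  next
    case (stuck \<sigma>s B Qs Es S)
    then show ?thesis using h by blast
  next
    case (none S)
    then show ?thesis using h by blast
  qed (auto intro: final_halts final.intros)
qed

lemma Qstate_halts_iff: "Qstate st st' \<Longrightarrow> halts st \<Longrightarrow> halts st'"
  by (metis halts_def rtranclp_imp_relpowp Qstate_halts)

section \<open>Invariance of normal forms under reduction of parts\<close>

lemma term_coinduct:
  assumes "\<And>p p'. R1 p p' \<Longrightarrow> \<exists>\<sigma>s e e'. p = Lam \<sigma>s e \<and> p' = Lam \<sigma>s e' \<and> R2 e e'"
    and "\<And>e e'. R2 e e' \<Longrightarrow> e = e' \<or> (\<exists>x qs qs' es es'. e = Case (App x qs) es \<and>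
      e' = Case (App x qs') es' \<and> list_all2 R1 qs qs' \<and> (\<forall>i. R2 (es i) (es' i)))"
  shows "R1 p p' \<Longrightarrow> p = p'" and "R2 e e' \<Longrightarrow> e = e'"
proof -
  let ?R1 = "\<lambda>p p'. p = p' \<or> R1 p p'" and ?R2 = "\<lambda>p p'. p = p' \<or> R2 p p'"
  let ?R3 = "\<lambda>a a'. \<exists>x qs qs'. a = App x qs \<and> a' = App x qs' \<and> list_all2 ?R1 qs qs'"
  have la: "list_all2 ?R1 Qs Qs" for Qs by (simp add: list_all2_refl)
  have lb: "list_all2 R1 Qs Qs' \<Longrightarrow> list_all2 ?R1 Qs Qs'" for Qs Qs'
    by (erule list_all2_mono) simp
  have "(?R1 p p' \<longrightarrow> p = p') \<and> (?R2 e e' \<longrightarrow> e = e') \<and> (?R3 a a' \<longrightarrow> a = a')" for p p' e e' a a'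
  proof (rule proc_exp_app.coinduct, goal_cases)
    case (1 p p')
    then show ?case using assms(1)[of p p'] by auto
  next
    case (2 e e')
    then show ?case
    proof
      assume e: "e = e'"
      obtain x qs where "un_Case1 e' = App x qs" by (cases "un_Case1 e'")
      then show ?thesis unfolding e using la[of qs] by (simp add: rel_fun_def)
    next
      assume "R2 e e'"
      from assms(2)[OF this] show ?thesis
      proof (elim disjE exE conjE)
        assume e: "e = e'"
        obtain x qs where "un_Case1 e' = App x qs" by (cases "un_Case1 e'")
        then show ?thesis unfolding e using la[of qs] by (simp add: rel_fun_def)
      next
        fix x qs qs' es es'
        assume "e = Case (App x qs) es" "e' = Case (App x qs') es'" "list_all2 R1 qs qs'" "\<forall>i. R2 (es i) (es' i)"
        then show ?thesis using lb by (simp add: rel_fun_def)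
      qed
    qed
  next
    case (3 a a')
    then show ?case by auto
  qed
  then show "R1 p p' \<Longrightarrow> p = p'" and "R2 e e' \<Longrightarrow> e = e'" by blast+
qed

text \<open>If the reduct halts, following its run exhibits the same head on both sides, with
  arguments and branches related again. If it diverges, so does the original, by
  \<open>Qstate_halts_iff\<close>.\<close>

lemma Qp_nf_eq: "Qp P P' \<Longrightarrow> nf_proc P = nf_proc P'"
  and Qstate_nfs_eq: "Qstate st st' \<Longrightarrow> nfs st = nfs st'"
proof -
  let ?R1 = "\<lambda>p p'. \<exists>P P'. Qp P P' \<and> p = nf_proc P \<and> p' = nf_proc P'"
  let ?R2 = "\<lambda>e e'. \<exists>st st'. Qstate st st' \<and> e = nfs st \<and> e' = nfs st'"
  have 1: "\<exists>\<sigma>s e e'. p = Lam \<sigma>s e \<and> p' = Lam \<sigma>s e' \<and> ?R2 e e'" if X: "?R1 p p'" for p p'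
  proof -
    from X obtain P P' where P: "Qp P P'" "p = nf_proc P" "p' = nf_proc P'" by blast
    from P(1) obtain \<sigma>s B B' where B: "P = MLam \<sigma>s B" "P' = MLam \<sigma>s B'" "Qe B [] B'" by (auto elim: QpE)
    have "Qstate (B, []) (B', [])" unfolding Qstate_def
      by (intro exI[of _ B] exI[of _ "[]"] exI[of _ B']) (simp add: B(3) Qst.intros(1))
    then have "?R2 (nf_exp B) (nf_exp B')" unfolding nf_exp_conv_nfs by blast
    then show ?thesis using P B by simp
  qed
  have 2: "e = e' \<or> (\<exists>x qs qs' es es'. e = Case (App x qs) es \<and>
      e' = Case (App x qs') es' \<and> list_all2 ?R1 qs qs' \<and> (\<forall>i. ?R2 (es i) (es' i)))" if X: "?R2 e e'" for e e'
  proof -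
    from X obtain st st' where st: "Qstate st st'" "e = nfs st" "e' = nfs st'" by blast
    show ?thesis
    proof (cases "halts st'")
      case True
      then obtain st1' where st1': "msteps st' st1'" "final st1'" by (auto simp: halts_def)
      from Qstate_final[OF st1' st(1)] show ?thesis unfolding Qout_def
      proof (elim disjE exE conjE)
        fix x Qs Qs' Es Es' S S'
        assume *: "st1' = (MCase (MVar x Qs') Es', S')" "msteps st (MCase (MVar x Qs) Es, S)"
          "list_all2 Qp Qs Qs'" "\<forall>i. Qstate (Es i, S) (Es' i, S')"
        have "list_all2 ?R1 (map nf_proc Qs) (map nf_proc Qs')"
          unfolding list_all2_map1 list_all2_map2 using *(3) by (rule list_all2_mono) blast
        moreover have "\<forall>i. ?R2 (nfs (Es i, S)) (nfs (Es' i, S'))" using *(4) by blast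
        moreover have "e = Case (App x (map nf_proc Qs)) (\<lambda>i. nfs (Es i, S))"
          using nfs_case[OF *(2)] st(2) by simp
        moreover have "e' = Case (App x (map nf_proc Qs')) (\<lambda>i. nfs (Es' i, S'))"
          using nfs_case[OF st1'(1)[unfolded *(1)]] st(3) by simp
        ultimately show ?thesis by blast
      next
        fix S
        assume "st1' = (MBot, S)" "nfs st = Bot"
        then show ?thesis using nfs_bot st1'(1) st(2,3) by simp
      next
        fix n
        assume "st1' = (MNum n, [])" "msteps st (MNum n, [])"
        then show ?thesis using nfs_num[of st' n] nfs_num[of st n] st1'(1) st(2,3) by simp
      qed
    next
      case False
      then have "\<not> halts st" using Qstate_halts_iff[OF st(1)] by blast
      then show ?thesis using False st(2,3) nfs_no_halt by simp
    qed
  qed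
  note co = term_coinduct[of ?R1 ?R2, OF 1 2]
  show "Qp P P' \<Longrightarrow> nf_proc P = nf_proc P'" by (rule co(1), assumption, assumption, intro exI conjI, assumption, rule refl, rule refl)
  show "Qstate st st' \<Longrightarrow> nfs st = nfs st'" by (rule co(2), assumption, assumption, intro exI conjI, assumption, rule refl, rule refl)
qed

lemma nf_emb [simp]: "nf_proc (emb_proc p) = p" "nf_exp (emb_exp e) = e"
proof -
  let ?R1 = "\<lambda>p p'. p = nf_proc (emb_proc p')" and ?R2 = "\<lambda>e e'. e = nf_exp (emb_exp e')"
  have 1: "\<exists>\<sigma>s e e'. p = Lam \<sigma>s e \<and> p' = Lam \<sigma>s e' \<and> ?R2 e e'" if X: "?R1 p p'" for p p'
    using X by (cases p') auto
  have 2: "e = e' \<or> (\<exists>x qs qs' es es'. e = Case (App x qs) es \<and>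
      e' = Case (App x qs') es' \<and> list_all2 ?R1 qs qs' \<and> (\<forall>i. ?R2 (es i) (es' i)))" if X: "?R2 e e'" for e e'
    using X by (cases e'; cases "un_Case1 e'") (auto simp: list_all2_conv_all_nth)
  note co = term_coinduct[of ?R1 ?R2, OF 1 2]
  show "nf_proc (emb_proc p) = p" by (rule co(1)) auto
  show "nf_exp (emb_exp e) = e" by (rule co(2)) auto
qed

section \<open>Equality of normal forms as a congruence\<close>

definition beq :: "mproc \<Rightarrow> mproc \<Rightarrow> bool" (infix "\<simeq>" 50) where
  "P \<simeq> P' \<longleftrightarrow> nf_proc P = nf_proc P'"

definition beqv :: "nat + mproc \<Rightarrow> nat + mproc \<Rightarrow> bool" where
  "beqv = rel_sum (=) (\<simeq>)"

lemma beq_refl [simp]: "P \<simeq> P" by (simp add: beq_def)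
lemma beq_sym: "P \<simeq> Q \<Longrightarrow> Q \<simeq> P" by (simp add: beq_def)
lemma beq_trans [trans]: "P \<simeq> Q \<Longrightarrow> Q \<simeq> R \<Longrightarrow> P \<simeq> R" by (simp add: beq_def)
lemma beqv_refl [simp]: "beqv v v" by (simp add: beqv_def rel_sum.simps) (metis beq_refl sum.exhaust)
lemma beqv_simps [simp]: "beqv (Inl x) (Inl y) \<longleftrightarrow> x = y" "beqv (Inr P) (Inr Q) \<longleftrightarrow> P \<simeq> Q"
  "\<not> beqv (Inl x) (Inr Q)" "\<not> beqv (Inr P) (Inl y)"
  by (simp_all add: beqv_def)

lemma emb_nf_beq [simp]: "emb_proc (nf_proc P) \<simeq> P"
  by (simp add: beq_def)

definition emb_nf_var :: "nat + mproc \<Rightarrow> nat + mproc" where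
  "emb_nf_var = map_sum id (emb_proc \<circ> nf_proc)"

lemma beqv_conv: "beqv v w \<longleftrightarrow> emb_nf_var v = emb_nf_var w"
  by (cases v; cases w) (auto simp: emb_nf_var_def beq_def dest: arg_cong[of _ _ nf_proc])

text \<open>Normalizing the procedure and all substituted procedures beforehand is an instance of
  \<open>Qp\<close>. Thereby both sides have the normal form of one and the same meta-term.\<close>

theorem nf_sub_cong:
  assumes "\<And>i. beqv (s i) (s' i)" and "P \<simeq> P'"
  shows "sub_proc s P \<simeq> sub_proc s' P'"
proof -
  have "Qsub s (emb_nf_var \<circ> s)" for s
  proof -
    have "rel_sum (=) Qp (s i) (emb_nf_var (s i))" for i
      by (cases "s i") (auto simp: emb_nf_var_def Qp_nf)
    then show ?thesis by (simp add: Qsub_def)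
  qed
  then have "nf_proc (sub_proc s P) = nf_proc (sub_proc (emb_nf_var \<circ> s) (emb_proc (nf_proc P)))" for s P
    by (intro Qp_nf_eq Qp_sub Qp_nf)
  moreover have "emb_nf_var \<circ> s = emb_nf_var \<circ> s'" using assms(1) by (auto simp: beqv_conv fun_eq_iff)
  ultimately show ?thesis using assms(2) unfolding beq_def by metis
qed

lemma MLam_beq: "MLam \<sigma>s B \<simeq> MLam \<tau>s B' \<longleftrightarrow> \<sigma>s = \<tau>s \<and> nf_exp B = nf_exp B'"
  by (simp add: beq_def)

lemma nf_sub_exp_cong:
  assumes "\<And>i. beqv (s i) (s' i)" and "nf_exp E = nf_exp E'"
  shows "nf_exp (sub_exp s E) = nf_exp (sub_exp s' E')"
proof -
  have "MLam [] E \<simeq> MLam [] E'" using assms by (simp add: MLam_beq)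
  from nf_sub_cong[of s s', OF assms(1) this] show ?thesis by (simp add: beq_def)
qed

lemma nf_MCase_cong:
  assumes "nf_exp E = nf_exp E'" "\<And>i. nf_exp (Es i) = nf_exp (Es' i)"
  shows "nf_exp (MCase (MExp E) Es) = nf_exp (MCase (MExp E') Es')"
proof -
  have *: "nf_exp (MCase (MExp E) Es)
    = nf_exp (MCase (MExp (emb_exp (nf_exp E))) (\<lambda>i. emb_exp (nf_exp (Es i))))" for E Es
  proof -
    have "Qe (MCase (MExp E) Es) [] (MCase (MExp (emb_exp (nf_exp E))) (\<lambda>i. emb_exp (nf_exp (Es i))))"
      unfolding nf_exp_conv_nfs by (rule Qe_case[OF rtranclp.rtrancl_refl Qa_exp[OF Qe_nf] Qe_nf])
    from Qp_nf_eq[OF Qp[OF this, of "[]"]] show ?thesis by simp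
  qed
  show ?thesis using *[of E Es] *[of E' Es'] assms by simp
qed

lemma nfs_conv_nf_exp: "nfs (E, F # S) = nf_exp (MCase (MExp E) (\<lambda>i. rload (F i) S))"
  by (simp add: nfs_def)

lemma nfs_cong:
  assumes "nf_exp E = nf_exp E'" "\<And>i. nfs (F i, S) = nfs (F' i, S')"
  shows "nfs (E, F # S) = nfs (E', F' # S')"
  unfolding nfs_conv_nf_exp using assms by (intro nf_MCase_cong) (simp_all add: nfs_def)

lemma nf_MApp_cong:
  assumes "P \<simeq> P'" "list_all2 (\<simeq>) Qs Qs'" "\<And>i. nf_exp (Es i) = nf_exp (Es' i)"
  shows "nf_exp (MCase (MApp P Qs) Es) = nf_exp (MCase (MApp P' Qs') Es')"
proof -
  have *: "nf_exp (MCase (MApp P Qs) Es) = nf_exp (MCase (MApp (emb_proc (nf_proc P)) (map (emb_proc \<circ> nf_proc) Qs))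
    (\<lambda>i. emb_exp (nf_exp (Es i))))" for P Qs Es
  proof -
    have "list_all2 Qp Qs (map (emb_proc \<circ> nf_proc) Qs)" by (auto simp: list_all2_conv_all_nth Qp_nf)
    then have "Qe (MCase (MApp P Qs) Es) [] (MCase (MApp (emb_proc (nf_proc P)) (map (emb_proc \<circ> nf_proc) Qs))
      (\<lambda>i. emb_exp (nf_exp (Es i))))"
      unfolding nf_exp_conv_nfs by (rule Qe_case[OF rtranclp.rtrancl_refl Qa_app[OF Qp_nf] Qe_nf])
    from Qp_nf_eq[OF Qp[OF this, of "[]"]] show ?thesis by simp
  qed
  have "map (emb_proc \<circ> nf_proc) Qs = map (emb_proc \<circ> nf_proc) Qs'"
    using assms(2) by (auto simp: list_all2_conv_all_nth beq_def intro: nth_equalityI)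
  then show ?thesis using *[of P Qs Es] *[of P' Qs' Es'] assms(1,3) by (simp add: beq_def)
qed

text \<open>The eta law of the ground type: a last frame that merely passes the number on has no
  effect. Denotations of variables produce such frames everywhere.\<close>

lemma nfs_snoc_MNum: "nfs (E, S @ [MNum]) = nfs (E, S)"
proof -
  let ?R = "\<lambda>e e'. e = e' \<or> (\<exists>E S. e = nfs (E, S @ [MNum]) \<and> e' = nfs (E, S))"
  have 1: "\<exists>\<sigma>s e e'. p = Lam \<sigma>s e \<and> p' = Lam \<sigma>s e' \<and> ?R e e'" if "p = p'" for p p'
    using that by (cases p) auto
  have 2: "e = e' \<or> (\<exists>x qs qs' es es'. e = Case (App x qs) es \<and>
      e' = Case (App x qs') es' \<and> list_all2 (=) qs qs' \<and> (\<forall>i. ?R (es i) (es' i)))"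
    if X: "?R e e'" for e e'
  proof (cases "e = e'")
    case False
    with X obtain E S where ES: "e = nfs (E, S @ [MNum])" "e' = nfs (E, S)" by blast
    show ?thesis
    proof (cases "halts (E, S)")
      case True
      then obtain E' S' where st: "msteps (E, S) (E', S')" "final (E', S')" by (auto simp: halts_def)
      from nfs_steps[OF st(1)] nfs_steps[OF msteps_append[OF st(1)]] ES
      have *: "e = nfs (E', S' @ [MNum])" "e' = nfs (E', S')" by simp_all
      from st(2) show ?thesis
      proof cases
        case (3 x Qs Es)
        then show ?thesis using * by (simp add: list.rel_eq) blast
      qed (use * in auto)
    next
      case False
      then show ?thesis using halts_append ES nfs_no_halt by metis
    qed
  qed simp
  show ?thesis by (rule term_coinduct(2)[of "(=)" ?R, OF 1 2]) auto
qed

lemma nfs_MNum [simp]: "nfs (E, [MNum]) = nf_exp E"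
  using nfs_snoc_MNum[of E "[]"] by (simp add: nf_exp_conv_nfs)

section \<open>Application\<close>

fun mappv :: "mproc \<Rightarrow> nat + mproc \<Rightarrow> mproc" where
  "mappv (MLam (\<sigma> # \<tau>s) B) v = sub_proc (push [v] Inl) (MLam \<tau>s B)"
| "mappv (MLam [] B) v = MLam [] MBot"

abbreviation mapp :: "mproc \<Rightarrow> mproc \<Rightarrow> mproc" where
  "mapp P Q \<equiv> mappv P (Inr Q)"

lemma nsp_app_conv: "p \<cdot> q = nf_proc (mapp (emb_proc p) (emb_proc q))"
  by (cases "(p, q)" rule: nsp_app.cases) (auto simp: inst_conv_push)

lemma beqv_push: "list_all2 beqv vs vs' \<Longrightarrow> (\<And>i. beqv (s i) (s' i)) \<Longrightarrow> beqv (push vs s i) (push vs' s' i)"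
  by (auto simp: push_def list_all2_conv_all_nth rev_nth)

lemma mappv_cong:
  assumes "P \<simeq> P'" "beqv v v'" shows "mappv P v \<simeq> mappv P' v'"
proof -
  obtain \<sigma>s B \<sigma>s' B' where P: "P = MLam \<sigma>s B" "P' = MLam \<sigma>s' B'" by (cases P; cases P')
  with assms(1) have *: "\<sigma>s' = \<sigma>s" "nf_exp B = nf_exp B'" by (auto simp: MLam_beq)
  show ?thesis
  proof (cases \<sigma>s)
    case (Cons \<sigma> \<tau>s)
    have "sub_proc (push [v] Inl) (MLam \<tau>s B) \<simeq> sub_proc (push [v'] Inl) (MLam \<tau>s B')"
      using assms(2) * by (intro nf_sub_cong beqv_push) (auto simp: MLam_beq)
    then show ?thesis using P * Cons by simp
  qed (use P * in simp)
qed

lemma emb_app_beq: "emb_proc (p \<cdot> q) \<simeq> mapp (emb_proc p) (emb_proc q)"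
  by (simp add: nsp_app_conv)

lemma up_subst_up: "up_subst r (up_subst r' s) = up_subst (r + r') s"
proof
  fix i
  show "up_subst r (up_subst r' s) i = up_subst (r + r') s i"
    by (cases "s (i - r - r')") (auto simp: up_subst_def ren_ren comp_def add.commute add.left_commute
      intro!: arg_cong[of _ _ "\<lambda>f. ren_proc f _"])
qed

lemma sub_push1: "sub_proc s (sub_proc (push [v] Inl) P) = sub_proc (push [sub_var s v] Inl) (sub_proc (up_subst 1 s) P)"
  using push_comp_up[of "[sub_var s v]" Inl s] by (simp add: sub_sub comp_push)

lemma sub_mappv: "sub_proc s (mappv P v) = mappv (sub_proc s P) (sub_var s v)"
proof (cases P)
  case (MLam \<sigma>s B)
  show ?thesis
  proof (cases \<sigma>s)
    case (Cons \<sigma> \<tau>s)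
    have "mappv (sub_proc s P) (sub_var s v) = sub_proc (push [sub_var s v] Inl) (sub_proc (up_subst 1 s) (MLam \<tau>s B))"
      using MLam Cons by (simp add: up_subst_up)
    then show ?thesis using MLam Cons by (simp only: mappv.simps sub_push1)
  qed (use MLam in simp)
qed

definition mappsv :: "mproc \<Rightarrow> (nat + mproc) list \<Rightarrow> mproc" where
  "mappsv P vs = foldl mappv P vs"

abbreviation mapps :: "mproc \<Rightarrow> mproc list \<Rightarrow> mproc" where
  "mapps P Qs \<equiv> mappsv P (map Inr Qs)"

lemma mappsv_simps [simp]: "mappsv P [] = P" "mappsv P (v # vs) = mappsv (mappv P v) vs"
  by (simp_all add: mappsv_def)

lemma mappsv_cong: "P \<simeq> P' \<Longrightarrow> list_all2 beqv vs vs' \<Longrightarrow> mappsv P vs \<simeq> mappsv P' vs'"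
  by (induction vs arbitrary: vs' P P') (auto simp: list_all2_Cons1 mappv_cong)

text \<open>Connects the unary application of procedures with the beta step of the machine, which
  consumes a whole block of arguments.\<close>

lemma mappsv_MLam:
  "length vs = length \<sigma>s \<Longrightarrow> mappsv (MLam (\<sigma>s @ \<tau>s) B) vs = sub_proc (push vs Inl) (MLam \<tau>s B)"
proof (induction vs arbitrary: \<sigma>s B)
  case Nil
  then show ?case by (simp add: up_subst_id)
next
  case (Cons v vs)
  then obtain \<sigma> \<sigma>s' where \<sigma>s: "\<sigma>s = \<sigma> # \<sigma>s'" by (cases \<sigma>s) auto
  let ?B = "sub_exp (up_subst (length (\<sigma>s' @ \<tau>s)) (push [v] Inl)) B"
  have "mappsv (MLam (\<sigma>s @ \<tau>s) B) (v # vs) = mappsv (MLam (\<sigma>s' @ \<tau>s) ?B) vs"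
    by (simp add: \<sigma>s)
  also have "\<dots> = sub_proc (push vs Inl) (MLam \<tau>s ?B)"
    using Cons.prems \<sigma>s by (intro Cons.IH) simp
  also have "MLam \<tau>s ?B = sub_proc (up_subst (length \<sigma>s') (push [v] Inl)) (MLam \<tau>s B)"
    by (simp add: up_subst_up add.commute)
  also have "sub_proc (push vs Inl) \<dots> = sub_proc (push (v # vs) Inl) (MLam \<tau>s B)"
    using Cons.prems \<sigma>s push_comp_up[of vs Inl "push [v] Inl"]
    by (simp only: sub_sub) (simp add: push_push)
  finally show ?case .
qed

lemma mappsv_full: "length vs = length \<sigma>s \<Longrightarrow> mappsv (MLam \<sigma>s B) vs = MLam [] (sub_exp (push vs Inl) B)"
  using mappsv_MLam[of vs \<sigma>s "[]" B] by simp

lemma mapps_full: "length Qs = length \<sigma>s \<Longrightarrow> mapps (MLam \<sigma>s B) Qs = MLam [] (sub_exp (inst Qs) B)"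
  by (simp add: mappsv_full inst_conv_push)

definition body :: "mproc \<Rightarrow> mexp" where
  "body P = (case P of MLam \<sigma>s B \<Rightarrow> B)"

lemma body_MLam [simp]: "body (MLam \<sigma>s B) = B"
  by (simp add: body_def)

lemma nfs_MApp: "length Qs = length \<sigma>s \<Longrightarrow>
    nfs (MCase (MApp (MLam \<sigma>s B) Qs) Es, S) = nfs (body (mapps (MLam \<sigma>s B) Qs), Es # S)"
  by (simp add: nfs_beta mapps_full)

section \<open>Renaming and free variables\<close>

text \<open>A renaming keeps a variable at the head, so final states stay final. A general
  substitution may set a final state in motion and has only the direction of
  \<open>halts_sub\<close>.\<close>

lemma halts_sub_ren: "halts (sub_state (Inl \<circ> f) st) \<longleftrightarrow> halts st"
proof
  assume "halts st"
  then obtain st' where st: "msteps st st'" "final st'" by (auto simp: halts_def)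
  have "final (sub_state (Inl \<circ> f) st')" using st(2)
    by (auto simp: final.simps sub_state_def)
  then show "halts (sub_state (Inl \<circ> f) st)" using msteps_sub[OF st(1), of "Inl \<circ> f"] unfolding halts_def by blast
qed (rule halts_sub)

lemma emb_nf_ren: "emb_proc (nf_proc (ren_proc f P)) = ren_proc f (emb_proc (nf_proc P))"
proof -
  let ?R1 = "\<lambda>P P'. \<exists>f X. P = emb_proc (nf_proc (sub_proc (Inl \<circ> f) X)) \<and> P' = sub_proc (Inl \<circ> f) (emb_proc (nf_proc X))"
  let ?R2 = "\<lambda>P P'. \<exists>f X. P = emb_exp (nfs (sub_state (Inl \<circ> f) X)) \<and> P' = sub_exp (Inl \<circ> f) (emb_exp (nfs X))"
  let ?R3 = "\<lambda>P P'. \<exists>x Qs Qs'. P = MVar x Qs \<and> P' = MVar x Qs' \<and> list_all2 ?R1 Qs Qs'"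
  have 1: "\<exists>\<sigma>s E E'. P = MLam \<sigma>s E \<and> P' = MLam \<sigma>s E' \<and> ?R2 E E'" if X: "?R1 P P'" for P P'
  proof -
    from X obtain f \<sigma>s B where *: "P = emb_proc (nf_proc (sub_proc (Inl \<circ> f) (MLam \<sigma>s B)))"
      "P' = sub_proc (Inl \<circ> f) (emb_proc (nf_proc (MLam \<sigma>s B)))" by (metis mproc.exhaust)
    let ?f = "up_ren (length \<sigma>s) f"
    have "P = MLam \<sigma>s (emb_exp (nfs (sub_state (Inl \<circ> ?f) (B, []))))"
      "P' = MLam \<sigma>s (sub_exp (Inl \<circ> ?f) (emb_exp (nfs (B, []))))"
      using * by (simp_all add: up_subst_Inl nf_exp_conv_nfs sub_state_def)
    then show ?thesis by blast
  qed
  have 2: "E = E' \<or>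
      (\<exists>G G' Es Es'. E = MCase G Es \<and> E' = MCase G' Es' \<and> ?R3 G G' \<and> (\<forall>i. ?R2 (Es i) (Es' i)))"
    if X: "?R2 E E'" for E E'
  proof -
    from X obtain f st where *: "E = emb_exp (nfs (sub_state (Inl \<circ> f) st))"
      "E' = sub_exp (Inl \<circ> f) (emb_exp (nfs st))" by blast
    show ?thesis
    proof (cases "halts st")
      case True
      then obtain st' where st: "msteps st st'" "final st'" by (auto simp: halts_def)
      from nfs_steps[OF st(1)] nfs_steps[OF msteps_sub[OF st(1), of "Inl \<circ> f"]] *
      have **: "E = emb_exp (nfs (sub_state (Inl \<circ> f) st'))" "E' = sub_exp (Inl \<circ> f) (emb_exp (nfs st'))"
        by simp_all
      from st(2) show ?thesis
      proof cases
        case (3 x Qs Es S)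
        let ?s = "Inl \<circ> f"
        have "E = MCase (MVar (f x) (map (\<lambda>Q. emb_proc (nf_proc (sub_proc ?s Q))) Qs))
            (\<lambda>i. emb_exp (nfs (sub_state ?s (Es i, S))))"
          "E' = MCase (MVar (f x) (map (\<lambda>Q. sub_proc ?s (emb_proc (nf_proc Q))) Qs))
            (\<lambda>i. sub_exp ?s (emb_exp (nfs (Es i, S))))"
          using ** 3 by (simp_all add: sub_state_def comp_def)
        moreover have "list_all2 ?R1 (map (\<lambda>Q. emb_proc (nf_proc (sub_proc ?s Q))) Qs)
            (map (\<lambda>Q. sub_proc ?s (emb_proc (nf_proc Q))) Qs)"
          by (rule list_all2_map_map) blast
        ultimately show ?thesis by blast
      qed (use ** in \<open>auto simp: sub_state_def\<close>)
    next
      case False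
      then have "\<not> halts (sub_state (Inl \<circ> f) st)" by (simp only: halts_sub_ren not_False_eq_True)
      then show ?thesis using * False nfs_no_halt by simp
    qed
  qed
  have 3: "?R3 G G' \<Longrightarrow> G = G' \<or> (\<exists>E E'. G = MExp E \<and> G' = MExp E' \<and> ?R2 E E') \<or>
      (\<exists>x Qs Qs'. G = MVar x Qs \<and> G' = MVar x Qs' \<and> list_all2 ?R1 Qs Qs') \<or>
      (\<exists>P P' Qs Qs'. G = MApp P Qs \<and> G' = MApp P' Qs' \<and> (P = P' \<or> ?R1 P P') \<and> list_all2 ?R1 Qs Qs')" for G G'
    by blast
  show ?thesis unfolding ren_conv_sub
    by (rule mterm_coinduct(1)[of ?R1 ?R2 ?R3, OF 1 2 3], assumption+, intro exI conjI, rule refl, rule refl)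
qed

text \<open>\<open>bnd n P\<close> says that the free variables of \<open>P\<close> are among the innermost \<open>n\<close> ones.\<close>

definition bnd :: "nat \<Rightarrow> mproc \<Rightarrow> bool" where
  "bnd n P \<longleftrightarrow> (\<forall>f. (\<forall>i<n. f i = i) \<longrightarrow> ren_proc f P = P)"

text \<open>Renamings that fix the indices below \<open>n\<close> leave \<open>P\<close> alone, so
  the other indices can be moved apart into even and odd copies. The one substitution
  \<open>?t\<close> then acts as \<open>s\<close> through the even copy and as \<open>s'\<close>
  through the odd one.\<close>

lemma bnd_sub_cong:
  assumes "bnd n P" "\<And>i. i < n \<Longrightarrow> s i = s' i" shows "sub_proc s P = sub_proc s' P"
proof -
  let ?f = "\<lambda>i. if i < n then i else n + 2 * (i - n)" and ?g = "\<lambda>i. if i < n then i else n + 2 * (i - n) + 1"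
  let ?t = "\<lambda>i. if i < n then s i else if even (i - n) then s (n + (i - n) div 2) else s' (n + (i - n) div 2)"
  have f: "?t \<circ> ?f = s" by (auto simp: fun_eq_iff)
  have g: "?t \<circ> ?g = s'" using assms(2) by (auto simp: fun_eq_iff)
  have "ren_proc ?f P = P" "ren_proc ?g P = P" using assms(1) unfolding bnd_def by simp_all
  then have "sub_proc (?t \<circ> ?f) P = sub_proc (?t \<circ> ?g) P" by (metis sub_ren(1))
  then show ?thesis unfolding f g .
qed

lemma bnd_0_sub: "bnd 0 P \<Longrightarrow> sub_proc s P = P"
  using bnd_sub_cong[of 0 P s Inl] by simp

lemma bnd_mapp: "bnd n P \<Longrightarrow> bnd n Q \<Longrightarrow> bnd n (mapp P Q)"
  by (simp add: bnd_def ren_conv_sub sub_mappv)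

lemma bnd_emb_nf: "bnd n P \<Longrightarrow> bnd n (emb_proc (nf_proc P))"
  unfolding bnd_def by (metis emb_nf_ren)

lemma bnd_app: "bnd n (emb_proc p) \<Longrightarrow> bnd n (emb_proc q) \<Longrightarrow> bnd n (emb_proc (p \<cdot> q))"
  by (simp add: nsp_app_conv bnd_emb_nf bnd_mapp)

lemma up_ren_up_ren: "up_ren r (up_ren r' f) = up_ren (r + r') f"
  by (auto simp: up_ren_def fun_eq_iff)

lemma bnd_lam: "bnd (Suc n) (emb_proc p) \<Longrightarrow> bnd n (emb_proc (lam \<sigma> p))"
proof (cases p)
  case (Lam \<sigma>s e)
  assume *: "bnd (Suc n) (emb_proc p)"
  have "ren_proc f (emb_proc (lam \<sigma> p)) = emb_proc (lam \<sigma> p)" if "\<forall>i<n. f i = i" for f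
  proof -
    have "\<forall>i<Suc n. up_ren 1 f i = i" using that by (auto simp: up_ren_def)
    with * have "ren_proc (up_ren 1 f) (emb_proc p) = emb_proc p" by (simp add: bnd_def)
    then show ?thesis using Lam by (simp add: up_ren_up_ren)
  qed
  then show ?thesis by (simp add: bnd_def)
qed

lemma wt_bnd: "wt_proc \<Gamma> p \<sigma> \<Longrightarrow> bnd (length \<Gamma>) (emb_proc p)"
proof -
  let ?R1 = "\<lambda>P P'. \<exists>\<Gamma> p \<sigma> f. wt_proc \<Gamma> p \<sigma> \<and> (\<forall>i<length \<Gamma>. f i = i) \<and> P = ren_proc f (emb_proc p) \<and> P' = emb_proc p"
  let ?R2 = "\<lambda>E E'. \<exists>\<Gamma> e f. wt_exp \<Gamma> e \<and> (\<forall>i<length \<Gamma>. f i = i) \<and> E = ren_exp f (emb_exp e) \<and> E' = emb_exp e"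
  let ?R3 = "\<lambda>G G'. \<exists>\<Gamma> a f. wt_app \<Gamma> a \<and> (\<forall>i<length \<Gamma>. f i = i) \<and> G = ren_app f (emb_app a) \<and> G' = emb_app a"
  have 1: "\<exists>\<sigma>s E E'. P = MLam \<sigma>s E \<and> P' = MLam \<sigma>s E' \<and> ?R2 E E'" if X: "?R1 P P'" for P P'
  proof -
    from X obtain \<Gamma> p \<sigma> f where *: "wt_proc \<Gamma> p \<sigma>" "\<forall>i<length \<Gamma>. f i = i"
      "P = ren_proc f (emb_proc p)" "P' = emb_proc p" by blast
    from *(1) obtain \<sigma>s e where p: "p = Lam \<sigma>s e" "wt_exp (rev \<sigma>s @ \<Gamma>) e" by (auto elim: wt_proc.cases)
    have "\<forall>i<length (rev \<sigma>s @ \<Gamma>). up_ren (length \<sigma>s) f i = i" using *(2) by (auto simp: up_ren_def)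
    with p(2) have "?R2 (ren_exp (up_ren (length \<sigma>s) f) (emb_exp e)) (emb_exp e)" by blast
    then show ?thesis using * p by simp
  qed
  have 2: "E = E' \<or> (\<exists>G G' Es Es'. E = MCase G Es \<and> E' = MCase G' Es' \<and> ?R3 G G' \<and> (\<forall>i. ?R2 (Es i) (Es' i)))"
    if X: "?R2 E E'" for E E'
  proof -
    from X obtain \<Gamma> e f where *: "wt_exp \<Gamma> e" "\<forall>i<length \<Gamma>. f i = i"
      "E = ren_exp f (emb_exp e)" "E' = emb_exp e" by blast
    show ?thesis
    proof (cases e)
      case (Case a es)
      with *(1) have wt: "wt_app \<Gamma> a" "\<And>i. wt_exp \<Gamma> (es i)" by (auto elim: wt_exp.cases)
      have E: "E = MCase (ren_app f (emb_app a)) (ren_exp f \<circ> (emb_exp \<circ> es))" "E' = MCase (emb_app a) (emb_exp \<circ> es)"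
        using * Case by simp_all
      have "?R3 (ren_app f (emb_app a)) (emb_app a)" using wt(1) *(2) by blast
      moreover have "?R2 ((ren_exp f \<circ> (emb_exp \<circ> es)) i) ((emb_exp \<circ> es) i)" for i
        unfolding comp_apply using wt(2)[of i] *(2) by blast
      ultimately show ?thesis unfolding E by blast
    qed (use * in auto)
  qed
  have 3: "G = G' \<or> (\<exists>E E'. G = MExp E \<and> G' = MExp E' \<and> ?R2 E E') \<or>
      (\<exists>x Qs Qs'. G = MVar x Qs \<and> G' = MVar x Qs' \<and> list_all2 ?R1 Qs Qs') \<or>
      (\<exists>P P' Qs Qs'. G = MApp P Qs \<and> G' = MApp P' Qs' \<and> (P = P' \<or> ?R1 P P') \<and> list_all2 ?R1 Qs Qs')"
    if X: "?R3 G G'" for G G'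
  proof -
    from X obtain \<Gamma> a f where *: "wt_app \<Gamma> a" "\<forall>i<length \<Gamma>. f i = i"
      "G = ren_app f (emb_app a)" "G' = emb_app a" by blast
    from *(1) obtain x qs where a: "a = App x qs" "x < length \<Gamma>" "list_all2 (wt_proc \<Gamma>) qs (args (\<Gamma> ! x))"
      by (auto elim: wt_app.cases)
    have "list_all2 ?R1 (map (\<lambda>q. ren_proc f (emb_proc q)) qs) (map emb_proc qs)"
    proof (rule list_all2_map_map)
      fix q assume "q \<in> set qs"
      then obtain \<tau> where "wt_proc \<Gamma> q \<tau>" using a(3) by (metis in_set_conv_nth list_all2_conv_all_nth)
      then show "?R1 (ren_proc f (emb_proc q)) (emb_proc q)" using *(2) by blast
    qed
    moreover have "G = MVar x (map (\<lambda>q. ren_proc f (emb_proc q)) qs)" "G' = MVar x (map emb_proc qs)"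
      using * a by (simp_all add: comp_def)
    ultimately show ?thesis by blast
  qed
  note co = mterm_coinduct(1)[of ?R1 ?R2 ?R3, OF 1 2 3]
  assume "wt_proc \<Gamma> p \<sigma>"
  then have "ren_proc f (emb_proc p) = emb_proc p" if "\<forall>i<length \<Gamma>. f i = i" for f
    using that by (intro co) auto
  then show ?thesis by (simp add: bnd_def)
qed

section \<open>Left-well-foundedness as an inductive predicate\<close>

text \<open>\<open>spine e a\<close> means that \<open>a\<close> is an outermost application of \<open>e\<close>, i.e. one that is not inside
  an argument of another application.\<close>

inductive spine :: "exp \<Rightarrow> app \<Rightarrow> bool" where
  here: "spine (Case a es) a"
| branch: "spine (es i) a \<Longrightarrow> spine (Case b es) a"

inductive_cases spine_CaseE: "spine (Case b es) a"
inductive_cases spine_BotE [elim!]: "spine Bot a"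
inductive_cases spine_NumE [elim!]: "spine (Num n) a"

text \<open>Only passing to an argument leads to a smaller procedure. Branches are not inside the
  scrutinee, so case expressions may continue forever, and all outermost applications are treated at
  one stroke.\<close>

inductive lwf :: "proc \<Rightarrow> bool" where
  "(\<And>x qs q. spine e (App x qs) \<Longrightarrow> q \<in> set qs \<Longrightarrow> lwf q) \<Longrightarrow> lwf (Lam \<sigma>s e)"

inductive spine_at :: "exp \<Rightarrow> step list \<Rightarrow> app \<Rightarrow> bool" where
  "spine_at (Case a es) [Scrut] a"
| "spine_at (es i) \<pi> a \<Longrightarrow> spine_at (Case b es) (Branch i # \<pi>) a"

lemma spine_iff_at: "spine e a \<longleftrightarrow> (\<exists>\<pi>. spine_at e \<pi> a)"
proof
  assume "spine e a"
  then show "\<exists>\<pi>. spine_at e \<pi> a" by induction (blast intro: spine_at.intros)+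
next
  assume "\<exists>\<pi>. spine_at e \<pi> a"
  then obtain \<pi> where "spine_at e \<pi> a" ..
  then show "spine e a" by induction (blast intro: spine.intros)+
qed

lemma app_at_exp_iff: "app_at_exp e \<pi> \<longleftrightarrow> (\<exists>\<tau> a \<rho>. spine_at e \<tau> a \<and> app_at_app a \<rho> \<and> \<pi> = \<tau> @ \<rho>)"
proof
  assume "app_at_exp e \<pi>"
  then show "\<exists>\<tau> a \<rho>. spine_at e \<tau> a \<and> app_at_app a \<rho> \<and> \<pi> = \<tau> @ \<rho>"
  proof (induction \<pi> arbitrary: e rule: list.induct)
    case Nil
    then show ?case by (auto elim: app_at_exp.cases)
  next
    case (Cons s \<pi>)
    from Cons.prems show ?case
    proof cases
      case (1 a es)
      then show ?thesis by (intro exI[of _ "[Scrut]"]) (auto intro: spine_at.intros)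
    next
      case (2 es i a)
      from Cons.IH[OF 2(3)] obtain \<tau> b \<rho> where "spine_at (es i) \<tau> b" "app_at_app b \<rho>" "\<pi> = \<tau> @ \<rho>" by blast
      then show ?thesis using 2 by (intro exI[of _ "Branch i # \<tau>"]) (auto intro: spine_at.intros)
    qed
  qed
next
  assume "\<exists>\<tau> a \<rho>. spine_at e \<tau> a \<and> app_at_app a \<rho> \<and> \<pi> = \<tau> @ \<rho>"
  then obtain \<tau> a \<rho> where "spine_at e \<tau> a" "app_at_app a \<rho>" "\<pi> = \<tau> @ \<rho>" by blast
  then show "app_at_exp e \<pi>"
    by (induction arbitrary: \<pi> rule: spine_at.induct) (auto intro: app_at_proc_app_at_exp_app_at_app.intros)
qed

lemma app_at_proc_iff: "app_at_proc (Lam \<sigma>s e) \<pi> \<longleftrightarrow>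
    (\<exists>\<tau> a \<rho>. spine_at e \<tau> a \<and> app_at_app a \<rho> \<and> \<pi> = Body # \<tau> @ \<rho>)"
proof -
  have "app_at_proc (Lam \<sigma>s e) \<pi> \<longleftrightarrow> (\<exists>\<pi>'. app_at_exp e \<pi>' \<and> \<pi> = Body # \<pi>')"
    by (auto elim: app_at_proc.cases intro: app_at_proc_app_at_exp_app_at_app.intros)
  then show ?thesis by (auto simp: app_at_exp_iff)
qed

lemma app_at_app_iff: "app_at_app (App x qs) \<rho> \<longleftrightarrow>
    \<rho> = [] \<or> (\<exists>j \<pi>. j < length qs \<and> app_at_proc (qs ! j) \<pi> \<and> \<rho> = Arg j # \<pi>)"
  by (auto elim: app_at_app.cases intro: app_at_proc_app_at_exp_app_at_app.intros)

text \<open>No outermost application is inside another: their positions part at two different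
  branches, or at \<open>Scrut\<close> against a branch.\<close>

lemma spine_at_prefix:
  "spine_at e \<tau> a \<Longrightarrow> spine_at e \<tau>' a' \<Longrightarrow> prefix \<tau> (\<tau>' @ \<rho>) \<Longrightarrow> \<tau> = \<tau>' \<and> a = a'"
proof (induction arbitrary: \<tau>' rule: spine_at.induct)
  case (1 a es)
  from 1(1) show ?case by cases (use 1(2) in auto)
next
  case (2 es i \<pi> a b)
  from 2(3) show ?case using 2(2,4) by cases auto
qed

text \<open>A chain stays inside one outermost application and, from its second member on, inside
  one argument of it. The tail is a chain in that argument.\<close>

lemma lwf_LWF: "lwf p \<Longrightarrow> LWF p"
proof (induction rule: lwf.induct)
  case (1 e \<sigma>s)
  show ?case unfolding LWF_def
  proof
    assume "\<exists>\<pi> :: nat \<Rightarrow> step list. \<forall>k. app_at_proc (Lam \<sigma>s e) (\<pi> k) \<and> strict_prefix (\<pi> k) (\<pi> (Suc k))"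
    then obtain \<pi> where \<pi>: "\<And>k. app_at_proc (Lam \<sigma>s e) (\<pi> k)" "\<And>k. strict_prefix (\<pi> k) (\<pi> (Suc k))" by blast
    have mono: "prefix (\<pi> 0) (\<pi> k)" for k
      by (induction k) (use \<pi>(2) in \<open>auto simp: strict_prefix_def intro: prefix_order.trans\<close>)
    from \<pi>(1)[of 0] obtain \<tau> x qs \<rho>0 where \<tau>: "spine_at e \<tau> (App x qs)" "\<pi> 0 = Body # \<tau> @ \<rho>0"
      unfolding app_at_proc_iff by (metis app.exhaust)
    have "\<exists>\<rho>. app_at_app (App x qs) \<rho> \<and> \<pi> k = Body # \<tau> @ \<rho>" for k
    proof -
      from \<pi>(1)[of k] obtain \<tau>' a \<rho> where *: "spine_at e \<tau>' a" "app_at_app a \<rho>" "\<pi> k = Body # \<tau>' @ \<rho>"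
        unfolding app_at_proc_iff by blast
      have "prefix \<tau> (\<tau>' @ \<rho>)" using mono[of k] \<tau>(2) *(3) by (auto dest: append_prefixD)
      from spine_at_prefix[OF \<tau>(1) *(1) this] * show ?thesis by blast
    qed
    then obtain \<rho> where \<rho>: "\<And>k. app_at_app (App x qs) (\<rho> k)" "\<And>k. \<pi> k = Body # \<tau> @ \<rho> k" by metis
    have sp: "strict_prefix (\<rho> k) (\<rho> (Suc k))" for k using \<pi>(2)[of k] \<rho>(2) by (auto simp: strict_prefix_def)
    have ne: "\<rho> (Suc k) \<noteq> []" for k using sp[of k] by auto
    have "\<exists>j \<theta>. j < length qs \<and> app_at_proc (qs ! j) \<theta> \<and> \<rho> (Suc k) = Arg j # \<theta>" for k
      using \<rho>(1)[of "Suc k"] ne[of k] unfolding app_at_app_iff by blast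
    then obtain j \<theta> where \<theta>: "\<And>k. j k < length qs" "\<And>k. app_at_proc (qs ! j k) (\<theta> k)" "\<And>k. \<rho> (Suc k) = Arg (j k) # \<theta> k"
      by metis
    have "j (Suc k) = j k" "strict_prefix (\<theta> k) (\<theta> (Suc k))" for k
      using sp[of "Suc k"] \<theta>(3)[of k] \<theta>(3)[of "Suc k"] by (auto simp: strict_prefix_def)
    moreover from this(1) have "j k = j 0" for k by (induction k) auto
    ultimately have "\<not> LWF (qs ! j 0)" unfolding LWF_def using \<theta>(2) by metis
    moreover have "spine e (App x qs)" using \<tau>(1) spine_iff_at by blast
    ultimately show False using 1 \<theta>(1) nth_mem by blast
  qed
qed

text \<open>A procedure outside \<open>lwf\<close> has an argument outside \<open>lwf\<close>;
  descending forever yields the forbidden chain.\<close>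

lemma LWF_lwf: "LWF p \<Longrightarrow> lwf p"
proof (rule ccontr)
  assume "LWF p" "\<not> lwf p"
  have "\<exists>q' \<tau> j. \<not> lwf q' \<and> app_at_proc q \<tau> \<and> (\<forall>\<pi>. app_at_proc q' \<pi> \<longrightarrow> app_at_proc q (\<tau> @ Arg j # \<pi>))"
    if "\<not> lwf q" for q
  proof -
    obtain \<sigma>s e where q: "q = Lam \<sigma>s e" by (cases q)
    with that obtain x qs q' where *: "spine e (App x qs)" "q' \<in> set qs" "\<not> lwf q'"
      using lwf.intros by blast
    then obtain \<tau> j where "spine_at e \<tau> (App x qs)" "j < length qs" "q' = qs ! j"
      by (metis in_set_conv_nth spine_iff_at)
    moreover from this have "app_at_proc q (Body # \<tau> @ [])"
      unfolding q app_at_proc_iff by (blast intro: app_at_proc_app_at_exp_app_at_app.intros)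
    moreover have "app_at_proc q (Body # \<tau> @ Arg j # \<pi>)" if "app_at_proc q' \<pi>" for \<pi>
      unfolding q app_at_proc_iff app_at_app_iff using calculation that
      by (intro exI[of _ \<tau>] exI[of _ "App x qs"] exI[of _ "Arg j # \<pi>"]) (auto simp: app_at_app_iff)
    ultimately show ?thesis using *(3)
      by (intro exI[of _ q'] exI[of _ "Body # \<tau>"] exI[of _ j]) auto
  qed
  then obtain nx \<tau> j where nx: "\<And>q. \<not> lwf q \<Longrightarrow> \<not> lwf (nx q)" "\<And>q. \<not> lwf q \<Longrightarrow> app_at_proc q (\<tau> q)"
    "\<And>q \<pi>. \<not> lwf q \<Longrightarrow> app_at_proc (nx q) \<pi> \<Longrightarrow> app_at_proc q (\<tau> q @ Arg (j q) # \<pi>)" by metis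
  define f where "f k = (nx ^^ k) p" for k
  have f: "\<not> lwf (f k)" for k by (induction k) (use \<open>\<not> lwf p\<close> nx(1) in \<open>auto simp: f_def\<close>)
  \<comment> \<open>\<open>pre k\<close> is the position of the procedure \<open>f k\<close> in
    \<open>p\<close>; appending \<open>\<tau> (f k)\<close> gives the application that has
    \<open>f (Suc k)\<close> among its arguments.\<close>
  define pre where "pre = rec_nat [] (\<lambda>k r. r @ \<tau> (f k) @ [Arg (j (f k))])"
  have pre: "pre 0 = []" "pre (Suc k) = pre k @ \<tau> (f k) @ [Arg (j (f k))]" for k
    by (simp_all add: pre_def)
  have "app_at_proc (f k) \<pi> \<Longrightarrow> app_at_proc p (pre k @ \<pi>)" for k \<pi>
  proof (induction k arbitrary: \<pi>)
    case 0
    then show ?case by (simp add: pre f_def)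
  next
    case (Suc k)
    have "f (Suc k) = nx (f k)" by (simp add: f_def)
    with Suc.prems have "app_at_proc (f k) (\<tau> (f k) @ Arg (j (f k)) # \<pi>)" using nx(3)[OF f] by simp
    from Suc.IH[OF this] show ?case by (simp add: pre)
  qed
  then have "app_at_proc p (pre k @ \<tau> (f k))" for k using nx(2)[OF f] by blast
  moreover have "strict_prefix (pre k @ \<tau> (f k)) (pre (Suc k) @ \<tau> (f (Suc k)))" for k
    by (auto simp: pre strict_prefix_def)
  ultimately have "\<exists>\<pi> :: nat \<Rightarrow> step list. \<forall>k. app_at_proc p (\<pi> k) \<and> strict_prefix (\<pi> k) (\<pi> (Suc k))"
    by (intro exI[of _ "\<lambda>k. pre k @ \<tau> (f k)"]) blast
  with \<open>LWF p\<close> show False unfolding LWF_def by blast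
qed

section \<open>Evaluation relative to two type-two functionals\<close>

text \<open>\<open>AF \<phi> i\<close> means that the functional answers \<open>i\<close> on the basis of the values \<open>\<phi>\<close> of its argument.
  The environment \<open>\<nu>\<close> interprets the type-zero variables, which are followed by \<open>G\<close> and \<open>F\<close>.\<close>

type_synonym fun2 = "(nat \<Rightarrow> nat \<Rightarrow> bool) \<Rightarrow> nat \<Rightarrow> bool"

text \<open>\<open>\<phi>\<close> has to be sound for the argument but need not contain all its
  values, so a functional answers on partial information. The premise about \<open>\<phi>\<close>
  lets induction on an evaluation reach those of the arguments.\<close>

inductive ev :: "fun2 \<Rightarrow> fun2 \<Rightarrow> exp \<Rightarrow> nat list \<Rightarrow> nat \<Rightarrow> bool" for AF AG where
  ev_num: "ev AF AG (Num m) \<nu> m"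
| ev_var: "y < length \<nu> \<Longrightarrow> ev AF AG (es (\<nu> ! y)) \<nu> m \<Longrightarrow> ev AF AG (Case (App y []) es) \<nu> m"
| ev_G: "AG \<phi> i \<Longrightarrow> (\<And>j v. \<phi> j v \<Longrightarrow> ev AF AG e (j # \<nu>) v) \<Longrightarrow> ev AF AG (es i) \<nu> m \<Longrightarrow>
    ev AF AG (Case (App (length \<nu>) [Lam [\<tau>] e]) es) \<nu> m"
| ev_F: "AF \<phi> i \<Longrightarrow> (\<And>j v. \<phi> j v \<Longrightarrow> ev AF AG e (j # \<nu>) v) \<Longrightarrow> ev AF AG (es i) \<nu> m \<Longrightarrow>
    ev AF AG (Case (App (Suc (length \<nu>)) [Lam [\<tau>] e]) es) \<nu> m"

inductive_cases ev_NumE: "ev AF AG (Num m') \<nu> m"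
inductive_cases ev_varE: "ev AF AG (Case (App y []) es) \<nu> m"
inductive_cases ev_CaseE: "ev AF AG (Case (App y [q]) es) \<nu> m"

lemma ev_GD: "ev AF AG (Case (App (length \<nu>) [Lam [\<tau>] e]) es) \<nu> m \<Longrightarrow>
    \<exists>\<phi> i. AG \<phi> i \<and> (\<forall>j v. \<phi> j v \<longrightarrow> ev AF AG e (j # \<nu>) v) \<and> ev AF AG (es i) \<nu> m"
  by (erule ev_CaseE) auto

lemma ev_FD: "ev AF AG (Case (App (Suc (length \<nu>)) [Lam [\<tau>] e]) es) \<nu> m \<Longrightarrow>
    \<exists>\<phi> i. AF \<phi> i \<and> (\<forall>j v. \<phi> j v \<longrightarrow> ev AF AG e (j # \<nu>) v) \<and> ev AF AG (es i) \<nu> m"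
  by (erule ev_CaseE) auto

section \<open>Determinacy and monotonicity of evaluations\<close>

definition compat :: "(nat \<Rightarrow> nat \<Rightarrow> bool) \<Rightarrow> (nat \<Rightarrow> nat \<Rightarrow> bool) \<Rightarrow> bool" where
  "compat \<phi> \<phi>' \<longleftrightarrow> (\<forall>j v v'. \<phi> j v \<longrightarrow> \<phi>' j v' \<longrightarrow> v = v')"

text \<open>Two different functionals are compared in order to relate evaluations at different
  stages. Determinacy is the case of a functional and itself.\<close>

definition agree :: "fun2 \<Rightarrow> fun2 \<Rightarrow> bool" where
  "agree A A' \<longleftrightarrow> (\<forall>\<phi> \<phi>' i i'. A \<phi> i \<longrightarrow> A' \<phi>' i' \<longrightarrow> compat \<phi> \<phi>' \<longrightarrow> i = i')"

lemma ev_agree: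
  assumes "agree AF AF'" "agree AG AG'"
  shows "ev AF AG e \<nu> m \<Longrightarrow> ev AF' AG' e \<nu> m' \<Longrightarrow> m = m'"
proof (induction arbitrary: m' rule: ev.induct)
  case (ev_num m \<nu>)
  then show ?case by (auto elim: ev_NumE)
next
  case (ev_var y \<nu> es m)
  from ev_var.prems show ?case by (auto elim!: ev_varE dest: ev_var.IH)
next
  case (ev_G \<phi> i e \<nu> es m \<tau>)
  from ev_G.prems obtain \<phi>' i' where *: "AG' \<phi>' i'" "\<And>j v. \<phi>' j v \<Longrightarrow> ev AF' AG' e (j # \<nu>) v" "ev AF' AG' (es i') \<nu> m'"
    by (blast dest: ev_GD)
  have "compat \<phi> \<phi>'" using ev_G.IH(1) *(2) by (auto simp: compat_def)
  then have "i = i'" using assms(2) *(1) ev_G.hyps(1) unfolding agree_def by blast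
  then show ?case using ev_G.IH(2) *(3) by blast
next
  case (ev_F \<phi> i e \<nu> es m \<tau>)
  from ev_F.prems obtain \<phi>' i' where *: "AF' \<phi>' i'" "\<And>j v. \<phi>' j v \<Longrightarrow> ev AF' AG' e (j # \<nu>) v" "ev AF' AG' (es i') \<nu> m'"
    by (blast dest: ev_FD)
  have "compat \<phi> \<phi>'" using ev_F.IH(1) *(2) by (auto simp: compat_def)
  then have "i = i'" using assms(1) *(1) ev_F.hyps(1) unfolding agree_def by blast
  then show ?case using ev_F.IH(2) *(3) by blast
qed

text \<open>Evaluations have unique values, so the information consulted is single-valued, which is
  the meaning of \<open>compat \<phi> \<phi>\<close>. Answers need to be compared for such
  \<open>\<phi>\<close> only.\<close>

lemma ev_mono:
  assumes det: "agree AF AF" "agree AG AG"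
    and F: "\<And>\<phi> i. compat \<phi> \<phi> \<Longrightarrow> AF \<phi> i \<Longrightarrow> AF' \<phi> i"
    and G: "\<And>\<phi> i. compat \<phi> \<phi> \<Longrightarrow> AG \<phi> i \<Longrightarrow> AG' \<phi> i"
  shows "ev AF AG e \<nu> m \<Longrightarrow> ev AF' AG' e \<nu> m"
proof (induction rule: ev.induct)
  case (ev_G \<phi> i e \<nu> es m \<tau>)
  have "compat \<phi> \<phi>" unfolding compat_def using ev_G.hyps(2) ev_agree[OF det] by blast
  from G[OF this ev_G.hyps(1)] show ?case by (rule ev.ev_G[where AG = AG']) (fact ev_G.IH)+
next
  case (ev_F \<phi> i e \<nu> es m \<tau>)
  have "compat \<phi> \<phi>" unfolding compat_def using ev_F.hyps(2) ev_agree[OF det] by blast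
  from F[OF this ev_F.hyps(1)] show ?case by (rule ev.ev_F[where AF = AF']) (fact ev_F.IH)+
qed (auto intro: ev.intros)

text \<open>Functionals for a sequence \<open>x\<close> and codes \<open>cd\<close> of its prefixes.  The functional \<open>F\<close> finds the first
  position where the argument differs from \<open>x\<close>.  The functional \<open>G\<close> asks for the value at \<open>x i\<close> if the
  value at \<open>0\<close> is \<open>cd i\<close>, but always answers \<open>0\<close>.  At stage \<open>k\<close> this question is omitted for
  \<open>i = k\<close>, and nothing beyond \<open>k\<close> must occur.  The variant \<open>G_below\<close> omits no question and also
  bounds the values.\<close>

definition F_upto :: "(nat \<Rightarrow> nat) \<Rightarrow> nat \<Rightarrow> fun2" where
  "F_upto x k \<phi> i \<longleftrightarrow> i \<le> k \<and> (\<forall>j<i. \<phi> j (x j)) \<and> (\<exists>v. \<phi> i v \<and> v \<noteq> x i)"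

definition G_stage :: "(nat \<Rightarrow> nat) \<Rightarrow> (nat \<Rightarrow> nat) \<Rightarrow> nat \<Rightarrow> fun2" where
  "G_stage cd x k \<phi> a \<longleftrightarrow> a = 0 \<and>
    (\<exists>t. \<phi> 0 t \<and> (\<forall>i. t = cd i \<longrightarrow> i \<le> k \<and> (i < k \<longrightarrow> (\<exists>v. \<phi> (x i) v))))"

definition G_below :: "(nat \<Rightarrow> nat) \<Rightarrow> (nat \<Rightarrow> nat) \<Rightarrow> nat \<Rightarrow> fun2" where
  "G_below cd x b \<phi> a \<longleftrightarrow> a = 0 \<and> (\<exists>t. \<phi> 0 t \<and> (\<forall>i. t = cd i \<longrightarrow> i < b \<and> (\<exists>v<b. \<phi> (x i) v)))"

text \<open>The first position of difference does not depend on the bound of the search. Giving no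
  answer without a difference is essential: the default answer \<open>k\<close> would separate the
  stages.\<close>

lemma agree_F_upto: "agree (F_upto x k) (F_upto x k')"
proof -
  have "i = i'" if "F_upto x k \<phi> i" "F_upto x k' \<phi>' i'" "compat \<phi> \<phi>'" for \<phi> \<phi>' i i'
    using that unfolding F_upto_def compat_def by (metis linorder_neqE_nat)
  then show ?thesis unfolding agree_def by blast
qed

text \<open>Holds because \<open>0\<close> is the only answer; this is what the choice
  \<open>K = 0\<close> is for.\<close>

lemma agree_G [simp]: "agree (G_stage cd x k) (G_stage cd x k')" "agree (G_stage cd x k) (G_below cd x b)"
  "agree (G_below cd x b) (G_below cd x b')"
  by (auto simp: agree_def G_stage_def G_below_def)

abbreviation "ev_stage cd x k \<equiv> ev (F_upto x k) (G_stage cd x k)"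
abbreviation "ev_below cd x b \<equiv> ev (F_upto x b) (G_below cd x b)"

lemma ev_stage_below: "ev_stage cd x k e \<nu> m \<Longrightarrow> ev_below cd x b e \<nu> m' \<Longrightarrow> m = m'"
  by (rule ev_agree[OF agree_F_upto agree_G(2)])

lemma ev_stage_det: "ev_stage cd x k e \<nu> m \<Longrightarrow> ev_stage cd x k' e \<nu> m' \<Longrightarrow> m = m'"
  by (rule ev_agree[OF agree_F_upto agree_G(1)])

lemma ev_below_mono: "b \<le> b' \<Longrightarrow> ev_below cd x b e \<nu> m \<Longrightarrow> ev_below cd x b' e \<nu> m"
proof (rule ev_mono[OF agree_F_upto agree_G(3), where x1 = x and k2 = b and b1 = b and cd1 = cd and x2 = x])
  fix \<phi> i assume "b \<le> b'" "G_below cd x b \<phi> i"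
  then show "G_below cd x b' \<phi> i" unfolding G_below_def by (meson order.strict_trans2)
qed (auto simp: F_upto_def)

text \<open>Left-well-foundedness turns convergence at all late stages into one finite run without any
  omission: every outermost run is the same at all stages, and the runs of the arguments are nested
  inside it.\<close>

lemma lwf_ev_below:
  assumes inj: "inj cd"
  shows "lwf p \<Longrightarrow> p = Lam \<sigma>s e \<Longrightarrow> (\<And>k. k \<ge> k0 \<Longrightarrow> \<exists>m. ev_stage cd x k e \<nu> m) \<Longrightarrow> \<exists>b m. ev_below cd x b e \<nu> m"
proof (induction arbitrary: \<sigma>s e \<nu> k0 rule: lwf.induct)
  case (1 e0 \<sigma>s0)
  \<comment> \<open>The outer induction hypothesis: an argument of an outermost application that
    converges at all late stages has a limit run.\<close>
  have arg: "\<exists>b v. ev_below cd x b e' \<nu> v"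
    if "spine e0 (App y [Lam [\<tau>] e'])" "\<And>k. k \<ge> k1 \<Longrightarrow> \<exists>m. ev_stage cd x k e' \<nu> m" for y \<tau> e' \<nu> k1
    using 1(2)[OF that(1) _ _ that(2)] by (metis list.set_intros(1))
  \<comment> \<open>The inner induction follows the outermost run at the single stage
    \<open>k0\<close>; by agreement the runs at later stages take the same branches.\<close>
  have main: "\<exists>b m. ev_below cd x b e \<nu> m"
    if "ev_stage cd x k0 e \<nu> m" "\<And>k. k \<ge> k0 \<Longrightarrow> \<exists>m. ev_stage cd x k e \<nu> m" "\<And>a. spine e a \<Longrightarrow> spine e0 a" for m e \<nu>
    using that
  proof (induction rule: ev.induct)
    case (ev_num m \<nu>)
    then show ?case by (blast intro: ev.intros)
  next
    case (ev_var y \<nu> es m)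
    have "\<exists>b m. ev_below cd x b (es (\<nu> ! y)) \<nu> m"
    proof (rule ev_var.IH)
      fix k assume "k \<ge> k0"
      from ev_var.prems(1)[OF this] show "\<exists>m. ev_stage cd x k (es (\<nu> ! y)) \<nu> m" by (auto elim: ev_varE)
    next
      fix a assume "spine (es (\<nu> ! y)) a"
      then show "spine e0 a" by (intro ev_var.prems(2) spine.branch)
    qed
    then show ?case using ev_var.hyps(1) by (blast intro: ev.intros)
  next
    case (ev_G \<phi> i e \<nu> es m \<tau>)
    have i: "i = 0" using ev_G.hyps(1) by (simp add: G_stage_def)
    have sp: "spine e0 (App (length \<nu>) [Lam [\<tau>] e])" by (intro ev_G.prems(2) spine.here)
    have conv: "\<exists>\<phi>. G_stage cd x k \<phi> 0 \<and> (\<forall>j v. \<phi> j v \<longrightarrow> ev_stage cd x k e (j # \<nu>) v) \<and> (\<exists>m. ev_stage cd x k (es 0) \<nu> m)"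
      if k: "k \<ge> k0" for k
    proof -
      from ev_G.prems(1)[OF k] obtain m' where "ev_stage cd x k (Case (App (length \<nu>) [Lam [\<tau>] e]) es) \<nu> m'" ..
      then obtain \<phi> i where *: "G_stage cd x k \<phi> i" "\<And>j v. \<phi> j v \<Longrightarrow> ev_stage cd x k e (j # \<nu>) v" "ev_stage cd x k (es i) \<nu> m'"
        by (blast dest: ev_GD)
      moreover from *(1) have "i = 0" by (simp add: G_stage_def)
      ultimately show ?thesis by blast
    qed
    \<comment> \<open>Every stage asks for the value at \<open>0\<close>, so the argument has a
      limit run there; its value \<open>t\<close> is common to the stages.\<close>
    have "\<exists>m. ev_stage cd x k e (0 # \<nu>) m" if k: "k \<ge> k0" for k
      using conv[OF k] unfolding G_stage_def by blast
    from arg[OF sp this] obtain b0 t where b0: "ev_below cd x b0 e (0 # \<nu>) t" by blast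
    have "\<exists>b2 m. ev_below cd x b2 (es 0) \<nu> m"
    proof (rule ev_G.IH(2)[unfolded i])
      fix k assume k: "k \<ge> k0"
      from conv[OF this] show "\<exists>m. ev_stage cd x k (es 0) \<nu> m" by blast
    next
      fix a assume "spine (es 0) a"
      then show "spine e0 a" by (intro ev_G.prems(2) spine.branch)
    qed
    then obtain b2 m2 where b2: "ev_below cd x b2 (es 0) \<nu> m2" by blast
    have "\<exists>b1. \<forall>i. t = cd i \<longrightarrow> i < b1 \<and> (\<exists>v<b1. ev_below cd x b1 e (x i # \<nu>) v)"
    proof (cases "\<exists>i. t = cd i")
      case True
      then obtain i where ti: "t = cd i" by blast
      \<comment> \<open>Stage \<open>i\<close> omits the question at \<open>x i\<close>, hence only
        stages beyond \<open>i\<close> are used.\<close>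
      have "\<exists>m. ev_stage cd x k e (x i # \<nu>) m" if k: "k \<ge> max k0 (Suc i)" for k
      proof -
        from k obtain \<phi> where *: "G_stage cd x k \<phi> 0" "\<forall>j v. \<phi> j v \<longrightarrow> ev_stage cd x k e (j # \<nu>) v"
          using conv[of k] by auto
        then obtain t' where t': "\<phi> 0 t'" "\<forall>i. t' = cd i \<longrightarrow> i \<le> k \<and> (i < k \<longrightarrow> (\<exists>v. \<phi> (x i) v))"
          unfolding G_stage_def by blast
        have "t' = t" using *(2) t'(1) b0 ev_stage_below by blast
        then show ?thesis using t'(2) ti *(2) k by fastforce
      qed
      from arg[OF sp this] obtain b1 v where b1: "ev_below cd x b1 e (x i # \<nu>) v" by blast
      \<comment> \<open>\<open>G_below\<close> also requires the index \<open>i\<close> and the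
        value \<open>v\<close> to be below the bound.\<close>
      then have "ev_below cd x (Max {b1, Suc i, Suc v}) e (x i # \<nu>) v"
        by (rule ev_below_mono[rotated]) simp
      moreover have "i' = i" if "t = cd i'" for i' using that ti inj by (auto dest: injD)
      moreover have "i < Max {b1, Suc i, Suc v}" "v < Max {b1, Suc i, Suc v}" by auto
      ultimately show ?thesis by blast
    qed blast
    then obtain b1 where b1: "\<And>i. t = cd i \<Longrightarrow> i < b1 \<and> (\<exists>v<b1. ev_below cd x b1 e (x i # \<nu>) v)" by blast
    define b where "b = Max {b0, b1, b2}"
    have le: "b0 \<le> b" "b1 \<le> b" "b2 \<le> b" by (auto simp: b_def)
    have "i < b \<and> (\<exists>v<b. ev_below cd x b e (x i # \<nu>) v)" if "t = cd i" for i
      using b1[OF that] le ev_below_mono by (meson order.strict_trans2)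
    moreover have "ev_below cd x b e (0 # \<nu>) t" using b0 le ev_below_mono by blast
    ultimately have "\<exists>t. ev_below cd x b e (0 # \<nu>) t \<and>
        (\<forall>i. t = cd i \<longrightarrow> i < b \<and> (\<exists>v<b. ev_below cd x b e (x i # \<nu>) v))" by blast
    then have "G_below cd x b (\<lambda>j. ev_below cd x b e (j # \<nu>)) 0"
      by (simp add: G_below_def)
    then have "ev_below cd x b (Case (App (length \<nu>) [Lam [\<tau>] e]) es) \<nu> m2"
      by (rule ev.ev_G[where AG = "G_below cd x b"]) (assumption, rule ev_below_mono[OF le(3) b2])
    then show ?case by blast
  next
    case (ev_F \<phi> i e \<nu> es m \<tau>)
    have sp: "spine e0 (App (Suc (length \<nu>)) [Lam [\<tau>] e])" by (intro ev_F.prems(2) spine.here)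
    have conv: "\<exists>\<phi>. F_upto x k \<phi> i \<and> (\<forall>j v. \<phi> j v \<longrightarrow> ev_stage cd x k e (j # \<nu>) v) \<and> (\<exists>m. ev_stage cd x k (es i) \<nu> m)"
      if k: "k \<ge> k0" for k
    proof -
      from ev_F.prems(1)[OF k] obtain m' where "ev_stage cd x k (Case (App (Suc (length \<nu>)) [Lam [\<tau>] e]) es) \<nu> m'" ..
      then obtain \<phi>' i' where *: "F_upto x k \<phi>' i'" "\<And>j v. \<phi>' j v \<Longrightarrow> ev_stage cd x k e (j # \<nu>) v" "ev_stage cd x k (es i') \<nu> m'"
        by (blast dest: ev_FD)
      moreover have "compat \<phi> \<phi>'" unfolding compat_def using ev_F.hyps(2) *(2) ev_stage_det by blast
      then have "i' = i" using agree_F_upto ev_F.hyps(1) *(1) unfolding agree_def by blast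
      ultimately show ?thesis by blast
    qed
    \<comment> \<open>The answer \<open>i\<close> is the same at all late stages, and giving it
      takes the values at all positions up to \<open>i\<close>.\<close>
    have "\<exists>b v. ev_below cd x b e (j # \<nu>) v" if j: "j \<le> i" for j
    proof (rule arg[OF sp])
      fix k assume "k \<ge> k0"
      from conv[OF this] obtain \<phi>' where *: "F_upto x k \<phi>' i" "\<And>j v. \<phi>' j v \<Longrightarrow> ev_stage cd x k e (j # \<nu>) v" by blast
      have "\<exists>v. \<phi>' j v"
      proof (cases "j = i")
        case False
        with j have "j < i" by simp
        then show ?thesis using *(1) unfolding F_upto_def by blast
      qed (use *(1) in \<open>auto simp: F_upto_def\<close>)
      then show "\<exists>m. ev_stage cd x k e (j # \<nu>) m" using *(2) by blast
    qed
    then obtain bf vf where bf: "\<And>j. j \<le> i \<Longrightarrow> ev_below cd x (bf j) e (j # \<nu>) (vf j)" by metis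
    have "\<exists>b2 m. ev_below cd x b2 (es i) \<nu> m"
    proof (rule ev_F.IH(2))
      fix k assume k: "k \<ge> k0"
      from conv[OF this] show "\<exists>m. ev_stage cd x k (es i) \<nu> m" by blast
    next
      fix a assume "spine (es i) a"
      then show "spine e0 a" by (intro ev_F.prems(2) spine.branch)
    qed
    then obtain b2 m2 where b2: "ev_below cd x b2 (es i) \<nu> m2" by blast
    define b where "b = Max (insert b2 (insert i (bf ` {..i})))"
    have le: "b2 \<le> b" "i \<le> b" "\<And>j. j \<le> i \<Longrightarrow> bf j \<le> b"
      unfolding b_def by (intro Max_ge; simp)+
    have bj: "ev_below cd x b e (j # \<nu>) (vf j)" if "j \<le> i" for j
      using bf[OF that] le(3)[OF that] ev_below_mono by blast
    \<comment> \<open>Limit values coincide with those at the stage, so the first difference is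
      again at \<open>i\<close>.\<close>
    have eq: "vf j = v" if "\<phi> j v" "j \<le> i" for j v
      using ev_stage_below[OF ev_F.hyps(2)[OF that(1)] bj[OF that(2)]] by simp
    from ev_F.hyps(1) obtain vi where vi: "\<phi> i vi" "vi \<noteq> x i" and lt: "\<And>j. j < i \<Longrightarrow> \<phi> j (x j)"
      unfolding F_upto_def by blast
    have "vf i = vi" "\<And>j. j < i \<Longrightarrow> vf j = x j"
      using eq[OF vi(1)] eq[OF lt] by simp_all
    have "ev_below cd x b e (i # \<nu>) vi" using bj[of i] \<open>vf i = vi\<close> by simp
    moreover have "ev_below cd x b e (j # \<nu>) (x j)" if "j < i" for j
      using bj[of j] \<open>\<And>j. j < i \<Longrightarrow> vf j = x j\<close>[OF that] that by simp
    ultimately have "F_upto x b (\<lambda>j. ev_below cd x b e (j # \<nu>)) i"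
      unfolding F_upto_def using le(2) vi(2) by auto
    then have "ev_below cd x b (Case (App (Suc (length \<nu>)) [Lam [\<tau>] e]) es) \<nu> m2"
      by (rule ev.ev_F[where AF = "F_upto x b"]) (assumption, rule ev_below_mono[OF le(1) b2])
    then show ?case by blast
  qed
  have e: "e = e0" using 1(3) by simp
  from 1(4)[of k0] obtain m where m: "ev_stage cd x k0 e \<nu> m" by blast
  show ?case by (rule main[OF m 1(4)]) (simp_all add: e)
qed

section \<open>Decision trees\<close>

datatype dt = Ret nat | Ask nat "nat \<Rightarrow> dt"

primrec bindd :: "dt \<Rightarrow> (nat \<Rightarrow> dt) \<Rightarrow> dt" where
  "bindd (Ret n) k = k n"
| "bindd (Ask j h) k = Ask j (\<lambda>v. bindd (h v) k)"

primrec dexp :: "dt \<Rightarrow> exp" where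
  "dexp (Ret n) = Num n"
| "dexp (Ask j h) = Case (App 0 [num j]) (\<lambda>v. dexp (h v))"

inductive run :: "dt \<Rightarrow> fun2" where
  run_Ret: "run (Ret m) \<phi> m"
| run_Ask: "\<phi> j v \<Longrightarrow> run (h v) \<phi> m \<Longrightarrow> run (Ask j h) \<phi> m"

inductive_cases run_RetE [elim!]: "run (Ret n) \<phi> m"
inductive_cases run_AskE: "run (Ask j h) \<phi> m"

lemma run_simps [simp]: "run (Ret n) \<phi> m \<longleftrightarrow> m = n" "run (Ask j h) \<phi> m \<longleftrightarrow> (\<exists>v. \<phi> j v \<and> run (h v) \<phi> m)"
  by (blast intro: run_Ret) (blast intro: run_Ask[of \<phi> j _ h m] elim: run_AskE)

lemma run_bindd: "run (bindd d k) \<phi> m \<longleftrightarrow> (\<exists>v. run d \<phi> v \<and> run (k v) \<phi> m)"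
  by (induction d) auto

lemma agree_run: "agree (run d) (run d)"
  unfolding agree_def
proof (intro allI impI)
  fix \<phi> \<phi>' i i' assume "run d \<phi> i" "run d \<phi>' i'" "compat \<phi> \<phi>'"
  then show "i = i'"
  proof (induction arbitrary: i' rule: run.induct)
    case (run_Ask \<phi> j v h m)
    then obtain v' where "\<phi>' j v'" "run (h v') \<phi>' i'" by auto
    moreover have "v' = v" using run_Ask.hyps(1) \<open>\<phi>' j v'\<close> run_Ask.prems(2) by (auto simp: compat_def)
    ultimately show ?case using run_Ask by blast
  qed simp
qed

text \<open>A test for equality from predecessor and zero test alone: the result is \<open>0\<close>
  if \<open>d\<close> yields \<open>a\<close>, and some nonzero number otherwise. Each decrement
  asks the questions of \<open>d\<close> anew, as evaluation by name does.\<close>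

primrec neqd :: "nat \<Rightarrow> dt \<Rightarrow> dt" where
  "neqd 0 d = d"
| "neqd (Suc a) d = bindd d (\<lambda>i. if i = 0 then Ret 1 else neqd a (bindd d (\<lambda>i. Ret (i - 1))))"

definition ifeq :: "nat \<Rightarrow> dt \<Rightarrow> dt \<Rightarrow> dt \<Rightarrow> dt" where
  "ifeq a d d1 d2 = bindd (neqd a d) (\<lambda>i. if i = 0 then d1 else d2)"

lemma run_neqd_ex: "run d \<phi> v \<Longrightarrow> \<exists>r. run (neqd a d) \<phi> r \<and> (r = 0 \<longleftrightarrow> v = a)"
proof (induction a arbitrary: d v)
  case (Suc a)
  show ?case
  proof (cases v)
    case 0
    then have "run (neqd (Suc a) d) \<phi> 1" using Suc.prems by (auto simp: run_bindd intro!: exI[of _ 0])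
    then show ?thesis using 0 by (intro exI[of _ 1]) simp
  next
    case (Suc w)
    have "run (bindd d (\<lambda>i. Ret (i - 1))) \<phi> w" using Suc.prems Suc by (auto simp: run_bindd)
    from Suc.IH[OF this] obtain r where "run (neqd a (bindd d (\<lambda>i. Ret (i - 1)))) \<phi> r" "r = 0 \<longleftrightarrow> w = a" by blast
    then have "run (neqd (Suc a) d) \<phi> r" using Suc.prems Suc by (auto simp: run_bindd intro!: exI[of _ v])
    with \<open>r = 0 \<longleftrightarrow> w = a\<close> show ?thesis using Suc by (intro exI[of _ r]) simp
  qed
qed auto

lemma run_neqd_run: "run (neqd a d) \<phi> r \<Longrightarrow> \<exists>v. run d \<phi> v"
  by (cases a) (auto simp: run_bindd)

text \<open>Repeated questions must receive the same answer, whence the assumption on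
  \<open>\<phi>\<close>.\<close>

lemma run_ifeq:
  assumes "compat \<phi> \<phi>"
  shows "run (ifeq a d d1 d2) \<phi> m \<longleftrightarrow> (\<exists>v. run d \<phi> v \<and> run (if v = a then d1 else d2) \<phi> m)"
proof -
  have det: "run d \<phi> v \<Longrightarrow> run d \<phi> v' \<Longrightarrow> v = v'" for d v v'
    using agree_run[of d, unfolded agree_def, rule_format, of \<phi> v \<phi> v'] assms by simp
  show ?thesis
  proof
    assume "run (ifeq a d d1 d2) \<phi> m"
    then obtain r where r: "run (neqd a d) \<phi> r" "run (if r = 0 then d1 else d2) \<phi> m"
      by (auto simp: ifeq_def run_bindd)
    from run_neqd_run[OF r(1)] obtain v where v: "run d \<phi> v" ..
    from run_neqd_ex[OF this, of a] obtain r' where "run (neqd a d) \<phi> r'" "r' = 0 \<longleftrightarrow> v = a" by blast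
    with det[OF r(1)] have "r = 0 \<longleftrightarrow> v = a" by simp
    with v r(2) show "\<exists>v. run d \<phi> v \<and> run (if v = a then d1 else d2) \<phi> m" by (intro exI[of _ v]) simp
  next
    assume "\<exists>v. run d \<phi> v \<and> run (if v = a then d1 else d2) \<phi> m"
    then obtain v where v: "run d \<phi> v" "run (if v = a then d1 else d2) \<phi> m" by blast
    from run_neqd_ex[OF v(1), of a] obtain r where r: "run (neqd a d) \<phi> r" "r = 0 \<longleftrightarrow> v = a" by blast
    have "run (if r = 0 then d1 else d2) \<phi> m" using v(2) r(2) by simp
    with r(1) show "run (ifeq a d d1 d2) \<phi> m" unfolding ifeq_def run_bindd by blast
  qed
qed

section \<open>Decision trees as definable functionals of type two\<close>

definition Fn :: "dt \<Rightarrow> proc" where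
  "Fn d = Lam [N \<rightarrow> N] (dexp d)"

lemma pure_2: "pure 2 = (N \<rightarrow> N) \<rightarrow> N" and pure_1: "pure 1 = N \<rightarrow> N"
  by (simp_all add: numeral_2_eq_2)

abbreviation f_ctx :: ctx where
  "f_ctx \<equiv> [(''f'', N \<rightarrow> N)]"

definition dt_definable :: "dt \<Rightarrow> bool" where
  "dt_definable d \<longleftrightarrow> (\<exists>M. wt_tm t0_str_ty f_ctx M N \<and> den f_ctx (replace t0_str_tr M) = Lam [] (dexp d))"

lemma Fn_definable: "dt_definable d \<Longrightarrow> definable_T0_str (pure 2) (Fn d)"
proof -
  assume "dt_definable d"
  then obtain M where "wt_tm t0_str_ty f_ctx M N" "den f_ctx (replace t0_str_tr M) = Lam [] (dexp d)"
    by (auto simp: dt_definable_def)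
  then show ?thesis unfolding definable_T0_str_def definable_def pure_2
    by (intro exI[of _ "Abs ''f'' (N \<rightarrow> N) M"]) (auto simp: Fn_def intro: wt_tm.intros)
qed

lemma funs_args [simp]: "funs (args \<sigma>) N = \<sigma>" and args_funs [simp]: "args (funs \<sigma>s N) = \<sigma>s"
  by (induction \<sigma>; simp add: funs_def) (induction \<sigma>s; simp add: funs_def)

lemma Fn_SP0: "Fn d \<in> SP0 (pure 2)"
proof -
  have wt_num: "wt_proc \<Gamma> (num j) N" for \<Gamma> j
    using wt_proc_wt_exp_wt_app.intros(1)[of "[]" \<Gamma> "Num j"]
    by (simp add: num_def funs_def wt_proc_wt_exp_wt_app.intros(3))
  have "wt_exp [N \<rightarrow> N] (dexp d)"
    by (induction d) (auto intro!: wt_proc_wt_exp_wt_app.intros wt_num)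
  then show ?thesis
    using wt_proc_wt_exp_wt_app.intros(1)[of "[N \<rightarrow> N]" "[]" "dexp d"]
    by (simp add: SP0_def Fn_def pure_2 funs_def)
qed

lemma nfs_emb [simp]: "nfs (emb_exp e, []) = e"
  using nf_emb(2) by (simp add: nf_exp_conv_nfs)

text \<open>Case-of-case conversion grafts the continuation onto the leaves of the tree. The
  definability of the operations on trees reduces to this.\<close>

lemma nf_bind: "(\<And>i. nf_exp (F i) = dexp (k i)) \<Longrightarrow> nfs (emb_exp (dexp d), [F]) = dexp (bindd d k)"
  by (induction d) (auto simp: nf_exp_conv_nfs num_def)

lemma nfs_MApp_Nil [simp]: "nfs (MCase (MApp (MLam [] B) []) Es, S) = nfs (B, Es # S)"
  by (simp add: nfs_beta)

lemma foldl_app: "foldl (\<cdot>) p qs = nf_proc (mapps (emb_proc p) (map emb_proc qs))"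
proof (induction qs arbitrary: p)
  case (Cons q qs)
  have "mapps (emb_proc (p \<cdot> q)) (map emb_proc qs) \<simeq> mapps (mapp (emb_proc p) (emb_proc q)) (map emb_proc qs)"
    by (intro mappsv_cong emb_app_beq) (simp add: list_all2_refl)
  with Cons show ?case by (simp add: beq_def)
qed simp

lemma dt_definable_Ret: "dt_definable (Ret n)"
  unfolding dt_definable_def
  by (rule exI[of _ "Con (CNum n)"]) (use wt_tm.intros(2)[of t0_str_ty _ "CNum n"] in \<open>auto simp: num_def\<close>)

lemma dt_definable_Ask: "dt_definable (Ask k Ret)"
proof -
  have "eta (N \<rightarrow> N) 0 \<cdot> num k = Lam [] (dexp (Ask k Ret))"
    by (simp add: eta.simps nsp_app_conv num_def push_def up_subst_def nf_exp_conv_nfs comp_def)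
  moreover have "wt_tm t0_str_ty f_ctx (Var ''f'' \<bullet> Con (CNum k)) N"
    using wt_tm.intros(2)[of t0_str_ty f_ctx "CNum k"] by (intro wt_tm.intros) auto
  ultimately show ?thesis unfolding dt_definable_def
    by (intro exI[of _ "Var ''f'' \<bullet> Con (CNum k)"]) simp
qed

lemma dt_definable_pre:
  assumes "dt_definable d" shows "dt_definable (bindd d (\<lambda>i. Ret (i - 1)))"
proof -
  from assms obtain M where M: "wt_tm t0_str_ty f_ctx M N" "den f_ctx (replace t0_str_tr M) = Lam [] (dexp d)"
    by (auto simp: dt_definable_def)
  have "den_const Pre_c \<cdot> Lam [] (dexp d) = Lam [] (dexp (bindd d (\<lambda>i. Ret (i - 1))))"
    by (simp add: push_def nf_exp_conv_nfs up_subst_def nsp_app_conv comp_def nf_bind)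
  moreover have "wt_tm t0_str_ty f_ctx (Con Pre_c \<bullet> M) N"
    using wt_tm.intros(2)[of t0_str_ty f_ctx Pre_c] M by (intro wt_tm.intros(3)[OF _ M(1)]) simp
  ultimately show ?thesis unfolding dt_definable_def
    by (intro exI[of _ "Con Pre_c \<bullet> M"]) (simp add: M)
qed

lemma dt_definable_if:
  assumes "dt_definable d" "dt_definable d1" "dt_definable d2"
  shows "dt_definable (bindd d (\<lambda>i. if i = 0 then d1 else d2))"
proof -
  from assms obtain M M1 M2 where M: "wt_tm t0_str_ty f_ctx M N" "den f_ctx (replace t0_str_tr M) = Lam [] (dexp d)"
    and M1: "wt_tm t0_str_ty f_ctx M1 N" "den f_ctx (replace t0_str_tr M1) = Lam [] (dexp d1)"
    and M2: "wt_tm t0_str_ty f_ctx M2 N" "den f_ctx (replace t0_str_tr M2) = Lam [] (dexp d2)"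
    by (auto simp: dt_definable_def)
  have "den_const Ifzero_c \<cdot> Lam [] (dexp d) \<cdot> Lam [] (dexp d1) \<cdot> Lam [] (dexp d2)
      = foldl (\<cdot>) (den_const Ifzero_c) [Lam [] (dexp d), Lam [] (dexp d1), Lam [] (dexp d2)]" by simp
  also have "\<dots> = Lam [] (dexp (bindd d (\<lambda>i. if i = 0 then d1 else d2)))"
  proof -
    let ?Qs = "[MLam [] (emb_exp (dexp d)), MLam [] (emb_exp (dexp d1)), MLam [] (emb_exp (dexp d2))]"
    have m: "mappsv (MLam [N, N, N] B) [Inr (MLam [] (emb_exp (dexp d))), Inr (MLam [] (emb_exp (dexp d1))),
        Inr (MLam [] (emb_exp (dexp d2)))] = MLam [] (sub_exp (inst ?Qs) B)" for B
      using mapps_full[of ?Qs "[N, N, N]" B] by (simp del: mappsv_simps)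
    have br: "nf_exp (sub_exp (inst ?Qs) (emb_exp (if i = 0 then Case (App 1 []) Num else Case (App 0 []) Num)))
        = dexp (if i = 0 then d1 else d2)" for i :: nat
      by (simp add: inst_def nf_exp_conv_nfs comp_def)
    show ?thesis unfolding foldl_app using nf_bind[OF br]
      by (simp add: m nf_exp_conv_nfs inst_def comp_def del: mappsv_simps)
  qed
  finally have eq: "den_const Ifzero_c \<cdot> Lam [] (dexp d) \<cdot> Lam [] (dexp d1) \<cdot> Lam [] (dexp d2)
      = Lam [] (dexp (bindd d (\<lambda>i. if i = 0 then d1 else d2)))" .
  have "wt_tm t0_str_ty f_ctx (Con Ifzero_c \<bullet> M \<bullet> M1 \<bullet> M2) N"
    using wt_tm.intros(2)[of t0_str_ty f_ctx Ifzero_c]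
    by (intro wt_tm.intros(3)[OF _ M2(1)] wt_tm.intros(3)[OF _ M1(1)] wt_tm.intros(3)[OF _ M(1)]) simp
  then show ?thesis unfolding dt_definable_def
    by (intro exI[of _ "Con Ifzero_c \<bullet> M \<bullet> M1 \<bullet> M2"]) (simp add: M M1 M2 eq del: den_const.simps)
qed

lemma dt_definable_ifeq:
  assumes "dt_definable d" "dt_definable d1" "dt_definable d2"
  shows "dt_definable (ifeq a d d1 d2)"
proof -
  have "dt_definable (neqd a d)" using assms(1)
    by (induction a arbitrary: d) (auto intro: dt_definable_if dt_definable_pre dt_definable_Ret)
  then show ?thesis unfolding ifeq_def using assms(2,3) by (rule dt_definable_if)
qed

text \<open>Only values of \<open>g\<close> at numerals matter. In this way values obtained from the
  bar recursion equations determine the answers of the trees, whatever the procedure behind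
  them.\<close>

lemma Fn_app:
  assumes g: "\<And>j v. \<phi> j v \<Longrightarrow> g \<cdot> num j = num v" and r: "run d \<phi> m"
  shows "Fn d \<cdot> g = num m"
proof -
  have ask: "nfs (MCase (MApp (emb_proc g) [emb_proc (num j)]) Es, S) = nfs (Es v, S)" if *: "g \<cdot> num j = num v" for j v Es S
  proof -
    from *  obtain \<sigma> b where gl: "g = Lam [\<sigma>] b"
      by (cases "(g, num j)" rule: nsp_app.cases) (auto simp: num_def)
    have "nf_exp (sub_exp (inst [emb_proc (num j)]) (emb_exp b)) = nf_exp (MNum v)"
      using * by (simp add: gl num_def)
    then have "nfs (sub_exp (inst [emb_proc (num j)]) (emb_exp b), Es # S) = nfs (MNum v, Es # S)"
      by (rule nfs_cong) simp
    then show ?thesis by (simp add: gl nfs_beta)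
  qed
  have "nfs (sub_exp (inst [emb_proc g]) (emb_exp (dexp d)), []) = Num m"
    using r g
  proof (induction rule: run.induct)
    case (run_Ask \<phi> j v h m)
    have "g \<cdot> num j = num v" using run_Ask.prems run_Ask.hyps(1) .
    from ask[OF this] run_Ask.IH[OF run_Ask.prems] show ?case by (simp add: inst_def num_def)
  qed simp
  then show ?thesis by (simp add: Fn_def nsp_app_conv nf_exp_conv_nfs num_def inst_conv_push)
qed

section \<open>The functionals for a prefix of a sequence\<close>

text \<open>The question in \<open>ftree []\<close> does not affect the answer, but makes it depend on the
  convergence of the argument at \<open>i\<close>, as at all other positions.\<close>

primrec ftree :: "nat list \<Rightarrow> nat \<Rightarrow> dt" where
  "ftree [] i = bindd (Ask i Ret) (\<lambda>v. if v = 0 then Ret i else Ret i)"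
| "ftree (y # ys) i = ifeq y (Ask i Ret) (ftree ys (Suc i)) (Ret i)"

text \<open>Comparing the value received with \<open>K\<close>, instead of returning it, restricts
  the answers to \<open>K\<close> and \<open>0\<close>; for \<open>K = 0\<close> they become
  constant.\<close>

primrec gtree :: "nat \<Rightarrow> nat \<Rightarrow> (nat \<times> nat) list \<Rightarrow> dt" where
  "gtree K t [] = ifeq t (Ask 0 Ret) (Ret K) (Ret 0)"
| "gtree K t (p # ps) =
    ifeq (fst p) (Ask 0 Ret) (ifeq K (Ask (snd p) Ret) (Ret K) (Ret 0)) (gtree K t ps)"

lemma dt_definable_ftree: "dt_definable (ftree xs i)"
proof (induction xs arbitrary: i)
  case Nil
  show ?case unfolding ftree.simps by (intro dt_definable_if dt_definable_Ask dt_definable_Ret)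
qed (auto intro: dt_definable_ifeq dt_definable_Ask dt_definable_Ret)

lemma dt_definable_gtree: "dt_definable (gtree K t ps)"
  by (induction ps) (auto intro: dt_definable_ifeq dt_definable_Ask dt_definable_Ret)

definition Ft :: "(nat \<Rightarrow> nat) \<Rightarrow> nat \<Rightarrow> dt" where
  "Ft x k = ftree (map x [0..<k]) 0"

definition Gt :: "nat \<Rightarrow> (nat \<Rightarrow> nat) \<Rightarrow> (nat \<Rightarrow> nat) \<Rightarrow> nat \<Rightarrow> dt" where
  "Gt K cd x k = gtree K (cd k) (map (\<lambda>i. (cd i, x i)) [0..<k])"

lemma run_ftree:
  assumes "compat \<phi> \<phi>"
  shows "i \<le> k \<Longrightarrow> run (ftree (map x [i..<k]) i) \<phi> m \<longleftrightarrow>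
    i \<le> m \<and> m \<le> k \<and> (\<forall>j. i \<le> j \<and> j < m \<longrightarrow> \<phi> j (x j)) \<and> (\<exists>v. \<phi> m v \<and> (m < k \<longrightarrow> v \<noteq> x m))"
proof (induction "k - i" arbitrary: i)
  case 0
  then have "i = k" by simp
  then show ?case by (auto simp: run_bindd split: if_splits)
next
  case (Suc d)
  then have lt: "i < k" by simp
  have IH: "run (ftree (map x [Suc i..<k]) (Suc i)) \<phi> m \<longleftrightarrow>
    Suc i \<le> m \<and> m \<le> k \<and> (\<forall>j. Suc i \<le> j \<and> j < m \<longrightarrow> \<phi> j (x j)) \<and> (\<exists>v. \<phi> m v \<and> (m < k \<longrightarrow> v \<noteq> x m))"
    using Suc.hyps(1)[of "Suc i"] Suc.hyps(2) lt by simp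
  have "run (ftree (map x [i..<k]) i) \<phi> m \<longleftrightarrow>
    (\<exists>v. \<phi> i v \<and> run (if v = x i then ftree (map x [Suc i..<k]) (Suc i) else Ret i) \<phi> m)"
    using lt by (simp add: upt_conv_Cons run_ifeq[OF assms])
  also have "\<dots> \<longleftrightarrow> (\<phi> i (x i) \<and> run (ftree (map x [Suc i..<k]) (Suc i)) \<phi> m) \<or> (m = i \<and> (\<exists>v. \<phi> i v \<and> v \<noteq> x i))"
    by auto
  also have "\<dots> \<longleftrightarrow> i \<le> m \<and> m \<le> k \<and> (\<forall>j. i \<le> j \<and> j < m \<longrightarrow> \<phi> j (x j)) \<and> (\<exists>v. \<phi> m v \<and> (m < k \<longrightarrow> v \<noteq> x m))"
  proof (cases "m = i")
    case True
    then show ?thesis using lt IH by auto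
  next
    case False
    have "(\<phi> i (x i) \<and> Suc i \<le> m \<and> (\<forall>j. Suc i \<le> j \<and> j < m \<longrightarrow> \<phi> j (x j))) \<longleftrightarrow>
      i \<le> m \<and> (\<forall>j. i \<le> j \<and> j < m \<longrightarrow> \<phi> j (x j))"
      using False by (metis Suc_leD Suc_leI le_eq_less_or_eq order_refl)
    then show ?thesis unfolding IH using False by blast
  qed
  finally show ?case .
qed

text \<open>Injectivity of \<open>cd\<close> makes the tests exclusive, so their order is
  irrelevant.\<close>

lemma run_gtree_at:
  assumes "compat \<phi> \<phi>" "inj cd" "\<phi> 0 t"
  shows "i \<le> k \<Longrightarrow> run (gtree K (cd k) (map (\<lambda>i. (cd i, x i)) [i..<k])) \<phi> m \<longleftrightarrow>
    (\<exists>j v. i \<le> j \<and> j < k \<and> t = cd j \<and> \<phi> (x j) v \<and> m = (if v = K then K else 0)) \<or>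
    ((\<forall>j. i \<le> j \<and> j < k \<longrightarrow> t \<noteq> cd j) \<and> m = (if t = cd k then K else 0))"
proof (induction "k - i" arbitrary: i)
  have u: "(\<exists>t'. \<phi> 0 t' \<and> P t') \<longleftrightarrow> P t" for P using assms(1,3) by (auto simp: compat_def)
  {
    case 0
    then have "i = k" by simp
    then show ?case by (auto simp: run_ifeq[OF assms(1)] u)
  next
    case (Suc d)
    then have lt: "i < k" by simp
    have ii: "cd i = cd j \<longleftrightarrow> i = j" for i j using assms(2) by (auto dest: injD)
    have IH: "run (gtree K (cd k) (map (\<lambda>i. (cd i, x i)) [Suc i..<k])) \<phi> m \<longleftrightarrow>
      (\<exists>j v. Suc i \<le> j \<and> j < k \<and> t = cd j \<and> \<phi> (x j) v \<and> m = (if v = K then K else 0)) \<or>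
      ((\<forall>j. Suc i \<le> j \<and> j < k \<longrightarrow> t \<noteq> cd j) \<and> m = (if t = cd k then K else 0))"
      using Suc.hyps(2) lt by (intro Suc.hyps(1)) auto
    have eq: "run (gtree K (cd k) (map (\<lambda>i. (cd i, x i)) [i..<k])) \<phi> m \<longleftrightarrow>
      run (if t = cd i then ifeq K (Ask (x i) Ret) (Ret K) (Ret 0)
         else gtree K (cd k) (map (\<lambda>i. (cd i, x i)) [Suc i..<k])) \<phi> m"
      using lt by (simp add: upt_conv_Cons run_ifeq[OF assms(1)] u)
    show ?case
    proof (cases "t = cd i")
      case True
      have "run (ifeq K (Ask (x i) Ret) (Ret K) (Ret 0)) \<phi> m \<longleftrightarrow> (\<exists>v. \<phi> (x i) v \<and> m = (if v = K then K else 0))"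
        unfolding run_ifeq[OF assms(1)] by (intro ex_cong1) auto
      then show ?thesis unfolding eq using True lt ii by auto
    next
      case False
      then have 1: "i \<le> j \<and> j < k \<and> t = cd j \<and> Q \<longleftrightarrow> Suc i \<le> j \<and> j < k \<and> t = cd j \<and> Q" for j Q
        by (auto simp: le_eq_less_or_eq)
      from False have 2: "(i \<le> j \<and> j < k \<longrightarrow> t \<noteq> cd j) \<longleftrightarrow> (Suc i \<le> j \<and> j < k \<longrightarrow> t \<noteq> cd j)" for j
        by (auto simp: le_eq_less_or_eq)
      show ?thesis unfolding eq 1 2 using False IH by simp
    qed
  }
qed

lemma run_gtree_ask: "compat \<phi> \<phi> \<Longrightarrow> run (gtree K t ps) \<phi> m \<Longrightarrow> \<exists>t. \<phi> 0 t"
  by (cases ps) (auto simp: run_ifeq)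

lemma run_Ft: "compat \<phi> \<phi> \<Longrightarrow> run (Ft x k) \<phi> m \<longleftrightarrow>
    m \<le> k \<and> (\<forall>j<m. \<phi> j (x j)) \<and> (\<exists>v. \<phi> m v \<and> (m < k \<longrightarrow> v \<noteq> x m))"
  using run_ftree[of \<phi> 0 k x m] by (simp add: Ft_def)

lemma run_Gt:
  assumes "compat \<phi> \<phi>" "inj cd"
  shows "run (Gt K cd x k) \<phi> m \<longleftrightarrow>
    (\<exists>t. \<phi> 0 t \<and> ((\<exists>j v. j < k \<and> t = cd j \<and> \<phi> (x j) v \<and> m = (if v = K then K else 0)) \<or>
      ((\<forall>j<k. t \<noteq> cd j) \<and> m = (if t = cd k then K else 0))))" (is "?L \<longleftrightarrow> (\<exists>t. \<phi> 0 t \<and> ?R t)")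
proof -
  have at: "?L \<longleftrightarrow> ?R t" if "\<phi> 0 t" for t
    using run_gtree_at[OF assms that, of 0 k K x m] by (simp add: Gt_def)
  have ask: "\<exists>t. \<phi> 0 t" if ?L
    using run_gtree_ask[OF assms(1)] that unfolding Gt_def .
  show ?thesis
  proof
    assume L: ?L
    then obtain t where "\<phi> 0 t" using ask by blast
    then show "\<exists>t. \<phi> 0 t \<and> ?R t" using L at[of t] by (intro exI[of _ t] conjI) simp_all
  next
    assume "\<exists>t. \<phi> 0 t \<and> ?R t"
    then obtain t where "\<phi> 0 t" "?R t" by (elim exE conjE)
    then show ?L using at[of t] by simp
  qed
qed

section \<open>Adequacy of the evaluation relation\<close>

definition env :: "dt \<Rightarrow> dt \<Rightarrow> nat list \<Rightarrow> subst" where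
  "env dF dG \<nu> = push (Inr (emb_proc (Fn dF)) # Inr (emb_proc (Fn dG)) # map (\<lambda>n. Inr (emb_proc (num n))) (rev \<nu>)) Inl"

lemma env_Cons: "push [Inr (emb_proc (num j))] (env dF dG \<nu>) = env dF dG (j # \<nu>)"
  by (simp add: env_def push_push)

lemma env_simps:
  "y < length \<nu> \<Longrightarrow> env dF dG \<nu> y = Inr (emb_proc (num (\<nu> ! y)))"
  "env dF dG \<nu> (length \<nu>) = Inr (emb_proc (Fn dG))"
  "env dF dG \<nu> (Suc (length \<nu>)) = Inr (emb_proc (Fn dF))"
  by (simp_all add: env_def push_def nth_append rev_map)

lemma relpow_mstep:
  assumes "(mstep ^^ n) st st2" "final st2" "mstep st st1"
  obtains k where "n = Suc k" "(mstep ^^ k) st1 st2"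
proof (cases n)
  case 0
  then show ?thesis using assms final_no_step by auto
next
  case (Suc k)
  with assms(1) obtain y where "mstep st y" "(mstep ^^ k) y st2" by (blast dest: relpowp_Suc_D2)
  then show ?thesis using that Suc assms(3) mstep_det by blast
qed

text \<open>A question begins with the beta step into the body \<open>B\<close>, so fewer than
  \<open>n\<^sub>0\<close> steps remain. Hence the assumption on \<open>B\<close> concerns shorter
  runs only and can later be an induction hypothesis.\<close>

lemma adequacy_dt:
  assumes body: "\<And>j n S. n < n\<^sub>0 \<Longrightarrow> (mstep ^^ n) (sub_exp (inst [emb_proc (num j)]) B, S) (MNum m, []) \<Longrightarrow>
      \<exists>v n'. n' \<le> n \<and> \<phi> j v \<and> (mstep ^^ n') (MNum v, S) (MNum m, [])"
  shows "n \<le> n\<^sub>0 \<Longrightarrow> (mstep ^^ n) (sub_exp (inst [MLam [\<tau>] B]) (emb_exp (dexp d)), S) (MNum m, []) \<Longrightarrow>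
    \<exists>v n'. n' \<le> n \<and> run d \<phi> v \<and> (mstep ^^ n') (MNum v, S) (MNum m, [])"
proof (induction d arbitrary: n S)
  case (Ret v)
  then show ?case by auto
next
  case (Ask j h)
  let ?s = "inst [MLam [\<tau>] B]"
  let ?F = "\<lambda>v. sub_exp ?s (emb_exp (dexp (h v)))"
  have fin: "final (MNum m, [])" by (rule final.intros)
  have e: "sub_exp ?s (emb_exp (dexp (Ask j h))) = MCase (MApp (MLam [\<tau>] B) [emb_proc (num j)]) ?F"
    by (simp add: inst_def num_def comp_def)
  have "mstep (sub_exp ?s (emb_exp (dexp (Ask j h))), S) (sub_exp (inst [emb_proc (num j)]) B, ?F # S)"
    unfolding e by (rule mstep.beta) simp
  from relpow_mstep[OF Ask.prems(2) fin this] obtain k where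
    k: "n = Suc k" "(mstep ^^ k) (sub_exp (inst [emb_proc (num j)]) B, ?F # S) (MNum m, [])" .
  have "k < n\<^sub>0" using k(1) Ask.prems(1) by simp
  from body[OF this k(2)] obtain v n' where
    v: "n' \<le> k" "\<phi> j v" "(mstep ^^ n') (MNum v, ?F # S) (MNum m, [])" by blast
  from relpow_mstep[OF v(3) fin mstep.num] obtain k' where
    k': "n' = Suc k'" "(mstep ^^ k') (?F v, S) (MNum m, [])" .
  have "k' \<le> n\<^sub>0" using k' v k Ask.prems(1) by simp
  from Ask.IH[OF _ this k'(2)] obtain w n'' where "n'' \<le> k'" "run (h w') \<phi> w \<or> w' \<noteq> v" "(mstep ^^ n'') (MNum w, S) (MNum m, [])" for w'
    by blast
  then show ?case using v(1,2) k(1) k'(1) by (intro exI[of _ w] exI[of _ n'']) auto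
qed

lemma wt_two: "wt_app \<Gamma> (App y qs) \<Longrightarrow> \<Gamma> ! y = pure 2 \<Longrightarrow> \<exists>e. qs = [Lam [N] e] \<and> wt_exp (N # \<Gamma>) e"
proof -
  assume *: "wt_app \<Gamma> (App y qs)" "\<Gamma> ! y = pure 2"
  then have "list_all2 (wt_proc \<Gamma>) qs [N \<rightarrow> N]" by (auto elim: wt_app.cases simp: pure_2)
  then obtain q where q: "qs = [q]" "wt_proc \<Gamma> q (N \<rightarrow> N)" by (auto simp: list_all2_Cons2)
  from q(2) obtain \<sigma>s e where e: "q = Lam \<sigma>s e" "funs \<sigma>s N = N \<rightarrow> N" "wt_exp (rev \<sigma>s @ \<Gamma>) e"
    by (auto elim!: wt_proc.cases)
  from arg_cong[OF e(2), of args] have "\<sigma>s = [N]" by simp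
  then show ?thesis using q e by simp
qed

text \<open>A run ending in a numeral must at some point hand a number to the stack
  \<open>S\<close>; the segment before it is an evaluation. Counting steps covers the bodies of
  arguments and the branches alike.\<close>

lemma adequacy:
  assumes "wt_exp (replicate (length \<nu>) N @ [pure 2, pure 2]) e"
    and "(mstep ^^ n) (sub_exp (env dF dG \<nu>) (emb_exp e), S) (MNum m, [])"
  shows "\<exists>v n'. n' \<le> n \<and> ev (run dF) (run dG) e \<nu> v \<and> (mstep ^^ n') (MNum v, S) (MNum m, [])"
  using assms
proof (induction n arbitrary: e \<nu> S rule: less_induct)
  case (less n)
  let ?\<Gamma> = "replicate (length \<nu>) N @ [pure 2, pure 2]" and ?s = "env dF dG \<nu>"
  have fin: "final (MNum m, [])" by (rule final.intros)
  show ?case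
  proof (cases e)
    case Bot
    then have *: "(mstep ^^ n) (MBot, S) (MNum m, [])" using less.prems(2) by simp
    show ?thesis
    proof (cases n)
      case (Suc k)
      then show ?thesis using relpowp_Suc_D2[of k mstep] * by blast
    qed (use * in simp)
  next
    case (Num v)
    then show ?thesis using less.prems(2) by (auto intro: ev.intros)
  next
    case (Case a es)
    obtain y qs where a: "a = App y qs" by (cases a)
    from less.prems(1) Case a have wt: "wt_app ?\<Gamma> (App y qs)" "\<And>i. wt_exp ?\<Gamma> (es i)" by (auto elim: wt_exp.cases)
    from wt(1) have y: "y < Suc (Suc (length \<nu>))" by (auto elim: wt_app.cases)
    let ?F = "\<lambda>i. sub_exp ?s (emb_exp (es i))"
    \<comment> \<open>The cases of \<open>F\<close> and \<open>G\<close> differ only in the index of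
      the variable; \<open>evI\<close> abstracts from the rule of \<open>ev\<close>.\<close>
    have fn: ?thesis if sy: "?s y = Inr (emb_proc (Fn d))" and \<Gamma>y: "?\<Gamma> ! y = pure 2"
      and evI: "\<And>\<phi> i e' m. run d \<phi> i \<Longrightarrow> (\<And>j v. \<phi> j v \<Longrightarrow> ev (run dF) (run dG) e' (j # \<nu>) v) \<Longrightarrow>
        ev (run dF) (run dG) (es i) \<nu> m \<Longrightarrow> ev (run dF) (run dG) (Case (App y [Lam [N] e']) es) \<nu> m" for d
    proof -
      from wt_two[OF wt(1) \<Gamma>y] obtain e' where e': "qs = [Lam [N] e']" "wt_exp (N # ?\<Gamma>) e'" by blast
      let ?B = "sub_exp (up_subst 1 ?s) (emb_exp e')"
      have st: "mstep (sub_exp ?s (emb_exp e), S) (sub_exp (inst [MLam [N] ?B]) (emb_exp (dexp d)), ?F # S)"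
        using mstep.beta[of "[MLam [N] ?B]" "[N \<rightarrow> N]" "emb_exp (dexp d)" ?F S] Case a e' sy
        by (simp add: Fn_def comp_def)
      from relpow_mstep[OF less.prems(2) fin this] obtain k where
        k: "n = Suc k" "(mstep ^^ k) (sub_exp (inst [MLam [N] ?B]) (emb_exp (dexp d)), ?F # S) (MNum m, [])" .
      have B: "sub_exp (inst [emb_proc (num j)]) ?B = sub_exp (env dF dG (j # \<nu>)) (emb_exp e')" for j
        by (subst sub_inst_up) (simp_all add: env_Cons)
      have wt': "wt_exp (replicate (length (j # \<nu>)) N @ [pure 2, pure 2]) e'" for j using e'(2) by simp
      have "\<exists>v n'. n' \<le> n1 \<and> ev (run dF) (run dG) e' (j # \<nu>) v \<and> (mstep ^^ n') (MNum v, S') (MNum m, [])"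
        if "n1 < n" "(mstep ^^ n1) (sub_exp (inst [emb_proc (num j)]) ?B, S') (MNum m, [])" for j n1 S'
        using less.IH[OF that(1) wt'] that(2) unfolding B by blast
      note body = this
      have "k \<le> n" using k(1) by simp
      from adequacy_dt[where \<phi> = "\<lambda>j. ev (run dF) (run dG) e' (j # \<nu>)" and n\<^sub>0 = n, OF body this k(2)]
      obtain i n' where i: "n' \<le> k" "run d (\<lambda>j. ev (run dF) (run dG) e' (j # \<nu>)) i"
        "(mstep ^^ n') (MNum i, ?F # S) (MNum m, [])" by blast
      from relpow_mstep[OF i(3) fin mstep.num] obtain k' where
        k': "n' = Suc k'" "(mstep ^^ k') (?F i, S) (MNum m, [])" .
      have "k' < n" using k' i k by simp
      from less.IH[OF this wt(2) k'(2)] obtain w n'' where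
        w: "n'' \<le> k'" "ev (run dF) (run dG) (es i) \<nu> w" "(mstep ^^ n'') (MNum w, S) (MNum m, [])" by blast
      have "ev (run dF) (run dG) e \<nu> w" unfolding Case a e' by (rule evI[OF i(2) _ w(2)])
      then show ?thesis using w \<open>k' < n\<close> by (intro exI[of _ w] exI[of _ n'']) auto
    qed
    consider (var) "y < length \<nu>" | (G) "y = length \<nu>" | (F) "y = Suc (length \<nu>)" using y by linarith
    then show ?thesis
    proof cases
      case var
      then have qs: "qs = []" using wt(1) by (auto elim!: wt_app.cases simp: nth_append)
      have st: "mstep (sub_exp ?s (emb_exp e), S) (MNum (\<nu> ! y), ?F # S)"
        using mstep.beta[of "[]" "[]" "MNum (\<nu> ! y)" ?F S] Case a qs env_simps(1)[OF var, of dF dG]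
        by (simp add: comp_def num_def)
      from relpow_mstep[OF less.prems(2) fin this] obtain k where
        k: "n = Suc k" "(mstep ^^ k) (MNum (\<nu> ! y), ?F # S) (MNum m, [])" .
      from relpow_mstep[OF k(2) fin mstep.num] obtain k' where
        k': "k = Suc k'" "(mstep ^^ k') (?F (\<nu> ! y), S) (MNum m, [])" .
      have "k' < n" using k k' by simp
      from less.IH[OF this wt(2) k'(2)] obtain w n'' where
        w: "n'' \<le> k'" "ev (run dF) (run dG) (es (\<nu> ! y)) \<nu> w" "(mstep ^^ n'') (MNum w, S) (MNum m, [])" by blast
      then show ?thesis using \<open>k' < n\<close> unfolding Case a qs
        by (intro exI[of _ w] exI[of _ n'']) (auto intro: ev_var[OF var])
    next
      case G
      show ?thesis
        by (rule fn[of dG]) (use G env_simps(2) in \<open>auto simp: nth_append intro: ev_G[where AG = "run dG"]\<close>)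
    next
      case F
      show ?thesis
        by (rule fn[of dF]) (use F env_simps(3) in \<open>auto simp: nth_append intro: ev_F[where AF = "run dF"]\<close>)
    qed
  qed
qed

lemma nfs_NumD: "nfs st = Num m \<Longrightarrow> msteps st (MNum m, [])"
proof -
  assume *: "nfs st = Num m"
  then have "halts st" using nfs_no_halt by fastforce
  then obtain st' where st: "msteps st st'" "final st'" by (auto simp: halts_def)
  from st(2) * nfs_steps[OF st(1)] have "st' = (MNum m, [])" by cases auto
  then show ?thesis using st(1) by simp
qed

lemma SP0_body:
  assumes "\<Phi> \<in> SP0 (pure 2 \<rightarrow> pure 2 \<rightarrow> pure 1)"
  obtains e where "\<Phi> = Lam [pure 2, pure 2, N] e" "wt_exp [N, pure 2, pure 2] e"
proof -
  from assms obtain \<sigma>s e where *: "\<Phi> = Lam \<sigma>s e" "wt_exp (rev \<sigma>s @ []) e"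
    "funs \<sigma>s N = pure 2 \<rightarrow> pure 2 \<rightarrow> pure 1" by (auto simp: SP0_def elim!: wt_proc.cases)
  from arg_cong[OF *(3), of args] have "\<sigma>s = [pure 2, pure 2, N]" by (simp add: pure_1)
  with * that show ?thesis by simp
qed

text \<open>The bridge from equations between applied procedures to evaluations of the body;
  \<open>[n]\<close> interprets its type-zero variable.\<close>

lemma ev_of_app:
  assumes "wt_exp [N, pure 2, pure 2] e" "Lam [pure 2, pure 2, N] e \<cdot> Fn dF \<cdot> Fn dG \<cdot> num n = num m"
  shows "ev (run dF) (run dG) e [n] m"
proof -
  let ?Qs = "[emb_proc (Fn dF), emb_proc (Fn dG), emb_proc (num n)]"
  have "num m = foldl (\<cdot>) (Lam [pure 2, pure 2, N] e) [Fn dF, Fn dG, num n]" using assms(2) by simp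
  also have "\<dots> = nf_proc (mapps (MLam [pure 2, pure 2, N] (emb_exp e)) ?Qs)" unfolding foldl_app by simp
  also have "mapps (MLam [pure 2, pure 2, N] (emb_exp e)) ?Qs = MLam [] (sub_exp (inst ?Qs) (emb_exp e))"
    by (rule mapps_full) simp
  also have "inst ?Qs = env dF dG [n]" by (simp add: inst_conv_push env_def)
  finally have "nfs (sub_exp (env dF dG [n]) (emb_exp e), []) = Num m" by (simp add: num_def nf_exp_conv_nfs)
  from nfs_NumD[OF this] obtain k where "(mstep ^^ k) (sub_exp (env dF dG [n]) (emb_exp e), []) (MNum m, [])"
    by (meson rtranclp_imp_relpowp)
  from adequacy[OF _ this] assms(1) obtain v n' where v: "ev (run dF) (run dG) e [n] v" "(mstep ^^ n') (MNum v, []) (MNum m, [])"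
    by auto
  from relpowp_imp_rtranclp[OF v(2)] have "v = m"
    by (meson final.intros(2) msteps_final_final rtranclp.rtrancl_refl prod.inject mexp.inject(1))
  with v(1) show ?thesis by simp
qed

section \<open>Denotations of closed terms are closed\<close>

lemma emb_etas: "map emb_proc (etas \<sigma>s k) = map2 (\<lambda>\<tau> z. emb_proc (eta \<tau> z)) \<sigma>s (rev [k..<k + length \<sigma>s])"
  by (simp add: etas_def comp_def split_def)

lemma eta_unfold: "eta \<sigma> x = Lam (args \<sigma>) (Case (App (x + length (args \<sigma>)) (etas (args \<sigma>) 0)) Num)"
  by (subst eta.simps) (simp add: etas_def split_def)

lemma ren_emb_eta: "ren_proc f (emb_proc (eta \<sigma> x)) = emb_proc (eta \<sigma> (f x))"
proof (induction \<sigma> x arbitrary: f rule: eta.induct)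
  case (1 \<sigma> x)
  let ?r = "length (args \<sigma>)"
  have "ren_proc (up_ren ?r f) (emb_proc (eta \<tau> z)) = emb_proc (eta \<tau> z)"
    if "(\<tau>, z) \<in> set (zip (args \<sigma>) (rev [0..<?r]))" for \<tau> z
  proof -
    from that have "z < ?r" by (auto dest: set_zip_rightD)
    then have "up_ren ?r f z = z" by (simp add: up_ren_def)
    then show ?thesis using 1[OF that refl, of "up_ren ?r f"] by simp
  qed
  then have "map (\<lambda>p. ren_proc (up_ren ?r f) (emb_proc (eta (fst p) (snd p)))) (zip (args \<sigma>) (rev [0..<?r]))
      = map (\<lambda>p. emb_proc (eta (fst p) (snd p))) (zip (args \<sigma>) (rev [0..<?r]))"
    by (intro map_cong) auto
  then show ?case
    by (subst (1 2) eta.simps) (simp add: split_def comp_def, simp add: up_ren_def)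
qed

lemma ren_emb_etas: "(\<And>i. k \<le> i \<Longrightarrow> i < k + length \<sigma>s \<Longrightarrow> f i = i) \<Longrightarrow>
    map (ren_proc f) (map emb_proc (etas \<sigma>s k)) = map emb_proc (etas \<sigma>s k)"
  by (auto simp: emb_etas ren_emb_eta dest!: set_zip_rightD intro!: map_cong)

lemma emb_fix_proc: "emb_proc (fix_proc \<sigma> k) = MLam (args \<sigma>)
    (MCase (MVar (k + length (args \<sigma>))
      (emb_proc (fix_proc \<sigma> (k + length (args \<sigma>))) # map emb_proc (etas (args \<sigma>) 0))) MNum)"
  by (subst fix_proc_unfold) (simp add: comp_def)

text \<open>The procedure is infinite, hence coinduction. Each unfolding shifts the index of
  \<open>f\<close> by the block, and the expanded variables of the block are bound and stay
  fixed.\<close>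

lemma ren_emb_fix_proc: "ren_proc f (emb_proc (fix_proc \<sigma> k)) = emb_proc (fix_proc \<sigma> (f k))"
proof -
  let ?r = "length (args \<sigma>)"
  let ?R1 = "\<lambda>P P'. (\<exists>f k. P = ren_proc f (emb_proc (fix_proc \<sigma> k)) \<and> P' = emb_proc (fix_proc \<sigma> (f k))) \<or> P = P'"
  let ?R2 = "\<lambda>E E'. (\<exists>G G'. E = MCase G MNum \<and> E' = MCase G' MNum \<and>
      (\<exists>f k. G = MVar (f k) (ren_proc f (emb_proc (fix_proc \<sigma> k)) # map emb_proc (etas (args \<sigma>) 0)) \<and>
        G' = MVar (f k) (emb_proc (fix_proc \<sigma> (f k)) # map emb_proc (etas (args \<sigma>) 0)))) \<or> E = E'"
  let ?R3 = "\<lambda>G G'. \<exists>f k. G = MVar (f k) (ren_proc f (emb_proc (fix_proc \<sigma> k)) # map emb_proc (etas (args \<sigma>) 0)) \<and>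
        G' = MVar (f k) (emb_proc (fix_proc \<sigma> (f k)) # map emb_proc (etas (args \<sigma>) 0))"
  have 1: "\<exists>\<sigma>s E E'. P = MLam \<sigma>s E \<and> P' = MLam \<sigma>s E' \<and> ?R2 E E'" if X: "?R1 P P'" for P P'
  proof (cases "P = P'")
    case True
    then show ?thesis by (cases P') blast
  next
    case False
    with X obtain f k where *: "P = ren_proc f (emb_proc (fix_proc \<sigma> k))" "P' = emb_proc (fix_proc \<sigma> (f k))" by blast
    let ?f = "up_ren ?r f"
    have f: "?f (k + ?r) = f k + ?r" by (simp add: up_ren_def)
    have e: "map (ren_proc ?f) (map emb_proc (etas (args \<sigma>) 0)) = map emb_proc (etas (args \<sigma>) 0)"
      by (rule ren_emb_etas) (simp add: up_ren_def)
    have "P = MLam (args \<sigma>) (MCase (MVar (?f (k + ?r)) (ren_proc ?f (emb_proc (fix_proc \<sigma> (k + ?r))) # map emb_proc (etas (args \<sigma>) 0))) MNum)"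
      unfolding *(1) by (subst emb_fix_proc) (simp add: comp_def e[unfolded map_map comp_def])
    moreover have "P' = MLam (args \<sigma>) (MCase (MVar (?f (k + ?r)) (emb_proc (fix_proc \<sigma> (?f (k + ?r))) # map emb_proc (etas (args \<sigma>) 0))) MNum)"
      unfolding *(2) f by (rule emb_fix_proc)
    ultimately show ?thesis by blast
  qed
  have 2: "E = E' \<or> (\<exists>G G' Es Es'. E = MCase G Es \<and> E' = MCase G' Es' \<and> ?R3 G G' \<and> (\<forall>i. ?R2 (Es i) (Es' i)))"
    if X: "?R2 E E'" for E E'
  proof (cases "E = E'")
    case False
    with X obtain G G' where "E = MCase G MNum" "E' = MCase G' MNum" "?R3 G G'" by blast
    moreover have "?R2 (MNum i) (MNum i)" for i by blast
    ultimately show ?thesis by blast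
  qed simp
  have 3: "G = G' \<or> (\<exists>E E'. G = MExp E \<and> G' = MExp E' \<and> ?R2 E E') \<or>
      (\<exists>x Qs Qs'. G = MVar x Qs \<and> G' = MVar x Qs' \<and> list_all2 ?R1 Qs Qs') \<or>
      (\<exists>P P' Qs Qs'. G = MApp P Qs \<and> G' = MApp P' Qs' \<and> (P = P' \<or> ?R1 P P') \<and> list_all2 ?R1 Qs Qs')"
    if X: "?R3 G G'" for G G'
  proof -
    from X obtain f k where G: "G = MVar (f k) (ren_proc f (emb_proc (fix_proc \<sigma> k)) # map emb_proc (etas (args \<sigma>) 0))"
        "G' = MVar (f k) (emb_proc (fix_proc \<sigma> (f k)) # map emb_proc (etas (args \<sigma>) 0))" by (elim exE conjE)
    have "list_all2 ?R1 Qs Qs" for Qs by (simp add: list_all2_refl)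
    moreover have "?R1 (ren_proc f (emb_proc (fix_proc \<sigma> k))) (emb_proc (fix_proc \<sigma> (f k)))" by blast
    ultimately have "list_all2 ?R1 (ren_proc f (emb_proc (fix_proc \<sigma> k)) # map emb_proc (etas (args \<sigma>) 0))
      (emb_proc (fix_proc \<sigma> (f k)) # map emb_proc (etas (args \<sigma>) 0))" by (simp only: list_all2_Cons)
    then show ?thesis unfolding G by blast
  qed
  show ?thesis
    by (rule mterm_coinduct(1)[of ?R1 ?R2 ?R3, OF 1 2 3], assumption+) blast
qed

lemma ren_emb_const: "ren_proc f (emb_proc (den_const c)) = emb_proc (den_const c)"
proof (cases c)
  case (Ext d)
  show ?thesis
  proof (cases d)
    case (Y_c \<sigma>)
    let ?r = "length (args \<sigma>)" and ?f = "up_ren (Suc (length (args \<sigma>))) f"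
    have "map (ren_proc ?f) (map emb_proc (etas (args \<sigma>) 0)) = map emb_proc (etas (args \<sigma>) 0)"
      by (rule ren_emb_etas) (simp add: up_ren_def)
    moreover have "?f ?r = ?r" by (simp add: up_ren_def)
    ultimately show ?thesis using Ext Y_c by (simp add: Let_def comp_def ren_emb_fix_proc)
  next
    case (Byval_c \<sigma>s \<tau>)
    let ?s = "length (args \<tau>)" and ?f = "up_ren (Suc (length \<sigma>s + Suc (length (args \<tau>)))) f"
    have "map (ren_proc ?f) (map emb_proc (etas (args \<tau>) 0)) = map emb_proc (etas (args \<tau>) 0)"
      "map (ren_proc ?f) (map emb_proc (etas \<sigma>s (Suc ?s))) = map emb_proc (etas \<sigma>s (Suc ?s))"
      by (rule ren_emb_etas; simp add: up_ren_def)+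
    moreover have "?f ?s = ?s" "?f (Suc (?s + length \<sigma>s)) = Suc (?s + length \<sigma>s)" by (simp_all add: up_ren_def)
    ultimately show ?thesis using Ext Byval_c by (simp add: Let_def comp_def num_def fun_eq_iff)
  qed
qed (auto simp: num_def up_ren_def fun_eq_iff)

primrec fv :: "'c tm \<Rightarrow> name set" where
  "fv (Var x) = {x}"
| "fv (Con c) = {}"
| "fv (L \<bullet> M) = fv L \<union> fv M"
| "fv (Abs x \<sigma> M) = fv M - {x}"

lemma index_less: "x \<in> fst ` set \<Gamma> \<Longrightarrow> index \<Gamma> x < length \<Gamma>"
  by (induction \<Gamma> x rule: index.induct) auto

lemma bnd_den: "fv M \<subseteq> fst ` set \<Gamma> \<Longrightarrow> bnd (length \<Gamma>) (emb_proc (den \<Gamma> M))"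
proof (induction M arbitrary: \<Gamma>)
  case (Var x)
  then show ?case using index_less[of x \<Gamma>] by (simp add: bnd_def ren_emb_eta)
next
  case (Con c)
  then show ?case by (simp add: bnd_def ren_emb_const)
next
  case (App_tm L M)
  then show ?case by (simp add: bnd_app)
next
  case (Abs x \<sigma> M)
  have "bnd (length ((x, \<sigma>) # \<Gamma>)) (emb_proc (den ((x, \<sigma>) # \<Gamma>) M))"
    using Abs.prems by (intro Abs.IH) auto
  then show ?case by (simp add: bnd_lam)
qed

lemma fv_wt: "wt_tm cty \<Gamma> M \<sigma> \<Longrightarrow> fv M \<subseteq> fst ` set \<Gamma>"
  by (induction rule: wt_tm.induct) (auto dest: map_of_SomeD intro: rev_image_eqI)

lemma fv_replace: "(\<And>c. fv (tr c) = {}) \<Longrightarrow> fv (replace tr M) = fv M"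
  by (induction M) (auto split: const.splits)

lemma fv_Rec_str: "fv Rec_str_tm = {}"
  by (auto simp: Rec_str_tm_def abss_def)

text \<open>Used for \<open>add\<close>, of which nothing but definability guarantees that the
  substitution for \<open>z\<close> in the bar recursion equation leaves it unchanged.\<close>

lemma definable_T0_str_closed:
  assumes "definable_T0_str \<sigma> p" shows "bnd 0 (emb_proc p)"
proof -
  from assms obtain M where M: "wt_tm t0_str_ty [] M \<sigma>" "p = den [] (replace t0_str_tr M)"
    by (auto simp: definable_T0_str_def definable_def)
  have "fv (t0_str_tr c) = {}" for c by (cases c) (simp_all add: fv_Rec_str)
  then have "fv (replace t0_str_tr M) = {}" using fv_wt[OF M(1)] by (simp add: fv_replace)
  then show ?thesis using bnd_den[of "replace t0_str_tr M" "[]"] M(2) by simp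
qed

section \<open>Values of bar recursors\<close>

lemma Fn_closed: "bnd 0 (emb_proc (Fn d))"
  using wt_bnd[of "[]" "Fn d"] Fn_SP0 by (auto simp: SP0_def)

lemma sub_num [simp]: "sub_proc s (emb_proc (num n)) = emb_proc (num n)"
  by (simp add: num_def)

text \<open>The body of the abstraction is already normalized. Up to equality of normal forms the
  substitution still passes through the applications, and the closed operators absorb it.\<close>

lemma lam_app_num:
  assumes "\<Phi> \<in> SP0 (pure 2 \<rightarrow> pure 2 \<rightarrow> pure 1)" "bnd 0 (emb_proc add)"
    and "bnd 0 (emb_proc F)" "bnd 0 (emb_proc G)"
  shows "lam N (\<Phi> \<cdot> F \<cdot> G \<cdot> (add \<cdot> num a \<cdot> eta N 0)) \<cdot> num k = \<Phi> \<cdot> F \<cdot> G \<cdot> (add \<cdot> num a \<cdot> num k)"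
proof -
  obtain e where \<Phi>: "\<Phi> = Lam [pure 2, pure 2, N] e" using SP0_body[OF assms(1)] by blast
  have \<Phi>0: "bnd 0 (emb_proc \<Phi>)" using wt_bnd[of "[]" \<Phi>] assms(1) by (auto simp: SP0_def)
  let ?A = "add \<cdot> num a \<cdot> eta N 0"
  let ?s = "inst [emb_proc (num k)]"
  have app3: "emb_proc (\<Phi> \<cdot> F \<cdot> G \<cdot> q) \<simeq> mapps (emb_proc \<Phi>) [emb_proc F, emb_proc G, emb_proc q]" for q
    using foldl_app[of \<Phi> "[F, G, q]"] by simp
  have app2: "emb_proc (add \<cdot> num a \<cdot> q) \<simeq> mapps (emb_proc add) [emb_proc (num a), emb_proc q]" for q
    using foldl_app[of add "[num a, q]"] by simp
  have eta: "sub_proc ?s (emb_proc (eta N 0)) \<simeq> emb_proc (num k)"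
    by (simp add: eta.simps inst_def num_def beq_def nf_exp_conv_nfs)
  have "sub_proc ?s (emb_proc ?A) \<simeq> sub_proc ?s (mapps (emb_proc add) [emb_proc (num a), emb_proc (eta N 0)])"
    by (rule nf_sub_cong[OF _ app2]) simp
  also have "\<dots> = mapps (emb_proc add) [emb_proc (num a), sub_proc ?s (emb_proc (eta N 0))]"
    by (simp add: sub_mappv bnd_0_sub[OF assms(2)])
  also have "\<dots> \<simeq> mapps (emb_proc add) [emb_proc (num a), emb_proc (num k)]"
    using eta by (intro mappsv_cong) auto
  also have "\<dots> \<simeq> emb_proc (add \<cdot> num a \<cdot> num k)" using app2 by (rule beq_sym)
  finally have A: "sub_proc ?s (emb_proc ?A) \<simeq> emb_proc (add \<cdot> num a \<cdot> num k)" .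
  have "sub_proc ?s (emb_proc (\<Phi> \<cdot> F \<cdot> G \<cdot> ?A)) \<simeq> sub_proc ?s (mapps (emb_proc \<Phi>) [emb_proc F, emb_proc G, emb_proc ?A])"
    by (rule nf_sub_cong[OF _ app3]) simp
  also have "\<dots> = mapps (emb_proc \<Phi>) [emb_proc F, emb_proc G, sub_proc ?s (emb_proc ?A)]"
    by (simp add: sub_mappv bnd_0_sub[OF \<Phi>0] bnd_0_sub[OF assms(3)] bnd_0_sub[OF assms(4)])
  also have "\<dots> \<simeq> mapps (emb_proc \<Phi>) [emb_proc F, emb_proc G, emb_proc (add \<cdot> num a \<cdot> num k)]"
    using A by (intro mappsv_cong) auto
  also have "\<dots> \<simeq> emb_proc (\<Phi> \<cdot> F \<cdot> G \<cdot> (add \<cdot> num a \<cdot> num k))" using app3 by (rule beq_sym)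
  finally have B: "sub_proc ?s (emb_proc (\<Phi> \<cdot> F \<cdot> G \<cdot> ?A)) \<simeq> emb_proc (\<Phi> \<cdot> F \<cdot> G \<cdot> (add \<cdot> num a \<cdot> num k))" .
  have "\<exists>b. \<Phi> \<cdot> F \<cdot> G \<cdot> ?A = Lam [] b"
    using foldl_app[of \<Phi> "[F, G, ?A]"] mapps_full[of "[emb_proc F, emb_proc G, emb_proc ?A]" "[pure 2, pure 2, N]" "emb_exp e"]
    by (simp add: \<Phi>)
  then obtain b where b: "\<Phi> \<cdot> F \<cdot> G \<cdot> ?A = Lam [] b" ..
  have "lam N (Lam [] b) \<cdot> num k = nf_proc (sub_proc ?s (emb_proc (Lam [] b)))"
    by (simp add: nsp_app_conv inst_conv_push)
  with B b show ?thesis by (simp add: beq_def)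
qed

definition prefix_code :: "(nat list \<Rightarrow> nat) \<Rightarrow> (nat \<Rightarrow> nat) \<Rightarrow> nat \<Rightarrow> nat" where
  "prefix_code c x i = 2 * c (map x [0..<i] @ [0]) + 1"

lemma inj_prefix_code: "inj c \<Longrightarrow> inj (prefix_code c x)"
proof (rule injI)
  fix i j assume "inj c" "prefix_code c x i = prefix_code c x j"
  then have "map x [0..<i] @ [0] = map x [0..<j] @ [0]" by (auto simp: prefix_code_def dest: injD)
  from arg_cong[OF this, of length] show "i = j" by simp
qed

lemma strict_prefix_snocI: "strict_prefix ys (xs @ [y]) \<longleftrightarrow> prefix ys xs"
  by (auto simp: strict_prefix_def)

lemma prefix_map_upt: "prefix ys (map x [0..<k]) \<longleftrightarrow> (\<exists>j\<le>k. ys = map x [0..<j])"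
proof
  assume "prefix ys (map x [0..<k])"
  then have "ys = take (length ys) (map x [0..<k])" "length ys \<le> k"
    by (auto simp: prefix_def dest: arg_cong[of _ _ length])
  then show "\<exists>j\<le>k. ys = map x [0..<j]" by (metis take_map take_upt add_0)
next
  assume "\<exists>j\<le>k. ys = map x [0..<j]"
  then obtain j where "j \<le> k" "ys = map x [0..<j]" by blast
  then show "prefix ys (map x [0..<k])" by (metis take_map take_upt add_0 take_is_prefix)
qed

lemma bar_recursor_value:
  assumes sc: "sequence_coding c len add basic"
    and br: "simplified_weak_Spector_bar_recursor c len add basic \<Phi>"
    and x: "\<And>i. i < k \<Longrightarrow> x i \<noteq> 0"
  shows "\<Phi> \<cdot> Fn (Ft x k) \<cdot> Fn (Gt K (prefix_code c x) x k) \<cdot> num (c []) = num K"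
proof -
  let ?F = "Fn (Ft x k)" and ?G = "Fn (Gt K (prefix_code c x) x k)"
  define px where "px i = map x [0..<i]" for i
  let ?T = "Spector_tree c len basic ?F"
  let ?bar = "Spector_bar c len basic ?F"
  have injc: "inj c" and len: "\<And>xs. len \<cdot> num (c xs) = num (length xs)"
    and add: "\<And>xs z. add \<cdot> num (c xs) \<cdot> num z = num (c (xs @ [z]))"
    and basic: "\<And>xs j i. basic \<cdot> num (c xs) \<cdot> num j \<cdot> num i = num (if i < length xs then xs ! i else j)"
    and addd: "definable_T0_str (N \<rightarrow> N \<rightarrow> N) add"
    using sc unfolding sequence_coding_def by blast+
  have \<Phi>: "\<Phi> \<in> SP0 (pure 2 \<rightarrow> pure 2 \<rightarrow> pure 1)" using br by (simp add: simplified_weak_Spector_bar_recursor_def)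
  have num_inj: "num m = num n \<longleftrightarrow> m = n" for m n by (simp add: num_def)
  \<comment> \<open>The sequence \<open>xs\<close> continued by zeros, which is what
    \<open>basic\<close> computes.\<close>
  define \<phi> where "\<phi> xs j v \<longleftrightarrow> v = (if j < length xs then xs ! j else 0)" for xs :: "nat list" and j v :: nat
  have comp: "compat (\<phi> xs) (\<phi> xs)" for xs by (auto simp: compat_def \<phi>_def)
  have Fval: "?F \<cdot> (basic \<cdot> num (c xs) \<cdot> num 0) = num m" if "run (Ft x k) (\<phi> xs) m" for xs m
    by (rule Fn_app[OF _ that]) (simp add: \<phi>_def basic)
  have bar_iff: "?bar xs \<longleftrightarrow> m < length xs" if "run (Ft x k) (\<phi> xs) m" for xs m
    using Fval[OF that] by (simp add: Spector_bar_def len num_inj)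
  \<comment> \<open>On the prefix of length \<open>i\<close> the value of \<open>F\<close> is
    \<open>i\<close>: the padding \<open>0\<close> differs from \<open>x i\<close>, or
    \<open>i = k\<close> is the end. It is not less than the length.\<close>
  have not_bar: "\<not> ?bar (px i)" if "i \<le> k" for i
  proof -
    have "run (Ft x k) (\<phi> (px i)) i"
      unfolding run_Ft[OF comp] using that x[of i] by (auto simp: \<phi>_def px_def)
    then show ?thesis using bar_iff by (simp add: px_def)
  qed
  \<comment> \<open>The additional member raises the length to \<open>i + 1\<close>, above the value
    \<open>i\<close>.\<close>
  have bar: "?bar (px i @ [y])" if "i \<le> k" "i = k \<or> y \<noteq> x i" for i y
  proof -
    have "run (Ft x k) (\<phi> (px i @ [y])) i"
      unfolding run_Ft[OF comp] using that by (auto simp: \<phi>_def px_def nth_append)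
    then show ?thesis using bar_iff by (simp add: px_def)
  qed
  have T: "px i \<in> ?T" "px i @ [y] \<in> ?T" if i: "i \<le> k" for i y
  proof -
    have "\<not> ?bar ys" if ys: "prefix ys (px i)" for ys
    proof -
      from ys obtain j where "j \<le> i" "ys = px j" unfolding px_def prefix_map_upt by blast
      then show ?thesis using not_bar[of j] i by simp
    qed
    then show "px i \<in> ?T" "px i @ [y] \<in> ?T"
      by (auto simp: Spector_tree_def strict_prefix_snocI strict_prefix_def[of _ "px i"])
  qed
  have leaf: "px i @ [y] \<in> leaves ?T" if "i \<le> k" "i = k \<or> y \<noteq> x i" for i y
  proof -
    have "px i @ [y] @ [z] \<notin> ?T" for z
      using bar[OF that] strict_prefix_snocI[of "px i @ [y]" "px i @ [y]" z]
      by (auto simp: Spector_tree_def)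
    then show ?thesis using T that by (simp add: leaves_def)
  qed
  have int: "px i \<in> internal_nodes ?T" if "i \<le> k" for i
    using T[OF that] by (auto simp: internal_nodes_def leaves_def)
  have def: "?F \<in> SP0 (pure 2)" "?G \<in> SP0 (pure 2)" "definable_T0_str (pure 2) ?F" "definable_T0_str (pure 2) ?G"
    by (simp_all add: Fn_SP0 Fn_definable Ft_def Gt_def dt_definable_ftree dt_definable_gtree)
  have leaf_val: "\<Phi> \<cdot> ?F \<cdot> ?G \<cdot> num (c xs) = num (2 * c xs + 1)" if "xs \<in> leaves ?T" for xs
    using br def that unfolding simplified_weak_Spector_bar_recursor_def by blast
  have int_val: "\<Phi> \<cdot> ?F \<cdot> ?G \<cdot> num (c xs) = ?G \<cdot> lam N (\<Phi> \<cdot> ?F \<cdot> ?G \<cdot> (add \<cdot> num (c xs) \<cdot> eta N 0))"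
    if "xs \<in> internal_nodes ?T" for xs
    using br def that unfolding simplified_weak_Spector_bar_recursor_def by blast
  \<comment> \<open>Backward from \<open>i = k\<close>: for \<open>i < k\<close> the answer of
    \<open>G\<close> depends on the value at the child \<open>x i\<close>, which is the node of
    \<open>Suc i\<close>.\<close>
  have val: "i \<le> k \<Longrightarrow> \<Phi> \<cdot> ?F \<cdot> ?G \<cdot> num (c (px i)) = num K" for i
  proof (induction "k - i" arbitrary: i rule: less_induct)
    case less
    define g where "g = lam N (\<Phi> \<cdot> ?F \<cdot> ?G \<cdot> (add \<cdot> num (c (px i)) \<cdot> eta N 0))"
    have gval: "g \<cdot> num y = \<Phi> \<cdot> ?F \<cdot> ?G \<cdot> num (c (px i @ [y]))" for y
      unfolding g_def using lam_app_num[OF \<Phi> definable_T0_str_closed[OF addd] Fn_closed Fn_closed] by (simp add: add)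
    define \<psi> where "\<psi> j v \<longleftrightarrow> g \<cdot> num j = num v" for j v
    have cpsi: "compat \<psi> \<psi>" by (auto simp: compat_def \<psi>_def num_inj)
    \<comment> \<open>Makes the child \<open>0\<close> a leaf, so that the argument of
      \<open>G\<close> has the identifying value at \<open>0\<close>.\<close>
    have "i = k \<or> 0 \<noteq> x i" using less.prems x[of i] by (cases "i = k") auto
    from leaf_val[OF leaf[OF less.prems this]]
    have psi0: "\<psi> 0 (prefix_code c x i)" by (simp add: \<psi>_def gval prefix_code_def px_def)
    have "run (Gt K (prefix_code c x) x k) \<psi> K"
    proof (cases "i = k")
      case True
      have "\<forall>j<k. prefix_code c x k \<noteq> prefix_code c x j" using inj_prefix_code[OF injc, of x] by (auto dest: injD)
      then show ?thesis unfolding run_Gt[OF cpsi inj_prefix_code[OF injc]]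
        using psi0 True by (intro exI[of _ "prefix_code c x k"]) simp
    next
      case False
      with less.prems have lt: "i < k" by simp
      have "\<psi> (x i) K" using less.hyps[of "Suc i"] lt by (simp add: \<psi>_def gval px_def)
      then show ?thesis unfolding run_Gt[OF cpsi inj_prefix_code[OF injc]]
        using psi0 lt by (intro exI[of _ "prefix_code c x i"] conjI disjI1 exI[of _ i] exI[of _ K]) simp_all
    qed
    then have "?G \<cdot> g = num K" by (rule Fn_app[rotated]) (simp add: \<psi>_def)
    then show ?case using int_val[OF int[OF less.prems]] by (simp add: g_def)
  qed
  from val[of 0] show ?thesis by (simp add: px_def)
qed

section \<open>Left-well-founded procedures are not bar recursors\<close>

text \<open>Bounds the values received, not the positions asked for: the tests in the trees are
  tests of values.\<close>

definition brun :: "dt \<Rightarrow> nat \<Rightarrow> fun2" where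
  "brun d B \<phi> = run d (\<lambda>j v. \<phi> j v \<and> v \<le> B)"

lemma run_mono: "run d \<phi> m \<Longrightarrow> (\<And>j v. \<phi> j v \<Longrightarrow> \<psi> j v) \<Longrightarrow> run d \<psi> m"
  by (induction rule: run.induct) (auto intro: run.intros)

lemma agree_brun: "agree (brun d B) (brun d B)"
  unfolding agree_def brun_def
proof (intro allI impI)
  fix \<phi> \<phi>' i i'
  assume *: "run d (\<lambda>j v. \<phi> j v \<and> v \<le> B) i" "run d (\<lambda>j v. \<phi>' j v \<and> v \<le> B) i'" "compat \<phi> \<phi>'"
  then have "compat (\<lambda>j v. \<phi> j v \<and> v \<le> B) (\<lambda>j v. \<phi>' j v \<and> v \<le> B)" by (auto simp: compat_def)
  then show "i = i'" using agree_run[of d] * unfolding agree_def by blast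
qed

lemma ev_brun_mono: "B \<le> B' \<Longrightarrow> ev (brun dF B) (brun dG B) e \<nu> m \<Longrightarrow> ev (brun dF B') (brun dG B') e \<nu> m"
proof -
  assume "B \<le> B'"
  then have mono: "brun d B \<phi> i \<Longrightarrow> brun d B' \<phi> i" for d \<phi> i
    unfolding brun_def using run_mono[of d "\<lambda>j v. \<phi> j v \<and> v \<le> B" i "\<lambda>j v. \<phi> j v \<and> v \<le> B'"] by auto
  show "ev (brun dF B) (brun dG B) e \<nu> m \<Longrightarrow> ev (brun dF B') (brun dG B') e \<nu> m"
    by (rule ev_mono[OF agree_brun agree_brun mono mono])
qed

text \<open>\<open>\<phi>\<close> may hold infinitely many values, but a run asks finitely many
  questions, so a maximum of bounds serves all of them.\<close>

lemma run_bound: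
  assumes "run d \<phi> m" and "\<And>j v. \<phi> j v \<Longrightarrow> \<exists>B. Q B j v" and mono: "\<And>B B' j v. Q B j v \<Longrightarrow> B \<le> B' \<Longrightarrow> Q B' j v"
  shows "\<exists>B :: nat. run d (Q B) m"
  using assms(1,2)
proof (induction rule: run.induct)
  case (run_Ret m \<phi>)
  then show ?case by (auto intro: run.intros)
next
  case (run_Ask \<phi> j v h m)
  from run_Ask.IH[OF run_Ask.prems] obtain B1 where "run (h v) (Q B1) m" by blast
  then have "run (h v) (Q (max B1 B2)) m" for B2 by (rule run_mono) (auto intro: mono)
  moreover from run_Ask.prems[OF run_Ask.hyps(1)] obtain B2 where "Q B2 j v" by blast
  then have "Q (max B1 B2) j v" by (rule mono) simp
  ultimately show ?case by (blast intro: run.run_Ask)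
qed

lemma ev_run_bounded: "ev (run dF) (run dG) e \<nu> m \<Longrightarrow> \<exists>B. ev (brun dF B) (brun dG B) e \<nu> m"
proof (induction rule: ev.induct)
  case (ev_num m \<nu>)
  then show ?case by (blast intro: ev.intros)
next
  case (ev_var y \<nu> es m)
  then show ?case by (blast intro: ev.intros)
next
  case (ev_G \<phi> i e \<nu> es m \<tau>)
  let ?Q = "\<lambda>B j v. ev (brun dF B) (brun dG B) e (j # \<nu>) v \<and> v \<le> B"
  have "\<exists>B. ?Q B j v" if "\<phi> j v" for j v
  proof -
    from ev_G.IH(1)[OF that] obtain B where "ev (brun dF B) (brun dG B) e (j # \<nu>) v" ..
    then have "?Q (max B v) j v" using ev_brun_mono[of B "max B v"] by simp
    then show ?thesis ..
  qed
  from run_bound[OF ev_G.hyps(1), of ?Q, OF this] ev_brun_mono obtain B1 where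
    B1: "run dG (?Q B1) i" by auto
  from ev_G.IH(2) obtain B2 where B2: "ev (brun dF B2) (brun dG B2) (es i) \<nu> m" ..
  let ?B = "max B1 B2"
  have "run dG (?Q ?B) i" by (rule run_mono[OF B1]) (use ev_brun_mono[of B1 ?B] in auto)
  then have "brun dG ?B (\<lambda>j. ev (brun dF ?B) (brun dG ?B) e (j # \<nu>)) i" by (simp add: brun_def)
  then have "ev (brun dF ?B) (brun dG ?B) (Case (App (length \<nu>) [Lam [\<tau>] e]) es) \<nu> m"
    by (rule ev.ev_G[where AG = "brun dG ?B"]) (assumption, rule ev_brun_mono[OF _ B2], simp)
  then show ?case ..
next
  case (ev_F \<phi> i e \<nu> es m \<tau>)
  let ?Q = "\<lambda>B j v. ev (brun dF B) (brun dG B) e (j # \<nu>) v \<and> v \<le> B"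
  have "\<exists>B. ?Q B j v" if "\<phi> j v" for j v
  proof -
    from ev_F.IH(1)[OF that] obtain B where "ev (brun dF B) (brun dG B) e (j # \<nu>) v" ..
    then have "?Q (max B v) j v" using ev_brun_mono[of B "max B v"] by simp
    then show ?thesis ..
  qed
  from run_bound[OF ev_F.hyps(1), of ?Q, OF this] ev_brun_mono obtain B1 where
    B1: "run dF (?Q B1) i" by auto
  from ev_F.IH(2) obtain B2 where B2: "ev (brun dF B2) (brun dG B2) (es i) \<nu> m" ..
  let ?B = "max B1 B2"
  have "run dF (?Q ?B) i" by (rule run_mono[OF B1]) (use ev_brun_mono[of B1 ?B] in auto)
  then have "brun dF ?B (\<lambda>j. ev (brun dF ?B) (brun dG ?B) e (j # \<nu>)) i" by (simp add: brun_def)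
  then have "ev (brun dF ?B) (brun dG ?B) (Case (App (Suc (length \<nu>)) [Lam [\<tau>] e]) es) \<nu> m"
    by (rule ev.ev_F[where AF = "brun dF ?B"]) (assumption, rule ev_brun_mono[OF _ B2], simp)
  then show ?case ..
qed

text \<open>Only finitely many codes are small, and by injectivity each of them determines the
  member that follows \<open>ys\<close>.\<close>

lemma fresh_exists:
  fixes c :: "nat list \<Rightarrow> nat"
  assumes "inj c" shows "\<exists>y>B. \<forall>zs. 2 * c (ys @ y # zs) + 1 > B"
proof -
  let ?bad = "{y. \<exists>zs. 2 * c (ys @ y # zs) + 1 \<le> B}"
  have "?bad \<subseteq> (\<lambda>a. the_inv c a ! length ys) ` {..B}"
  proof
    fix y assume "y \<in> ?bad"
    then obtain zs where "2 * c (ys @ y # zs) + 1 \<le> B" by blast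
    then have "c (ys @ y # zs) \<in> {..B}" by simp
    moreover have "the_inv c (c (ys @ y # zs)) ! length ys = y" by (simp add: the_inv_f_f[OF assms])
    ultimately show "y \<in> (\<lambda>a. the_inv c a ! length ys) ` {..B}" by (metis imageI)
  qed
  then have "finite (?bad \<union> {..B})" by (meson finite_Un finite_atMost finite_imageI finite_subset)
  from ex_new_if_finite[OF infinite_UNIV_nat this] show ?thesis by (auto simp: not_le)
qed

theorem bar_recursor_not_LWF:
  assumes sc: "sequence_coding c len add basic"
    and br: "simplified_weak_Spector_bar_recursor c len add basic \<Phi>"
  shows "\<not> LWF \<Phi>"
proof
  assume LWF: "LWF \<Phi>"
  have injc: "inj c" using sc by (simp add: sequence_coding_def)
  have "\<Phi> \<in> SP0 (pure 2 \<rightarrow> pure 2 \<rightarrow> pure 1)" using br by (simp add: simplified_weak_Spector_bar_recursor_def)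
  then obtain e where \<Phi>: "\<Phi> = Lam [pure 2, pure 2, N] e" and wt: "wt_exp [N, pure 2, pure 2] e" by (rule SP0_body)
  let ?cd = "prefix_code c"
  have val: "ev (run (Ft x k)) (run (Gt K (?cd x) x k)) e [c []] K" if "\<And>i. i < k \<Longrightarrow> x i \<noteq> 0" for x k K
    using bar_recursor_value[OF sc br that] unfolding \<Phi> by (intro ev_of_app[OF wt])
  txt \<open>A member that is fresh for the prefix \<open>ys\<close> exceeds every value in the finite evaluation with
    \<open>K = 0\<close> at stage \<open>length ys\<close>, and so do the codes that mention it.  This evaluation therefore
    cannot tell the last stage from the whole sequence.\<close>
  define fresh where "fresh ys y \<longleftrightarrow> (\<exists>B. ev (brun (Ft (\<lambda>i. ys ! i) (length ys)) B)
      (brun (Gt 0 (?cd (\<lambda>i. ys ! i)) (\<lambda>i. ys ! i) (length ys)) B) e [c []] 0 \<and> B < y \<and>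
      (\<forall>zs. B < 2 * c (ys @ y # zs) + 1))" for ys y
  have "\<exists>y. fresh ys y" if "0 \<notin> set ys" for ys
  proof -
    have nz: "(\<lambda>i. ys ! i) i \<noteq> 0" if "i < length ys" for i using \<open>0 \<notin> set ys\<close> that by (metis nth_mem)
    from ev_run_bounded[OF val[of "length ys" "\<lambda>i. ys ! i" 0, OF nz]] obtain B where
      "ev (brun (Ft (\<lambda>i. ys ! i) (length ys)) B)
        (brun (Gt 0 (?cd (\<lambda>i. ys ! i)) (\<lambda>i. ys ! i) (length ys)) B) e [c []] 0" by blast
    with fresh_exists[OF injc, of B ys] show ?thesis unfolding fresh_def by blast
  qed
  then obtain fr where fr: "\<And>ys. 0 \<notin> set ys \<Longrightarrow> fresh ys (fr ys)" by metis
  \<comment> \<open>Each member is chosen after the evaluation at its stage, which involves the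
    earlier members only.\<close>
  define pre where "pre = rec_nat [] (\<lambda>_ ys. ys @ [fr ys])"
  have pre: "pre 0 = []" "pre (Suc k) = pre k @ [fr (pre k)]" for k by (simp_all add: pre_def)
  define x where "x k = fr (pre k)" for k
  have pre_x: "pre k = map x [0..<k]" for k by (induction k) (simp_all add: pre x_def)
  have pos: "0 \<notin> set (pre k)" for k
  proof (induction k)
    case (Suc k)
    from fr[OF Suc] have "fr (pre k) \<noteq> 0" by (auto simp: fresh_def)
    then show ?case using Suc by (simp add: pre)
  qed (simp add: pre)
  have x0: "x k \<noteq> 0" for k using pos[of "Suc k"] by (auto simp: pre_x)
  have stage: "ev_stage (?cd x) x k e [c []] 0" for k
  proof -
    \<comment> \<open>The functionals of stage \<open>k\<close> depend on the first \<open>k\<close>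
      members only, so those built from the list \<open>pre k\<close> and from \<open>x\<close>
      coincide.\<close>
    have eq: "(\<lambda>i. pre k ! i) i = x i" if "i < k" for i using that by (simp add: pre_x)
    then have m: "map (\<lambda>i. pre k ! i) [0..<i] = map x [0..<i]" if "i \<le> k" for i using that by auto
    have lp: "length (pre k) = k" by (simp add: pre_x)
    have cdx: "?cd (\<lambda>i. pre k ! i) i = ?cd x i" if "i \<le> k" for i using m[OF that] by (simp only: prefix_code_def)
    have F: "Ft (\<lambda>i. pre k ! i) k = Ft x k" by (simp only: Ft_def m[OF order_refl])
    have "map (\<lambda>i. (?cd (\<lambda>i. pre k ! i) i, pre k ! i)) [0..<k] = map (\<lambda>i. (?cd x i, x i)) [0..<k]"
      using cdx eq by auto
    note mG = this
    have G: "Gt 0 (?cd (\<lambda>i. pre k ! i)) (\<lambda>i. pre k ! i) k = Gt 0 (?cd x) x k"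
      by (simp only: Gt_def mG cdx[OF order_refl])
    from fr[OF pos, of k] obtain B where B: "ev (brun (Ft x k) B) (brun (Gt 0 (?cd x) x k) B) e [c []] 0"
      "B < x k" "\<And>zs. B < 2 * c (pre k @ x k # zs) + 1"
      unfolding fresh_def lp F G x_def[symmetric] by blast
    show ?thesis
    proof (rule ev_mono[OF agree_brun agree_brun _ _ B(1)])
      fix \<phi> i assume "compat \<phi> \<phi>" and r: "brun (Ft x k) B \<phi> i"
      then have c: "compat (\<lambda>j v. \<phi> j v \<and> v \<le> B) (\<lambda>j v. \<phi> j v \<and> v \<le> B)" by (auto simp: compat_def)
      from r[unfolded brun_def run_Ft[OF c]] obtain v where
        *: "i \<le> k" "\<forall>j<i. \<phi> j (x j)" "\<phi> i v" "v \<le> B" "i < k \<longrightarrow> v \<noteq> x i" by blast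
      \<comment> \<open>At \<open>i = k\<close> the tree makes no comparison; freshness of
        \<open>x k\<close> supplies the difference that \<open>F_upto\<close> demands.\<close>
      have "v \<noteq> x i" using * B(2) by (cases "i = k") auto
      with * show "F_upto x k \<phi> i" by (auto simp: F_upto_def)
    next
      fix \<phi> a assume "compat \<phi> \<phi>" and r: "brun (Gt 0 (?cd x) x k) B \<phi> a"
      then have c: "compat (\<lambda>j v. \<phi> j v \<and> v \<le> B) (\<lambda>j v. \<phi> j v \<and> v \<le> B)" by (auto simp: compat_def)
      from r[unfolded brun_def run_Gt[OF c inj_prefix_code[OF injc]]] obtain t where
        t: "\<phi> 0 t" "t \<le> B" "a = 0" "(\<exists>j v. j < k \<and> t = ?cd x j \<and> \<phi> (x j) v) \<or> (\<forall>j<k. t \<noteq> ?cd x j)"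
        by (auto split: if_splits)
      have "i \<le> k \<and> (i < k \<longrightarrow> (\<exists>v. \<phi> (x i) v))" if ti: "t = ?cd x i" for i
      proof
        show "i \<le> k"
        proof (rule ccontr)
          assume "\<not> i \<le> k"
          \<comment> \<open>The code for an index beyond \<open>k\<close> mentions
            \<open>x k\<close> and would exceed the bound on \<open>t\<close>.\<close>
          then have "[0..<i] = [0..<k] @ k # [Suc k..<i]"
            by (metis less_imp_le_nat not_le upt_add_eq_append upt_conv_Cons zero_le le_add_diff_inverse)
          then have "t = 2 * c (pre k @ x k # (map x [Suc k..<i] @ [0])) + 1"
            by (simp add: ti prefix_code_def pre_x)
          with B(3) t(2) show False by (metis not_le)
        qed
        show "i < k \<longrightarrow> (\<exists>v. \<phi> (x i) v)"
          using t(4) ti injD[OF inj_prefix_code[OF injc, of x]] by blast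
      qed
      with t show "G_stage (?cd x) x k \<phi> a" by (auto simp: G_stage_def)
    qed
  qed
  have "\<exists>b m. ev_below (?cd x) x b e [c []] m"
    by (rule lwf_ev_below[OF inj_prefix_code[OF injc] LWF_lwf[OF LWF] \<Phi>, of 0]) (use stage in blast)
  then obtain b m where b: "ev_below (?cd x) x b e [c []] m" by blast
  have "m = 0" using ev_stage_below[OF stage b] by simp
  txt \<open>No value in the evaluation below \<open>b\<close> reaches \<open>?k\<close>, hence it stays valid for \<open>K = ?k\<close>.\<close>
  let ?k = "Suc b"
  have "ev (run (Ft x ?k)) (run (Gt ?k (?cd x) x ?k)) e [c []] 0"
  proof (rule ev_mono[OF agree_F_upto agree_G(3) _ _ b[unfolded \<open>m = 0\<close>]])
    fix \<phi> i assume "compat \<phi> \<phi>" "F_upto x b \<phi> i"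
    then show "run (Ft x ?k) \<phi> i" by (subst run_Ft) (auto simp: F_upto_def)
  next
    fix \<phi> a assume c: "compat \<phi> \<phi>" and "G_below (?cd x) x b \<phi> a"
    then obtain t where t: "a = 0" "\<phi> 0 t" "\<forall>i. t = ?cd x i \<longrightarrow> i < b \<and> (\<exists>v<b. \<phi> (x i) v)"
      by (auto simp: G_below_def)
    show "run (Gt ?k (?cd x) x ?k) \<phi> a"
      unfolding run_Gt[OF c inj_prefix_code[OF injc]]
    proof (intro exI[of _ t] conjI)
      show "(\<exists>j v. j < ?k \<and> t = ?cd x j \<and> \<phi> (x j) v \<and> a = (if v = ?k then ?k else 0)) \<or>
        ((\<forall>j<?k. t \<noteq> ?cd x j) \<and> a = (if t = ?cd x ?k then ?k else 0))"
      proof (cases "\<exists>i. t = ?cd x i")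
        case True
        then obtain i where i: "t = ?cd x i" ..
        with t(3) obtain v where "i < b" "v < b" "\<phi> (x i) v" by blast
        with i t(1) show ?thesis by (intro disjI1 exI[of _ i] exI[of _ v]) auto
      qed (use t(1) in auto)
    qed (rule t(2))
  qed
  \<comment> \<open>\<open>?k\<close> is a successor, so this value differs from
    \<open>0\<close>.\<close>
  moreover have "ev (run (Ft x ?k)) (run (Gt ?k (?cd x) x ?k)) e [c []] ?k" using val x0 by blast
  ultimately show False using ev_agree[OF agree_run agree_run] by blast
qed

section \<open>Well-typed left-well-founded procedures are closed under application\<close>

text \<open>\<open>good\<close> is the conjunction of well-typedness and left-well-foundedness.\<close>

inductive good :: "ty list \<Rightarrow> proc \<Rightarrow> ty \<Rightarrow> bool" where
  "(\<And>x qs. spine e (App x qs) \<Longrightarrow> x < length (rev (args \<sigma>) @ \<Gamma>) \<and>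
      list_all2 (good (rev (args \<sigma>) @ \<Gamma>)) qs (args ((rev (args \<sigma>) @ \<Gamma>) ! x))) \<Longrightarrow>
    good \<Gamma> (Lam (args \<sigma>) e) \<sigma>"
monos list_all2_mono

definition gexp :: "ty list \<Rightarrow> exp \<Rightarrow> bool" where
  "gexp \<Gamma> e \<longleftrightarrow> (\<forall>x qs. spine e (App x qs) \<longrightarrow> x < length \<Gamma> \<and> list_all2 (good \<Gamma>) qs (args (\<Gamma> ! x)))"

lemma good_Lam: "good \<Gamma> (Lam \<sigma>s e) \<sigma> \<longleftrightarrow> \<sigma>s = args \<sigma> \<and> gexp (rev (args \<sigma>) @ \<Gamma>) e"
  by (subst good.simps) (auto simp: gexp_def)

lemma good_LamE:
  assumes "good \<Gamma> p \<sigma>" obtains e where "p = Lam (args \<sigma>) e" "gexp (rev (args \<sigma>) @ \<Gamma>) e"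
  using assms by (cases p) (auto simp: good_Lam)

lemma good_lwf: "good \<Gamma> p \<sigma> \<Longrightarrow> lwf p"
proof (induction rule: good.induct)
  case (1 e \<sigma> \<Gamma>)
  show ?case
  proof (rule lwf.intros)
    fix x qs q assume "spine e (App x qs)" "q \<in> set qs"
    then show "lwf q" using 1 by (fastforce simp: in_set_conv_nth list_all2_conv_all_nth)
  qed
qed

lemma gexp_simps [simp]: "gexp \<Gamma> Bot" "gexp \<Gamma> (Num n)"
  "gexp \<Gamma> (Case (App x qs) es) \<longleftrightarrow> x < length \<Gamma> \<and> list_all2 (good \<Gamma>) qs (args (\<Gamma> ! x)) \<and> (\<forall>i. gexp \<Gamma> (es i))"
  unfolding gexp_def by (auto intro: spine.intros elim!: spine_CaseE)

definition renok :: "ty list \<Rightarrow> (nat \<Rightarrow> nat) \<Rightarrow> ty list \<Rightarrow> bool" where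
  "renok \<Gamma> \<rho> \<Delta> \<longleftrightarrow> (\<forall>i<length \<Gamma>. \<rho> i < length \<Delta> \<and> \<Delta> ! \<rho> i = \<Gamma> ! i)"

text \<open>Reducibility in the style of Tait, for variables and meta-procedures: all applications to
  reducible arguments have a good normal form.  Since variables are admitted as arguments,
  a reducible meta-procedure has itself a good normal form.\<close>

function Red :: "ty \<Rightarrow> ty list \<Rightarrow> nat + mproc \<Rightarrow> bool" where
  "Red \<sigma> \<Gamma> (Inl y) \<longleftrightarrow> y < length \<Gamma> \<and> \<Gamma> ! y = \<sigma>"
| "Red \<sigma> \<Gamma> (Inr P) \<longleftrightarrow> (\<exists>B. P = MLam (args \<sigma>) B \<and>
    (\<forall>\<Delta> \<rho> vs. renok \<Gamma> \<rho> \<Delta> \<longrightarrow> length vs = length (args \<sigma>) \<longrightarrow>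
      (\<forall>i<length (args \<sigma>). Red (args \<sigma> ! i) \<Delta> (vs ! i)) \<longrightarrow>
      gexp \<Delta> (nf_exp (sub_exp (push vs (Inl \<circ> \<rho>)) B))))"
  by pat_completeness auto
termination
  by (relation "measure (\<lambda>(\<sigma>, \<Gamma>, v). size \<sigma>)") (auto intro: size_args nth_mem)

declare Red.simps(2) [simp del]

definition Reds :: "ty list \<Rightarrow> ty list \<Rightarrow> (nat + mproc) list \<Rightarrow> bool" where
  "Reds \<sigma>s \<Delta> vs \<longleftrightarrow> list_all2 (\<lambda>\<sigma> v. Red \<sigma> \<Delta> v) \<sigma>s vs"

lemma Red_Inr: "Red \<sigma> \<Gamma> (Inr P) \<longleftrightarrow> (\<exists>B. P = MLam (args \<sigma>) B \<and>
    (\<forall>\<Delta> \<rho> vs. renok \<Gamma> \<rho> \<Delta> \<longrightarrow> Reds (args \<sigma>) \<Delta> vs \<longrightarrow> gexp \<Delta> (nf_exp (sub_exp (push vs (Inl \<circ> \<rho>)) B))))"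
  unfolding Red.simps(2) Reds_def list_all2_conv_all_nth by metis

lemma Reds_simps [simp]: "Reds [] \<Delta> vs \<longleftrightarrow> vs = []" "Reds (\<sigma> # \<sigma>s) \<Delta> vs \<longleftrightarrow> (\<exists>w ws. vs = w # ws \<and> Red \<sigma> \<Delta> w \<and> Reds \<sigma>s \<Delta> ws)"
  by (auto simp: Reds_def list_all2_Cons1)

lemma Reds_length: "Reds \<sigma>s \<Delta> vs \<Longrightarrow> length vs = length \<sigma>s"
  by (simp add: Reds_def list_all2_lengthD)

abbreviation ren_var :: "(nat \<Rightarrow> nat) \<Rightarrow> nat + mproc \<Rightarrow> nat + mproc" where
  "ren_var \<rho> \<equiv> sub_var (Inl \<circ> \<rho>)"

lemma renok_comp: "renok \<Gamma> f \<Delta> \<Longrightarrow> renok \<Delta> g \<Theta> \<Longrightarrow> renok \<Gamma> (g \<circ> f) \<Theta>"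
  by (auto simp: renok_def)

lemma renok_id [simp]: "renok \<Gamma> id \<Gamma>"
  by (simp add: renok_def)

text \<open>Built into \<open>Red\<close> by quantifying over all typed renamings, as in a Kripke
  model.\<close>

lemma Red_ren: "Red \<sigma> \<Gamma> v \<Longrightarrow> renok \<Gamma> f \<Delta> \<Longrightarrow> Red \<sigma> \<Delta> (ren_var f v)"
proof (cases v)
  case (Inl y)
  assume "Red \<sigma> \<Gamma> v" "renok \<Gamma> f \<Delta>"
  then show ?thesis using Inl by (auto simp: renok_def)
next
  case (Inr P)
  assume "Red \<sigma> \<Gamma> v" and f: "renok \<Gamma> f \<Delta>"
  then obtain B where B: "P = MLam (args \<sigma>) B"
    "\<And>\<Delta> \<rho> vs. renok \<Gamma> \<rho> \<Delta> \<Longrightarrow> Reds (args \<sigma>) \<Delta> vs \<Longrightarrow> gexp \<Delta> (nf_exp (sub_exp (push vs (Inl \<circ> \<rho>)) B))"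
    using Inr by (auto simp: Red_Inr)
  have "gexp \<Theta> (nf_exp (sub_exp (push vs (Inl \<circ> \<rho>)) (sub_exp (up_subst (length (args \<sigma>)) (Inl \<circ> f)) B)))"
    if "renok \<Delta> \<rho> \<Theta>" "Reds (args \<sigma>) \<Theta> vs" for \<Theta> \<rho> vs
  proof -
    have "push vs (Inl \<circ> \<rho>) \<odot> up_subst (length (args \<sigma>)) (Inl \<circ> f) = push vs (Inl \<circ> (\<rho> \<circ> f))"
      using push_comp_up[of vs "Inl \<circ> \<rho>" "Inl \<circ> f"] Reds_length[OF that(2)] by (simp add: comp_Inl_ren comp_assoc)
    then show ?thesis using B(2)[OF renok_comp[OF f that(1)] that(2)] by (simp add: sub_sub)
  qed
  then show ?thesis using Inr B(1) by (auto simp: Red_Inr)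
qed

lemma Reds_vars:
  "Reds \<sigma>s (rev \<sigma>s @ \<Gamma>) (map Inl (rev [0..<length \<sigma>s]))"
  by (auto simp: Reds_def list_all2_conv_all_nth rev_nth nth_append)

lemma renok_shift: "length \<Theta> = r \<Longrightarrow> renok \<Gamma> (\<lambda>i. i + r) (\<Theta> @ \<Gamma>)"
  by (auto simp: renok_def nth_append)

text \<open>The block is applied to its own variables in the extended context; variables of the
  right type are reducible by definition.\<close>

lemma Red_good: "Red \<sigma> \<Gamma> (Inr P) \<Longrightarrow> good \<Gamma> (nf_proc P) \<sigma>"
proof -
  assume "Red \<sigma> \<Gamma> (Inr P)"
  then obtain B where B: "P = MLam (args \<sigma>) B"
    "\<And>\<Delta> \<rho> vs. renok \<Gamma> \<rho> \<Delta> \<Longrightarrow> Reds (args \<sigma>) \<Delta> vs \<Longrightarrow> gexp \<Delta> (nf_exp (sub_exp (push vs (Inl \<circ> \<rho>)) B))"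
    by (auto simp: Red_Inr)
  let ?r = "length (args \<sigma>)"
  have "push (map Inl (rev [0..<?r])) (Inl \<circ> (\<lambda>i. i + ?r)) = Inl"
    by (auto simp: push_def fun_eq_iff rev_map)
  with B(2)[OF renok_shift Reds_vars, of ?r] have "gexp (rev (args \<sigma>) @ \<Gamma>) (nf_exp B)" by simp
  then show ?thesis by (simp add: B(1) good_Lam)
qed

lemma Red_beq:
  assumes "Red \<sigma> \<Gamma> (Inr P)" "P \<simeq> P'" shows "Red \<sigma> \<Gamma> (Inr P')"
proof -
  from assms(1) obtain B where B: "P = MLam (args \<sigma>) B"
    "\<And>\<Delta> \<rho> vs. renok \<Gamma> \<rho> \<Delta> \<Longrightarrow> Reds (args \<sigma>) \<Delta> vs \<Longrightarrow> gexp \<Delta> (nf_exp (sub_exp (push vs (Inl \<circ> \<rho>)) B))"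
    by (auto simp: Red_Inr)
  obtain B' where B': "P' = MLam (args \<sigma>) B'" "nf_exp B = nf_exp B'"
    using assms(2) B(1) by (cases P') (auto simp: MLam_beq)
  have "nf_exp (sub_exp s B) = nf_exp (sub_exp s B')" for s
    by (rule nf_sub_exp_cong[OF _ B'(2)]) simp
  then show ?thesis using B(2) B'(1) by (auto simp: Red_Inr)
qed

lemma Red_N_num: "P \<simeq> emb_proc (num k) \<Longrightarrow> Red N \<Gamma> (Inr P)"
  by (rule Red_beq[of _ _ "emb_proc (num k)"]) (auto simp: Red_Inr num_def beq_sym)

definition Redsub :: "ty list \<Rightarrow> subst \<Rightarrow> ty list \<Rightarrow> bool" where
  "Redsub \<Gamma> s \<Delta> \<longleftrightarrow> (\<forall>i<length \<Gamma>. Red (\<Gamma> ! i) \<Delta> (s i))"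

lemma Redsub_push:
  assumes "Redsub \<Gamma> s \<Delta>" "renok \<Delta> \<rho> \<Theta>" "Reds \<sigma>s \<Theta> vs"
  shows "Redsub (rev \<sigma>s @ \<Gamma>) (push vs ((Inl \<circ> \<rho>) \<odot> s)) \<Theta>"
proof -
  have "Red ((rev \<sigma>s @ \<Gamma>) ! i) \<Theta> (push vs ((Inl \<circ> \<rho>) \<odot> s) i)" if "i < length (rev \<sigma>s @ \<Gamma>)" for i
  proof (cases "i < length \<sigma>s")
    case True
    then show ?thesis using assms(3) by (auto simp: Reds_def list_all2_conv_all_nth push_def nth_append rev_nth)
  next
    case False
    have "Red (\<Gamma> ! (i - length \<sigma>s)) \<Theta> (ren_var \<rho> (s (i - length \<sigma>s)))"
      using assms(1,2) that False by (intro Red_ren) (auto simp: Redsub_def)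
    then show ?thesis using False Reds_length[OF assms(3)]
      by (simp add: push_def nth_append comp_subst_def sub_var_def)
  qed
  then show ?thesis by (simp add: Redsub_def)
qed

subsection \<open>Outermost applications of normal forms\<close>

text \<open>Counts machine steps together with the branches entered. A normal form may be infinite,
  but each of its outermost applications is reached after finitely many of these, which provides an
  induction.\<close>

inductive reach :: "nat \<Rightarrow> state \<Rightarrow> nat \<Rightarrow> mproc list \<Rightarrow> bool" where
  "reach 0 (MCase (MVar y Qs) Es, S) y Qs"
| "reach n (Es i, S) y Qs \<Longrightarrow> reach (Suc n) (MCase (MVar y' Qs') Es, S) y Qs"
| "mstep st st' \<Longrightarrow> reach n st' y Qs \<Longrightarrow> reach (Suc n) st y Qs"

lemma reach_steps: "msteps st st' \<Longrightarrow> reach n st' y Qs \<Longrightarrow> \<exists>m. reach m st y Qs"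
  by (induction rule: converse_rtranclp_induct) (blast intro: reach.intros)+

lemma spine_reach: "spine e a \<Longrightarrow> e = nfs st \<Longrightarrow> \<exists>n y Qs. reach n st y Qs \<and> a = App y (map nf_proc Qs)"
proof (induction arbitrary: st rule: spine.induct)
  case (here a es)
  then have "halts st" using nfs_no_halt by fastforce
  then obtain st' where st: "msteps st st'" "final st'" by (auto simp: halts_def)
  from st(2) here nfs_steps[OF st(1)] show ?case
  proof cases
    case (3 x Qs Es S)
    then have "a = App x (map nf_proc Qs)" using here nfs_steps[OF st(1)] by simp
    then show ?thesis using reach_steps[OF st(1)] reach.intros(1) 3 by blast
  qed simp_all
next
  case (branch es i a b)
  then have "halts st" using nfs_no_halt by fastforce
  then obtain st' where st: "msteps st st'" "final st'" by (auto simp: halts_def)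
  from st(2) branch.prems nfs_steps[OF st(1)] show ?case
  proof cases
    case (3 x Qs Es S)
    then have "es i = nfs (Es i, S)" using branch.prems nfs_steps[OF st(1)] by simp
    from branch.IH[OF this] obtain n y Qs' where "reach n (Es i, S) y Qs'" "a = App y (map nf_proc Qs')" by blast
    then show ?thesis using reach_steps[OF st(1)] reach.intros(2) 3 by blast
  qed simp_all
qed

lemma reach_spine: "reach n st y Qs \<Longrightarrow> spine (nfs st) (App y (map nf_proc Qs))"
  by (induction rule: reach.induct) (auto intro: spine.intros dest: nfs_step)

text \<open>The application is met before \<open>E\<close> delivers its value to the frame
  \<open>F\<close>, or afterwards with a smaller count; the decrease feeds the induction in
  \<open>gexp_sub\<close>.\<close>

lemma reach_append: "reach n (E, S @ F # U) y Qs \<Longrightarrow>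
    (\<exists>m. reach m (E, S) y Qs) \<or> (\<exists>i m. m < n \<and> reach m (F i, U) y Qs)"
proof (induction n "(E, S @ F # U)" y Qs arbitrary: E S rule: reach.induct)
  case (1 y Qs Es)
  then show ?case by (blast intro: reach.intros)
next
  case (2 n Es i y Qs y' Qs')
  from 2(2) show ?case by (blast intro: reach.intros less_SucI)
next
  case (3 st' n y Qs)
  from 3(1) show ?case
  proof (cases rule: mstep.cases)
    case (num k F' S')
    show ?thesis
    proof (cases S)
      case Nil
      then show ?thesis using num 3(2) by auto
    next
      case (Cons F1 S1)
      then have st': "st' = (F1 k, S1 @ F # U)" "E = MNum k" using num by auto
      from 3(3)[OF st'(1)] reach.intros(3)[OF mstep.num[of k F1 S1]] show ?thesis
        unfolding st'(2) Cons by (blast intro: less_SucI)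
    qed
  next
    case (exp D Es)
    then have "st' = (D, (Es # S) @ F # U)" by simp
    from 3(3)[OF this] reach.intros(3)[OF mstep.exp[of D Es S]] show ?thesis
      using exp by (blast intro: less_SucI)
  next
    case (beta Rs \<sigma>s B Es)
    then have "st' = (sub_exp (inst Rs) B, (Es # S) @ F # U)" by simp
    from 3(3)[OF this] reach.intros(3)[OF mstep.beta[OF beta(3), of B Es S]] show ?thesis
      using beta by (blast intro: less_SucI)
  qed
qed

lemma gexp_nfs: "gexp \<Delta> (nfs st) \<longleftrightarrow>
    (\<forall>n y Qs. reach n st y Qs \<longrightarrow> y < length \<Delta> \<and> list_all2 (good \<Delta>) (map nf_proc Qs) (args (\<Delta> ! y)))"
  unfolding gexp_def by (metis app.inject spine_reach reach_spine)

text \<open>The step of the fundamental lemma; the induction on the number of machine steps deals with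
  infinitely long evaluations.\<close>

lemma gexp_sub:
  assumes s: "Redsub \<Gamma> s \<Delta>"
    and a: "\<And>x qs. spine e (App x qs) \<Longrightarrow> x < length \<Gamma> \<and>
      list_all2 (\<lambda>q \<tau>. Red \<tau> \<Delta> (Inr (sub_proc s (emb_proc q)))) qs (args (\<Gamma> ! x))"
  shows "gexp \<Delta> (nf_exp (sub_exp s (emb_exp e)))"
proof -
  have "y < length \<Delta> \<and> list_all2 (good \<Delta>) (map nf_proc Qs) (args (\<Delta> ! y))"
    if "reach n (sub_exp s (emb_exp e), []) y Qs" for n y Qs
    using that a
  proof (induction n arbitrary: e rule: less_induct)
    case (less n)
    show ?case
    proof (cases e)
      case (Case b es)
      obtain x rs where b: "b = App x rs" by (cases b)
      let ?rs = "map (\<lambda>q. sub_proc s (emb_proc q)) rs" and ?Es = "\<lambda>i. sub_exp s (emb_exp (es i))"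
      from less.prems(2)[of x rs] Case b have x: "x < length \<Gamma>"
        "list_all2 (\<lambda>q \<tau>. Red \<tau> \<Delta> (Inr (sub_proc s (emb_proc q)))) rs (args (\<Gamma> ! x))" by (auto intro: spine.intros)
      have sx: "Red (\<Gamma> ! x) \<Delta> (s x)" using s x(1) by (simp add: Redsub_def)
      have IH: ?thesis if "m < n" "reach m (?Es i, []) y Qs" for i m
        using less.IH[OF that(1), of "es i"] that(2) less.prems(2) Case by (auto intro: spine.intros)
      show ?thesis
      proof (cases "s x")
        case (Inl z)
        have st: "(sub_exp s (emb_exp e), []) = (MCase (MVar z ?rs) ?Es, [])"
          using Case b Inl by (simp add: comp_def)
        from less.prems(1) show ?thesis unfolding st
        proof cases
          case 1
          have "list_all2 (good \<Delta>) (map nf_proc ?rs) (args (\<Gamma> ! x))"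
            using x(2) by (auto simp: list_all2_conv_all_nth intro: Red_good)
          then show ?thesis using 1 sx Inl by auto
        next
          case (2 m i)
          then show ?thesis using IH by auto
        next
          case (3 st' m)
          then show ?thesis by auto
        qed
      next
        case (Inr P)
        from sx Inr obtain B where B: "P = MLam (args (\<Gamma> ! x)) B"
          "\<And>\<rho> \<Theta> vs. renok \<Delta> \<rho> \<Theta> \<Longrightarrow> Reds (args (\<Gamma> ! x)) \<Theta> vs \<Longrightarrow> gexp \<Theta> (nf_exp (sub_exp (push vs (Inl \<circ> \<rho>)) B))"
          by (auto simp: Red_Inr)
        have st: "(sub_exp s (emb_exp e), []) = (MCase (MApp (MLam (args (\<Gamma> ! x)) B) ?rs) ?Es, [])"
          using Case b Inr B(1) by (simp add: comp_def)
        have len: "length ?rs = length (args (\<Gamma> ! x))" using x(2) by (simp add: list_all2_lengthD)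
        have "Reds (args (\<Gamma> ! x)) \<Delta> (map Inr ?rs)"
          using x(2) by (auto simp: Reds_def list_all2_conv_all_nth)
        \<comment> \<open>Reducibility of the head accounts for the applications met while its body
          is evaluated; those in the branches fall under the induction hypothesis.\<close>
        from B(2)[OF renok_id this] have g: "gexp \<Delta> (nfs (sub_exp (inst ?rs) B, []))"
          by (simp add: inst_conv_push comp_def nf_exp_conv_nfs id_def)
        from less.prems(1) obtain m where m: "n = Suc m" "reach m (sub_exp (inst ?rs) B, [] @ ?Es # []) y Qs"
          unfolding st
        proof cases
          case (3 st' m)
          from mstep_det[OF 3(2) mstep.beta[OF len]] 3 show ?thesis using that by auto
        qed
        from reach_append[OF m(2)] show ?thesis
        proof
          assume "\<exists>k. reach k (sub_exp (inst ?rs) B, []) y Qs"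
          then show ?thesis using g unfolding gexp_nfs by blast
        next
          assume "\<exists>i k. k < m \<and> reach k (?Es i, []) y Qs"
          then obtain i k where "k < n" "reach k (?Es i, []) y Qs" using m(1) less_SucI by blast
          then show ?thesis by (rule IH)
        qed
      qed
    qed (use reach_spine[OF less.prems(1)] in auto)
  qed
  then show ?thesis unfolding nf_exp_conv_nfs gexp_nfs by blast
qed

text \<open>The fundamental lemma of reducibility, by induction on the nesting of arguments.\<close>

lemma good_Red: "good \<Gamma> p \<sigma> \<Longrightarrow> Redsub \<Gamma> s \<Delta> \<Longrightarrow> Red \<sigma> \<Delta> (Inr (sub_proc s (emb_proc p)))"
proof (induction arbitrary: s \<Delta> rule: good.induct)
  case (1 e \<sigma> \<Gamma>)
  have "gexp \<Theta> (nf_exp (sub_exp (push vs (Inl \<circ> \<rho>)) (sub_exp (up_subst (length (args \<sigma>)) s) (emb_exp e))))"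
    if *: "renok \<Delta> \<rho> \<Theta>" "Reds (args \<sigma>) \<Theta> vs" for \<Theta> \<rho> vs
  proof -
    let ?t = "push vs ((Inl \<circ> \<rho>) \<odot> s)"
    have t: "Redsub (rev (args \<sigma>) @ \<Gamma>) ?t \<Theta>" by (rule Redsub_push[OF 1(2) *])
    have "gexp \<Theta> (nf_exp (sub_exp ?t (emb_exp e)))"
    proof (rule gexp_sub[OF t])
      fix x qs assume "spine e (App x qs)"
      from 1(1)[OF this] show "x < length (rev (args \<sigma>) @ \<Gamma>) \<and>
        list_all2 (\<lambda>q \<tau>. Red \<tau> \<Theta> (Inr (sub_proc ?t (emb_proc q)))) qs (args ((rev (args \<sigma>) @ \<Gamma>) ! x))"
        using t by (auto simp: list_all2_conv_all_nth)
    qed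
    moreover have "push vs (Inl \<circ> \<rho>) \<odot> up_subst (length (args \<sigma>)) s = ?t"
      using push_comp_up[of vs "Inl \<circ> \<rho>" s] Reds_length[OF *(2)] by simp
    ultimately show ?thesis by (simp add: sub_sub)
  qed
  then show ?case by (auto simp: Red_Inr)
qed

lemma Redsub_Inl: "Redsub \<Gamma> Inl (\<Gamma> @ \<Delta>)"
  by (auto simp: Redsub_def nth_append)

lemma good_Red_emb: "good \<Gamma> p \<sigma> \<Longrightarrow> Red \<sigma> \<Gamma> (Inr (emb_proc p))"
  using good_Red[OF _ Redsub_Inl[of \<Gamma> "[]"]] by simp

lemma good_weaken: "good \<Gamma> p \<sigma> \<Longrightarrow> good (\<Gamma> @ \<Delta>) p \<sigma>"
  using Red_good[OF good_Red[OF _ Redsub_Inl[of \<Gamma> \<Delta>]]] by simp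

lemma Red_mappv:
  assumes "Red (\<sigma> \<rightarrow> \<tau>) \<Delta> (Inr P)" "Red \<sigma> \<Delta> v" shows "Red \<tau> \<Delta> (Inr (mappv P v))"
proof -
  from assms(1) obtain B where B: "P = MLam (\<sigma> # args \<tau>) B"
    "\<And>\<Theta> \<rho> vs. renok \<Delta> \<rho> \<Theta> \<Longrightarrow> Reds (\<sigma> # args \<tau>) \<Theta> vs \<Longrightarrow> gexp \<Theta> (nf_exp (sub_exp (push vs (Inl \<circ> \<rho>)) B))"
    by (auto simp: Red_Inr)
  have "gexp \<Theta> (nf_exp (sub_exp (push vs (Inl \<circ> \<rho>)) (sub_exp (up_subst (length (args \<tau>)) (push [v] Inl)) B)))"
    if *: "renok \<Delta> \<rho> \<Theta>" "Reds (args \<tau>) \<Theta> vs" for \<Theta> \<rho> vs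
  proof -
    have "push vs (Inl \<circ> \<rho>) \<odot> up_subst (length (args \<tau>)) (push [v] Inl) = push (ren_var \<rho> v # vs) (Inl \<circ> \<rho>)"
      using push_comp_up[of vs "Inl \<circ> \<rho>" "push [v] Inl"] Reds_length[OF *(2)]
      by (simp add: comp_push push_push)
    moreover have "Reds (\<sigma> # args \<tau>) \<Theta> (ren_var \<rho> v # vs)" using * assms(2) Red_ren by auto
    ultimately show ?thesis using B(2)[OF *(1)] by (simp add: sub_sub)
  qed
  then show ?thesis by (auto simp: Red_Inr B(1))
qed

text \<open>Substitution can create new nesting, so a direct induction on \<open>good\<close> does
  not give this; hence the detour through reducibility.\<close>

lemma good_app: "good \<Gamma> p (\<sigma> \<rightarrow> \<tau>) \<Longrightarrow> good \<Gamma> q \<sigma> \<Longrightarrow> good \<Gamma> (p \<cdot> q) \<tau>"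
  unfolding nsp_app_conv by (intro Red_good Red_mappv good_Red_emb)

lemma good_lam: "good (\<sigma> # \<Gamma>) p \<tau> \<Longrightarrow> good \<Gamma> (lam \<sigma> p) (\<sigma> \<rightarrow> \<tau>)"
  by (erule good_LamE) (simp add: good_Lam)

lemma good_eta: "x < length \<Gamma> \<Longrightarrow> \<Gamma> ! x = \<sigma> \<Longrightarrow> good \<Gamma> (eta \<sigma> x) \<sigma>"
proof (induction \<sigma> x arbitrary: \<Gamma> rule: eta.induct)
  case (1 \<sigma> x)
  let ?r = "length (args \<sigma>)"
  have "list_all2 (good (rev (args \<sigma>) @ \<Gamma>)) (map (\<lambda>(\<tau>, z). eta \<tau> z) (zip (args \<sigma>) (rev [0..<?r]))) (args \<sigma>)"
  proof -
    have "good (rev (args \<sigma>) @ \<Gamma>) (eta (args \<sigma> ! i) (?r - Suc i)) (args \<sigma> ! i)" if i: "i < ?r" for i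
    proof -
      have "zip (args \<sigma>) (rev [0..<?r]) ! i = (args \<sigma> ! i, ?r - Suc i)" using i by (simp add: rev_nth)
      then have "(args \<sigma> ! i, ?r - Suc i) \<in> set (zip (args \<sigma>) (rev [0..<?r]))"
        using i by (metis length_rev length_upt length_zip min.idem minus_nat.diff_0 nth_mem)
      moreover have "(rev (args \<sigma>) @ \<Gamma>) ! (?r - Suc i) = args \<sigma> ! i"
      proof -
        have "?r - Suc i < ?r" using i by linarith
        then show ?thesis using i by (simp add: nth_append rev_nth)
      qed
      ultimately show ?thesis using 1(1)[OF _ refl, of "args \<sigma> ! i" "?r - Suc i" "rev (args \<sigma>) @ \<Gamma>"] i by simp
    qed
    then show ?thesis by (auto simp: list_all2_conv_all_nth rev_nth)
  qed
  then show ?case using 1(2,3) by (subst eta.simps) (simp add: good_Lam nth_append)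
qed

lemma good_etas:
  assumes "\<And>i. i < length \<sigma>s \<Longrightarrow> k + i < length \<Gamma> \<and> \<Gamma> ! (k + i) = rev \<sigma>s ! i"
  shows "list_all2 (good \<Gamma>) (etas \<sigma>s k) \<sigma>s"
proof -
  have "good \<Gamma> (eta (\<sigma>s ! i) (k + length \<sigma>s - Suc i)) (\<sigma>s ! i)" if "i < length \<sigma>s" for i
    using assms[of "length \<sigma>s - Suc i"] that by (intro good_eta) (simp_all add: rev_nth)
  then show ?thesis by (auto simp: etas_def list_all2_conv_all_nth rev_nth)
qed

lemma good_num: "good \<Gamma> (num n) N"
  by (simp add: num_def good_Lam)

lemma good_byval: "good \<Gamma> (den_const (Ext (Byval_c \<sigma>s \<tau>))) (pcf_ty (Byval_c \<sigma>s \<tau>))"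
proof -
  have args_funs': "args (funs \<sigma>s (N \<rightarrow> \<tau>)) = \<sigma>s @ N # args \<tau>"
    by (induction \<sigma>s) (simp_all add: funs_def)
  let ?\<Delta> = "rev (args (pcf_ty (Byval_c \<sigma>s \<tau>))) @ \<Gamma>" and ?s = "length (args \<tau>)"
  have \<Delta>: "?\<Delta> = rev (args \<tau>) @ N # rev \<sigma>s @ funs \<sigma>s (N \<rightarrow> \<tau>) # \<Gamma>" by (simp add: args_funs')
  have 1: "list_all2 (good ?\<Delta>) (etas (args \<tau>) 0) (args \<tau>)"
    unfolding \<Delta> by (rule good_etas) (simp add: nth_append)
  have 2: "list_all2 (good ?\<Delta>) (etas \<sigma>s (?s + 1)) \<sigma>s"
    unfolding \<Delta> by (rule good_etas) (simp add: nth_append)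
  have "list_all2 (good ?\<Delta>) (etas \<sigma>s (?s + 1) @ num i # etas (args \<tau>) 0) (\<sigma>s @ N # args \<tau>)" for i
    using 1 2 by (intro list_all2_appendI list_all2_Cons[THEN iffD2] conjI good_num)
  then show ?thesis by (simp add: good_Lam Let_def args_funs' nth_append)
qed

lemma good_const: "(\<And>d. c = Ext d \<Longrightarrow> \<exists>\<sigma>s \<tau>. d = Byval_c \<sigma>s \<tau>) \<Longrightarrow> good \<Gamma> (den_const c) (const_ty pcf_ty c)"
proof (cases c)
  case (Ext d)
  assume "\<And>d. c = Ext d \<Longrightarrow> \<exists>\<sigma>s \<tau>. d = Byval_c \<sigma>s \<tau>"
  then show ?thesis using Ext good_byval by auto
qed (simp_all add: good_num good_Lam)

lemma index_nth: "map_of \<Gamma> x = Some \<sigma> \<Longrightarrow> index \<Gamma> x < length \<Gamma> \<and> snd (\<Gamma> ! index \<Gamma> x) = \<sigma>"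
  by (induction \<Gamma> x rule: index.induct) (auto split: if_splits)

text \<open>Leaves the added constants. \<open>Y\<close> on its own is infinitely nested, so the
  translations that use it are treated as wholes.\<close>

lemma good_den:
  assumes "wt_tm cty \<Gamma> M \<sigma>" and "\<And>d \<Gamma>. d \<in> set_tm M \<Longrightarrow> good (map snd \<Gamma>) (den \<Gamma> (tr d)) (cty d)"
  shows "good (map snd \<Gamma>) (den \<Gamma> (replace tr M)) \<sigma>"
  using assms
proof (induction rule: wt_tm.induct)
  case (1 \<Gamma> x \<sigma>)
  then show ?case using index_nth[OF 1(1)] by (auto intro: good_eta)
next
  case (2 \<Gamma> c)
  show ?case
  proof (cases c)
    case (Ext d)
    then show ?thesis using 2[of d] by simp
  qed (use good_const[of "CNum _" "map snd \<Gamma>"] good_const[of Suc_c "map snd \<Gamma>"]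
      good_const[of Pre_c "map snd \<Gamma>"] good_const[of Ifzero_c "map snd \<Gamma>"] in auto)
next
  case (3 \<Gamma> L \<sigma> \<tau> M)
  then show ?case by (auto intro: good_app)
next
  case (4 x \<sigma> \<Gamma> M \<tau>)
  then show ?case by (auto intro!: good_lam)
qed

section \<open>Evaluating denotations under substitutions\<close>

definition dn :: "subst \<Rightarrow> ctx \<Rightarrow> pcf tm \<Rightarrow> mproc" where
  "dn s \<Gamma> M = sub_proc s (emb_proc (den \<Gamma> M))"

text \<open>Variables denote their eta expansions, so a bound value is met in expanded form.
  Expansions are mostly carried along instead of being removed: they preserve reducibility, which is
  enough.\<close>

definition etav :: "ty \<Rightarrow> nat + mproc \<Rightarrow> mproc" where
  "etav \<sigma> v = sub_proc (\<lambda>_. v) (emb_proc (eta \<sigma> 0))"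

abbreviation etavs :: "ty list \<Rightarrow> (nat + mproc) list \<Rightarrow> mproc list" where
  "etavs \<equiv> map2 etav"

lemma sub_eta: "sub_proc s (emb_proc (eta \<sigma> i)) = etav \<sigma> (s i)"
proof -
  have "sub_proc s (emb_proc (eta \<sigma> i)) = sub_proc s (ren_proc (\<lambda>_. i) (emb_proc (eta \<sigma> 0)))"
    by (simp add: ren_emb_eta)
  then show ?thesis by (simp add: sub_ren etav_def comp_def)
qed

lemma etav_Inl: "etav \<sigma> (Inl y) = emb_proc (eta \<sigma> y)"
  using sub_eta[of Inl \<sigma> y] by simp

lemma sub_etav: "sub_proc s (etav \<sigma> v) = etav \<sigma> (sub_var s v)"
proof -
  have "s \<odot> (\<lambda>_. v) = (\<lambda>_. sub_var s v)" by (auto simp: comp_subst_def sub_var_def)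
  then show ?thesis by (simp add: etav_def sub_sub)
qed

lemma etav_cong: "beqv v w \<Longrightarrow> etav \<sigma> v \<simeq> etav \<sigma> w"
  unfolding etav_def by (rule nf_sub_cong) simp_all

lemma Red_etav: "Red \<sigma> \<Delta> v \<Longrightarrow> Red \<sigma> \<Delta> (Inr (etav \<sigma> v))"
  unfolding etav_def by (rule good_Red[of "[\<sigma>]"]) (simp_all add: good_eta Redsub_def)

lemma Reds_etavs: "Reds \<sigma>s \<Delta> vs \<Longrightarrow> Reds \<sigma>s \<Delta> (map Inr (etavs \<sigma>s vs))"
  by (auto simp: Reds_def list_all2_conv_all_nth Red_etav)

definition appv :: "nat + mproc \<Rightarrow> mproc list \<Rightarrow> mapp" where
  "appv v Qs = (case v of Inl y \<Rightarrow> MVar y Qs | Inr P \<Rightarrow> MApp P Qs)"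

lemma appv_simps [simp]: "appv (Inl y) Qs = MVar y Qs" "appv (Inr P) Qs = MApp P Qs"
  by (simp_all add: appv_def)

lemma sub_app_MVar: "sub_app s (MVar x Qs) = appv (s x) (map (sub_proc s) Qs)"
  by (simp add: appv_def)

lemma sub_etas:
  assumes "length vs = length \<sigma>s" "\<And>i. i < length \<sigma>s \<Longrightarrow> s (k + i) = rev vs ! i"
  shows "map (sub_proc s) (map emb_proc (etas \<sigma>s k)) = etavs \<sigma>s vs"
proof (rule nth_equalityI)
  fix i assume "i < length (map (sub_proc s) (map emb_proc (etas \<sigma>s k)))"
  then have i: "i < length \<sigma>s" by (simp add: etas_def)
  then have "length \<sigma>s - Suc i < length \<sigma>s" by linarith
  from assms(2)[OF this] i assms(1) have "s (k + length \<sigma>s - Suc i) = vs ! i" by (simp add: rev_nth)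
  then show "map (sub_proc s) (map emb_proc (etas \<sigma>s k)) ! i = etavs \<sigma>s vs ! i"
    using i assms(1) by (simp add: etas_def sub_eta rev_nth)
qed (simp add: etas_def assms(1))

lemma nf_body_cong: "P \<simeq> P' \<Longrightarrow> nf_exp (body P) = nf_exp (body P')"
  by (cases P; cases P') (simp add: MLam_beq)

lemma nf_MApp: "length Qs = length \<sigma>s \<Longrightarrow> P = MLam \<sigma>s B \<Longrightarrow>
    nf_exp (MCase (MApp P Qs) MNum) = nf_exp (body (mapps P Qs))"
  by (simp add: nf_exp_conv_nfs nfs_MApp)

lemma body_etav:
  assumes "length vs = length (args \<sigma>)"
  shows "body (mappsv (etav \<sigma> v) vs) = MCase (appv v (etavs (args \<sigma>) vs)) MNum"
proof -
  let ?r = "length (args \<sigma>)"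
  let ?s = "push vs (\<lambda>_. v)"
  have "etav \<sigma> v = MLam (args \<sigma>) (sub_exp (up_subst ?r (\<lambda>_. v)) (MCase (MVar ?r (map emb_proc (etas (args \<sigma>) 0))) MNum))"
    unfolding etav_def by (subst eta_unfold) (simp add: comp_def)
  then have "body (mappsv (etav \<sigma> v) vs) = sub_exp (push vs Inl) (sub_exp (up_subst ?r (\<lambda>_. v)) (MCase (MVar ?r (map emb_proc (etas (args \<sigma>) 0))) MNum))"
    using assms by (simp add: mappsv_full del: sub_simps)
  also have "\<dots> = sub_exp ?s (MCase (MVar ?r (map emb_proc (etas (args \<sigma>) 0))) MNum)"
  proof -
    have "push vs Inl \<odot> up_subst ?r (\<lambda>_. v) = ?s" using push_comp_up[of vs Inl "\<lambda>_. v"] assms by simp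
    then show ?thesis by (simp only: sub_sub)
  qed
  also have "\<dots> = MCase (appv v (etavs (args \<sigma>) vs)) MNum"
  proof -
    have "map (sub_proc ?s) (map emb_proc (etas (args \<sigma>) 0)) = etavs (args \<sigma>) vs"
      by (rule sub_etas[OF assms]) (simp add: push_def assms)
    then show ?thesis using assms by (simp add: sub_app_MVar comp_def del: sub_simps(6)) (simp add: push_def)
  qed
  finally show ?thesis .
qed

text \<open>Under full application the expansion of the head becomes an expansion of the
  arguments.\<close>

lemma nf_etav_app:
  assumes "length vs = length (args \<sigma>)" "P = MLam (args \<sigma>) B"
  shows "nf_exp (body (mappsv (etav \<sigma> (Inr P)) vs)) = nf_exp (body (mapps P (etavs (args \<sigma>) vs)))"
  using assms by (simp add: body_etav nf_MApp)

lemma etav_num: "P \<simeq> emb_proc (num k) \<Longrightarrow> etav N (Inr P) \<simeq> emb_proc (num k)"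
proof -
  assume "P \<simeq> emb_proc (num k)"
  then have "etav N (Inr P) \<simeq> etav N (Inr (emb_proc (num k)))" by (intro etav_cong) simp
  also have "\<dots> \<simeq> emb_proc (num k)"
    unfolding etav_def by (subst eta.simps) (simp add: num_def MLam_beq nf_exp_conv_nfs)
  finally show ?thesis .
qed

section \<open>Denotations applied to arguments\<close>

lemma dn_App: "dn s \<Gamma> (L \<bullet> M) \<simeq> mapp (dn s \<Gamma> L) (dn s \<Gamma> M)"
proof -
  have "sub_proc s (emb_proc (den \<Gamma> L \<cdot> den \<Gamma> M)) \<simeq> sub_proc s (mapp (emb_proc (den \<Gamma> L)) (emb_proc (den \<Gamma> M)))"
    by (rule nf_sub_cong) (simp_all add: emb_app_beq)
  then show ?thesis by (simp add: dn_def sub_mappv)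
qed

lemma dn_Con [simp]: "dn s \<Gamma> (Con c) = emb_proc (den_const c)"
  unfolding dn_def by (simp add: bnd_0_sub bnd_def ren_emb_const)

lemma mappv_dn_Abs: "mappv (dn s \<Gamma> (Abs x \<sigma> M)) v = dn (push [v] s) ((x, \<sigma>) # \<Gamma>) M"
proof (cases "den ((x, \<sigma>) # \<Gamma>) M")
  case (Lam \<tau>s e)
  have "sub_proc (push [v] Inl) (sub_proc (up_subst 1 s) (MLam \<tau>s (emb_exp e))) = sub_proc (push [v] s) (MLam \<tau>s (emb_exp e))"
    using push_comp_up[of "[v]" Inl s] by (simp only: sub_sub) simp
  then show ?thesis by (simp add: dn_def Lam up_subst_up)
qed

lemma mappsv_dn_abss: "length vs = length bs \<Longrightarrow> mappsv (dn s \<Gamma> (abss bs M)) vs = dn (push vs s) (rev bs @ \<Gamma>) M"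
proof (induction bs arbitrary: vs s \<Gamma>)
  case (Cons b bs)
  then obtain v ws where vs: "vs = v # ws" "length ws = length bs" by (cases vs) auto
  obtain x \<sigma> where b: "b = (x, \<sigma>)" by (cases b)
  have "mappsv (dn s \<Gamma> (abss (b # bs) M)) vs = mappsv (dn (push [v] s) (b # \<Gamma>) (abss bs M)) ws"
    by (simp add: vs b abss_def mappv_dn_Abs)
  also have "\<dots> = dn (push ws (push [v] s)) (rev bs @ b # \<Gamma>) M" by (rule Cons.IH[OF vs(2)])
  finally show ?case by (simp add: push_push vs)
qed (simp add: abss_def)

lemma dn_apps: "dn s \<Gamma> (apps M Ms) \<simeq> mapps (dn s \<Gamma> M) (map (dn s \<Gamma>) Ms)"
proof (induction Ms arbitrary: M)
  case (Cons K Ms)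
  have "dn s \<Gamma> (apps M (K # Ms)) = dn s \<Gamma> (apps (M \<bullet> K) Ms)" by (simp add: apps_def)
  also have "\<dots> \<simeq> mapps (dn s \<Gamma> (M \<bullet> K)) (map (dn s \<Gamma>) Ms)" by (rule Cons.IH)
  also have "\<dots> \<simeq> mapps (mapp (dn s \<Gamma> M) (dn s \<Gamma> K)) (map (dn s \<Gamma>) Ms)"
    by (rule mappsv_cong[OF dn_App]) (simp add: list_all2_refl)
  finally show ?case by simp
qed (simp add: apps_def)

lemma dn_App2: "dn s \<Gamma> (L \<bullet> M1 \<bullet> M2) \<simeq> mapps (dn s \<Gamma> L) [dn s \<Gamma> M1, dn s \<Gamma> M2]"
  using dn_apps[of s \<Gamma> L "[M1, M2]"] by (simp add: apps_def)

lemma dn_App3: "dn s \<Gamma> (L \<bullet> M1 \<bullet> M2 \<bullet> M3) \<simeq> mapps (dn s \<Gamma> L) [dn s \<Gamma> M1, dn s \<Gamma> M2, dn s \<Gamma> M3]"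
  using dn_apps[of s \<Gamma> L "[M1, M2, M3]"] by (simp add: apps_def)

lemma dn_App4: "dn s \<Gamma> (L \<bullet> M1 \<bullet> M2 \<bullet> M3 \<bullet> M4) \<simeq>
    mapps (dn s \<Gamma> L) [dn s \<Gamma> M1, dn s \<Gamma> M2, dn s \<Gamma> M3, dn s \<Gamma> M4]"
  using dn_apps[of s \<Gamma> L "[M1, M2, M3, M4]"] by (simp add: apps_def)

lemma dn_Var: "dn s \<Gamma> (Var x) = etav (the (map_of \<Gamma> x)) (s (index \<Gamma> x))"
  by (simp add: dn_def sub_eta)

lemma index_distinct: "distinct (map fst l) \<Longrightarrow> i < length l \<Longrightarrow>
    index (l @ \<Gamma>) (fst (l ! i)) = i \<and> map_of (l @ \<Gamma>) (fst (l ! i)) = Some (snd (l ! i))"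
proof (induction l arbitrary: i)
  case (Cons b l)
  then show ?case by (cases i; cases b) auto
qed simp

lemma dn_Var_push:
  assumes "distinct (map fst bs)" "length vs = length bs" "j < length bs"
  shows "dn (push vs s) (rev bs @ \<Gamma>) (Var (fst (bs ! j))) = etav (snd (bs ! j)) (vs ! j)"
proof -
  let ?i = "length bs - Suc j"
  have i: "?i < length bs" using assms(3) by linarith
  then have b: "rev bs ! ?i = bs ! j" using assms(3) by (simp add: rev_nth)
  have "index (rev bs @ \<Gamma>) (fst (bs ! j)) = ?i \<and> map_of (rev bs @ \<Gamma>) (fst (bs ! j)) = Some (snd (bs ! j))"
    using index_distinct[of "rev bs" ?i \<Gamma>] assms(1) i b by (simp add: rev_map[symmetric])
  moreover have "push vs s ?i = vs ! j" using assms i by (simp add: push_def rev_nth)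
  ultimately show ?thesis by (simp add: dn_Var)
qed

section \<open>Evaluation equations for the constants\<close>

lemma emb_byval: "emb_proc (den_const (Ext (Byval_c \<sigma>s \<tau>))) = MLam (funs \<sigma>s (N \<rightarrow> \<tau>) # \<sigma>s @ N # args \<tau>)
    (MCase (MVar (length (args \<tau>)) [])
      (\<lambda>i. MCase (MVar (length (args \<tau>) + 1 + length \<sigma>s)
        (map emb_proc (etas \<sigma>s (length (args \<tau>) + 1)) @ emb_proc (num i) # map emb_proc (etas (args \<tau>) 0))) MNum))"
  by (simp add: Let_def comp_def)

lemma body_byval:
  assumes "length vs = length \<sigma>s" "length ws = length (args \<tau>)"
  shows "body (mappsv (emb_proc (den_const (Ext (Byval_c \<sigma>s \<tau>)))) (g # vs @ a # ws)) =
    MCase (appv a []) (\<lambda>i. MCase (appv g (etavs \<sigma>s vs @ emb_proc (num i) # etavs (args \<tau>) ws)) MNum)"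
proof -
  let ?s = "push (g # vs @ a # ws) Inl" and ?n = "length (args \<tau>)"
  have "map (sub_proc ?s) (map emb_proc (etas \<sigma>s (?n + 1))) = etavs \<sigma>s vs"
    by (rule sub_etas[OF assms(1)]) (simp add: push_def nth_append assms)
  moreover have "map (sub_proc ?s) (map emb_proc (etas (args \<tau>) 0)) = etavs (args \<tau>) ws"
    by (rule sub_etas[OF assms(2)]) (simp add: push_def nth_append assms)
  moreover have "?s ?n = a" "?s (?n + 1 + length \<sigma>s) = g" by (simp_all add: push_def nth_append assms)
  moreover have "mappsv (emb_proc (den_const (Ext (Byval_c \<sigma>s \<tau>)))) (g # vs @ a # ws) =
    MLam [] (sub_exp ?s (body (emb_proc (den_const (Ext (Byval_c \<sigma>s \<tau>))))))"
    unfolding emb_byval by (subst mappsv_full) (simp_all add: assms del: sub_simps mappsv_simps)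
  ultimately show ?thesis unfolding emb_byval
    by (simp add: sub_app_MVar comp_def del: sub_simps(6) mappsv_simps)
qed

text \<open>An argument that evaluates to a number reaches \<open>G\<close> as the numeral itself,
  so its own structure is not nested into the call.\<close>

lemma nf_byval:
  assumes "length vs = length \<sigma>s" "length ws = length (args \<tau>)" "A \<simeq> emb_proc (num k)"
    and G: "G = MLam (\<sigma>s @ N # args \<tau>) B"
  shows "nf_exp (body (mappsv (emb_proc (den_const (Ext (Byval_c \<sigma>s \<tau>)))) (Inr G # vs @ Inr A # ws))) =
    nf_exp (body (mapps G (etavs \<sigma>s vs @ emb_proc (num k) # etavs (args \<tau>) ws)))"
proof -
  let ?F = "\<lambda>i. MCase (MApp G (etavs \<sigma>s vs @ emb_proc (num i) # etavs (args \<tau>) ws)) MNum"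
  have "nf_exp (MCase (MApp A []) ?F) = nf_exp (MCase (MApp (emb_proc (num k)) []) ?F)"
    by (rule nf_MApp_cong[OF assms(3)]) simp_all
  also have "\<dots> = nf_exp (?F k)" by (simp add: num_def nf_exp_conv_nfs)
  also have "\<dots> = nf_exp (body (mapps G (etavs \<sigma>s vs @ emb_proc (num k) # etavs (args \<tau>) ws)))"
    by (rule nf_MApp[OF _ G]) (simp add: assms)
  finally show ?thesis using body_byval[OF assms(1,2), of "Inr G" "Inr A"] by simp
qed

lemma sub_fix: "sub_proc s (emb_proc (fix_proc \<sigma> k)) = sub_proc (\<lambda>_. s k) (emb_proc (fix_proc \<sigma> 0))"
proof -
  have "sub_proc s (emb_proc (fix_proc \<sigma> k)) = sub_proc s (ren_proc (\<lambda>_. k) (emb_proc (fix_proc \<sigma> 0)))"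
    by (simp add: ren_emb_fix_proc)
  then show ?thesis by (simp add: sub_ren comp_def)
qed

definition Yp :: "ty \<Rightarrow> mproc \<Rightarrow> mproc" where
  "Yp \<sigma> P = mapp (emb_proc (den_const (Ext (Y_c \<sigma>)))) P"

lemma emb_Y: "emb_proc (den_const (Ext (Y_c \<sigma>))) = MLam ((\<sigma> \<rightarrow> \<sigma>) # args \<sigma>)
    (MCase (MVar (length (args \<sigma>)) (emb_proc (fix_proc \<sigma> (length (args \<sigma>))) # map emb_proc (etas (args \<sigma>) 0))) MNum)"
  by (simp add: Let_def comp_def)

lemma Yp_conv: "Yp \<sigma> P = sub_proc (\<lambda>_. Inr P) (emb_proc (fix_proc \<sigma> 0))"
proof -
  have "Yp \<sigma> P = sub_proc (push [Inr P] Inl) (emb_proc (fix_proc \<sigma> 0))"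
    unfolding Yp_def emb_Y mappv.simps by (subst emb_fix_proc[of \<sigma> 0]) simp
  also have "\<dots> = sub_proc (\<lambda>_. Inr P) (emb_proc (fix_proc \<sigma> 0))"
    using sub_fix[of "push [Inr P] Inl" \<sigma> 0] by (simp add: push_def)
  finally show ?thesis .
qed

lemma Yp_MLam: "\<exists>B. Yp \<sigma> P = MLam (args \<sigma>) B"
  unfolding Yp_def emb_Y by simp

lemma sub_Yp: "sub_proc s (Yp \<sigma> P) = Yp \<sigma> (sub_proc s P)"
  unfolding Yp_def by (simp add: sub_mappv bnd_0_sub bnd_def ren_emb_const del: den_const.simps)

text \<open>One unfolding of the fixed point. The shape of \<open>P\<close> ensures that the beta
  step finds the right number of arguments.\<close>

lemma nf_Yp:
  assumes "length vs = length (args \<sigma>)" "P = MLam (\<sigma> # args \<sigma>) B"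
  shows "nf_exp (body (mappsv (Yp \<sigma> P) vs)) = nf_exp (body (mapps P (Yp \<sigma> P # etavs (args \<sigma>) vs)))"
proof -
  let ?s = "push (Inr P # vs) Inl" and ?r = "length (args \<sigma>)"
  have "mappsv (Yp \<sigma> P) vs = mappsv (emb_proc (den_const (Ext (Y_c \<sigma>)))) (Inr P # vs)"
    by (simp add: Yp_def)
  also have "\<dots> = MLam [] (sub_exp ?s (body (emb_proc (den_const (Ext (Y_c \<sigma>))))))"
    unfolding emb_Y by (subst mappsv_full) (simp_all add: assms del: sub_simps mappsv_simps)
  finally have *: "body (mappsv (Yp \<sigma> P) vs) = sub_exp ?s (body (emb_proc (den_const (Ext (Y_c \<sigma>)))))" by simp
  have "?s ?r = Inr P" by (simp add: push_def nth_append assms)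
  moreover from this have "sub_proc ?s (emb_proc (fix_proc \<sigma> ?r)) = Yp \<sigma> P"
    using sub_fix[of ?s \<sigma> ?r] by (simp add: Yp_conv)
  moreover have "map (sub_proc ?s) (map emb_proc (etas (args \<sigma>) 0)) = etavs (args \<sigma>) vs"
    by (rule sub_etas[OF assms(1)]) (simp add: push_def nth_append assms)
  ultimately have "body (mappsv (Yp \<sigma> P) vs) = MCase (MApp P (Yp \<sigma> P # etavs (args \<sigma>) vs)) MNum"
    unfolding * emb_Y by (simp add: sub_app_MVar comp_def del: sub_simps(6))
  then show ?thesis using nf_MApp[OF _ assms(2), of "Yp \<sigma> P # etavs (args \<sigma>) vs"] assms(1) by simp
qed

abbreviation ifz :: mproc where
  "ifz \<equiv> emb_proc (den_const Ifzero_c)"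

lemma body_ifz: "body (mapps ifz [A, B, C]) =
    MCase (MApp A []) (\<lambda>i. if i = 0 then MCase (MApp B []) MNum else MCase (MApp C []) MNum)"
proof -
  have "mapps ifz [A, B, C] = MLam [] (sub_exp (push [Inr A, Inr B, Inr C] Inl) (body ifz))"
    by (simp add: mappsv_full del: mappsv_simps)
  then show ?thesis by (simp add: push_def fun_eq_iff)
qed

lemma nf_ifz:
  assumes "A = MLam [] A'" "B = MLam [] B'" "C = MLam [] C'"
  shows "nf_exp (body (mapps ifz [A, B, C])) = nfs (A', [\<lambda>i. if i = 0 then B' else C'])"
proof -
  have "nfs (if i = 0 then MCase (MApp B []) MNum else MCase (MApp C []) MNum, []) = nfs (if i = 0 then B' else C', [])" for i :: nat
    by (simp add: assms nf_exp_conv_nfs)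
  then show ?thesis unfolding body_ifz nf_exp_conv_nfs assms(1) nfs_MApp_Nil by (intro nfs_cong) auto
qed

lemma zname_inj: "zname i = zname j \<Longrightarrow> i = j"
  by (auto simp: zname_def dest: arg_cong[of _ _ length])

lemma distinct_znames: "distinct ([''n'', ''x'', ''y''] @ map zname [0..<r])"
  by (auto simp: distinct_map inj_on_def dest: zname_inj) (auto simp: zname_def)

text \<open>The eta expansions come from the interpretation of variables.\<close>

lemma ifzero_at_app:
  assumes "length ws = length (args \<sigma>)"
  shows "mappsv (dn s \<Gamma> (ifzero_at \<sigma>)) ([a, b, c] @ ws) \<simeq>
    mapps ifz [etav N a, mapps (etav \<sigma> b) (etavs (args \<sigma>) ws), mapps (etav \<sigma> c) (etavs (args \<sigma>) ws)]"
proof -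
  let ?r = "length (args \<sigma>)"
  define ns where "ns = map zname [0..<?r]"
  define bs where "bs = [(''n'', N), (''x'', \<sigma>), (''y'', \<sigma>)] @ zip ns (args \<sigma>)"
  define vs where "vs = [a, b, c] @ ws"
  define D where "D = dn (push vs s) (rev bs @ \<Gamma>)"
  have len: "length ns = ?r" by (simp add: ns_def)
  have d: "distinct (map fst bs)" using distinct_znames[of ?r] by (simp add: bs_def len flip: ns_def)
  have l: "length vs = length bs" using assms by (simp add: vs_def bs_def len)
  have n: "D (Var ''n'') = etav N a" "D (Var ''x'') = etav \<sigma> b" "D (Var ''y'') = etav \<sigma> c"
    using dn_Var_push[OF d l, of 0 s \<Gamma>] dn_Var_push[OF d l, of 1 s \<Gamma>] dn_Var_push[OF d l, of 2 s \<Gamma>]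
    by (simp_all add: D_def) (simp_all add: bs_def vs_def)
  have "D (Var (ns ! i)) = etav (args \<sigma> ! i) (ws ! i)" if "i < ?r" for i
    using dn_Var_push[OF d l, of "3 + i" s \<Gamma>] that assms unfolding D_def[symmetric]
    by (simp add: bs_def vs_def len)
  then have z: "map D (map Var ns) = etavs (args \<sigma>) ws"
    using assms by (auto intro!: nth_equalityI simp: len)
  have 1: "mappsv (dn s \<Gamma> (ifzero_at \<sigma>)) vs =
    D (Con Ifzero_c \<bullet> Var ''n'' \<bullet> apps (Var ''x'') (map Var ns) \<bullet> apps (Var ''y'') (map Var ns))"
    unfolding ifzero_at_def Let_def D_def ns_def[symmetric] bs_def[symmetric] by (rule mappsv_dn_abss[OF l])
  have 2: "D (Con Ifzero_c \<bullet> Var ''n'' \<bullet> apps (Var ''x'') (map Var ns) \<bullet> apps (Var ''y'') (map Var ns)) \<simeq>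
    mapps (D (Con Ifzero_c)) [D (Var ''n''), D (apps (Var ''x'') (map Var ns)), D (apps (Var ''y'') (map Var ns))]"
    unfolding D_def by (rule dn_App3)
  have 3: "mapps (D (Con Ifzero_c)) [D (Var ''n''), D (apps (Var ''x'') (map Var ns)), D (apps (Var ''y'') (map Var ns))] \<simeq>
    mapps ifz [etav N a, mapps (etav \<sigma> b) (etavs (args \<sigma>) ws), mapps (etav \<sigma> c) (etavs (args \<sigma>) ws)]"
  proof -
    have dn: "D (apps (Var x) (map Var ns)) \<simeq> mapps (D (Var x)) (map D (map Var ns))" for x
      unfolding D_def by (rule dn_apps)
    have ifz: "D (Con Ifzero_c) = ifz" using dn_Con D_def by metis
    have x: "D (apps (Var ''x'') (map Var ns)) \<simeq> mapps (etav \<sigma> b) (etavs (args \<sigma>) ws)"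
      using dn[of "''x''"] by (simp only: n z)
    have y: "D (apps (Var ''y'') (map Var ns)) \<simeq> mapps (etav \<sigma> c) (etavs (args \<sigma>) ws)"
      using dn[of "''y''"] by (simp only: n z)
    have l: "list_all2 beqv (map Inr [D (Var ''n''), D (apps (Var ''x'') (map Var ns)), D (apps (Var ''y'') (map Var ns))])
      (map Inr [etav N a, mapps (etav \<sigma> b) (etavs (args \<sigma>) ws), mapps (etav \<sigma> c) (etavs (args \<sigma>) ws)])"
      by (simp only: list.map list_all2_Cons list_all2_Nil beqv_simps x y n beq_refl simp_thms)
    show ?thesis unfolding ifz by (rule mappsv_cong[OF beq_refl l])
  qed
  from beq_trans[OF 2 3] show ?thesis unfolding vs_def[symmetric] 1 .
qed

lemma etav_MLam: "\<exists>B. etav \<sigma> v = MLam (args \<sigma>) B"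
  unfolding etav_def by (subst eta.simps) simp

lemma mapps_MLam_Nil: "P = MLam \<sigma>s B \<Longrightarrow> length vs = length \<sigma>s \<Longrightarrow> mappsv P vs = MLam [] (body (mappsv P vs))"
  by (simp add: mappsv_full)

lemma nf_ifzero_at:
  assumes "length ws = length (args \<sigma>)"
  shows "nf_exp (body (mappsv (dn s \<Gamma> (ifzero_at \<sigma>)) ([a, b, c] @ ws))) =
    nfs (body (etav N a), [\<lambda>i. if i = 0 then body (mapps (etav \<sigma> b) (etavs (args \<sigma>) ws))
      else body (mapps (etav \<sigma> c) (etavs (args \<sigma>) ws))])"
proof -
  have e: "mapps (etav \<sigma> b) (etavs (args \<sigma>) ws) = MLam [] (body (mapps (etav \<sigma> b) (etavs (args \<sigma>) ws)))" for b
    using etav_MLam[of \<sigma> b] assms by (auto intro!: mapps_MLam_Nil)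
  have n: "etav N a = MLam [] (body (etav N a))" using etav_MLam[of N a] by auto
  show ?thesis unfolding nf_body_cong[OF ifzero_at_app[OF assms]] by (rule nf_ifz[OF n e e])
qed

lemma nf_ifzero_at_num:
  assumes "length ws = length (args \<sigma>)" "A \<simeq> emb_proc (num k)"
  shows "nf_exp (body (mappsv (dn s \<Gamma> (ifzero_at \<sigma>)) ([Inr A, b, c] @ ws))) =
    nf_exp (body (mapps (etav \<sigma> (if k = 0 then b else c)) (etavs (args \<sigma>) ws)))"
proof -
  have "nf_exp (body (etav N (Inr A))) = nf_exp (MNum k)"
    using nf_body_cong[OF etav_num[OF assms(2)]] by (simp add: num_def)
  then have "nfs (body (etav N (Inr A)), [F]) = nfs (MNum k, [F])" for F by (rule nfs_cong) simp
  then show ?thesis unfolding nf_ifzero_at[OF assms(1)] by (simp add: nf_exp_conv_nfs)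
qed

lemma RedI:
  assumes "P = MLam (args \<sigma>) B" "\<And>\<Theta> \<rho> vs. renok \<Delta> \<rho> \<Theta> \<Longrightarrow> Reds (args \<sigma>) \<Theta> vs \<Longrightarrow>
    gexp \<Theta> (nf_exp (body (mappsv (sub_proc (Inl \<circ> \<rho>) P) vs)))"
  shows "Red \<sigma> \<Delta> (Inr P)"
proof -
  have "gexp \<Theta> (nf_exp (sub_exp (push vs (Inl \<circ> \<rho>)) B))" if "renok \<Delta> \<rho> \<Theta>" "Reds (args \<sigma>) \<Theta> vs" for \<Theta> \<rho> vs
    using assms(2)[OF that] push_comp_up[of vs Inl "Inl \<circ> \<rho>"] Reds_length[OF that(2)]
    by (simp add: assms(1) mappsv_full sub_sub)
  then show ?thesis using assms(1) by (auto simp: Red_Inr)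
qed

lemma Red_body: "Red \<sigma> \<Delta> (Inr P) \<Longrightarrow> Reds (args \<sigma>) \<Delta> vs \<Longrightarrow> gexp \<Delta> (nf_exp (body (mappsv P vs)))"
proof -
  assume r: "Red \<sigma> \<Delta> (Inr P)" "Reds (args \<sigma>) \<Delta> vs"
  then obtain B where B: "P = MLam (args \<sigma>) B"
    "\<And>\<Theta> \<rho> vs. renok \<Delta> \<rho> \<Theta> \<Longrightarrow> Reds (args \<sigma>) \<Theta> vs \<Longrightarrow> gexp \<Theta> (nf_exp (sub_exp (push vs (Inl \<circ> \<rho>)) B))"
    by (auto simp: Red_Inr)
  from B(2)[OF renok_id r(2)] show ?thesis using B(1) Reds_length[OF r(2)] by (simp add: mappsv_full id_def comp_def)
qed

lemma good_nfI:
  assumes "P = MLam (args \<sigma>) B"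
    and "gexp (rev (args \<sigma>) @ \<Gamma>) (nf_exp (body (mappsv (sub_proc (Inl \<circ> (\<lambda>i. i + length (args \<sigma>))) P)
      (map Inl (rev [0..<length (args \<sigma>)])))))"
  shows "good \<Gamma> (nf_proc P) \<sigma>"
proof -
  let ?r = "length (args \<sigma>)"
  have p: "push (map Inl (rev [0..<?r])) (Inl \<circ> (\<lambda>i. i + ?r)) = Inl"
    by (auto simp: push_def fun_eq_iff rev_map)
  have "body (mappsv (sub_proc (Inl \<circ> (\<lambda>i. i + ?r)) P) (map Inl (rev [0..<?r]))) = B"
    using push_comp_up[of "map Inl (rev [0..<?r])" Inl "Inl \<circ> (\<lambda>i. i + ?r)"] p
    by (simp add: assms(1) mappsv_full sub_sub)
  then show ?thesis using assms by (simp add: good_Lam)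
qed

section \<open>Primitive recursion, minimization and iteration\<close>

declare den_const.simps(5,6) [simp del]

text \<open>The outer block of a denotation can be computed along the term without typing. This
  provides the shapes \<open>MLam \<sigma>s B\<close> that the evaluation equations require.\<close>

definition bds :: "proc \<Rightarrow> ty list" where
  "bds p = (case p of Lam \<sigma>s e \<Rightarrow> \<sigma>s)"

lemma bds_Lam [simp]: "bds (Lam \<sigma>s e) = \<sigma>s"
  by (simp add: bds_def)

lemma bds_app [simp]: "bds (p \<cdot> q) = tl (bds p)"
  by (cases "(p, q)" rule: nsp_app.cases) auto

lemma bds_lam [simp]: "bds (lam \<sigma> p) = \<sigma> # bds p"
  by (cases p) simp

lemma bds_eta [simp]: "bds (eta \<sigma> x) = args \<sigma>"
  by (subst eta.simps) simp

lemma bds_abss: "bds (den \<Gamma> (abss bs M)) = map snd bs @ bds (den (rev bs @ \<Gamma>) M)"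
  by (induction bs arbitrary: \<Gamma>) (auto simp: abss_def)

lemma bds_ifzero_at [simp]: "bds (den \<Gamma> (ifzero_at \<sigma>)) = N # \<sigma> # \<sigma> # args \<sigma>"
  by (simp add: ifzero_at_def Let_def bds_abss)

lemma dn_MLam: "bds (den \<Gamma> M) = \<sigma>s \<Longrightarrow> \<exists>B. dn s \<Gamma> M = MLam \<sigma>s B"
  by (cases "den \<Gamma> M") (simp add: dn_def)

lemma dn_Inl: "dn Inl \<Gamma> M = emb_proc (den \<Gamma> M)"
  by (simp add: dn_def)

lemma sub_const [simp]: "sub_proc s (emb_proc (den_const c)) = emb_proc (den_const c)"
  by (simp add: bnd_0_sub bnd_def ren_emb_const)

lemma den_append: "fv M \<subseteq> fst ` set \<Gamma> \<Longrightarrow> den (\<Gamma> @ \<Gamma>') M = den \<Gamma> M"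
proof (induction M arbitrary: \<Gamma>)
  case (Var x)
  then have "map_of (\<Gamma> @ \<Gamma>') x = map_of \<Gamma> x \<and> index (\<Gamma> @ \<Gamma>') x = index \<Gamma> x"
    by (induction \<Gamma> x rule: index.induct) auto
  then show ?case by simp
next
  case (Abs x \<sigma> M)
  have "fv M \<subseteq> fst ` set ((x, \<sigma>) # \<Gamma>)" using Abs.prems by auto
  from Abs.IH[OF this] show ?case by simp
qed auto

lemma good_closed_term:
  assumes "good [] (den [] M) \<sigma>" "fv M = {}" shows "good \<Delta> (den \<Gamma> M) \<sigma>"
  using good_weaken[OF assms(1), of \<Delta>] den_append[of M "[]" \<Gamma>] assms(2) by simp

lemma pre_num: "A \<simeq> emb_proc (num k) \<Longrightarrow> mapp (emb_proc (den_const Pre_c)) A \<simeq> emb_proc (num (k - 1))"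
proof -
  assume "A \<simeq> emb_proc (num k)"
  then have "mapp (emb_proc (den_const Pre_c)) A \<simeq> mapp (emb_proc (den_const Pre_c)) (emb_proc (num k))"
    by (intro mappv_cong) simp_all
  also have "\<dots> \<simeq> emb_proc (num (k - 1))"
    by (simp add: num_def MLam_beq push_def nf_exp_conv_nfs)
  finally show ?thesis .
qed

lemma suc_num: "A \<simeq> emb_proc (num k) \<Longrightarrow> mapp (emb_proc (den_const Suc_c)) A \<simeq> emb_proc (num (Suc k))"
proof -
  assume "A \<simeq> emb_proc (num k)"
  then have "mapp (emb_proc (den_const Suc_c)) A \<simeq> mapp (emb_proc (den_const Suc_c)) (emb_proc (num k))"
    by (intro mappv_cong) simp_all
  also have "\<dots> \<simeq> emb_proc (num (Suc k))"
    by (simp add: num_def MLam_beq push_def nf_exp_conv_nfs)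
  finally show ?thesis .
qed

lemma beqv_refl_list [simp]: "list_all2 beqv vs vs"
  by (simp add: list_all2_refl)

lemma nf_mappsv_cong: "P \<simeq> P' \<Longrightarrow> nf_exp (body (mappsv P vs)) = nf_exp (body (mappsv P' vs))"
  by (intro nf_body_cong mappsv_cong) simp_all

subsection \<open>Primitive recursion\<close>

context
  fixes \<sigma> :: ty
begin

abbreviation (input) "\<phi>t \<equiv> \<sigma> \<rightarrow> N \<rightarrow> \<sigma>"

abbreviation (input) "bv \<equiv> emb_proc (den_const (Ext (Byval_c [\<sigma>, \<phi>t] \<sigma>)))"

definition rec_ctx :: ctx where
  "rec_ctx = [(''r'', rec_ty \<sigma>), (''x'', \<sigma>), (''f'', \<phi>t), (''n'', N)]"

definition rec_call :: "pcf tm" where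
  "rec_call = byval_plus \<sigma> \<bullet> Var ''r'' \<bullet> Var ''x'' \<bullet> Var ''f'' \<bullet> Var ''m''"

definition rec_step :: "pcf tm" where
  "rec_step = byval_tm [] \<sigma> \<bullet> Abs ''m'' N (Var ''f'' \<bullet> rec_call \<bullet> Var ''m'') \<bullet> (Con Pre_c \<bullet> Var ''n'')"

definition rec_body :: "pcf tm" where
  "rec_body = ifzero_at \<sigma> \<bullet> Var ''n'' \<bullet> Var ''x'' \<bullet> rec_step"

lemma Rec_tm_conv: "Rec_tm \<sigma> = byval_plus \<sigma> \<bullet> (Y_tm (rec_ty \<sigma>) \<bullet> abss rec_ctx rec_body)"
  by (simp add: Rec_tm_def rec_ctx_def rec_body_def rec_step_def rec_call_def)

lemma args_rec_ty: "args (rec_ty \<sigma>) = \<sigma> # \<phi>t # N # args \<sigma>"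
  by (simp add: rec_ty_def)

definition rec_h :: mproc where
  "rec_h = emb_proc (den [] (abss rec_ctx rec_body))"

definition rec_Y :: mproc where
  "rec_Y = Yp (rec_ty \<sigma>) rec_h"

lemma fv_ifzero_at: "fv (ifzero_at \<sigma>) = {}"
proof -
  have 1: "fv (abss bs M) = fv M - fst ` set bs" for bs and M :: "'c tm"
    by (induction bs) (auto simp: abss_def)
  have 2: "fv (apps M Ms) = fv M \<union> \<Union> (fv ` set Ms)" for M :: "'c tm" and Ms
    by (induction Ms arbitrary: M) (auto simp: apps_def)
  have "fst ` set (zip (map zname [0..<length (args \<sigma>)]) (args \<sigma>)) = set (map zname [0..<length (args \<sigma>)])"
    by (subst set_map[symmetric], subst map_fst_zip) simp_all
  then show ?thesis unfolding ifzero_at_def Let_def 1 set_append image_Un by (auto simp: 2)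
qed

lemma fv_rec: "fv (abss rec_ctx rec_body) = {}"
  by (simp add: abss_def rec_ctx_def rec_body_def rec_step_def rec_call_def fv_ifzero_at) auto

lemma sub_rec_Y [simp]: "sub_proc s rec_Y = rec_Y"
proof -
  have "bnd 0 rec_h" unfolding rec_h_def using bnd_den[of "abss rec_ctx rec_body" "[]"] fv_rec by simp
  then show ?thesis by (simp add: rec_Y_def sub_Yp bnd_0_sub)
qed

lemma bv_MLam: "length vs = 4 \<Longrightarrow> \<exists>B. mappsv bv vs = MLam (args \<sigma>) B"
  unfolding emb_byval using mappsv_MLam[of vs "[funs [\<sigma>, \<phi>t] (N \<rightarrow> \<sigma>), \<sigma>, \<phi>t, N]" "args \<sigma>"] by auto

lemma nf_bv:
  assumes "length ws = length (args \<sigma>)" "A \<simeq> emb_proc (num k)"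
  shows "nf_exp (body (mappsv bv ([Inr (etav (rec_ty \<sigma>) (Inr rec_Y)), x, f, Inr A] @ ws))) =
    nf_exp (body (mapps rec_Y (etavs (args (rec_ty \<sigma>)) (map Inr (etavs [\<sigma>, \<phi>t] [x, f] @ emb_proc (num k) # etavs (args \<sigma>) ws)))))"
proof -
  obtain B where "etav (rec_ty \<sigma>) (Inr rec_Y) = MLam (args (rec_ty \<sigma>)) B" using etav_MLam by blast
  then have B: "etav (rec_ty \<sigma>) (Inr rec_Y) = MLam ([\<sigma>, \<phi>t] @ N # args \<sigma>) B" by (simp add: args_rec_ty)
  obtain B' where "rec_Y = MLam (args (rec_ty \<sigma>)) B'" using Yp_MLam unfolding rec_Y_def by blast
  from nf_etav_app[OF _ this, of "map Inr (etavs [\<sigma>, \<phi>t] [x, f] @ emb_proc (num k) # etavs (args \<sigma>) ws)"]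
    nf_byval[OF _ assms B, of "[x, f]"] assms(1)
  show ?thesis by (simp add: args_rec_ty del: mappsv_simps)
qed

text \<open>By induction on \<open>k\<close>: \<open>byval\<close> turns the argument of the recursive call into a numeral before
  the call, and it is smaller than \<open>k\<close>.\<close>

lemma gexp_rec:
  "Red \<sigma> \<Delta> x \<Longrightarrow> Red \<phi>t \<Delta> f \<Longrightarrow> A \<simeq> emb_proc (num k) \<Longrightarrow> Reds (args \<sigma>) \<Delta> ws \<Longrightarrow>
    gexp \<Delta> (nf_exp (body (mappsv rec_Y (x # f # Inr A # ws))))"
proof (induction k arbitrary: \<Delta> x f A ws rule: less_induct)
  case (less k)
  have lws: "length ws = length (args \<sigma>)" using less.prems(4) by (rule Reds_length)
  let ?x = "etav \<sigma> x" and ?f = "etav \<phi>t f" and ?A = "etav N (Inr A)"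
  define ws1 :: "(nat + mproc) list" where "ws1 = map Inr (etavs (args \<sigma>) ws)"
  have ws1: "Reds (args \<sigma>) \<Delta> ws1" unfolding ws1_def by (rule Reds_etavs[OF less.prems(4)])
  have lws1: "length ws1 = length (args \<sigma>)" using ws1 by (rule Reds_length)
  have Rx: "Red \<sigma> \<Delta> (Inr ?x)" and Rf: "Red \<phi>t \<Delta> (Inr ?f)" using less.prems by (auto intro: Red_etav)
  have A: "?A \<simeq> emb_proc (num k)" using less.prems(3) by (rule etav_num)
  define vs :: "(nat + mproc) list" where "vs = [Inr rec_Y, Inr ?x, Inr ?f, Inr ?A]"
  define D where "D = dn (push vs Inl) (rev rec_ctx @ [])"
  have dc: "distinct (map fst rec_ctx)" "length vs = length rec_ctx" by (simp_all add: rec_ctx_def vs_def)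
  have Dv: "D (Var ''x'') = etav \<sigma> (Inr ?x)" "D (Var ''n'') = etav N (Inr ?A)"
    using dn_Var_push[OF dc, of 1 Inl "[]"] dn_Var_push[OF dc, of 3 Inl "[]"]
    unfolding D_def[symmetric] by (simp_all add: rec_ctx_def vs_def)
  have n: "D (Var ''n'') \<simeq> emb_proc (num k)" unfolding Dv by (rule etav_num[OF A])
  have "bds (den [] (abss rec_ctx rec_body)) = rec_ty \<sigma> # args (rec_ty \<sigma>)"
    by (simp add: bds_abss rec_ctx_def rec_body_def args_rec_ty)
  then obtain B where B: "rec_h = MLam (rec_ty \<sigma> # args (rec_ty \<sigma>)) B"
    using dn_MLam[of "[]" _ _ Inl] unfolding rec_h_def dn_Inl by blast
  have "nf_exp (body (mappsv rec_Y (x # f # Inr A # ws))) =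
      nf_exp (body (mapps rec_h (rec_Y # etavs (args (rec_ty \<sigma>)) (x # f # Inr A # ws))))"
    unfolding rec_Y_def by (rule nf_Yp[OF _ B]) (simp add: args_rec_ty lws)
  also have "mapps rec_h (rec_Y # etavs (args (rec_ty \<sigma>)) (x # f # Inr A # ws)) = mappsv (mappsv rec_h vs) ws1"
    by (simp add: args_rec_ty vs_def ws1_def)
  also have "mappsv rec_h vs = D rec_body"
    unfolding rec_h_def D_def using mappsv_dn_abss[OF dc(2), of Inl "[]" rec_body] by (simp add: dn_Inl)
  also have "nf_exp (body (mappsv (D rec_body) ws1)) =
      nf_exp (body (mappsv (mapps (D (ifzero_at \<sigma>)) [D (Var ''n''), D (Var ''x''), D rec_step]) ws1))"
    unfolding rec_body_def by (rule nf_mappsv_cong) (unfold D_def, rule dn_App3)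
  also have "\<dots> = nf_exp (body (mappsv (D (ifzero_at \<sigma>)) ([Inr (D (Var ''n'')), Inr (D (Var ''x'')), Inr (D rec_step)] @ ws1)))"
    by simp
  also have "\<dots> = nf_exp (body (mapps (etav \<sigma> (if k = 0 then Inr (D (Var ''x'')) else Inr (D rec_step))) (etavs (args \<sigma>) ws1)))"
    using n unfolding D_def by (intro nf_ifzero_at_num[OF lws1])
  finally have eq: "nf_exp (body (mappsv rec_Y (x # f # Inr A # ws))) = \<dots>" .
  show ?case
  proof (cases k)
    case 0
    have "Red \<sigma> \<Delta> (Inr (etav \<sigma> (Inr (D (Var ''x'')))))" unfolding Dv by (intro Red_etav Rx)
    from Red_body[OF this Reds_etavs[OF ws1]] show ?thesis unfolding eq using 0 by simp
  next
    case (Suc j)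
    \<comment> \<open>Each further layer of expansion comes from a variable or a constant through
      which the remaining arguments pass.\<close>
    define ws2 :: "(nat + mproc) list" where "ws2 = map Inr (etavs (args \<sigma>) ws1)"
    define ws3 :: "(nat + mproc) list" where "ws3 = map Inr (etavs (args \<sigma>) ws2)"
    define ws4 :: "(nat + mproc) list" where "ws4 = map Inr (etavs (args \<sigma>) ws3)"
    have R2: "Reds (args \<sigma>) \<Delta> ws2" unfolding ws2_def by (rule Reds_etavs[OF ws1])
    have R3: "Reds (args \<sigma>) \<Delta> ws3" unfolding ws3_def by (rule Reds_etavs[OF R2])
    have R4: "Reds (args \<sigma>) \<Delta> ws4" unfolding ws4_def by (rule Reds_etavs[OF R3])
    have "bds (den (rev rec_ctx @ []) rec_step) = args \<sigma>" by (simp add: rec_step_def Let_def den_const.simps(5))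
    from dn_MLam[OF this] obtain B1 where B1: "D rec_step = MLam (args \<sigma>) B1" unfolding D_def by blast
    let ?C = "Var ''f'' \<bullet> rec_call \<bullet> Var ''m''"
    let ?G = "D (Abs ''m'' N ?C)"
    have "bds (den (rev rec_ctx @ []) (Abs ''m'' N ?C)) = [] @ N # args \<sigma>" by (simp add: rec_ctx_def)
    from dn_MLam[OF this] obtain B2 where B2: "?G = MLam ([] @ N # args \<sigma>) B2" unfolding D_def by blast
    define vs' where "vs' = vs @ [Inr (emb_proc (num j))]"
    define bs' where "bs' = rec_ctx @ [(''m'', N)]"
    define D' where "D' = dn (push vs' Inl) (rev bs' @ [])"
    have dc': "distinct (map fst bs')" "length vs' = length bs'" by (simp_all add: rec_ctx_def vs_def bs'_def vs'_def)
    have Dv': "D' (Var ''r'') = etav (rec_ty \<sigma>) (Inr rec_Y)" "D' (Var ''x'') = etav \<sigma> (Inr ?x)"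
      "D' (Var ''f'') = etav \<phi>t (Inr ?f)" "D' (Var ''m'') = etav N (Inr (emb_proc (num j)))"
      using dn_Var_push[OF dc', of 0 Inl "[]"] dn_Var_push[OF dc', of 1 Inl "[]"]
        dn_Var_push[OF dc', of 2 Inl "[]"] dn_Var_push[OF dc', of 4 Inl "[]"]
      unfolding D'_def[symmetric] by (simp_all add: rec_ctx_def vs_def bs'_def vs'_def)
    have pre: "D (Con Pre_c \<bullet> Var ''n'') \<simeq> emb_proc (num j)"
    proof -
      have "D (Con Pre_c \<bullet> Var ''n'') \<simeq> mapp (D (Con Pre_c)) (D (Var ''n''))" unfolding D_def by (rule dn_App)
      also have "D (Con Pre_c) = emb_proc (den_const Pre_c)" unfolding D_def by (rule dn_Con)
      also have "mapp (emb_proc (den_const Pre_c)) (D (Var ''n'')) \<simeq> emb_proc (num j)"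
        using pre_num[OF n] Suc by simp
      finally show ?thesis .
    qed
    have "nf_exp (body (mapps (etav \<sigma> (Inr (D rec_step))) (etavs (args \<sigma>) ws1))) = nf_exp (body (mappsv (D rec_step) ws3))"
      unfolding ws3_def ws2_def[symmetric] by (rule nf_etav_app[OF Reds_length[OF R2] B1])
    also have "\<dots> = nf_exp (body (mappsv (mapps (D (byval_tm [] \<sigma>)) [?G, D (Con Pre_c \<bullet> Var ''n'')]) ws3))"
      unfolding rec_step_def by (rule nf_mappsv_cong) (unfold D_def, rule dn_App2)
    also have "\<dots> = nf_exp (body (mappsv (emb_proc (den_const (Ext (Byval_c [] \<sigma>)))) (Inr ?G # [] @ Inr (D (Con Pre_c \<bullet> Var ''n'')) # ws3)))"
      unfolding D_def by simp
    also have "\<dots> = nf_exp (body (mapps ?G (etavs [] [] @ emb_proc (num j) # etavs (args \<sigma>) ws3)))"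
      by (rule nf_byval[OF _ Reds_length[OF R3] pre B2]) simp
    also have "\<dots> = nf_exp (body (mappsv (mapp ?G (emb_proc (num j))) ws4))" by (simp add: ws4_def)
    also have "mapp ?G (emb_proc (num j)) = D' ?C"
      unfolding D_def mappv_dn_Abs push_push D'_def vs'_def bs'_def by simp
    finally have eq2: "nf_exp (body (mapps (etav \<sigma> (Inr (D rec_step))) (etavs (args \<sigma>) ws1))) = nf_exp (body (mappsv (D' ?C) ws4))" .
    \<comment> \<open>The recursive call is handed to \<open>f\<close> unevaluated, so it must be
      reducible as a procedure, under every renaming and for all further arguments. This is why the
      induction hypothesis is general in the context and in the arguments.\<close>
    have 1: "Red \<sigma> \<Delta> (Inr (D' rec_call))"
    proof -
      let ?R = "mapps bv [etav (rec_ty \<sigma>) (Inr rec_Y), etav \<sigma> (Inr ?x), etav \<phi>t (Inr ?f), etav N (Inr (emb_proc (num j)))]"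
      obtain B3 where B3: "?R = MLam (args \<sigma>) B3" 
        using bv_MLam[of "map Inr [etav (rec_ty \<sigma>) (Inr rec_Y), etav \<sigma> (Inr ?x), etav \<phi>t (Inr ?f), etav N (Inr (emb_proc (num j)))]"] by auto
      have "Red \<sigma> \<Delta> (Inr ?R)"
      proof (rule RedI[OF B3])
        fix \<Theta> \<rho> us assume \<rho>: "renok \<Delta> \<rho> \<Theta>" and us: "Reds (args \<sigma>) \<Theta> us"
        let ?s = "Inl \<circ> \<rho>"
        let ?x' = "etav \<sigma> (Inr (sub_proc ?s ?x))" and ?f' = "etav \<phi>t (Inr (sub_proc ?s ?f))"
        have "mappsv (sub_proc ?s ?R) us = mappsv bv ([Inr (etav (rec_ty \<sigma>) (Inr rec_Y)), Inr ?x', Inr ?f', Inr (etav N (Inr (emb_proc (num j))))] @ us)"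
          by (simp add: sub_mappv sub_etav)
        then have e: "nf_exp (body (mappsv (sub_proc ?s ?R) us)) =
          nf_exp (body (mapps rec_Y (etavs (args (rec_ty \<sigma>)) (map Inr (etavs [\<sigma>, \<phi>t] [Inr ?x', Inr ?f'] @ emb_proc (num j) # etavs (args \<sigma>) us)))))"
          using nf_bv[OF Reds_length[OF us] etav_num[OF beq_refl]] by simp
        have "Red \<sigma> \<Theta> (Inr (sub_proc ?s ?x))" "Red \<phi>t \<Theta> (Inr (sub_proc ?s ?f))"
          using Red_ren[OF Rx \<rho>] Red_ren[OF Rf \<rho>] by simp_all
        then have "gexp \<Theta> (nf_exp (body (mappsv rec_Y (Inr (etav \<sigma> (Inr (etav \<sigma> (Inr ?x')))) # Inr (etav \<phi>t (Inr (etav \<phi>t (Inr ?f')))) #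
            Inr (etav N (Inr (emb_proc (num j)))) # map Inr (etavs (args \<sigma>) (map Inr (etavs (args \<sigma>) us)))))))"
          by (intro less.IH[of j] Red_etav Reds_etavs etav_num us beq_refl) (simp_all add: Suc)
        then show "gexp \<Theta> (nf_exp (body (mappsv (sub_proc ?s ?R) us)))"
          unfolding e by (simp add: args_rec_ty)
      qed
      moreover have "D' rec_call \<simeq> mapps (D' (byval_plus \<sigma>)) [D' (Var ''r''), D' (Var ''x''), D' (Var ''f''), D' (Var ''m'')]"
        unfolding rec_call_def D'_def by (rule dn_App4)
      then have "D' rec_call \<simeq> ?R" unfolding Dv' unfolding D'_def dn_Con .
      ultimately show ?thesis by (rule Red_beq[OF _ beq_sym])
    qed
    have 2: "Red \<phi>t \<Delta> (Inr (D' (Var ''f'')))" unfolding Dv' by (rule Red_etav[OF Rf])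
    have 3: "Red N \<Delta> (Inr (D' (Var ''m'')))" unfolding Dv' by (rule Red_N_num[OF etav_num[OF beq_refl]])
    have 4: "mapps (D' (Var ''f'')) [D' rec_call, D' (Var ''m'')] \<simeq> D' ?C"
      unfolding D'_def by (rule beq_sym[OF dn_App2])
    have "Red \<sigma> \<Delta> (Inr (mapps (D' (Var ''f'')) [D' rec_call, D' (Var ''m'')]))"
      using Red_mappv[OF Red_mappv[OF 2 1] 3] by simp
    from Red_beq[OF this 4] have "Red \<sigma> \<Delta> (Inr (D' ?C))" .
    from Red_body[OF this R4] show ?thesis unfolding eq Suc by (simp only: eq2 nat.distinct if_False)
  qed
qed

text \<open>The outer \<open>byval\<close> branches on the numerical argument. In branch
  \<open>i\<close> the recursion starts from the numeral \<open>i\<close>, so every branch is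
  covered by \<open>gexp_rec\<close>, although the nesting may grow with \<open>i\<close>.\<close>

lemma good_Rec: "good [] (den [] (Rec_tm \<sigma>)) (rec_ty \<sigma>)"
proof -
  let ?P = "mapp bv rec_Y"
  let ?r = "length (args \<sigma>)"
  have "emb_proc (den [] (Y_tm (rec_ty \<sigma>) \<bullet> abss rec_ctx rec_body)) \<simeq> rec_Y"
    using dn_App[of Inl "[]" "Y_tm (rec_ty \<sigma>)" "abss rec_ctx rec_body"]
    unfolding rec_Y_def Yp_def rec_h_def dn_Con by (simp only: dn_Inl)
  then have "mapp bv (emb_proc (den [] (Y_tm (rec_ty \<sigma>) \<bullet> abss rec_ctx rec_body))) \<simeq> ?P"
    by (intro mappv_cong beq_refl) (simp only: beqv_simps)
  then have den: "den [] (Rec_tm \<sigma>) = nf_proc ?P"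
    unfolding Rec_tm_conv by (simp add: nsp_app_conv beq_def)
  let ?\<Delta> = "rev (args (rec_ty \<sigma>)) @ []"
  have \<Delta>: "?\<Delta> = rev (args \<sigma>) @ [N, \<phi>t, \<sigma>]" by (simp add: args_rec_ty)
  obtain B where B: "?P = MLam (args (rec_ty \<sigma>)) B" unfolding emb_byval by (simp add: args_rec_ty)
  obtain B' where B': "rec_Y = MLam (args (rec_ty \<sigma>)) B'" using Yp_MLam unfolding rec_Y_def by blast
  let ?ws = "map Inl (rev [0..<?r])"
  have R: "Reds (args \<sigma>) ?\<Delta> ?ws" "Red \<sigma> ?\<Delta> (Inl (?r + 2))" "Red \<phi>t ?\<Delta> (Inl (?r + 1))"
    unfolding \<Delta> using Reds_vars[of "args \<sigma>" "[N, \<phi>t, \<sigma>]"] by (simp_all add: nth_append)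
  have vars: "map Inl (rev [0..<length (args (rec_ty \<sigma>))]) = [Inl (?r + 2), Inl (?r + 1), Inl ?r] @ ?ws"
    by (simp add: args_rec_ty)
  have "good [] (nf_proc ?P) (rec_ty \<sigma>)"
  proof (rule good_nfI[OF B], unfold vars)
    let ?v = "[Inl (?r + 2), Inl (?r + 1)]"
    have "body (mappsv (sub_proc (Inl \<circ> (\<lambda>i. i + length (args (rec_ty \<sigma>)))) ?P) ([Inl (?r + 2), Inl (?r + 1), Inl ?r] @ ?ws)) =
      body (mappsv bv (Inr rec_Y # ?v @ Inl ?r # ?ws))"
      by (simp add: sub_mappv)
    also have "\<dots> = MCase (MVar ?r []) (\<lambda>i. MCase (MApp rec_Y (etavs [\<sigma>, \<phi>t] ?v @ emb_proc (num i) # etavs (args \<sigma>) ?ws)) MNum)"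
      by (subst body_byval) simp_all
    finally have e: "nf_exp (body (mappsv (sub_proc (Inl \<circ> (\<lambda>i. i + length (args (rec_ty \<sigma>)))) ?P) ([Inl (?r + 2), Inl (?r + 1), Inl ?r] @ ?ws)))
      = Case (App ?r []) (\<lambda>i. nf_exp (body (mapps rec_Y (etavs [\<sigma>, \<phi>t] ?v @ emb_proc (num i) # etavs (args \<sigma>) ?ws))))"
      by (simp add: nf_MApp[OF _ B'] args_rec_ty)
    have "gexp ?\<Delta> (nf_exp (body (mappsv rec_Y (Inr (etav \<sigma> (Inl (?r + 2))) # Inr (etav \<phi>t (Inl (?r + 1))) # Inr (emb_proc (num i)) # map Inr (etavs (args \<sigma>) ?ws)))))" for i
      by (intro gexp_rec[where k = i] Red_etav R Reds_etavs beq_refl)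
    then show "gexp ?\<Delta> (nf_exp (body (mappsv (sub_proc (Inl \<circ> (\<lambda>i. i + length (args (rec_ty \<sigma>)))) ?P) ([Inl (?r + 2), Inl (?r + 1), Inl ?r] @ ?ws))))"
      unfolding e \<Delta> by (simp add: nth_append)
  qed
  then show ?thesis unfolding den .
qed

end

subsection \<open>Minimization\<close>

text \<open>Every round of the minimization expands \<open>f\<close> again. This law keeps it equal
  to the expansion of one variable.\<close>

lemma etav_etav_N_N: "etav (N \<rightarrow> N) (Inr (etav (N \<rightarrow> N) (Inl y))) \<simeq> etav (N \<rightarrow> N) (Inl y)"
proof -
  have 1: "emb_proc (eta N z) = MLam [] (MCase (MVar z []) MNum)" for z
    by (subst eta.simps) (simp add: comp_def)
  have 2: "emb_proc (eta (N \<rightarrow> N) z) = MLam [N] (MCase (MVar (Suc z) [MLam [] (MCase (MVar 0 []) MNum)]) MNum)" for z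
    by (subst eta.simps) (simp add: comp_def 1)
  show ?thesis
    unfolding etav_def 2 by (simp add: comp_def MLam_beq nf_exp_conv_nfs push_def inst_conv_push up_subst_def up_ren_def nfs_beta)
qed

definition min_ctx :: ctx where
  "min_ctx = [(''m'', min_ty), (''f'', N \<rightarrow> N), (''n'', N)]"

definition min_step :: "pcf tm" where
  "min_step = byval_tm [N \<rightarrow> N] N \<bullet> Var ''m'' \<bullet> Var ''f'' \<bullet> (Con Suc_c \<bullet> Var ''n'')"

definition min_body :: "pcf tm" where
  "min_body = Con Ifzero_c \<bullet> (Var ''f'' \<bullet> Var ''n'') \<bullet> Var ''n'' \<bullet> min_step"

lemma Min_tm_conv: "Min_tm = byval_tm [N \<rightarrow> N] N \<bullet> (Y_tm min_ty \<bullet> abss min_ctx min_body)"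
  by (simp add: Min_tm_def min_ctx_def min_body_def min_step_def)

lemma args_min_ty: "args min_ty = [N \<rightarrow> N, N]"
  by (simp add: min_ty_def)

definition min_h :: mproc where
  "min_h = emb_proc (den [] (abss min_ctx min_body))"

definition min_Y :: mproc where
  "min_Y = Yp min_ty min_h"

lemma fv_min: "fv (abss min_ctx min_body) = {}"
  by (simp add: abss_def min_ctx_def min_body_def min_step_def) auto

lemma sub_min_Y [simp]: "sub_proc s min_Y = min_Y"
proof -
  have "bnd 0 min_h" unfolding min_h_def using bnd_den[of "abss min_ctx min_body" "[]"] fv_min by simp
  then show ?thesis by (simp add: min_Y_def sub_Yp bnd_0_sub)
qed

text \<open>One round of the loop. The arguments are described up to equality of normal forms only,
  and the next ones satisfy the same description, so the lemma can be iterated.\<close>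

lemma nf_min:
  assumes F: "F \<simeq> etav (N \<rightarrow> N) (Inl y)" and A: "A \<simeq> emb_proc (num i)"
  obtains F' A' where "F' \<simeq> etav (N \<rightarrow> N) (Inl y)" "A' \<simeq> emb_proc (num (Suc i))"
    "nf_exp (body (mapps min_Y [F, A])) =
      Case (App y [num i]) (\<lambda>j. if j = 0 then Num i else nf_exp (body (mapps min_Y [F', A'])))"
proof -
  let ?f = "etav (N \<rightarrow> N) (Inr F)" and ?n = "etav N (Inr A)"
  define vs :: "(nat + mproc) list" where "vs = [Inr min_Y, Inr ?f, Inr ?n]"
  define D where "D = dn (push vs Inl) (rev min_ctx @ [])"
  have dc: "distinct (map fst min_ctx)" "length vs = length min_ctx" by (simp_all add: min_ctx_def vs_def)
  have Dv: "D (Var ''m'') = etav min_ty (Inr min_Y)" "D (Var ''f'') = etav (N \<rightarrow> N) (Inr ?f)" "D (Var ''n'') = etav N (Inr ?n)"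
    using dn_Var_push[OF dc, of 0 Inl "[]"] dn_Var_push[OF dc, of 1 Inl "[]"] dn_Var_push[OF dc, of 2 Inl "[]"]
    unfolding D_def[symmetric] by (simp_all add: min_ctx_def vs_def)
  have eta: "etav (N \<rightarrow> N) (Inr P) \<simeq> etav (N \<rightarrow> N) (Inl y)" if "P \<simeq> etav (N \<rightarrow> N) (Inl y)" for P
    using beq_trans[OF etav_cong etav_etav_N_N] that by simp
  have f: "D (Var ''f'') \<simeq> etav (N \<rightarrow> N) (Inl y)" unfolding Dv by (intro eta F)
  have n: "D (Var ''n'') \<simeq> emb_proc (num i)" unfolding Dv by (intro etav_num A)
  define F' where "F' = etav (N \<rightarrow> N) (Inr (etav (N \<rightarrow> N) (Inr (D (Var ''f'')))))"
  define A' where "A' = etav N (Inr (emb_proc (num (Suc i))))"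
  let ?app = "Var ''f'' \<bullet> Var ''n''"
  have "bds (den [] (abss min_ctx min_body)) = min_ty # args min_ty"
    by (simp add: bds_abss min_ctx_def min_body_def args_min_ty)
  then obtain B where B: "min_h = MLam (min_ty # args min_ty) B"
    using dn_MLam[of "[]" _ _ Inl] unfolding min_h_def dn_Inl by blast
  have "bds (den (rev min_ctx @ []) ?app) = []" "bds (den (rev min_ctx @ []) (Var ''n'')) = []"
    "bds (den (rev min_ctx @ []) min_step) = []"
    by (simp_all add: min_ctx_def min_step_def Let_def den_const.simps(5))
  then obtain B1 B2 B3 where B3: "D ?app = MLam [] B1" "D (Var ''n'') = MLam [] B2" "D min_step = MLam [] B3"
    using dn_MLam unfolding D_def by metis
  have suc: "D (Con Suc_c \<bullet> Var ''n'') \<simeq> emb_proc (num (Suc i))"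
  proof -
    have "D (Con Suc_c \<bullet> Var ''n'') \<simeq> mapp (D (Con Suc_c)) (D (Var ''n''))" unfolding D_def by (rule dn_App)
    also have "D (Con Suc_c) = emb_proc (den_const Suc_c)" unfolding D_def by (rule dn_Con)
    also have "mapp (emb_proc (den_const Suc_c)) (D (Var ''n'')) \<simeq> emb_proc (num (Suc i))"
      by (rule suc_num[OF n])
    finally show ?thesis .
  qed
  have "D ?app \<simeq> mapp (D (Var ''f'')) (D (Var ''n''))" unfolding D_def by (rule dn_App)
  also have "\<dots> \<simeq> mapp (etav (N \<rightarrow> N) (Inl y)) (emb_proc (num i))"
    using f n by (intro mappv_cong) simp_all
  finally have "D ?app \<simeq> mapp (etav (N \<rightarrow> N) (Inl y)) (emb_proc (num i))" .
  moreover have "body (mapp (etav (N \<rightarrow> N) (Inl y)) (emb_proc (num i))) = MCase (MVar y [A0]) MNum"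
    if "A0 = etav N (Inr (emb_proc (num i)))" for A0
    using body_etav[of "[Inr (emb_proc (num i))]" "N \<rightarrow> N" "Inl y"] that by simp
  ultimately have app: "nf_exp B1 = nf_exp (MCase (MVar y [etav N (Inr (emb_proc (num i)))]) MNum)"
    using nf_body_cong[of "D ?app"] B3(1) by simp
  have nn: "nf_proc (etav N (Inr (emb_proc (num i)))) = num i"
    using etav_num[OF beq_refl, of i] by (simp add: beq_def)
  have 2: "nf_exp B2 = Num i"
    using nf_body_cong[OF n] B3(2) by (simp add: num_def nf_exp_conv_nfs)
  have "etav min_ty (Inr min_Y) = MLam (args min_ty) (body (etav min_ty (Inr min_Y)))"
    using etav_MLam[of min_ty "Inr min_Y"] by auto
  then have m: "D (Var ''m'') = MLam ([N \<rightarrow> N] @ N # args N) (body (etav min_ty (Inr min_Y)))"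
    unfolding Dv by (simp add: args_min_ty)
  have Y: "min_Y = MLam (args min_ty) (body min_Y)"
    using Yp_MLam[of min_ty min_h] unfolding min_Y_def by auto
  have "D min_step \<simeq> mapps (D (byval_tm [N \<rightarrow> N] N)) [D (Var ''m''), D (Var ''f''), D (Con Suc_c \<bullet> Var ''n'')]"
    unfolding min_step_def D_def by (rule dn_App3)
  then have "nf_exp B3 = nf_exp (body (mapps (D (byval_tm [N \<rightarrow> N] N)) [D (Var ''m''), D (Var ''f''), D (Con Suc_c \<bullet> Var ''n'')]))"
    using nf_body_cong[of "D min_step"] B3(3) by simp
  also have "\<dots> = nf_exp (body (mappsv (emb_proc (den_const (Ext (Byval_c [N \<rightarrow> N] N)))) (Inr (D (Var ''m'')) # [Inr (D (Var ''f''))] @ Inr (D (Con Suc_c \<bullet> Var ''n'')) # [])))"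
    unfolding D_def by simp
  also have "\<dots> = nf_exp (body (mapps (D (Var ''m'')) (etavs [N \<rightarrow> N] [Inr (D (Var ''f''))] @ emb_proc (num (Suc i)) # etavs (args N) [])))"
    by (rule nf_byval[OF _ _ suc m]) simp_all
  also have "\<dots> = nf_exp (body (mapps min_Y [F', A']))"
    using nf_etav_app[OF _ Y, of "map Inr (etavs [N \<rightarrow> N] [Inr (D (Var ''f''))] @ emb_proc (num (Suc i)) # etavs (args N) [])"]
    unfolding Dv(1) by (simp add: args_min_ty F'_def A'_def)
  finally have 3: "nf_exp B3 = nf_exp (body (mapps min_Y [F', A']))" .
  have "nf_exp (body (mapps min_Y [F, A])) = nf_exp (body (mapps min_h (min_Y # etavs (args min_ty) [Inr F, Inr A])))"
    using nf_Yp[OF _ B, of "[Inr F, Inr A]"] unfolding min_Y_def by (simp add: args_min_ty)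
  also have "mapps min_h (min_Y # etavs (args min_ty) [Inr F, Inr A]) = mappsv min_h vs"
    by (simp add: args_min_ty vs_def)
  also have "mappsv min_h vs = D min_body"
    unfolding min_h_def D_def using mappsv_dn_abss[OF dc(2), of Inl "[]" min_body] by (simp add: dn_Inl)
  also have "nf_exp (body (D min_body)) = nf_exp (body (mapps (D (Con Ifzero_c)) [D ?app, D (Var ''n''), D min_step]))"
    unfolding min_body_def D_def by (rule nf_body_cong[OF dn_App3])
  also have "D (Con Ifzero_c) = ifz" unfolding D_def by (rule dn_Con)
  also have "nf_exp (body (mapps ifz [D ?app, D (Var ''n''), D min_step])) = nfs (B1, [\<lambda>i. if i = 0 then B2 else B3])"
    by (rule nf_ifz[OF B3])
  also have "\<dots> = nfs (MCase (MVar y [etav N (Inr (emb_proc (num i)))]) MNum, [\<lambda>i. if i = 0 then B2 else B3])"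
    by (rule nfs_cong[OF app refl])
  also have "\<dots> = Case (App y [num i]) (\<lambda>j. nf_exp (if j = 0 then B2 else B3))"
    by (simp add: nn nf_exp_conv_nfs)
  also have "\<dots> = Case (App y [num i]) (\<lambda>j. if j = 0 then Num i else nf_exp (body (mapps min_Y [F', A'])))"
    by (rule arg_cong[of _ _ "Case _"]) (simp add: 2 3 fun_eq_iff)
  finally show thesis
    by (intro that[of F' A'] etav_num beq_refl eta f) (simp_all add: F'_def A'_def eta f etav_num)
qed

text \<open>Induction on the spine: the loop need not end, but each outermost application belongs to
  a definite round.\<close>

lemma spine_min:
  "spine e a \<Longrightarrow> e = nf_exp (body (mapps min_Y [F, A])) \<Longrightarrow> F \<simeq> etav (N \<rightarrow> N) (Inl y) \<Longrightarrow>
    A \<simeq> emb_proc (num i) \<Longrightarrow> \<exists>j. a = App y [num j]"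
proof (induction e a arbitrary: F A i rule: spine.induct)
  case (here a es)
  from nf_min[OF here(2,3)] here(1) show ?case by (metis exp.inject(2))
next
  case (branch es k a b)
  from nf_min[OF branch(4,5)] obtain F' A' where FA: "F' \<simeq> etav (N \<rightarrow> N) (Inl y)" "A' \<simeq> emb_proc (num (Suc i))"
    "nf_exp (body (mapps min_Y [F, A])) =
      Case (App y [num i]) (\<lambda>j. if j = 0 then Num i else nf_exp (body (mapps min_Y [F', A'])))" .
  from branch(3) FA(3) have es: "es k = (if k = 0 then Num i else nf_exp (body (mapps min_Y [F', A'])))" by simp
  show ?case
  proof (cases "k = 0")
    case True
    then show ?thesis using branch(1) es by (auto elim: spine.cases)
  next
    case False
    then show ?thesis using branch(2)[OF _ FA(1,2)] es by simp
  qed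
qed

lemma good_Min: "good [] (den [] Min_tm) min_ty"
proof -
  let ?bv = "emb_proc (den_const (Ext (Byval_c [N \<rightarrow> N] N)))"
  let ?P = "mapp ?bv min_Y"
  have "emb_proc (den [] (Y_tm min_ty \<bullet> abss min_ctx min_body)) \<simeq> min_Y"
    using dn_App[of Inl "[]" "Y_tm min_ty" "abss min_ctx min_body"]
    unfolding min_Y_def Yp_def min_h_def dn_Con by (simp only: dn_Inl)
  then have "mapp ?bv (emb_proc (den [] (Y_tm min_ty \<bullet> abss min_ctx min_body))) \<simeq> ?P"
    by (intro mappv_cong beq_refl) (simp only: beqv_simps)
  then have den: "den [] Min_tm = nf_proc ?P"
    unfolding Min_tm_conv by (simp add: nsp_app_conv beq_def)
  obtain B where B: "?P = MLam (args min_ty) B" unfolding emb_byval by (simp add: args_min_ty)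
  have Y: "min_Y = MLam (args min_ty) (body min_Y)"
    using Yp_MLam[of min_ty min_h] unfolding min_Y_def by auto
  have "good [] (nf_proc ?P) min_ty"
  proof (rule good_nfI[OF B])
    let ?E = "body (mappsv (sub_proc (Inl \<circ> (\<lambda>i. i + length (args min_ty))) ?P) (map Inl (rev [0..<length (args min_ty)])))"
    have vars: "map Inl (rev [0..<length (args min_ty)]) = [Inl 1] @ Inl 0 # []"
      by (simp add: args_min_ty)
    have "?E = body (mappsv ?bv (Inr min_Y # [Inl 1] @ Inl 0 # []))"
      unfolding vars by (simp add: sub_mappv)
    also have "\<dots> = MCase (MVar 0 []) (\<lambda>i. MCase (MApp min_Y (etavs [N \<rightarrow> N] [Inl 1] @ emb_proc (num i) # etavs (args N) [])) MNum)"
      by (subst body_byval) simp_all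
    finally have e: "nf_exp ?E = Case (App 0 []) (\<lambda>i. nf_exp (body (mapps min_Y [etav (N \<rightarrow> N) (Inl 1), emb_proc (num i)])))"
      by (simp add: nf_MApp[OF _ Y] args_min_ty)
    have "gexp [N, N \<rightarrow> N] (nf_exp (body (mapps min_Y [etav (N \<rightarrow> N) (Inl 1), emb_proc (num i)])))" for i
      unfolding gexp_def using spine_min[OF _ refl beq_refl beq_refl] by (fastforce simp: good_num)
    then show "gexp (rev (args min_ty) @ []) (nf_exp ?E)"
      unfolding e by (simp add: args_min_ty)
  qed
  then show ?thesis unfolding den .
qed

subsection \<open>Iteration\<close>

context
  fixes \<sigma> :: ty
begin

text \<open>The innermost binder comes first: \<open>f\<close>, \<open>x\<close>, \<open>c\<close>
  have the indices 0, 1, 2, so \<open>\<rho> 2\<close> below is the variable of the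
  condition.\<close>

definition while_outer :: ctx where
  "while_outer = [(''f'', \<sigma> \<rightarrow> \<sigma>), (''x'', \<sigma>), (''c'', \<sigma> \<rightarrow> N)]"

definition while_ctx :: ctx where
  "while_ctx = [(''w'', \<sigma> \<rightarrow> \<sigma>), (''v'', \<sigma>)]"

definition while_body :: "pcf tm" where
  "while_body = ifzero_at \<sigma> \<bullet> (Var ''c'' \<bullet> Var ''v'') \<bullet> (Var ''w'' \<bullet> (Var ''f'' \<bullet> Var ''v'')) \<bullet> Var ''v''"

definition while_h :: "(nat \<Rightarrow> nat) \<Rightarrow> mproc" where
  "while_h \<rho> = dn (Inl \<circ> \<rho>) while_outer (abss while_ctx while_body)"

definition while_Y :: "(nat \<Rightarrow> nat) \<Rightarrow> mproc" where
  "while_Y \<rho> = Yp (\<sigma> \<rightarrow> \<sigma>) (while_h \<rho>)"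

text \<open>Besides the shape of one round it states that the next state and the remaining arguments
  are again reducible, which is the invariant of the loop.\<close>

lemma nf_while:
  assumes \<rho>: "renok [\<sigma> \<rightarrow> \<sigma>, \<sigma>, \<sigma> \<rightarrow> N] \<rho> \<Delta>" and v: "Red \<sigma> \<Delta> v" and ws: "Reds (args \<sigma>) \<Delta> ws"
  obtains v' ws' q e where "Red \<sigma> \<Delta> v'" "Reds (args \<sigma>) \<Delta> ws'" "good \<Delta> q \<sigma>" "gexp \<Delta> e"
    "nf_exp (body (mappsv (while_Y \<rho>) (v # ws))) =
      Case (App (\<rho> 2) [q]) (\<lambda>j. if j = 0 then nf_exp (body (mappsv (while_Y \<rho>) (v' # ws'))) else e)"
proof -
  let ?v = "etav \<sigma> v"
  have Rv: "Red \<sigma> \<Delta> (Inr ?v)" using v by (rule Red_etav)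
  define ws1 :: "(nat + mproc) list" where "ws1 = map Inr (etavs (args \<sigma>) ws)"
  define ws2 :: "(nat + mproc) list" where "ws2 = map Inr (etavs (args \<sigma>) ws1)"
  define ws3 :: "(nat + mproc) list" where "ws3 = map Inr (etavs (args \<sigma>) ws2)"
  define ws4 :: "(nat + mproc) list" where "ws4 = map Inr (etavs (args \<sigma>) ws3)"
  have R1: "Reds (args \<sigma>) \<Delta> ws1" unfolding ws1_def by (rule Reds_etavs[OF ws])
  have R2: "Reds (args \<sigma>) \<Delta> ws2" unfolding ws2_def by (rule Reds_etavs[OF R1])
  have R3: "Reds (args \<sigma>) \<Delta> ws3" unfolding ws3_def by (rule Reds_etavs[OF R2])
  have R4: "Reds (args \<sigma>) \<Delta> ws4" unfolding ws4_def by (rule Reds_etavs[OF R3])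
  define vs :: "(nat + mproc) list" where "vs = [Inr (while_Y \<rho>), Inr ?v]"
  define D where "D = dn (push vs (Inl \<circ> \<rho>)) (rev while_ctx @ while_outer)"
  have dc: "distinct (map fst while_ctx)" "length vs = length while_ctx" by (simp_all add: while_ctx_def vs_def)
  have Dw: "D (Var ''w'') = etav (\<sigma> \<rightarrow> \<sigma>) (Inr (while_Y \<rho>))" and Dv: "D (Var ''v'') = etav \<sigma> (Inr ?v)"
    using dn_Var_push[OF dc, of 0 "Inl \<circ> \<rho>" while_outer] dn_Var_push[OF dc, of 1 "Inl \<circ> \<rho>" while_outer]
    unfolding D_def[symmetric] by (simp_all add: while_ctx_def vs_def)
  have Df: "D (Var ''f'') = etav (\<sigma> \<rightarrow> \<sigma>) (Inl (\<rho> 0))" and Dc: "D (Var ''c'') = etav (\<sigma> \<rightarrow> N) (Inl (\<rho> 2))"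
    unfolding D_def dn_Var by (simp_all add: while_ctx_def while_outer_def vs_def push_def numeral_eq_Suc)
  have RDv: "Red \<sigma> \<Delta> (Inr (D (Var ''v'')))" unfolding Dv by (rule Red_etav[OF Rv])
  define q where "q = etav \<sigma> (Inr (D (Var ''v'')))"
  define v' where "v' = etav \<sigma> (Inr (D (Var ''f'' \<bullet> Var ''v'')))"
  define e where "e = nf_exp (body (mapps (etav \<sigma> (Inr (D (Var ''v'')))) (etavs (args \<sigma>) ws1)))"
  have Rq: "good \<Delta> (nf_proc q) \<sigma>" unfolding q_def by (rule Red_good[OF Red_etav[OF RDv]])
  have Re: "gexp \<Delta> e" unfolding e_def by (rule Red_body[OF Red_etav[OF RDv] R2[unfolded ws2_def]])
  have Rv': "Red \<sigma> \<Delta> (Inr v')"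
  proof -
    have "Red (\<sigma> \<rightarrow> \<sigma>) \<Delta> (Inr (D (Var ''f'')))"
      unfolding Df using \<rho> by (intro Red_etav) (simp add: renok_def)
    from Red_mappv[OF this RDv] have "Red \<sigma> \<Delta> (Inr (mapp (D (Var ''f'')) (D (Var ''v''))))" .
    moreover have "mapp (D (Var ''f'')) (D (Var ''v'')) \<simeq> D (Var ''f'' \<bullet> Var ''v'')"
      unfolding D_def by (rule beq_sym[OF dn_App])
    ultimately have "Red \<sigma> \<Delta> (Inr (D (Var ''f'' \<bullet> Var ''v'')))" by (rule Red_beq)
    then show ?thesis unfolding v'_def by (rule Red_etav)
  qed
  let ?c = "Var ''c'' \<bullet> Var ''v''" and ?w = "Var ''w'' \<bullet> (Var ''f'' \<bullet> Var ''v'')"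
  have "bds (den while_outer (abss while_ctx while_body)) = (\<sigma> \<rightarrow> \<sigma>) # args (\<sigma> \<rightarrow> \<sigma>)"
    by (simp add: bds_abss while_ctx_def while_body_def)
  from dn_MLam[OF this] obtain B where B: "while_h \<rho> = MLam ((\<sigma> \<rightarrow> \<sigma>) # args (\<sigma> \<rightarrow> \<sigma>)) B"
    unfolding while_h_def by blast
  have Y: "while_Y \<rho> = MLam (args (\<sigma> \<rightarrow> \<sigma>)) (body (while_Y \<rho>))"
    using Yp_MLam[of "\<sigma> \<rightarrow> \<sigma>" "while_h \<rho>"] unfolding while_Y_def by auto
  have "bds (den (rev while_ctx @ while_outer) ?w) = args \<sigma>" by (simp add: while_ctx_def)
  from dn_MLam[OF this] obtain B1 where B1: "D ?w = MLam (args \<sigma>) B1" unfolding D_def by blast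
  have "bds (den (rev while_ctx @ while_outer) ?c) = []" by (simp add: while_ctx_def while_outer_def)
  from dn_MLam[OF this] obtain B2 where B2: "D ?c = MLam (args N) B2" unfolding D_def by auto
  have cond: "nf_exp (body (etav N (Inr (D ?c)))) = nf_exp (MCase (MVar (\<rho> 2) [q]) MNum)"
  proof -
    have "nf_exp (body (etav N (Inr (D ?c)))) = nf_exp (body (D ?c))"
      using nf_etav_app[OF _ B2, of "[]"] by simp
    also have "\<dots> = nf_exp (body (mapp (D (Var ''c'')) (D (Var ''v''))))"
      unfolding D_def by (rule nf_body_cong[OF dn_App])
    also have "body (mapp (D (Var ''c'')) (D (Var ''v''))) = MCase (MVar (\<rho> 2) [q]) MNum"
      using body_etav[of "[Inr (D (Var ''v''))]" "\<sigma> \<rightarrow> N" "Inl (\<rho> 2)"] unfolding Dc by (simp add: q_def)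
    finally show ?thesis .
  qed
  have loop: "nf_exp (body (mapps (etav \<sigma> (Inr (D ?w))) (etavs (args \<sigma>) ws1))) = nf_exp (body (mappsv (while_Y \<rho>) (Inr v' # ws4)))"
  proof -
    have "nf_exp (body (mapps (etav \<sigma> (Inr (D ?w))) (etavs (args \<sigma>) ws1))) = nf_exp (body (mappsv (D ?w) ws3))"
      unfolding ws3_def ws2_def[symmetric] by (rule nf_etav_app[OF Reds_length[OF R2] B1])
    also have "\<dots> = nf_exp (body (mappsv (mapp (D (Var ''w'')) (D (Var ''f'' \<bullet> Var ''v''))) ws3))"
      by (rule nf_mappsv_cong) (unfold D_def, rule dn_App)
    also have "\<dots> = nf_exp (body (mappsv (etav (\<sigma> \<rightarrow> \<sigma>) (Inr (while_Y \<rho>))) (Inr (D (Var ''f'' \<bullet> Var ''v'')) # ws3)))"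
      unfolding Dw by simp
    also have "\<dots> = nf_exp (body (mapps (while_Y \<rho>) (etavs (args (\<sigma> \<rightarrow> \<sigma>)) (Inr (D (Var ''f'' \<bullet> Var ''v'')) # ws3))))"
      by (rule nf_etav_app[OF _ Y]) (simp add: Reds_length[OF R3])
    also have "\<dots> = nf_exp (body (mappsv (while_Y \<rho>) (Inr v' # ws4)))"
      by (simp add: v'_def ws4_def)
    finally show ?thesis .
  qed
  have "nf_exp (body (mappsv (while_Y \<rho>) (v # ws))) =
      nf_exp (body (mapps (while_h \<rho>) (while_Y \<rho> # etavs (args (\<sigma> \<rightarrow> \<sigma>)) (v # ws))))"
    unfolding while_Y_def by (rule nf_Yp[OF _ B]) (simp add: Reds_length[OF ws])
  also have "mapps (while_h \<rho>) (while_Y \<rho> # etavs (args (\<sigma> \<rightarrow> \<sigma>)) (v # ws)) = mappsv (mappsv (while_h \<rho>) vs) ws1"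
    by (simp add: vs_def ws1_def)
  also have "mappsv (while_h \<rho>) vs = D while_body"
    unfolding while_h_def D_def by (rule mappsv_dn_abss[OF dc(2)])
  also have "nf_exp (body (mappsv (D while_body) ws1)) =
      nf_exp (body (mappsv (mapps (D (ifzero_at \<sigma>)) [D ?c, D ?w, D (Var ''v'')]) ws1))"
    unfolding while_body_def by (rule nf_mappsv_cong) (unfold D_def, rule dn_App3)
  also have "\<dots> = nf_exp (body (mappsv (D (ifzero_at \<sigma>)) ([Inr (D ?c), Inr (D ?w), Inr (D (Var ''v''))] @ ws1)))"
    by simp
  also have "\<dots> = nfs (body (etav N (Inr (D ?c))),
      [\<lambda>i. if i = 0 then body (mapps (etav \<sigma> (Inr (D ?w))) (etavs (args \<sigma>) ws1))
        else body (mapps (etav \<sigma> (Inr (D (Var ''v'')))) (etavs (args \<sigma>) ws1))])"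
    unfolding D_def by (rule nf_ifzero_at[OF Reds_length[OF R1]])
  also have "\<dots> = nfs (MCase (MVar (\<rho> 2) [q]) MNum,
      [\<lambda>i. if i = 0 then body (mapps (etav \<sigma> (Inr (D ?w))) (etavs (args \<sigma>) ws1))
        else body (mapps (etav \<sigma> (Inr (D (Var ''v'')))) (etavs (args \<sigma>) ws1))])"
    by (rule nfs_cong[OF cond refl])
  also have "\<dots> = Case (App (\<rho> 2) [nf_proc q]) (\<lambda>j. nf_exp (if j = 0 then body (mapps (etav \<sigma> (Inr (D ?w))) (etavs (args \<sigma>) ws1))
        else body (mapps (etav \<sigma> (Inr (D (Var ''v'')))) (etavs (args \<sigma>) ws1))))"
    by (simp only: nfs_simps nf_exp_conv_nfs list.map)
  also have "\<dots> = Case (App (\<rho> 2) [nf_proc q]) (\<lambda>j. if j = 0 then nf_exp (body (mappsv (while_Y \<rho>) (Inr v' # ws4))) else e)"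
    by (rule arg_cong[of _ _ "Case _"]) (simp only: if_distrib[of nf_exp] loop e_def)
  finally show thesis by (rule that[OF Rv' R4 Rq Re])
qed

text \<open>Unlike in minimization the state grows by an application of \<open>f\<close> in every
  round, so the outermost applications are not listed; the reducibility of the state takes the place
  of a list.\<close>

lemma gexp_while:
  assumes \<rho>: "renok [\<sigma> \<rightarrow> \<sigma>, \<sigma>, \<sigma> \<rightarrow> N] \<rho> \<Delta>" and "Red \<sigma> \<Delta> v" "Reds (args \<sigma>) \<Delta> ws"
  shows "gexp \<Delta> (nf_exp (body (mappsv (while_Y \<rho>) (v # ws))))"
proof -
  have "spine e a \<Longrightarrow> e = nf_exp (body (mappsv (while_Y \<rho>) (v # ws))) \<Longrightarrow> Red \<sigma> \<Delta> v \<Longrightarrow> Reds (args \<sigma>) \<Delta> ws \<Longrightarrow>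
      a = App x qs \<Longrightarrow> x < length \<Delta> \<and> list_all2 (good \<Delta>) qs (args (\<Delta> ! x))" for e a x qs v ws
  proof (induction e a arbitrary: v ws rule: spine.induct)
    case (here a es)
    obtain v' ws' q e where "good \<Delta> q \<sigma>" "nf_exp (body (mappsv (while_Y \<rho>) (v # ws))) =
      Case (App (\<rho> 2) [q]) (\<lambda>j. if j = 0 then nf_exp (body (mappsv (while_Y \<rho>) (v' # ws'))) else e)"
      using nf_while[OF \<rho> here(2,3)] .
    then have "x = \<rho> 2" "qs = [q]" "good \<Delta> q \<sigma>" using here by simp_all
    moreover have "\<rho> 2 < length \<Delta> \<and> \<Delta> ! \<rho> 2 = \<sigma> \<rightarrow> N" using \<rho> by (auto simp: renok_def)
    ultimately show ?case by simp
  next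
    case (branch es k a b)
    obtain v' ws' q e where *: "Red \<sigma> \<Delta> v'" "Reds (args \<sigma>) \<Delta> ws'" "gexp \<Delta> e" "nf_exp (body (mappsv (while_Y \<rho>) (v # ws))) =
      Case (App (\<rho> 2) [q]) (\<lambda>j. if j = 0 then nf_exp (body (mappsv (while_Y \<rho>) (v' # ws'))) else e)"
      using nf_while[OF \<rho> branch(4,5)] .
    from branch(3) *(4) have es: "es k = (if k = 0 then nf_exp (body (mappsv (while_Y \<rho>) (v' # ws'))) else e)" by simp
    show ?case
    proof (cases "k = 0")
      case True
      then show ?thesis using branch(2)[OF _ *(1,2) branch(6)] es by simp
    next
      case False
      then show ?thesis using branch(1,6) *(3) es by (simp add: gexp_def)
    qed
  qed
  then show ?thesis using assms(2,3) unfolding gexp_def by blast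
qed

text \<open>The loop is examined in the context of its three parameters, where these are variables;
  the abstractions are added last.\<close>

lemma good_While: "good [] (den [] (While_tm \<sigma>)) ((\<sigma> \<rightarrow> N) \<rightarrow> \<sigma> \<rightarrow> (\<sigma> \<rightarrow> \<sigma>) \<rightarrow> \<sigma>)"
proof -
  let ?M = "Y_tm (\<sigma> \<rightarrow> \<sigma>) \<bullet> abss while_ctx while_body"
  let ?\<Gamma> = "[\<sigma> \<rightarrow> \<sigma>, \<sigma>, \<sigma> \<rightarrow> N]" and ?r = "length (args \<sigma>)"
  define \<rho> where "\<rho> = (\<lambda>i. i + ?r)"
  define h where "h = emb_proc (den while_outer (abss while_ctx while_body))"
  let ?P = "mapp (Yp (\<sigma> \<rightarrow> \<sigma>) h) (etav \<sigma> (Inl 1))"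
  have "emb_proc (den while_outer ?M) \<simeq> Yp (\<sigma> \<rightarrow> \<sigma>) h"
    using dn_App[of Inl while_outer "Y_tm (\<sigma> \<rightarrow> \<sigma>)" "abss while_ctx while_body"]
    unfolding Yp_def h_def dn_Con by (simp only: dn_Inl)
  then have "mapp (emb_proc (den while_outer ?M)) (etav \<sigma> (Inl 1)) \<simeq> ?P"
    by (rule mappv_cong) simp
  then have den: "den while_outer (?M \<bullet> Var ''x'') = nf_proc ?P"
    by (simp add: nsp_app_conv beq_def etav_Inl) (simp add: while_outer_def)
  obtain B where B: "?P = MLam (args \<sigma>) B" using Yp_MLam[of "\<sigma> \<rightarrow> \<sigma>" h] by auto
  have "good ?\<Gamma> (nf_proc ?P) \<sigma>"
  proof (rule good_nfI[OF B])
    let ?vs = "map Inl (rev [0..<?r]) :: (nat + mproc) list"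
    have "sub_proc (Inl \<circ> \<rho>) h = while_h \<rho>" by (simp add: h_def while_h_def dn_def)
    then have "mappsv (sub_proc (Inl \<circ> \<rho>) ?P) ?vs = mappsv (while_Y \<rho>) (Inr (etav \<sigma> (Inl (\<rho> 1))) # ?vs)"
      by (simp add: sub_mappv sub_Yp sub_etav while_Y_def)
    moreover have \<rho>: "renok ?\<Gamma> \<rho> (rev (args \<sigma>) @ ?\<Gamma>)" unfolding \<rho>_def by (rule renok_shift) simp
    moreover have "Red \<sigma> (rev (args \<sigma>) @ ?\<Gamma>) (Inl (\<rho> 1))" by (simp add: \<rho>_def nth_append)
    ultimately show "gexp (rev (args \<sigma>) @ ?\<Gamma>) (nf_exp (body (mappsv (sub_proc (Inl \<circ> (\<lambda>i. i + ?r)) ?P) ?vs)))"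
      using gexp_while[OF \<rho> Red_etav Reds_vars] unfolding \<rho>_def by simp
  qed
  then have "good ?\<Gamma> (den while_outer (?M \<bullet> Var ''x'')) \<sigma>" unfolding den .
  then have "good [] (lam (\<sigma> \<rightarrow> N) (lam \<sigma> (lam (\<sigma> \<rightarrow> \<sigma>) (den while_outer (?M \<bullet> Var ''x''))))) ((\<sigma> \<rightarrow> N) \<rightarrow> \<sigma> \<rightarrow> (\<sigma> \<rightarrow> \<sigma>) \<rightarrow> \<sigma>)"
    by (intro good_lam)
  then show ?thesis
    by (simp add: While_tm_def while_outer_def while_ctx_def while_body_def abss_def)
qed

lemma fv_While: "fv (While_tm \<sigma>) = {}"
  by (simp add: While_tm_def abss_def fv_ifzero_at) auto

end

theorem mainTheorem2:
  fixes c :: "nat list \<Rightarrow> nat" and len add basic :: proc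
  assumes "sequence_coding c len add basic"
  shows "(\<forall>\<Phi>. simplified_weak_Spector_bar_recursor c len add basic \<Phi> \<longrightarrow> \<not> LWF \<Phi>)
    \<and> \<not> (\<exists>\<Phi>. simplified_weak_Spector_bar_recursor c len add basic \<Phi>
          \<and> definable_T_min (pure 2 \<rightarrow> pure 2 \<rightarrow> pure 1) \<Phi>)
    \<and> \<not> (\<exists>\<Phi>. simplified_weak_Spector_bar_recursor c len add basic \<Phi>
          \<and> definable_W (pure 2 \<rightarrow> pure 2 \<rightarrow> pure 1) \<Phi>)"
proof -
  have 1: "\<not> LWF \<Phi>" if "simplified_weak_Spector_bar_recursor c len add basic \<Phi>" for \<Phi>
    by (rule bar_recursor_not_LWF[OF assms that])
  have "good (map snd \<Gamma>) (den \<Gamma> (t_min_tr d)) (t_min_ty d)" for d \<Gamma>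
  proof (cases d)
    case (Rec_c \<sigma>)
    have "fv (Rec_tm \<sigma>) = {}" using fv_rec unfolding Rec_tm_conv by simp
    from good_closed_term[OF good_Rec this] show ?thesis using Rec_c by simp
  next
    case Min_c
    have "fv Min_tm = {}" using fv_min unfolding Min_tm_conv by simp
    from good_closed_term[OF good_Min this] show ?thesis using Min_c by simp
  qed
  from good_den[where \<Gamma> = "[]" and tr = t_min_tr and cty = t_min_ty, OF _ this] have 2: "LWF \<Phi>" if "definable_T_min \<sigma> \<Phi>" for \<sigma> \<Phi>
    using that by (auto simp: definable_T_min_def definable_def intro!: lwf_LWF intro: good_lwf)
  have "good (map snd \<Gamma>) (den \<Gamma> (w_tr d)) (w_ty d)" for d \<Gamma>
    using good_closed_term[OF good_While fv_While] by (cases d) simp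
  from good_den[where \<Gamma> = "[]" and tr = w_tr and cty = w_ty, OF _ this] have 3: "LWF \<Phi>" if "definable_W \<sigma> \<Phi>" for \<sigma> \<Phi>
    using that by (auto simp: definable_W_def definable_def intro!: lwf_LWF intro: good_lwf)
  from 1 2 3 show ?thesis by blast
qed

end
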